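(* Let $\Delta \geq 3$ and $\delta \in (0,1)$. There exists a deterministic algorithm which, on input a graph $G = (V,E)$ on $n$ vertices of maximum degree at most $\Delta$, an integer $1\leq k \leq (1-\delta)m^*(G)$, and an error parameter $\epsilon \in (0,1)$, outputs an $\epsilon$-relative approximation to $m_k(G)$ in time $(n/\epsilon)^{O_{\delta, \Delta}(1)}$ (i.e. the exponent of the polynomial depends only on $\delta$ and $\Delta$).
   Context: For a graph $G$, $m_k(G)$ denotes the number of matchings of $G$ with exactly $k$ edges, and $m^*(G)$ denotes the size of a maximum matching of $G$. For a positive real number $m$, a real number $A$ is an $\epsilon$-relative approximation to $m$ if $e^{-\epsilon} m \le A \le e^{\epsilon} m$. *)

theory Defs
  imports Complex_Main "HOL-Library.Discrete_Functions"
begin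

section \<open>Matchings in finite simple graphs\<close>

definition simple_graph :: "'a set \<Rightarrow> 'a set set \<Rightarrow> bool" where
  "simple_graph V E \<longleftrightarrow> finite V \<and> (\<forall>e\<in>E. e \<subseteq> V \<and> card e = 2)"

definition degree :: "'a set set \<Rightarrow> 'a \<Rightarrow> nat" where
  "degree E v = card {e \<in> E. v \<in> e}"

definition is_matching :: "'a set set \<Rightarrow> 'a set set \<Rightarrow> bool" where
  "is_matching E M \<longleftrightarrow> M \<subseteq> E \<and> pairwise disjnt M"

definition num_matchings :: "'a set set \<Rightarrow> nat \<Rightarrow> nat" where
  "num_matchings E k = card {M. is_matching E M \<and> card M = k}"

definition matching_number :: "'a set set \<Rightarrow> nat" where
  "matching_number E = Max (card ` {M. is_matching E M})"

definition relative_approx :: "real \<Rightarrow> real \<Rightarrow> real \<Rightarrow> bool" where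
  "relative_approx \<epsilon> m A \<longleftrightarrow> exp (- \<epsilon>) * m \<le> A \<and> A \<le> exp \<epsilon> * m"


section \<open>Deterministic algorithms and their running time\<close>

text \<open>
  Algorithms are programs for a deterministic random access machine with the logarithmic cost
  criterion (Aho, Hopcroft and Ullman), written in a structured while language. The memory is a
  sequence of natural numbers, all \<open>0\<close> initially; the input is a second, read-only sequence with
  random access. Every value that is computed, fetched, or used as an address is charged its
  number of binary digits, so running time is polynomially related to that of a Turing machine.
\<close>

datatype expr =
    Const nat
  | Mem expr        \<comment> \<open>contents of the memory cell with the given address\<close>
  | Inp expr        \<comment> \<open>input item with the given index\<close>
  | Add expr expr
  | Sub expr expr   \<comment> \<open>truncated subtraction\<close>
  | Mul expr expr
  | Div expr expr   \<comment> \<open>rounded down; division by \<open>0\<close> gives \<open>0\<close>\<close>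

datatype prog =
    Skip
  | Store expr expr     \<comment> \<open>address, new contents\<close>
  | Seq prog prog
  | If expr prog prog   \<comment> \<open>a condition holds iff its value is nonzero\<close>
  | While expr prog

primrec val :: "(nat \<Rightarrow> nat) \<Rightarrow> (nat \<Rightarrow> nat) \<Rightarrow> expr \<Rightarrow> nat" where
  "val inp s (Const c) = c"
| "val inp s (Mem a) = s (val inp s a)"
| "val inp s (Inp a) = inp (val inp s a)"
| "val inp s (Add a b) = val inp s a + val inp s b"
| "val inp s (Sub a b) = val inp s a - val inp s b"
| "val inp s (Mul a b) = val inp s a * val inp s b"
| "val inp s (Div a b) = val inp s a div val inp s b"

text \<open>The number of binary digits, where \<open>0\<close> has one digit.\<close>

definition num_bits :: "nat \<Rightarrow> nat" where
  "num_bits x = Suc (floor_log x)"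

primrec cost :: "(nat \<Rightarrow> nat) \<Rightarrow> (nat \<Rightarrow> nat) \<Rightarrow> expr \<Rightarrow> nat" where
  "cost inp s (Const c) = num_bits c"
| "cost inp s (Mem a) = cost inp s a + num_bits (val inp s (Mem a))"
| "cost inp s (Inp a) = cost inp s a + num_bits (val inp s (Inp a))"
| "cost inp s (Add a b) = cost inp s a + cost inp s b + num_bits (val inp s (Add a b))"
| "cost inp s (Sub a b) = cost inp s a + cost inp s b + num_bits (val inp s (Sub a b))"
| "cost inp s (Mul a b) = cost inp s a + cost inp s b + num_bits (val inp s (Mul a b))"
| "cost inp s (Div a b) = cost inp s a + cost inp s b + num_bits (val inp s (Div a b))"

text \<open>
  \<open>runs inp p s t s'\<close>: on input \<open>inp\<close> and initial memory \<open>s\<close>, the program \<open>p\<close> halts after time \<open>t\<close>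
  with memory \<open>s'\<close>.
\<close>

inductive runs ::
  "(nat \<Rightarrow> nat) \<Rightarrow> prog \<Rightarrow> (nat \<Rightarrow> nat) \<Rightarrow> nat \<Rightarrow> (nat \<Rightarrow> nat) \<Rightarrow> bool" for inp where
  Skip: "runs inp Skip s 1 s"
| Store: "runs inp (Store a e) s (cost inp s a + cost inp s e + 1)
    (s(val inp s a := val inp s e))"
| Seq: "runs inp p s t s' \<Longrightarrow> runs inp q s' u s'' \<Longrightarrow> runs inp (Seq p q) s (t + u) s''"
| IfTrue: "val inp s b \<noteq> 0 \<Longrightarrow> runs inp p s t s' \<Longrightarrow>
    runs inp (If b p q) s (cost inp s b + t + 1) s'"
| IfFalse: "val inp s b = 0 \<Longrightarrow> runs inp q s t s' \<Longrightarrow>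
    runs inp (If b p q) s (cost inp s b + t + 1) s'"
| WhileTrue: "val inp s b \<noteq> 0 \<Longrightarrow> runs inp p s t s' \<Longrightarrow> runs inp (While b p) s' u s'' \<Longrightarrow>
    runs inp (While b p) s (cost inp s b + t + u + 1) s''"
| WhileFalse: "val inp s b = 0 \<Longrightarrow> runs inp (While b p) s (cost inp s b + 1) s"

lemma runs_deterministic:
  "runs inp p s t s' \<Longrightarrow> runs inp p s u s'' \<Longrightarrow> u = t \<and> s'' = s'"
proof (induction arbitrary: u s'' rule: runs.induct)
  case Skip
  then show ?case by (cases rule: runs.cases) simp_all
next
  case Store
  then show ?case by (cases rule: runs.cases) simp_all
next
  case Seq
  from Seq.prems show ?case by (cases rule: runs.cases) (metis Seq.IH)
next
  case IfTrue
  from IfTrue.prems show ?case by (cases rule: runs.cases) (metis IfTrue.hyps(1) IfTrue.IH)+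
next
  case IfFalse
  from IfFalse.prems show ?case by (cases rule: runs.cases) (metis IfFalse.hyps(1) IfFalse.IH)+
next
  case WhileTrue
  from WhileTrue.prems show ?case by (cases rule: runs.cases) (metis WhileTrue.hyps(1) WhileTrue.IH)+
next
  case WhileFalse
  from WhileFalse.prems show ?case by (cases rule: runs.cases) (use WhileFalse.hyps in simp_all)
qed


section \<open>Input and output conventions\<close>

text \<open>
  The input graph has vertex set \<open>{..<n}\<close>. The input sequence consists of \<open>n\<close>, then \<open>k\<close>, then the
  \<open>n * n\<close> entries of the adjacency matrix in row-major order, then the binary digits of the real
  number \<open>\<epsilon> \<in> (0,1)\<close> after the point, most significant first. Giving \<open>\<epsilon>\<close> by its (infinite) binary
  expansion allows arbitrary real error parameters; only the digits inspected cost time.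
\<close>

definition binary_digit :: "real \<Rightarrow> nat \<Rightarrow> nat" where
  "binary_digit x j = nat (\<lfloor>x * 2 ^ Suc j\<rfloor> mod 2)"

definition encode_input :: "nat \<Rightarrow> nat set set \<Rightarrow> nat \<Rightarrow> real \<Rightarrow> nat \<Rightarrow> nat" where
  "encode_input n E k \<epsilon> i =
     (if i = 0 then n
      else if i = 1 then k
      else if i < 2 + n * n then of_bool ({(i - 2) div n, (i - 2) mod n} \<in> E)
      else binary_digit \<epsilon> (i - (2 + n * n)))"

text \<open>The output is a rational number, with numerator in cell \<open>0\<close> and denominator in cell \<open>1\<close>.\<close>

definition output_value :: "(nat \<Rightarrow> nat) \<Rightarrow> real" where
  "output_value s = real (s 0) / real (s 1)"

definition computes_within ::
  "prog \<Rightarrow> (nat \<Rightarrow> nat) \<Rightarrow> real \<Rightarrow> real \<Rightarrow> bool" where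
  "computes_within p inp T A \<longleftrightarrow>
     (\<exists>t s. runs inp p (\<lambda>_. 0) t s \<and> real t \<le> T \<and> s 1 \<noteq> 0 \<and> A = output_value s)"

end

theory Submission
  imports "HOL-Analysis.Infinite_Products" "HOL-Computational_Algebra.Fundamental_Theorem_Algebra" Defs
begin

text \<open>
  Let \<open>Z(z) = (\<Sum>j. m\<^sub>j z\<^sup>j)\<close>. Deleting vertices one by one writes \<open>Z\<close> as a product of inverses of
  ratios that satisfy a recursion over the tree of self-avoiding paths. After multiplication by the
  square root of \<open>z\<close>, one level of that recursion is a strict contraction of the hyperbolic metric of the
  right half-plane, uniformly for \<open>Re z \<ge> 0\<close> in a bounded set. So \<open>Z(z)\<close> is determined up to relative
  error \<open>1 / q\<close> by the path tree cut off at depth \<open>O(log q)\<close>, whose size is polynomial. As the roots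
  of \<open>Z\<close> are real and negative, its coefficients are log-concave, and since \<open>k \<le> (1 - \<delta>) m\<^sup>*\<close> some
  activity \<open>\<lambda>\<close> bounded in terms of \<open>\<delta>\<close> and \<open>\<Delta>\<close> makes \<open>k\<close> the mode of the distribution
  \<open>m\<^sub>j \<lambda>\<^sup>j / Z(\<lambda>)\<close>. Then \<open>m\<^sub>k \<lambda>\<^sup>k / Z(\<lambda>)\<close> is at least an inverse polynomial and is a Fourier coefficient of
  \<open>Z\<close> on the circle of radius \<open>\<lambda>\<close>. On the left half of the circle \<open>\<bar>Z\<bar>\<close> is exponentially small in \<open>m\<^sup>*\<close>
  compared with \<open>Z(\<lambda>)\<close>, so the right half suffices; when \<open>m\<^sup>*\<close> is only logarithmic, \<open>\<lambda>\<close> can be taken below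
  \<open>1 / (8 \<Delta>)\<close>, where the cut-off tree is accurate on the whole circle.

  No search for \<open>\<lambda>\<close> is needed: a sum over a grid of activities of the estimates of \<open>m\<^sub>k \<lambda>\<^sup>k / Z(\<lambda>)\<close>, divided by the
  sum of the values of \<open>\<lambda>\<^sup>k / Z(\<lambda>)\<close>, is dominated by good activities. Instead of roots of unity the program uses
  powers of \<open>(q\<^sup>2 + i)\<^sup>2 / (q\<^sup>4 + 1)\<close>, so that all numbers are fractions of Gaussian integers; these are
  computed exactly modulo \<open>B\<^sup>2 + 1\<close> with \<open>B = 2\<^sup>K\<close> in the role of \<open>i\<close> and \<open>K\<close> polynomial in \<open>q\<close>.
\<close>

section \<open>The matching polynomial\<close>

text \<open>Fourier extraction has an error that is additive on the scale of
  \<open>Z(\<lambda>)\<close>, so it says nothing about \<open>m_k\<close> unless the weight of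
  \<open>k\<close> at \<open>\<lambda>\<close> is at least an inverse polynomial, and the program
  has no way to recognise such a \<open>\<lambda>\<close>. Summation removes both problems: the
  weight at activity \<open>\<lambda>\<close> is \<open>m_k\<close> times
  \<open>\<lambda>^k / Z(\<lambda>)\<close> with the same unknown factor \<open>m_k\<close>
  throughout, so the quotient of the two sums is exact up to the accumulated additive errors, and
  one good activity outweighs all of these. The program does not compute \<open>mstar\<close>
  either. The choice between large and logarithmic \<open>mstar\<close> is made by the number of
  edges, which agrees with \<open>mstar\<close> up to a factor \<open>2 * \<Delta>\<close>.
  Fractions are never reduced, so their length must be controlled: the degree bound, and not
  \<open>n\<close>, has to govern the growth per level of the tree, since the depth is logarithmic
  and \<open>n^depth\<close> would be superpolynomial. Each circle is summed a second time with
  \<open>\<i>\<close> replaced by its negative. This makes the final numerator and denominator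
  positive reals, and a number below the modulus can be read off its residue.\<close>

locale fin_graph =
  fixes n :: nat and E :: "nat set set"
  assumes simple: "simple_graph {..<n} E"
begin

definition avoid :: "nat set \<Rightarrow> nat set set" where
  "avoid S = {e \<in> E. e \<inter> S = {}}"

definition nbrs :: "nat set \<Rightarrow> nat \<Rightarrow> nat set" where
  "nbrs S v = {u. {v, u} \<in> E \<and> u \<notin> insert v S}"

text \<open>\<open>avoid S\<close> deletes the vertices of \<open>S\<close>, so this is the matching
  polynomial of what remains. It is generic in the coefficients because it serves over nat as a
  count, over real at the activities, and over complex for roots and Fourier sums.\<close>

definition Z :: "nat set \<Rightarrow> 'a::comm_semiring_1 \<Rightarrow> 'a" where
  "Z S z = (\<Sum>M | is_matching (avoid S) M. z ^ card M)"

lemma edge_subset: "e \<in> E \<Longrightarrow> e \<subseteq> {..<n}"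
  and edge_card: "e \<in> E \<Longrightarrow> card e = 2"
  using simple by (auto simp: simple_graph_def)

lemma finite_E [simp]: "finite E"
  using finite_subset[of E "Pow {..<n}"] edge_subset by blast

lemma finite_avoid [simp]: "finite (avoid S)"
  by (simp add: avoid_def)

lemma finite_matchings [simp]: "finite {M. is_matching (avoid S) M}"
  by (rule finite_subset[of _ "Pow (avoid S)"]) (auto simp: is_matching_def)

lemma finite_matching: "is_matching (avoid S) M \<Longrightarrow> finite M"
  by (meson finite_avoid finite_subset is_matching_def)

lemma edge_pair:
  assumes "e \<in> E" "v \<in> e"
  obtains u where "e = {v, u}" "u \<noteq> v"
proof -
  obtain x y where "e = {x, y}" "x \<noteq> y" using edge_card[OF assms(1)] by (meson card_2_iff)
  with assms(2) that show ?thesis by (cases "v = x") (auto simp: doubleton_eq_iff insert_commute)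
qed

lemma edge_lt: "{v, u} \<in> E \<Longrightarrow> v < n \<and> u < n"
  using edge_subset by fastforce

lemma nbrs_subset: "nbrs S v \<subseteq> {..<n}"
  using edge_lt by (auto simp: nbrs_def)

lemma finite_nbrs [simp]: "finite (nbrs S v)"
  using nbrs_subset finite_subset by blast

lemma inj_on_doubleton: "inj_on (\<lambda>u. {v, u}) A"
  by (auto simp: inj_on_def doubleton_eq_iff)

lemma card_nbrs: "card (nbrs S v) \<le> degree E v"
proof -
  have "card (nbrs S v) = card ((\<lambda>u. {v, u}) ` nbrs S v)"
    by (simp add: card_image inj_on_doubleton)
  also have "\<dots> \<le> degree E v"
    unfolding degree_def by (rule card_mono) (auto simp: nbrs_def)
  finally show ?thesis .
qed

text \<open>A matching that avoids \<open>S\<close> either misses \<open>v\<close> or contains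
  exactly one edge \<open>{v, u}\<close>; removing that edge costs a factor \<open>z\<close> and
  leaves a matching that avoids \<open>u\<close> and \<open>v\<close> too. Divided by
  \<open>Z (insert v S) z\<close>, this is the recursion for the ratios.\<close>

lemma Z_rec:
  fixes z :: "'a::comm_semiring_1"
  assumes "v \<notin> S"
  shows "Z S z = Z (insert v S) z + z * (\<Sum>u\<in>nbrs S v. Z (insert u (insert v S)) z)"
proof -
  let ?M = "\<lambda>S. {M. is_matching (avoid S) M}"
  let ?B = "\<lambda>u. insert {v, u} ` ?M (insert u (insert v S))"
  have avoid_sub: "avoid (insert u (insert v S)) \<subseteq> avoid S" for u v by (auto simp: avoid_def)
  have split: "?M S = ?M (insert v S) \<union> (\<Union>u\<in>nbrs S v. ?B u)"
  proof (intro equalityI subsetI)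
    fix M assume "M \<in> ?M S"
    then have M: "M \<subseteq> avoid S" "pairwise disjnt M" by (auto simp: is_matching_def)
    show "M \<in> ?M (insert v S) \<union> (\<Union>u\<in>nbrs S v. ?B u)"
    proof (cases "\<exists>e\<in>M. v \<in> e")
      case False
      then have "M \<subseteq> avoid (insert v S)" using M by (auto simp: avoid_def)
      then show ?thesis using M by (auto simp: is_matching_def)
    next
      case True
      then obtain e where e: "e \<in> M" "v \<in> e" by blast
      then have eE: "e \<in> E" "e \<inter> S = {}" using M by (auto simp: avoid_def)
      obtain u where u: "e = {v, u}" "u \<noteq> v" by (rule edge_pair[OF eE(1) e(2)])
      have "f \<inter> {v, u} = {}" if "f \<in> M - {e}" for f
        using pairwiseD[OF M(2), of f e] e that u by (auto simp: disjnt_def)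
      then have "M - {e} \<subseteq> avoid (insert u (insert v S))" using M by (auto simp: avoid_def)
      then have "M - {e} \<in> ?M (insert u (insert v S))"
        using M(2) by (auto simp: is_matching_def intro: pairwise_subset)
      moreover have "M = insert {v, u} (M - {e})" using e u by auto
      moreover have "u \<in> nbrs S v" using u eE by (auto simp: nbrs_def)
      ultimately show ?thesis by blast
    qed
  next
    fix M assume "M \<in> ?M (insert v S) \<union> (\<Union>u\<in>nbrs S v. ?B u)"
    then consider "M \<in> ?M (insert v S)" | u N where "u \<in> nbrs S v" "M = insert {v, u} N"
        "is_matching (avoid (insert u (insert v S))) N"
      by auto
    then show "M \<in> ?M S"
    proof cases
      case 1 then show ?thesis by (auto simp: is_matching_def avoid_def)
    next
      case 2
      have "{v, u} \<in> avoid S" using 2(1) assms by (auto simp: avoid_def nbrs_def)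
      moreover have "disjnt {v, u} f" if "f \<in> N" for f
        using that 2(3) by (auto simp: is_matching_def avoid_def)
      moreover have "N \<subseteq> avoid S" using 2(3) avoid_sub[of u v] by (auto simp: is_matching_def)
      ultimately show ?thesis using 2
        by (auto simp: is_matching_def pairwise_insert disjnt_sym)
    qed
  qed
  have vu: "{v, u} \<notin> N" if "is_matching (avoid (insert u (insert v S))) N" for u N
    using that by (auto simp: is_matching_def avoid_def)
  have disj1: "?M (insert v S) \<inter> (\<Union>u\<in>nbrs S v. ?B u) = {}"
    by (auto simp: is_matching_def avoid_def)
  have disj2: "?B u \<inter> ?B u' = {}" if "u \<in> nbrs S v" "u' \<in> nbrs S v" "u \<noteq> u'" for u u'
  proof (rule ccontr)
    assume "?B u \<inter> ?B u' \<noteq> {}"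
    then obtain N N' where N: "insert {v, u} N = insert {v, u'} N'"
      "is_matching (avoid (insert u' (insert v S))) N'" by auto
    have "{v, u} \<in> insert {v, u'} N'" unfolding N(1)[symmetric] by simp
    moreover have "{v, u} \<noteq> {v, u'}" using that(3) by (simp add: doubleton_eq_iff)
    ultimately have "{v, u} \<in> N'" by blast
    then show False using N(2) by (auto simp: is_matching_def avoid_def)
  qed
  have "Z S z = Z (insert v S) z + (\<Sum>M\<in>(\<Union>u\<in>nbrs S v. ?B u). z ^ card M)"
    unfolding Z_def split by (rule sum.union_disjoint) (use disj1 in auto)
  also have "(\<Sum>M\<in>(\<Union>u\<in>nbrs S v. ?B u). z ^ card M) = (\<Sum>u\<in>nbrs S v. \<Sum>M\<in>?B u. z ^ card M)"
    by (rule sum.UNION_disjoint) (use disj2 in auto)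
  also have "\<dots> = (\<Sum>u\<in>nbrs S v. z * Z (insert u (insert v S)) z)"
  proof (rule sum.cong[OF refl])
    fix u assume "u \<in> nbrs S v"
    have "(\<Sum>M\<in>?B u. z ^ card M) = (\<Sum>N\<in>?M (insert u (insert v S)). z ^ card (insert {v, u} N))"
    proof (subst sum.reindex)
      show "inj_on (insert {v, u}) (?M (insert u (insert v S)))"
        using vu by (intro inj_onI) (simp add: insert_ident)
    qed simp
    also have "\<dots> = (\<Sum>N\<in>?M (insert u (insert v S)). z * z ^ card N)"
      by (rule sum.cong) (use vu finite_matching in auto)
    finally show "(\<Sum>M\<in>?B u. z ^ card M) = z * Z (insert u (insert v S)) z"
      by (simp add: Z_def sum_distrib_left)
  qed
  finally show ?thesis by (simp add: sum_distrib_left)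
qed

lemma Z_UNIV: "{..<n} \<subseteq> S \<Longrightarrow> Z S z = 1"
proof -
  assume S: "{..<n} \<subseteq> S"
  have False if e: "e \<in> E" "e \<inter> S = {}" for e
  proof -
    have "e = {}" using edge_subset[OF e(1)] S e(2) by blast
    then show False using edge_card[OF e(1)] by simp
  qed
  then have "avoid S = {}" by (auto simp: avoid_def)
  then have "{M. is_matching (avoid S) M} = {{}}" by (auto simp: is_matching_def)
  then show ?thesis by (simp add: Z_def)
qed

section \<open>Counting bounds for matchings\<close>

abbreviation mnum :: "nat \<Rightarrow> nat" where "mnum \<equiv> num_matchings E"
abbreviation mstar :: nat where "mstar \<equiv> matching_number E"

lemma avoid_empty [simp]: "avoid {} = E" by (simp add: avoid_def)

lemma finite_matchings' [simp]: "finite {M. is_matching E M}"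
  using finite_matchings[of "{}"] by simp

lemma finite_matching': "is_matching E M \<Longrightarrow> finite M"
  using finite_matching[of "{}"] by simp

lemma empty_matching [simp]: "is_matching E {}"
  by (simp add: is_matching_def)

lemma card_le_mstar: "is_matching E M \<Longrightarrow> card M \<le> mstar"
  unfolding matching_number_def by (rule Max_ge) auto

lemma mstar_attained: obtains M where "is_matching E M" "card M = mstar"
proof -
  have "mstar \<in> card ` {M. is_matching E M}"
    unfolding matching_number_def by (rule Max_in) (auto intro: exI[of _ "{}"])
  then show ?thesis using that by auto
qed

lemma mnum_0: "mnum 0 = 1"
proof -
  have "{M. is_matching E M \<and> card M = 0} = {{}}"
    using finite_matching' by auto
  then show ?thesis by (simp add: num_matchings_def)
qed

lemma mnum_mstar: "mnum mstar \<ge> 1"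
proof -
  obtain M where "is_matching E M" "card M = mstar" by (rule mstar_attained)
  then have "{M. is_matching E M \<and> card M = mstar} \<noteq> {}" by auto
  moreover have "finite {M. is_matching E M \<and> card M = mstar}"
    by (rule finite_subset[OF _ finite_matchings']) auto
  ultimately show ?thesis unfolding num_matchings_def by (simp add: Suc_le_eq card_gt_0_iff)
qed

lemma mnum_eq_0: "k > mstar \<Longrightarrow> mnum k = 0"
  using card_le_mstar by (force simp: num_matchings_def card_eq_0_iff)

lemma Z_eq_sum: "Z {} z = (\<Sum>k\<le>mstar. of_nat (mnum k) * z ^ k)"
proof -
  have "Z {} z = (\<Sum>M | is_matching E M. z ^ card M)" by (simp add: Z_def)
  also have "\<dots> = (\<Sum>k\<le>mstar. \<Sum>M\<in>{M\<in>{M. is_matching E M}. card M = k}. z ^ card M)"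
    by (rule sum.group[symmetric]) (auto simp: card_le_mstar)
  also have "\<dots> = (\<Sum>k\<le>mstar. of_nat (mnum k) * z ^ k)"
    by (rule sum.cong) (auto simp: num_matchings_def)
  finally show ?thesis .
qed

lemma mnum_le: "mnum k \<le> 2 ^ card E"
proof -
  have "mnum k \<le> card (Pow E)" unfolding num_matchings_def
    by (rule card_mono) (auto simp: is_matching_def)
  then show ?thesis by (simp add: card_Pow)
qed

lemma Z_one_le: "(Z {} 1 :: nat) \<le> 2 ^ card E"
proof -
  have "card {M. is_matching E M} \<le> card (Pow E)"
    by (rule card_mono) (auto simp: is_matching_def)
  then show ?thesis by (simp add: Z_def card_Pow)
qed

lemma mnum_1: "mnum 1 = card E"
proof -
  have "bij_betw (\<lambda>e. {e}) E {M. is_matching E M \<and> card M = 1}"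
    by (auto simp: bij_betw_def inj_on_def is_matching_def card_1_singleton_iff image_iff)
  then show ?thesis using bij_betw_same_card by (fastforce simp: num_matchings_def)
qed

lemma card_E_le: "card E \<le> n * n"
proof -
  have "E \<subseteq> (\<lambda>(a, b). {a, b}) ` ({..<n} \<times> {..<n})"
  proof
    fix e assume e: "e \<in> E"
    then obtain a b where "e = {a, b}" using edge_card by (meson card_2_iff)
    then show "e \<in> (\<lambda>(a, b). {a, b}) ` ({..<n} \<times> {..<n})" using edge_subset[OF e] by force
  qed
  then have "card E \<le> card ((\<lambda>(a, b). {a, b}) ` ({..<n} \<times> {..<n}))"
    by (intro card_mono) auto
  also have "\<dots> \<le> card ({..<n} \<times> {..<n})" by (rule card_image_le) auto
  finally show ?thesis by simp
qed

text \<open>The endpoints of a maximum matching meet every edge, as the matching could be enlarged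
  otherwise. There are \<open>2 * mstar\<close> of them, and each lies on at most \<Delta>
  edges.\<close>

lemma card_E_le_mstar:
  assumes deg: "\<And>v. v < n \<Longrightarrow> degree E v \<le> \<Delta>"
  shows "card E \<le> 2 * \<Delta> * mstar"
proof -
  obtain M where M: "is_matching E M" "card M = mstar" by (rule mstar_attained)
  have ME: "M \<subseteq> E" and fM: "finite M" using M finite_matching' by (auto simp: is_matching_def)
  have fU: "finite (\<Union>M)"
    using ME edge_subset by (intro finite_subset[of "\<Union>M" "{..<n}"]) auto
  have "\<exists>v\<in>\<Union>M. v \<in> e" if e: "e \<in> E" for e
  proof (rule ccontr)
    assume *: "\<not> ?thesis"
    then have "e \<notin> M" using edge_card[OF e] by fastforce
    moreover have "is_matching E (insert e M)"
      using M e * by (fastforce simp: is_matching_def pairwise_insert disjnt_def)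
    ultimately show False using card_le_mstar[of "insert e M"] M fM by simp
  qed
  then have "E \<subseteq> (\<Union>v\<in>\<Union>M. {e \<in> E. v \<in> e})" by (auto simp del: Union_iff)
  then have "card E \<le> card (\<Union>v\<in>\<Union>M. {e \<in> E. v \<in> e})"
    by (rule card_mono[rotated]) (rule finite_subset[of _ E], auto)
  also have "\<dots> \<le> (\<Sum>v\<in>\<Union>M. card {e \<in> E. v \<in> e})"
    by (rule card_UN_le[OF fU])
  also have "\<dots> \<le> (\<Sum>v\<in>\<Union>M. \<Delta>)"
    by (rule sum_mono) (use deg ME edge_subset in \<open>force simp: degree_def\<close>)
  also have "\<dots> = card (\<Union>M) * \<Delta>" by simp
  also have "card (\<Union>M) \<le> (\<Sum>e\<in>M. card e)"
    by (rule card_Union_le_sum_card)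
  also have "(\<Sum>e\<in>M. card e) = 2 * mstar"
    using M ME edge_card by (subst sum.cong[OF refl, of M _ "\<lambda>_. 2"]) auto
  finally show ?thesis by (simp add: ac_simps)
qed

end

section \<open>Contraction and correlation decay\<close>

lemma Re_inverse_pos: "Re w > 0 \<Longrightarrow> Re (inverse w) > 0"
  by (auto simp: sum_power2_gt_zero_iff)

lemma Re_inverse: "Re (inverse w) = Re w / (cmod w)\<^sup>2"
  by (simp add: cmod_power2)

text \<open>The quantity \<open>\<bar>x - y\<bar> / sqrt (Re x * Re y)\<close> is a function of the hyperbolic distance of the
  right half-plane; inversion preserves it and addition of a point with positive real part contracts
  it.\<close>

lemma inverse_isometry:
  assumes "Re x > 0" "Re y > 0" "cmod (x - y) \<le> D * sqrt (Re x * Re y)"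
  shows "cmod (inverse x - inverse y) \<le> D * sqrt (Re (inverse x) * Re (inverse y))"
proof -
  have nz: "x \<noteq> 0" "y \<noteq> 0" using assms by auto
  have "cmod (inverse x - inverse y) = cmod (x - y) / (cmod x * cmod y)"
  proof -
    have "inverse x - inverse y = - (x - y) / (x * y)" using nz by (simp add: field_simps)
    then show ?thesis by (simp add: norm_divide norm_mult norm_minus_commute)
  qed
  also have "\<dots> \<le> D * sqrt (Re x * Re y) / (cmod x * cmod y)"
    by (intro divide_right_mono assms) auto
  also have "\<dots> = D * sqrt (Re (inverse x) * Re (inverse y))"
    unfolding Re_inverse by (simp add: real_sqrt_divide real_sqrt_mult)
  finally show ?thesis .
qed

text \<open>By Cauchy-Schwarz, summing two families that are close term by term does not increase
  the quantity. The gain comes from the common summand \<open>u\<close>: a total real part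
  \<open>X \<le> b / a\<close> becomes \<open>a + X\<close>, and \<open>X / (a + X)\<close> is
  increasing in \<open>X\<close>, hence at most \<open>b / (b + a^2)\<close>.\<close>

lemma sum_contraction:
  fixes f g :: "'a \<Rightarrow> complex"
  assumes a: "a > 0" and u: "Re u = a" and D: "D \<ge> 0" and b: "b > 0"
    and f: "\<And>i. i \<in> A \<Longrightarrow> Re (f i) > 0" and g: "\<And>i. i \<in> A \<Longrightarrow> Re (g i) > 0"
    and fg: "\<And>i. i \<in> A \<Longrightarrow> cmod (f i - g i) \<le> D * sqrt (Re (f i) * Re (g i))"
    and fb: "(\<Sum>i\<in>A. Re (f i)) \<le> b / a" and gb: "(\<Sum>i\<in>A. Re (g i)) \<le> b / a"
  shows "cmod ((u + sum f A) - (u + sum g A)) \<le> (b / (b + a\<^sup>2)) * D * sqrt (Re (u + sum f A) * Re (u + sum g A))"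
proof -
  define \<gamma> where "\<gamma> = b / (b + a\<^sup>2)"
  let ?F = "\<Sum>i\<in>A. Re (f i)" and ?G = "\<Sum>i\<in>A. Re (g i)"
  have nonneg: "?F \<ge> 0" "?G \<ge> 0" using f g by (simp_all add: sum_nonneg less_imp_le)
  have \<gamma>: "\<gamma> \<ge> 0" using b a by (simp add: \<gamma>_def)
  have *: "X \<le> \<gamma> * (a + X)" if "X \<le> b / a" for X
  proof -
    have "X * a \<le> b" using that a by (simp add: field_simps)
    then have "X * a * a \<le> b * a" using a by (intro mult_right_mono) auto
    then have "X * (b + a\<^sup>2) \<le> b * (a + X)" by (simp add: algebra_simps power2_eq_square)
    moreover have "b + a\<^sup>2 > 0" using b by (simp add: add_pos_nonneg)
    ultimately show ?thesis by (simp add: \<gamma>_def field_simps)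
  qed
  have cs: "(\<Sum>i\<in>A. sqrt (Re (f i)) * sqrt (Re (g i)))\<^sup>2 \<le> ?F * ?G"
  proof -
    have "(\<Sum>i\<in>A. sqrt (Re (f i)) * sqrt (Re (g i)))\<^sup>2
        \<le> (\<Sum>i\<in>A. (sqrt (Re (f i)))\<^sup>2) * (\<Sum>i\<in>A. (sqrt (Re (g i)))\<^sup>2)"
      by (rule Cauchy_Schwarz_ineq_sum)
    also have "\<dots> = ?F * ?G"
      using f g by (intro arg_cong2[of _ _ _ _ "(*)"] sum.cong) (auto simp: less_imp_le)
    finally show ?thesis .
  qed
  have "cmod ((u + sum f A) - (u + sum g A)) = cmod (\<Sum>i\<in>A. f i - g i)"
    by (simp add: sum_subtractf)
  also have "\<dots> \<le> (\<Sum>i\<in>A. D * sqrt (Re (f i) * Re (g i)))"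
    by (rule order_trans[OF norm_sum sum_mono[OF fg]])
  also have "\<dots> = D * (\<Sum>i\<in>A. sqrt (Re (f i)) * sqrt (Re (g i)))"
    by (simp add: sum_distrib_left real_sqrt_mult)
  also have "\<dots> \<le> D * sqrt (?F * ?G)"
    by (intro mult_left_mono D real_le_rsqrt cs)
  also have "\<dots> \<le> D * sqrt ((\<gamma> * (a + ?F)) * (\<gamma> * (a + ?G)))"
    using nonneg a \<gamma> by (intro mult_left_mono D real_sqrt_le_mono mult_mono * fb gb) auto
  also have "(\<gamma> * (a + ?F)) * (\<gamma> * (a + ?G)) = \<gamma>\<^sup>2 * ((a + ?F) * (a + ?G))"
    by (simp add: power2_eq_square algebra_simps)
  also have "sqrt \<dots> = \<gamma> * sqrt ((a + ?F) * (a + ?G))"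
    using \<gamma> by (simp add: real_sqrt_mult)
  finally show ?thesis using u by (simp add: \<gamma>_def algebra_simps)
qed

text \<open>This converts the hyperbolic bound to an ordinary relative error. With
  \<open>D \<le> 1 / 2\<close> the bound itself forces \<open>cmod y \<le> 4 * cmod x\<close>, after
  which \<open>sqrt (Re x * Re y)\<close> is at most \<open>2 * cmod x\<close>.\<close>

lemma relative_error:
  assumes "Re x > 0" "Re y > 0" "cmod (x - y) \<le> D * sqrt (Re x * Re y)" "0 \<le> D" "D \<le> 1 / 2"
  shows "cmod (y / x - 1) \<le> 2 * D"
proof -
  define t where "t = sqrt (cmod x)"
  define t' where "t' = sqrt (cmod y)"
  have x0: "cmod x > 0" using assms(1) by auto
  have sq: "t\<^sup>2 = cmod x" "t'\<^sup>2 = cmod y" "t > 0" "t' \<ge> 0" using x0 by (auto simp: t_def t'_def)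
  have "sqrt (Re x * Re y) \<le> sqrt (cmod x * cmod y)"
    using assms(1,2) complex_Re_le_cmod by (intro real_sqrt_le_mono mult_mono) auto
  also have "\<dots> = t * t'" by (simp add: t_def t'_def real_sqrt_mult)
  finally have le: "cmod (x - y) \<le> D * (t * t')"
    using assms(3,4) mult_left_mono order_trans by blast
  have "cmod y \<le> cmod x + cmod (x - y)"
    using norm_triangle_ineq4[of x "x - y"] by simp
  then have q: "t'\<^sup>2 \<le> t\<^sup>2 + D * (t * t')" using le sq by simp
  have "t' \<le> 2 * t"
  proof (rule ccontr)
    assume c: "\<not> t' \<le> 2 * t"
    have "D * (t * t') \<le> (1/2) * (t * t')" using assms(5) sq by (intro mult_right_mono) auto
    moreover have "2 * (t * t') \<le> t' * t'" using c sq by (simp add: mult.assoc[symmetric] mult_right_mono)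
    moreover have "2 * (t * t) < t * t'" using c sq by (simp add: mult.left_commute)
    moreover have "t * t > 0" using sq by simp
    ultimately show False using q unfolding power2_eq_square by linarith
  qed
  then have "D * (t * t') \<le> D * (t * (2 * t))" using assms(4) sq by (intro mult_left_mono) auto
  also have "\<dots> = 2 * D * cmod x" using sq by (simp add: power2_eq_square)
  finally have *: "cmod (y - x) \<le> 2 * D * cmod x" using le by (simp add: norm_minus_commute)
  have "y / x - 1 = (y - x) / x" using x0 by (simp add: field_simps)
  then show ?thesis using * x0 by (simp add: norm_divide field_simps)
qed

section \<open>Truncated ratios on the tree of self-avoiding paths\<close>

context fin_graph
begin

text \<open>Approximates \<open>Z (insert v S) z / Z S z\<close> by the self-avoiding paths from
  \<open>v\<close> of length at most \<open>d\<close> that stay outside \<open>S\<close>. The leaf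
  value 1 is the ratio of an isolated vertex.\<close>

primrec Rt :: "complex \<Rightarrow> nat \<Rightarrow> nat set \<Rightarrow> nat \<Rightarrow> complex" where
  "Rt z 0 S v = 1"
| "Rt z (Suc d) S v = inverse (1 + z * (\<Sum>u\<in>nbrs S v. Rt z d (insert v S) u))"

definition Zt :: "nat \<Rightarrow> complex \<Rightarrow> complex" where
  "Zt d z = (\<Prod>r<n. inverse (Rt z d {..<r} r))"

text \<open>Induction on the number of remaining vertices: no self-avoiding path is longer, so depth
  \<open>m\<close> exhausts the tree. Nonvanishing of \<open>Z\<close> is obtained along the way, as
  each vertex contributes one nonzero factor.\<close>

lemma Rt_exact:
  assumes nz: "\<And>d S v. Rt z d S v \<noteq> 0"
  shows "card ({..<n} - S) \<le> m \<Longrightarrow> Z S z \<noteq> 0 \<and>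
    (\<forall>v d. v < n \<longrightarrow> v \<notin> S \<longrightarrow> m \<le> d \<longrightarrow> Z (insert v S) z = Z S z * Rt z d S v)"
proof (induction m arbitrary: S)
  case 0
  then have "{..<n} \<subseteq> S" by simp
  then show ?case by (auto simp: Z_UNIV)
next
  case (Suc m)
  have *: "Z S z \<noteq> 0 \<and> Z (insert v S) z = Z S z * Rt z (Suc d) S v"
    if v: "v < n" "v \<notin> S" and d: "m \<le> d" for v d
  proof -
    have "{..<n} - insert v S = ({..<n} - S) - {v}" by auto
    then have "card ({..<n} - insert v S) \<le> m" using Suc.prems v by (simp add: card_Diff_singleton)
    note IH = Suc.IH[OF this]
    have "Z S z = Z (insert v S) z + z * (\<Sum>u\<in>nbrs S v. Z (insert u (insert v S)) z)"
      by (rule Z_rec) (fact v)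
    also have "(\<Sum>u\<in>nbrs S v. Z (insert u (insert v S)) z)
        = (\<Sum>u\<in>nbrs S v. Z (insert v S) z * Rt z d (insert v S) u)"
    proof (rule sum.cong[OF refl])
      fix u assume u: "u \<in> nbrs S v"
      then have "u < n" "u \<notin> insert v S" using nbrs_subset by (auto simp: nbrs_def)
      then show "Z (insert u (insert v S)) z = Z (insert v S) z * Rt z d (insert v S) u"
        using IH d by blast
    qed
    finally have eq: "Z S z = Z (insert v S) z * (1 + z * (\<Sum>u\<in>nbrs S v. Rt z d (insert v S) u))"
      by (simp add: sum_distrib_left algebra_simps)
    have "1 + z * (\<Sum>u\<in>nbrs S v. Rt z d (insert v S) u) \<noteq> 0"
      using nz[of "Suc d" S v] by simp
    with eq IH show ?thesis by simp
  qed
  show ?case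
  proof (cases "{..<n} \<subseteq> S")
    case True
    then show ?thesis by (auto simp: Z_UNIV)
  next
    case False
    then obtain v where "v < n" "v \<notin> S" by auto
    then have "Z S z \<noteq> 0" using * by blast
    moreover have "Z (insert v S) z = Z S z * Rt z d S v"
      if "v < n" "v \<notin> S" "Suc m \<le> d" for v d
      using *[of v "d - 1"] that by (cases d) auto
    ultimately show ?thesis by blast
  qed
qed

lemma Z_nonzero:
  assumes nz: "\<And>d S v. Rt z d S v \<noteq> 0"
  shows "Z S z \<noteq> 0"
  using Rt_exact[OF nz order_refl] by blast

lemma Z_eq_Zt:
  assumes nz: "\<And>d S v. Rt z d S v \<noteq> 0" and d: "n \<le> d"
  shows "Z {} z = Zt d z"
proof -
  have "Z {} z = Z {..<m} z * (\<Prod>r<m. inverse (Rt z d {..<r} r))" if "m \<le> n" for m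
    using that
  proof (induction m)
    case (Suc m)
    have "card ({..<n} - {..<m}) \<le> n" using card_mono[of "{..<n}" "{..<n} - {..<m}"] by simp
    then have "Z (insert m {..<m}) z = Z {..<m} z * Rt z d {..<m} m"
      using Rt_exact[of z "{..<m}" n] nz Suc.prems d by simp
    then have "Z {..<m} z = Z {..<Suc m} z * inverse (Rt z d {..<m} m)"
      using nz[of d "{..<m}" m] by (simp add: lessThan_Suc)
    then show ?case using Suc by simp
  qed simp
  from this[of n] show ?thesis by (simp add: Zt_def Z_UNIV)
qed

text \<open>With \<open>z = w^2\<close>, the recursion for \<open>f = w * Rt\<close> loses its
  coefficient and becomes \<open>f = 1 / (1/w + sum of f)\<close>. Addition and inversion keep the
  right half-plane, so no ratio vanishes. Every \<open>z\<close> off the nonpositive real axis has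
  such a \<open>w\<close>.\<close>

lemma Rt_Re_pos:
  assumes w: "Re w > 0" and z: "z = w\<^sup>2"
  shows "Re (w * Rt z d S v) > 0"
    and "w * Rt z (Suc d) S v = inverse (inverse w + (\<Sum>u\<in>nbrs S v. w * Rt z d (insert v S) u))"
proof -
  have w0: "w \<noteq> 0" using w by auto
  have rec: "w * Rt z (Suc d) S v = inverse (inverse w + (\<Sum>u\<in>nbrs S v. w * Rt z d (insert v S) u))"
    for d S v
  proof -
    have "inverse w + (\<Sum>u\<in>nbrs S v. w * Rt z d (insert v S) u)
       = inverse w * (1 + z * (\<Sum>u\<in>nbrs S v. Rt z d (insert v S) u))"
      using w0 by (simp add: z field_simps power2_eq_square sum_distrib_left)
    then show ?thesis by simp
  qed
  then show "w * Rt z (Suc d) S v = inverse (inverse w + (\<Sum>u\<in>nbrs S v. w * Rt z d (insert v S) u))" .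
  show "Re (w * Rt z d S v) > 0"
  proof (induction d arbitrary: S v)
    case 0
    then show ?case using w by simp
  next
    case (Suc d)
    have "Re (inverse w + (\<Sum>u\<in>nbrs S v. w * Rt z d (insert v S) u)) > 0"
      unfolding plus_complex.sel Re_sum
      by (intro add_pos_nonneg Re_inverse_pos w sum_nonneg less_imp_le Suc)
    then show ?case unfolding rec by (rule Re_inverse_pos)
  qed
qed

lemma Rt_nonzero:
  assumes "Re w > 0" "z = w\<^sup>2"
  shows "Rt z d S v \<noteq> 0"
  using Rt_Re_pos(1)[OF assms, of d S v] by auto

lemma Re_csqrt_pos: "z \<notin> \<real>\<^sub>\<le>\<^sub>0 \<Longrightarrow> Re (csqrt z) > 0"
proof (rule ccontr)
  assume z: "z \<notin> \<real>\<^sub>\<le>\<^sub>0" and neg: "\<not> Re (csqrt z) > 0"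
  have "Re (csqrt z) = 0" using neg csqrt_principal[of z] by auto
  then have "z = - of_real ((Im (csqrt z))\<^sup>2)"
    by (subst power2_csqrt[symmetric]) (simp add: complex_eq_iff power2_eq_square)
  then obtain x where "z = - of_real (x\<^sup>2)" by blast
  then have "z \<in> \<real>\<^sub>\<le>\<^sub>0" by (simp add: complex_nonpos_Reals_iff del: of_real_power)
  with z show False by simp
qed


text \<open>Every \<open>w * Rt\<close> is the inverse of a number with real part at least
  \<open>a\<close>, so it has modulus at most \<open>1 / a\<close>, and the sum over at most
  \<Delta> children is at most \<open>\<Delta> / a\<close> in modulus. Hence
  \<open>sum_contraction\<close> applies with \<open>b = \<Delta>\<close> on every level. At the
  leaves, \<open>1/w\<close> is compared with \<open>1/w + s\<close> where \<open>s\<close> has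
  modulus at most \<open>\<Delta> / a\<close>, which gives the initial distance
  \<open>\<Delta> / a^2\<close>.\<close>

lemma Rt_contraction:
  assumes w: "Re w > 0" and z: "z = w\<^sup>2" and \<Delta>: "\<And>S v. card (nbrs S v) \<le> \<Delta>" "\<Delta> \<ge> 1"
    and a: "a = Re (inverse w)"
  shows "cmod (w * Rt z d S v - w * Rt z (d + m) S v) \<le> (\<Delta> / a\<^sup>2) * (\<Delta> / (\<Delta> + a\<^sup>2)) ^ d
    * sqrt (Re (w * Rt z d S v) * Re (w * Rt z (d + m) S v))"
proof -
  define f where "f = (\<lambda>d S v. w * Rt z d S v)"
  have rec: "f (Suc d) S v = inverse (inverse w + (\<Sum>u\<in>nbrs S v. f d (insert v S) u))" for d S v
    unfolding f_def by (rule Rt_Re_pos(2)[OF w z])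
  have fpos: "Re (f d S v) > 0" for d S v unfolding f_def by (rule Rt_Re_pos(1)[OF w z])
  have a0: "a > 0" using a w by (simp add: Re_inverse_pos del: inverse_complex.sel)
  have spos: "Re (inverse w + (\<Sum>u\<in>nbrs S v. f d T u)) \<ge> a" for d S v T
    using fpos by (simp add: a sum_nonneg less_imp_le del: inverse_complex.sel)
  have fle: "cmod (f d S v) \<le> 1 / a" for d S v
  proof (cases d)
    case 0
    have "a \<le> cmod (inverse w)" unfolding a by (rule complex_Re_le_cmod)
    then have "inverse (cmod (inverse w)) \<le> inverse a" using a0 by (rule le_imp_inverse_le)
    then show ?thesis using 0 by (simp add: f_def norm_inverse norm_divide inverse_eq_divide)
  next
    case (Suc d')
    have "a \<le> cmod (inverse w + (\<Sum>u\<in>nbrs S v. f d' (insert v S) u))"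
      using spos complex_Re_le_cmod order_trans by blast
    then have "inverse (cmod (inverse w + (\<Sum>u\<in>nbrs S v. f d' (insert v S) u))) \<le> inverse a"
      using a0 by (rule le_imp_inverse_le)
    then show ?thesis using Suc by (simp add: rec norm_inverse norm_divide inverse_eq_divide)
  qed
  have sumle: "cmod (\<Sum>u\<in>nbrs S v. f d T u) \<le> \<Delta> / a" for d S v T
  proof -
    have "cmod (\<Sum>u\<in>nbrs S v. f d T u) \<le> (\<Sum>u\<in>nbrs S v. 1 / a)"
      by (rule order_trans[OF norm_sum sum_mono[OF fle]])
    also have "\<dots> = card (nbrs S v) * (1 / a)" by simp
    also have "\<dots> \<le> \<Delta> * (1 / a)" using \<Delta>(1)[of S v] a0 by (intro mult_right_mono) auto
    finally show ?thesis by simp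
  qed
  have sumRe: "(\<Sum>u\<in>nbrs S v. Re (f d T u)) \<le> \<Delta> / a" for d S v T
    using complex_Re_le_cmod[of "\<Sum>u\<in>nbrs S v. f d T u"] sumle[of d T S v] by simp
  define D where "D = \<Delta> / a\<^sup>2"
  define \<gamma> where "\<gamma> = \<Delta> / (\<Delta> + a\<^sup>2)"
  have D0: "D \<ge> 0" and \<gamma>0: "\<gamma> \<ge> 0" using a0 by (simp_all add: D_def \<gamma>_def)
  have "cmod (f d S v - f (d + m) S v) \<le> (D * \<gamma> ^ d) * sqrt (Re (f d S v) * Re (f (d + m) S v))"
  proof (induction d arbitrary: S v)
    case 0
    show ?case
    proof (cases m)
      case 0
      then show ?thesis using D0 by simp
    next
      case (Suc m')
      define s where "s = (\<Sum>u\<in>nbrs S v. f m' (insert v S) u)"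
      have Rs: "Re s \<ge> 0" unfolding s_def by (simp add: sum_nonneg less_imp_le fpos)
      have u: "Re (inverse w + s) > 0" using a0 Rs by (simp add: a del: inverse_complex.sel)
      have "cmod (inverse w - (inverse w + s)) = cmod s" by simp
      also have "\<dots> \<le> \<Delta> / a" unfolding s_def by (rule sumle)
      also have "\<dots> = D * sqrt (a * a)" using a0 by (simp add: D_def power2_eq_square)
      also have "\<dots> \<le> D * sqrt (Re (inverse w) * Re (inverse w + s))"
        using a0 Rs by (intro mult_left_mono D0 real_sqrt_le_mono) (auto simp: a simp del: inverse_complex.sel)
      finally have "cmod (inverse (inverse w) - inverse (inverse w + s))
          \<le> D * sqrt (Re (inverse (inverse w)) * Re (inverse (inverse w + s)))"
        by (intro inverse_isometry Re_inverse_pos w u)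
      moreover have "f 0 S v = w" "f m S v = inverse (inverse w + s)"
        using Suc by (simp_all only: rec s_def) (simp add: f_def)
      ultimately show ?thesis by simp
    qed
  next
    case (Suc d)
    let ?s = "\<lambda>d. \<Sum>u\<in>nbrs S v. f d (insert v S) u"
    have "cmod ((inverse w + ?s d) - (inverse w + ?s (d + m)))
      \<le> \<gamma> * (D * \<gamma> ^ d) * sqrt (Re (inverse w + ?s d) * Re (inverse w + ?s (d + m)))"
      by (rule sum_contraction[where b = "real \<Delta>" and a = a, folded \<gamma>_def])
        (use a0 a D0 \<gamma>0 fpos \<Delta>(2) Suc sumRe in \<open>auto simp del: inverse_complex.sel\<close>)
    also have "\<gamma> * (D * \<gamma> ^ d) = D * \<gamma> ^ Suc d" by simp
    finally show ?case unfolding rec add_Suc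
      by (intro inverse_isometry) (use spos a0 in \<open>auto intro: less_le_trans simp del: plus_complex.sel inverse_complex.sel\<close>)
  qed
  then show ?thesis by (simp add: D_def \<gamma>_def f_def)
qed


text \<open>For \<open>Re z \<ge> 0\<close> the root \<open>w\<close> has argument at most pi/4 in
  absolute value, so \<open>(Re w)^2\<close> is at least half of \<open>cmod z\<close>. This makes
  \<open>a = Re (1/w)\<close> satisfy \<open>2 * a^2 * \<Lambda> \<ge> 1\<close>, and
  \<open>X\<close> is the resulting bound for \<open>\<Delta> / a^2\<close>. The contraction is thus
  uniform, even on the imaginary axis.\<close>

lemma Rt_error_half_plane:
  assumes z: "Re z \<ge> 0" "z \<noteq> 0" "cmod z \<le> \<Lambda>" and \<Delta>: "\<And>S v. card (nbrs S v) \<le> \<Delta>" "\<Delta> \<ge> 1"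
    and X: "X = 2 * \<Delta> * \<Lambda>" and small: "(2 * X + 4) * (X / (X + 1)) ^ d \<le> 1"
  shows "Rt z d S v \<noteq> 0"
    and "cmod (Rt z (d + m) S v / Rt z d S v - 1) \<le> (2 * X + 4) * (X / (X + 1)) ^ d"
proof -
  define w where "w = csqrt z"
  have zw: "z = w\<^sup>2" by (simp add: w_def)
  have "z \<notin> \<real>\<^sub>\<le>\<^sub>0" using z by (auto simp: complex_nonpos_Reals_iff complex_eq_iff)
  then have w: "Re w > 0" unfolding w_def by (rule Re_csqrt_pos)
  show nz: "Rt z d S v \<noteq> 0" for d S v by (rule Rt_nonzero[OF w zw])
  define a where "a = Re (inverse w)"
  have w0: "w \<noteq> 0" using w by auto
  have cz: "cmod z = (cmod w)\<^sup>2" by (simp add: zw norm_power)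
  have cz0: "cmod z > 0" using z by simp
  have "Re z = (Re w)\<^sup>2 - (Im w)\<^sup>2" by (simp add: zw power2_eq_square)
  then have "(cmod w)\<^sup>2 \<le> 2 * (Re w)\<^sup>2" using z(1) by (simp add: cmod_power2)
  then have "cmod z * cmod z \<le> 2 * (Re w)\<^sup>2 * cmod z" unfolding cz by (intro mult_right_mono) auto
  also have "\<dots> \<le> 2 * (Re w)\<^sup>2 * \<Lambda>" using z(3) by (intro mult_left_mono) auto
  finally have A: "cmod z * cmod z \<le> 2 * (Re w)\<^sup>2 * \<Lambda>" .
  have B: "(Re w)\<^sup>2 = a\<^sup>2 * (cmod z * cmod z)"
    using w0 unfolding a_def Re_inverse cz by (simp add: power_divide power2_eq_square)
  have *: "1 \<le> 2 * a\<^sup>2 * \<Lambda>"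
  proof (rule ccontr)
    assume "\<not> ?thesis"
    then have "(2 * a\<^sup>2 * \<Lambda>) * (cmod z * cmod z) < 1 * (cmod z * cmod z)"
      using cz0 by (intro mult_strict_right_mono) auto
    then show False using A unfolding B by (simp add: algebra_simps)
  qed
  have a2: "a\<^sup>2 > 0" using Re_inverse_pos[OF w] by (simp add: a_def del: inverse_complex.sel)
  have \<Lambda>: "\<Lambda> > 0" using z(3) cz0 by linarith
  have dX: "\<Delta> / a\<^sup>2 \<le> X"
    using * a2 mult_left_mono[OF *, of "real \<Delta>"] by (simp add: X field_simps)
  have d0: "\<Delta> / a\<^sup>2 > 0" using \<Delta>(2) a2 by simp
  have mono: "t / (t + 1) \<le> X / (X + 1)" if "0 < t" "t \<le> X" for t
    using that by (simp add: field_simps)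
  have "\<Delta> / (\<Delta> + a\<^sup>2) = (\<Delta> / a\<^sup>2) / (\<Delta> / a\<^sup>2 + 1)" using a2 by (simp add: field_simps)
  also have "\<dots> \<le> X / (X + 1)" by (rule mono[OF d0 dX])
  finally have \<gamma>: "\<Delta> / (\<Delta> + a\<^sup>2) \<le> X / (X + 1)" .
  define D where "D = (\<Delta> / a\<^sup>2) * (\<Delta> / (\<Delta> + a\<^sup>2)) ^ d"
  have DX: "D \<le> X * (X / (X + 1)) ^ d"
    unfolding D_def using d0 dX \<gamma> a2 by (intro mult_mono power_mono) auto
  have D0: "0 \<le> D" by (simp add: D_def)
  have p0: "(X / (X + 1)) ^ d \<ge> 0" using d0 dX by simp
  have D2: "2 * D \<le> (2 * X + 4) * (X / (X + 1)) ^ d" using DX p0 by (simp add: algebra_simps)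
  then have "D \<le> 1 / 2" using small by linarith
  from relative_error[OF Rt_Re_pos(1)[OF w zw] Rt_Re_pos(1)[OF w zw]
      Rt_contraction[OF w zw \<Delta> a_def, where d = d, folded D_def] D0 this]
  have "cmod ((w * Rt z (d + m) S v) / (w * Rt z d S v) - 1) \<le> 2 * D" .
  with D2 have "cmod ((w * Rt z (d + m) S v) / (w * Rt z d S v) - 1) \<le> (2 * X + 4) * (X / (X + 1)) ^ d"
    by linarith
  then show "cmod (Rt z (d + m) S v / Rt z d S v - 1) \<le> (2 * X + 4) * (X / (X + 1)) ^ d"
    using w0 by simp
qed

text \<open>In this disc the recursion contracts in the ordinary metric: every denominator is within
  1/4 of 1, so one level multiplies the error by at most \<open>(1/8) / (3/4)^2 = 2/9\<close>.
  Unlike the half-plane estimate this covers the negative axis, so it also keeps the roots of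
  \<open>Z\<close> away from 0.\<close>

lemma Rt_error_disc:
  assumes z: "cmod z * \<Delta> \<le> 1 / 8" and \<Delta>: "\<And>S v. card (nbrs S v) \<le> \<Delta>"
  shows "Rt z d S v \<noteq> 0"
    and "cmod (Rt z (d + m) S v / Rt z d S v - 1) \<le> 4 * (1 / 2) ^ d"
proof -
  let ?s = "\<lambda>d S v. z * (\<Sum>u\<in>nbrs S v. Rt z d (insert v S) u)"
  have sle: "cmod (z * (\<Sum>u\<in>nbrs S v. g u)) \<le> cmod z * \<Delta> * b" if "\<And>u. cmod (g u) \<le> b" for b g S v
  proof -
    have b: "b \<ge> 0" using that[of undefined] norm_ge_zero order_trans by blast
    have "cmod (\<Sum>u\<in>nbrs S v. g u) \<le> (\<Sum>u\<in>nbrs S v. b)"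
      by (rule order_trans[OF norm_sum sum_mono[OF that]])
    also have "\<dots> = card (nbrs S v) * b" by simp
    also have "\<dots> \<le> \<Delta> * b" using \<Delta>[of S v] b by (intro mult_right_mono) auto
    finally show ?thesis by (simp add: norm_mult mult_left_mono mult.assoc)
  qed
  have den_aux: "cmod (1 + ?s d S v) \<ge> 3 / 4" "cmod (1 + ?s d S v) \<le> 5 / 4" if "\<And>S v. cmod (Rt z d S v) \<le> 2" for d S v
  proof -
    have "cmod (?s d S v) \<le> cmod z * \<Delta> * 2" using that by (intro sle)
    also have "\<dots> \<le> 1 / 4" using z by simp
    finally have "cmod (?s d S v) \<le> 1 / 4" .
    then show "cmod (1 + ?s d S v) \<ge> 3 / 4" "cmod (1 + ?s d S v) \<le> 5 / 4"
      using norm_triangle_ineq[of 1 "?s d S v"] norm_triangle_ineq4[of "1 + ?s d S v" "?s d S v"] by auto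
  qed
  have R2: "cmod (Rt z d S v) \<le> 2" for d S v
  proof (induction d arbitrary: S v)
    case (Suc d)
    have "inverse (cmod (1 + ?s d S v)) \<le> inverse (3 / 4)"
      by (rule le_imp_inverse_le) (use den_aux(1)[OF Suc] in auto)
    then show ?case by (simp add: norm_inverse)
  qed simp
  have den: "cmod (1 + ?s d S v) \<ge> 3 / 4" "cmod (1 + ?s d S v) \<le> 5 / 4" for d S v
    by (rule den_aux[OF R2])+
  have den0: "1 + ?s d S v \<noteq> 0" for d S v using den(1)[of d v S] by auto
  show nz: "Rt z d S v \<noteq> 0" for d S v using den0 by (cases d) auto
  have R1: "inverse (cmod (Rt z d S v)) \<le> 5 / 4" for d S v
    using den(2) by (cases d) (auto simp: norm_inverse)
  have diff: "cmod (Rt z (d + m) S v - Rt z d S v) \<le> 3 * (1 / 2) ^ d"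
  proof (induction d arbitrary: S v)
    case 0
    show ?case using norm_triangle_ineq4[of "Rt z m S v" 1] R2[of m S v] by simp
  next
    case (Suc d)
    have inv: "inverse x - inverse y = (y - x) / (x * y)" if "x \<noteq> 0" "y \<noteq> 0" for x y :: complex
      using that by (simp add: field_simps)
    have "Rt z (Suc d + m) S v - Rt z (Suc d) S v = ((1 + ?s d S v) - (1 + ?s (d + m) S v)) / ((1 + ?s (d + m) S v) * (1 + ?s d S v))"
      unfolding add_Suc Rt.simps by (rule inv) (rule den0)+
    moreover have "(1 + ?s d S v) - (1 + ?s (d + m) S v) = - (z * (\<Sum>u\<in>nbrs S v. Rt z (d + m) (insert v S) u - Rt z d (insert v S) u))"
      by (simp add: sum_subtractf algebra_simps)
    ultimately have "cmod (Rt z (Suc d + m) S v - Rt z (Suc d) S v)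
       = cmod (z * (\<Sum>u\<in>nbrs S v. Rt z (d + m) (insert v S) u - Rt z d (insert v S) u))
          / (cmod (1 + ?s (d + m) S v) * cmod (1 + ?s d S v))"
      by (simp only: norm_divide norm_mult norm_minus_cancel)
    also have "\<dots> \<le> (cmod z * \<Delta> * (3 * (1 / 2) ^ d)) / ((3 / 4) * (3 / 4))"
    proof (rule frac_le)
      show "cmod (z * (\<Sum>u\<in>nbrs S v. Rt z (d + m) (insert v S) u - Rt z d (insert v S) u))
          \<le> cmod z * \<Delta> * (3 * (1 / 2) ^ d)"
        by (rule sle) (rule Suc)
      show "3 / 4 * (3 / 4) \<le> cmod (1 + ?s (d + m) S v) * cmod (1 + ?s d S v)"
        by (rule mult_mono[OF den(1) den(1)]) auto
    qed auto
    also have "\<dots> \<le> (1 / 8 * (3 * (1 / 2) ^ d)) / ((3 / 4) * (3 / 4))"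
      by (intro divide_right_mono mult_right_mono z) auto
    also have "\<dots> \<le> 3 * (1 / 2) ^ Suc d" by simp
    finally show ?case .
  qed
  have "Rt z (d + m) S v / Rt z d S v - 1 = (Rt z (d + m) S v - Rt z d S v) * inverse (Rt z d S v)"
    using nz[of d S v] by (simp add: field_simps)
  then have "cmod (Rt z (d + m) S v / Rt z d S v - 1) = cmod (Rt z (d + m) S v - Rt z d S v) * inverse (cmod (Rt z d S v))"
    by (simp add: norm_mult norm_inverse)
  also have "\<dots> \<le> (3 * (1 / 2) ^ d) * (5 / 4)"
    by (intro mult_mono diff R1) auto
  also have "\<dots> \<le> 4 * (1 / 2) ^ d" by simp
  finally show "cmod (Rt z (d + m) S v / Rt z d S v - 1) \<le> 4 * (1 / 2) ^ d" .
qed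

text \<open>Depth \<open>d + n\<close> serves as the reference because the tree is complete there
  and \<open>Zt\<close> equals \<open>Z\<close>. The \<open>n\<close> relative errors \<eta> then
  multiply to at most \<open>exp (n * \<eta>)\<close>.\<close>

lemma Zt_error_aux:
  fixes \<eta> :: real
  assumes nz: "\<And>d S v. Rt z d S v \<noteq> 0"
    and err: "\<And>S v. cmod (Rt z (d + n) S v / Rt z d S v - 1) \<le> \<eta>" and n\<eta>: "n * \<eta> \<le> 1"
  shows "Z {} z \<noteq> 0" "cmod (Zt d z / Z {} z - 1) \<le> 2 * (n * \<eta>)"
proof -
  have \<eta>0: "\<eta> \<ge> 0" using err[of undefined undefined] norm_ge_zero order_trans by blast
  show "Z {} z \<noteq> 0" by (rule Z_nonzero[OF nz])
  have "Zt d z / Z {} z = (\<Prod>r<n. 1 + (Rt z (d + n) {..<r} r / Rt z d {..<r} r - 1))"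
    unfolding Z_eq_Zt[OF nz, of "d + n", simplified] Zt_def
    by (simp add: prod_dividef[symmetric] inverse_eq_divide)
  then have "cmod (Zt d z / Z {} z - 1) \<le> (\<Prod>r<n. 1 + cmod (Rt z (d + n) {..<r} r / Rt z d {..<r} r - 1)) - 1"
    using norm_prod_minus1_le_prod_minus1[of "\<lambda>r. Rt z (d + n) {..<r} r / Rt z d {..<r} r - 1" "{..<n}"] by simp
  also have "\<dots> \<le> (\<Prod>r<n. 1 + \<eta>) - 1"
    by (intro diff_right_mono prod_mono) (auto intro: err add_nonneg_nonneg)
  also have "\<dots> = (1 + \<eta>) ^ n - 1" by simp
  also have "(1 + \<eta>) ^ n \<le> exp \<eta> ^ n" using \<eta>0 by (intro power_mono exp_ge_add_one_self) auto
  also have "\<dots> = exp (n * \<eta>)" by (simp add: exp_of_nat_mult)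
  also have "\<dots> \<le> 1 + n * \<eta> + (n * \<eta>)\<^sup>2" using \<eta>0 n\<eta> by (intro exp_bound) auto
  also have "(n * \<eta>)\<^sup>2 \<le> n * \<eta>" using \<eta>0 n\<eta> by (simp add: power2_eq_square mult_left_le_one_le)
  finally show "cmod (Zt d z / Z {} z - 1) \<le> 2 * (n * \<eta>)" by (simp add: mult.commute)
qed

lemma Zt_error:
  assumes z: "z \<noteq> 0" "cmod z \<le> \<Lambda>" "Re z \<ge> 0 \<or> cmod z * \<Delta> \<le> 1 / 8" and \<Lambda>: "\<Lambda> \<ge> 1"
    and deg: "\<And>v. v < n \<Longrightarrow> degree E v \<le> \<Delta>" "\<Delta> \<ge> 1"
    and X: "X = 2 * \<Delta> * \<Lambda>" and n\<eta>: "n * ((2 * X + 4) * (X / (X + 1)) ^ d) \<le> 1" and n: "n \<ge> 1"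
  shows "Rt z d S v \<noteq> 0" "Z {} z \<noteq> 0" "Zt d z \<noteq> 0"
    "cmod (Zt d z / Z {} z - 1) \<le> 2 * (n * ((2 * X + 4) * (X / (X + 1)) ^ d))"
proof -
  have nb: "card (nbrs S v) \<le> \<Delta>" for S v
  proof (cases "v < n")
    case False
    then have "nbrs S v = {}" using edge_lt by (auto simp: nbrs_def)
    then show ?thesis by simp
  qed (meson card_nbrs deg order_trans)
  let ?\<eta> = "(2 * X + 4) * (X / (X + 1)) ^ d"
  have X2: "X \<ge> 2" using mult_mono[of 1 "real \<Delta>" 1 \<Lambda>] \<Lambda> deg(2) by (simp add: X)
  then have \<eta>0: "?\<eta> \<ge> 0" by simp
  have "1 * ?\<eta> \<le> n * ?\<eta>" using n \<eta>0 by (intro mult_right_mono) auto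
  then have \<eta>1: "?\<eta> \<le> 1" using n\<eta> by linarith
  have "(\<forall>d S v. Rt z d S v \<noteq> 0) \<and> (\<forall>S v. cmod (Rt z (d + n) S v / Rt z d S v - 1) \<le> ?\<eta>)"
  proof (cases "Re z \<ge> 0")
    case True
    from Rt_nonzero[of "csqrt z" z] True z(1) have nz: "Rt z d S v \<noteq> 0" for d S v
      using Re_csqrt_pos[of z] by (auto simp: complex_nonpos_Reals_iff complex_eq_iff)
    then show ?thesis using Rt_error_half_plane(2)[OF True z(1,2) nb deg(2) X \<eta>1] by blast
  next
    case False
    then have s: "cmod z * \<Delta> \<le> 1 / 8" using z by simp
    \<comment> \<open>The half-plane bound dominates the disc bound, since \<open>X \<ge> 2\<close>
      makes \<open>X / (X + 1)\<close> at least \<open>1 / 2\<close>; one error term thus serves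
      both regions.\<close>
    have "4 * (1 / 2) ^ d \<le> ?\<eta>" using X2 by (intro mult_mono power_mono) (auto simp: field_simps)
    then show ?thesis using Rt_error_disc[OF s nb] order_trans by blast
  qed
  then have nz: "\<And>d S v. Rt z d S v \<noteq> 0" and err: "\<And>S v. cmod (Rt z (d + n) S v / Rt z d S v - 1) \<le> ?\<eta>"
    by blast+
  show "Rt z d S v \<noteq> 0" by (rule nz)
  show "Zt d z \<noteq> 0" using nz by (simp add: Zt_def)
  show "Z {} z \<noteq> 0" "cmod (Zt d z / Z {} z - 1) \<le> 2 * (n * ?\<eta>)"
    using Zt_error_aux[OF nz err n\<eta>] by blast+
qed

end

section \<open>Location of the roots, mode and tail\<close>

lemma prod_mset_nonneg:
  fixes f :: "'a \<Rightarrow> real"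
  shows "(\<And>x. x \<in># R \<Longrightarrow> f x \<ge> 0) \<Longrightarrow> (\<Prod>x\<in>#R. f x) \<ge> 0"
  by (induction R) auto

text \<open>The two-index form says that ratios of consecutive terms decrease. It also excludes
  zeros between positive terms, which the usual condition, the case \<open>j = Suc i\<close>, does
  not.\<close>

definition log_concave :: "(nat \<Rightarrow> real) \<Rightarrow> bool" where
  "log_concave a \<longleftrightarrow> (\<forall>i. a i \<ge> 0) \<and> (\<forall>i j. i \<le> j \<longrightarrow> a i * a (Suc j) \<le> a (Suc i) * a j)"

text \<open>With \<open>b\<close> the shift of \<open>a\<close>, the new coefficients are
  \<open>r * a i + b i\<close>. The inequality is compared separately for each power of
  \<open>r\<close>; in the coefficient of \<open>r\<close> the products \<open>a i * a j\<close>
  cancel and the inequality labelled 2 remains.\<close>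

lemma log_concave_mult_linear:
  assumes "log_concave (coeff p)" "r \<ge> 0"
  shows "log_concave (coeff ([:r, 1:] * p))"
proof -
  define a where "a = coeff p"
  define b where "b = (\<lambda>i. case i of 0 \<Rightarrow> 0 | Suc i \<Rightarrow> a i)"
  have a0: "a i \<ge> 0" and lc: "i \<le> j \<Longrightarrow> a i * a (Suc j) \<le> a (Suc i) * a j" for i j
    using assms(1) by (auto simp: log_concave_def a_def)
  have b0: "b i \<ge> 0" and bS: "b (Suc i) = a i" for i by (auto simp: b_def a0 split: nat.split)
  have c: "coeff ([:r, 1:] * p) i = r * a i + b i" for i
    by (simp add: a_def b_def coeff_pCons split: nat.split)
  have 1: "b i * a j \<le> a i * b j" if "i \<le> j" for i j
    using lc[of "i - 1" "j - 1"] that a0 b0 by (cases i; cases j) (auto simp: b_def)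
  \<comment> \<open>Here the indices on the two sides differ by two shifts, so log-concavity is
    applied twice, unless the indices coincide and the two sides are equal.\<close>
  have 2: "b i * a (Suc j) \<le> a (Suc i) * b j" if ij: "i \<le> j" for i j
  proof (cases i)
    case 0
    then show ?thesis using a0 b0 by (simp add: b_def)
  next
    case (Suc i')
    then obtain j' where j: "j = Suc j'" "i' \<le> j'" using ij by (cases j) auto
    show ?thesis
    proof (cases "i' = j'")
      case True
      then show ?thesis using Suc j by (simp add: bS)
    next
      case False
      then show ?thesis using Suc j lc[of i' "Suc j'"] lc[of "Suc i'" j'] by (simp add: bS)
    qed
  qed
  have "(r * a i + b i) * (r * a (Suc j) + b (Suc j)) \<le> (r * a (Suc i) + b (Suc i)) * (r * a j + b j)"
    if "i \<le> j" for i j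
  proof -
    have "r * r * (a i * a (Suc j)) \<le> r * r * (a (Suc i) * a j)"
      using lc[OF that] by (intro mult_left_mono) auto
    moreover have "r * (b i * a (Suc j)) \<le> r * (a (Suc i) * b j)"
      using 2[OF that] assms(2) by (intro mult_left_mono)
    ultimately show ?thesis using 1[OF that] by (simp add: bS algebra_simps)
  qed
  then show ?thesis unfolding log_concave_def c using a0 b0 assms(2) by simp
qed

lemma log_concave_prod_mset:
  "(\<And>r. r \<in># R \<Longrightarrow> r \<ge> 0) \<Longrightarrow> log_concave (coeff (\<Prod>r\<in>#R. [:r, 1:]))"
proof (induction R)
  case empty
  show ?case by (auto simp: log_concave_def coeff_1)
next
  case (add r R)
  then show ?case by (simp add: log_concave_mult_linear del: mult_pCons_left)
qed

lemma log_concave_smult: "log_concave (coeff p) \<Longrightarrow> c \<ge> 0 \<Longrightarrow> log_concave (coeff (smult c p))"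
  unfolding log_concave_def coeff_smult
proof (intro conjI allI impI; elim conjE)
  fix i j :: nat
  assume c: "0 \<le> c" and *: "\<forall>i. 0 \<le> coeff p i"
    "\<forall>i j. i \<le> j \<longrightarrow> coeff p i * coeff p (Suc j) \<le> coeff p (Suc i) * coeff p j"
  show "0 \<le> c * coeff p i" using c * by simp
  assume "i \<le> j"
  then have "c * c * (coeff p i * coeff p (Suc j)) \<le> c * c * (coeff p (Suc i) * coeff p j)"
    using c * by (intro mult_left_mono) auto
  then show "c * coeff p i * (c * coeff p (Suc j)) \<le> c * coeff p (Suc i) * (c * coeff p j)"
    by (simp only: mult_ac)
qed

section \<open>Real roots, mode, and decay on the left half-circle\<close>

context fin_graph
begin

lemma Z_of_real: "Z S (of_real x :: complex) = of_real (Z S x)"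
  by (simp add: Z_def)

lemma mnum_pos: "k \<le> mstar \<Longrightarrow> mnum k > 0"
proof -
  assume k: "k \<le> mstar"
  obtain M where M: "is_matching E M" "card M = mstar" by (rule mstar_attained)
  obtain N where "N \<subseteq> M" "card N = k" using obtain_subset_with_card_n[of k M] k M by metis
  then have "N \<in> {M. is_matching E M \<and> card M = k}"
    using M by (auto simp: is_matching_def intro: pairwise_subset)
  moreover have "finite {M. is_matching E M \<and> card M = k}"
    by (rule finite_subset[OF _ finite_matchings']) auto
  ultimately show ?thesis unfolding num_matchings_def card_gt_0_iff by blast
qed

text \<open>Off the nonpositive axis \<open>csqrt\<close> provides the \<open>w\<close> for which
  all ratios are nonzero, so \<open>Z\<close> cannot vanish there (a theorem of Heilmann and Lieb).
  Every root is therefore \<open>-r\<close> with \<open>r \<ge> 0\<close>, and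
  \<open>Rt_error_disc\<close> pushes \<open>r\<close> above
  \<open>1 / (8 * \<Delta>)\<close>.\<close>

lemma Z_factorization:
  assumes deg: "\<And>v. v < n \<Longrightarrow> degree E v \<le> \<Delta>" "\<Delta> \<ge> 1"
  obtains R where "size R = mstar" "\<And>r. r \<in># R \<Longrightarrow> r > 1 / (8 * real \<Delta>)"
    "\<And>k. real (mnum k) = coeff (smult (real (mnum mstar)) (\<Prod>r\<in>#R. [:r, 1:])) k"
    "\<And>z::complex. Z {} z = of_nat (mnum mstar) * (\<Prod>r\<in>#R. z + of_real r)"
proof -
  define p :: "complex poly" where "p = (\<Sum>k\<le>mstar. monom (of_nat (mnum k)) k)"
  have coeff_p: "coeff p k = of_nat (mnum k)" for k
    using mnum_eq_0[of k] by (auto simp: p_def coeff_sum sum.delta if_distrib[of of_nat])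
  have poly_p: "poly p z = Z {} z" for z
    by (simp add: p_def poly_sum poly_monom Z_eq_sum)
  have deg_p: "Polynomial.degree p = mstar"
    using mnum_pos[of mstar] mnum_eq_0 by (intro antisym degree_le le_degree) (auto simp: coeff_p)
  have "p \<noteq> 0" using mnum_pos[of mstar] coeff_p[of mstar] by auto
  then obtain A where A: "size A = mstar" "p = smult (of_nat (mnum mstar)) (\<Prod>x\<in>#A. [:-x, 1:])"
    using alg_closed_imp_factorization[of p] by (auto simp: deg_p coeff_p)
  have nb: "card (nbrs S v) \<le> \<Delta>" for S v
  proof (cases "v < n")
    case False
    then have "nbrs S v = {}" using edge_lt by (auto simp: nbrs_def)
    then show ?thesis by simp
  qed (meson card_nbrs deg order_trans)
  have root: "x = - of_real (- Re x) \<and> - Re x > 1 / (8 * real \<Delta>)" if "x \<in># A" for x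
  proof -
    have "poly p x = 0" using that unfolding A(2) by (auto simp: poly_prod_mset prod_mset_zero_iff)
    then have Zx: "Z {} x = 0" by (simp add: poly_p)
    have x: "x \<in> \<real>\<^sub>\<le>\<^sub>0"
    proof (rule ccontr)
      assume "x \<notin> \<real>\<^sub>\<le>\<^sub>0"
      then have "Re (csqrt x) > 0" by (rule Re_csqrt_pos)
      then have "Rt x d S v \<noteq> 0" for d S v by (rule Rt_nonzero) simp
      then show False using Z_nonzero[of x] Zx by blast
    qed
    have "\<not> cmod x * \<Delta> \<le> 1 / 8"
    proof
      assume "cmod x * \<Delta> \<le> 1 / 8"
      from Rt_error_disc(1)[OF this nb] show False using Z_nonzero[of x] Zx by blast
    qed
    then have "cmod x > 1 / (8 * real \<Delta>)" using deg(2) by (simp add: field_simps)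
    moreover have "x = of_real (Re x)" "Re x \<le> 0"
      using x by (auto simp: complex_nonpos_Reals_iff complex_eq_iff)
    ultimately show ?thesis by (metis abs_of_nonpos minus_minus norm_of_real of_real_minus)
  qed
  define R where "R = image_mset (\<lambda>x. - Re x) A"
  have AR: "image_mset (\<lambda>r. - of_real r) R = A"
    unfolding R_def image_mset.compositionality
    by (rule trans[OF image_mset_cong[of _ _ id]]) (use root in auto)
  have map_prod: "map_poly complex_of_real (\<Prod>r\<in>#R. [:r, 1:]) = (\<Prod>r\<in>#R. [:of_real r, 1:])" for R
  proof (induction R)
    case (add r R)
    have "map_poly complex_of_real ([:r, 1:] * q) = [:of_real r, 1:] * map_poly of_real q" for q
      by (rule poly_eqI) (simp add: coeff_map_poly coeff_pCons split: nat.split)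
    then show ?case using add by (simp del: mult_pCons_left)
  qed simp
  have pR: "p = smult (of_nat (mnum mstar)) (\<Prod>r\<in>#R. [:of_real r, 1:])"
    unfolding A(2) AR[symmetric] by (simp add: image_mset.compositionality o_def)
  show ?thesis
  proof (rule that[of R])
    show "size R = mstar" using A by (simp add: R_def)
    show "r > 1 / (8 * real \<Delta>)" if "r \<in># R" for r using that root by (auto simp: R_def)
    show "real (mnum k) = coeff (smult (real (mnum mstar)) (\<Prod>r\<in>#R. [:r, 1:])) k" for k
    proof -
      have "of_real (real (mnum k)) = coeff p k" by (simp add: coeff_p)
      also have "\<dots> = of_real (coeff (smult (real (mnum mstar)) (\<Prod>r\<in>#R. [:r, 1:])) k)"
        unfolding pR map_prod[symmetric] by (simp add: coeff_map_poly)
      finally show ?thesis by (simp only: of_real_eq_iff)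
    qed
    show "Z {} z = of_nat (mnum mstar) * (\<Prod>r\<in>#R. z + of_real r)" for z :: complex
      unfolding poly_p[symmetric] pR by (simp add: poly_prod_mset image_mset.compositionality o_def add.commute)
  qed
qed

lemma mnum_log_concave:
  assumes deg: "\<And>v. v < n \<Longrightarrow> degree E v \<le> \<Delta>" "\<Delta> \<ge> 1"
  shows "log_concave (\<lambda>k. real (mnum k))"
proof -
  obtain R where R: "\<And>r. r \<in># R \<Longrightarrow> r > 1 / (8 * real \<Delta>)"
    "\<And>k. real (mnum k) = coeff (smult (real (mnum mstar)) (\<Prod>r\<in>#R. [:r, 1:])) k"
    using Z_factorization[OF deg] by metis
  have "r \<ge> 0" if "r \<in># R" for r using R(1)[OF that] by (rule order_trans[OF _ less_imp_le, rotated]) simp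
  then have "log_concave (coeff (smult (real (mnum mstar)) (\<Prod>r\<in>#R. [:r, 1:])))"
    by (intro log_concave_smult log_concave_prod_mset) auto
  moreover have "(\<lambda>k. real (mnum k)) = coeff (smult (real (mnum mstar)) (\<Prod>r\<in>#R. [:r, 1:]))"
    by (rule ext) (rule R(2))
  ultimately show ?thesis by (simp only:)
qed

text \<open>At \<open>l = a (k - 1) / a k\<close> the terms \<open>k - 1\<close> and
  \<open>k\<close> are equal, and log-concavity makes them maximal, so term \<open>k\<close> has at
  least the average weight. Iterating up to index \<open>mstar\<close>, whose coefficient is at
  least 1, gives \<open>l^(mstar - k) \<le> a k \<le> 2^(card E)\<close>. Since
  \<open>card E\<close> is linear in \<open>mstar\<close> and \<open>mstar\<close> in
  \<open>mstar - k\<close>, a root can be taken to bound \<open>l\<close>: this is where the slack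
  between \<open>k\<close> and \<open>mstar\<close> enters. The lower bound compares with the ratio
  at index 0, \<open>l \<ge> a 0 / a 1 = 1 / card E\<close>.\<close>

lemma mode_activity:
  assumes deg: "\<And>v. v < n \<Longrightarrow> degree E v \<le> \<Delta>" "\<Delta> \<ge> 1"
    and k: "1 \<le> k" "k < mstar" and D: "mstar \<le> D * (mstar - k)"
  obtains l :: real where "l > 0" "l \<le> 2 ^ (2 * \<Delta> * D)" "1 \<le> l * (n * n)"
    "Z {} l \<le> (n * n + 1) * (mnum k * l ^ k)"
proof -
  define a where "a = (\<lambda>k. real (mnum k))"
  define l where "l = a (k - 1) / a k"
  have lc: "i \<le> j \<Longrightarrow> a i * a (Suc j) \<le> a (Suc i) * a j" and a0: "a i \<ge> 0" for i j
    using mnum_log_concave[OF deg] by (auto simp: log_concave_def a_def)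
  have apos: "a i > 0" if "i \<le> mstar" for i using mnum_pos[OF that] by (simp add: a_def)
  have ak: "a k > 0" using apos k by simp
  have Sk: "Suc (k - 1) = k" using k by simp
  have l0: "l > 0" using ak apos[of "k - 1"] k by (simp add: l_def)
  have up: "a (Suc j) * l \<le> a j" if "k - 1 \<le> j" for j
    using lc[OF that] ak unfolding Sk by (simp add: l_def field_simps)
  have down: "a j \<le> a (Suc j) * l" if "j \<le> k - 1" for j
    using lc[OF that] ak unfolding Sk by (simp add: l_def field_simps)
  have up': "a (k + i) * l ^ i \<le> a k" for i
  proof (induction i)
    case (Suc i)
    have "a (k + Suc i) * l ^ Suc i = (a (Suc (k + i)) * l) * l ^ i" by simp
    also have "\<dots> \<le> a (k + i) * l ^ i" using l0 by (intro mult_right_mono up) auto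
    finally show ?case using Suc by simp
  qed simp
  have mode: "a j * l ^ j \<le> a k * l ^ k" for j
  proof (cases "j \<ge> k")
    case True
    then obtain i where j: "j = k + i" using le_Suc_ex by blast
    have "a (k + i) * l ^ i * l ^ k \<le> a k * l ^ k" using l0 by (intro mult_right_mono up') auto
    then show ?thesis by (simp add: j power_add mult_ac)
  next
    case False
    then have "j \<le> k" by simp
    then show ?thesis
    proof (induction rule: inc_induct)
      case (step j)
      have "a j * l ^ j \<le> (a (Suc j) * l) * l ^ j"
        using l0 step by (intro mult_right_mono down) auto
      also have "\<dots> = a (Suc j) * l ^ Suc j" by simp
      finally show ?case using step by linarith
    qed simp
  qed
  show ?thesis
  proof (rule that[OF l0])
    have "a (k + (mstar - k)) * l ^ (mstar - k) \<le> a k" by (rule up')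
    moreover have "1 \<le> a mstar" using mnum_mstar by (simp add: a_def)
    then have "1 * l ^ (mstar - k) \<le> a mstar * l ^ (mstar - k)"
      using l0 by (intro mult_right_mono) auto
    moreover have "k + (mstar - k) = mstar" using k by simp
    ultimately have "1 * l ^ (mstar - k) \<le> a k" by simp
    also have "a k \<le> 2 ^ card E"
      unfolding a_def using mnum_le[of k] by (metis of_nat_le_iff of_nat_numeral of_nat_power)
    also have "\<dots> \<le> (2::real) ^ (2 * \<Delta> * (D * (mstar - k)))"
    proof (rule power_increasing)
      have "card E \<le> 2 * \<Delta> * mstar" by (rule card_E_le_mstar[OF deg(1)])
      also have "\<dots> \<le> 2 * \<Delta> * (D * (mstar - k))" by (rule mult_le_mono2[OF D])
      finally show "card E \<le> 2 * \<Delta> * (D * (mstar - k))" .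
    qed simp
    also have "\<dots> = (2 ^ (2 * \<Delta> * D)) ^ (mstar - k)" by (simp add: power_mult[symmetric] mult_ac)
    finally have "l ^ (mstar - k) \<le> (2 ^ (2 * \<Delta> * D)) ^ (mstar - k)" by simp
    then show "l \<le> 2 ^ (2 * \<Delta> * D)"
      using k power_le_imp_le_base[of l "mstar - k - 1" "2 ^ (2 * \<Delta> * D)"] by (simp add: Suc_diff_Suc)
    have "a 0 * a k \<le> a 1 * a (k - 1)" using lc[of 0 "k - 1"] Sk by simp
    then have "1 \<le> a 1 * l" using ak by (simp add: l_def field_simps a_def mnum_0)
    also have "\<dots> \<le> (n * n) * l"
      using l0 card_E_le mnum_1 unfolding a_def by (intro mult_right_mono) (simp_all flip: of_nat_mult)
    finally show "1 \<le> l * (n * n)" by (simp add: mult.commute)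
    have "Z {} l = (\<Sum>j\<le>mstar. a j * l ^ j)" by (simp add: Z_eq_sum a_def)
    also have "\<dots> \<le> (\<Sum>j\<le>mstar. a k * l ^ k)" by (intro sum_mono mode)
    also have "\<dots> = (mstar + 1) * (a k * l ^ k)" by simp
    also have "\<dots> \<le> (n * n + 1) * (a k * l ^ k)"
    proof (intro mult_right_mono)
      have "mstar \<le> card E" using mstar_attained card_mono[OF finite_E] by (metis is_matching_def)
      then show "real (mstar + 1) \<le> real (n * n + 1)" using card_E_le by linarith
    qed (use ak l0 in auto)
    finally show "Z {} l \<le> (n * n + 1) * (mnum k * l ^ k)" by (simp add: a_def)
  qed
qed

text \<open>For \<open>Re z \<le> 0\<close> each root \<open>-r\<close> with \<open>r\<close> in a
  bounded range makes \<open>cmod (z + r)\<close> smaller than \<open>l + r\<close> by a constant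
  factor \<rho>, and \<open>g\<close> counts these roots. Roots with \<open>r > K\<close> give no
  gain, but there are few of them, because the product of all \<open>r\<close> is at most 1 and each
  \<open>r\<close> is at least \<open>b\<close>. The choice \<open>K = 1 / b^2\<close> gives
  \<open>2 * s \<le> g\<close> for their number \<open>s\<close>, so \<open>g\<close> is at least
  \<open>mstar / 2\<close>, which in turn is linear in \<open>card E\<close>.\<close>

lemma tail_bound:
  assumes deg: "\<And>v. v < n \<Longrightarrow> degree E v \<le> \<Delta>" "\<Delta> \<ge> 1"
    and z: "cmod z = l" "Re z \<le> 0" and l: "1 / (8 * real \<Delta>) \<le> l" "l \<le> \<Lambda>"
    and \<rho>: "\<rho> = sqrt (1 - 2 * (1 / (8 * real \<Delta>))\<^sup>2 / (\<Lambda> + (8 * real \<Delta>)\<^sup>2)\<^sup>2)"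
  obtains g where "card E \<le> 4 * \<Delta> * g" "cmod (Z {} z) \<le> \<rho> ^ g * Z {} l"
proof -
  obtain R where R: "size R = mstar" "\<And>r. r \<in># R \<Longrightarrow> r > 1 / (8 * real \<Delta>)"
    "\<And>k. real (mnum k) = coeff (smult (real (mnum mstar)) (\<Prod>r\<in>#R. [:r, 1:])) k"
    "\<And>z::complex. Z {} z = of_nat (mnum mstar) * (\<Prod>r\<in>#R. z + of_real r)"
    using Z_factorization[OF deg] by metis
  define b where "b = 1 / (8 * real \<Delta>)"
  define K where "K = (8 * real \<Delta>)\<^sup>2"
  have b: "b > 0" "b < 1" "K = 1 / b\<^sup>2" using deg(2) by (auto simp: b_def K_def power2_eq_square)
  define g where "g = size (filter_mset (\<lambda>r. r \<le> K) R)"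
  define s where "s = size (filter_mset (\<lambda>r. \<not> r \<le> K) R)"
  have gs: "g + s = mstar" unfolding g_def s_def R(1)[symmetric]
    by (metis multiset_partition size_union)
  have Rb: "r \<ge> b" if "r \<in># R" for r using R(2)[OF that] by (simp add: b_def)
  \<comment> \<open>The constant coefficient is \<open>mnum 0 = 1\<close> and equals the leading
    coefficient, which is at least 1, times the product of the \<open>r\<close>.\<close>
  have "(\<Prod>r\<in>#R. r) \<le> 1"
  proof -
    have "1 = real (mnum mstar) * coeff (\<Prod>r\<in>#R. [:r, 1:]) 0" using R(3)[of 0] by (simp add: mnum_0)
    also have "coeff (\<Prod>r\<in>#R. [:r, 1:]) 0 = (\<Prod>r\<in>#R. r)"
      by (simp add: poly_0_coeff_0[symmetric] poly_prod_mset image_mset.compositionality o_def)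
    finally have "1 = real (mnum mstar) * (\<Prod>r\<in>#R. r)" .
    moreover have "(\<Prod>r\<in>#R. r) \<ge> 0" using Rb b by (intro prod_mset_nonneg) (meson less_imp_le order_trans)
    ultimately show ?thesis using mnum_mstar mult_right_mono[of 1 "real (mnum mstar)" "\<Prod>r\<in>#R. r"] by simp
  qed
  moreover have "b ^ size (filter_mset (\<lambda>r. r \<le> K) R) * K ^ size (filter_mset (\<lambda>r. \<not> r \<le> K) R) \<le> (\<Prod>r\<in>#R. r)"
    using Rb
  proof (induction R)
    case (add r R)
    have nn: "0 \<le> b ^ size (filter_mset (\<lambda>r. r \<le> K) R) * K ^ size (filter_mset (\<lambda>r. \<not> r \<le> K) R)"
      using b by simp
    show ?case
    proof (cases "r \<le> K")
      case True
      have "b * (b ^ size (filter_mset (\<lambda>r. r \<le> K) R) * K ^ size (filter_mset (\<lambda>r. \<not> r \<le> K) R)) \<le> r * (\<Prod>r\<in>#R. r)"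
        using add.prems[of r] b nn by (intro mult_mono add.IH add.prems) auto
      then show ?thesis using True by (simp add: mult_ac)
    next
      case False
      have "K * (b ^ size (filter_mset (\<lambda>r. r \<le> K) R) * K ^ size (filter_mset (\<lambda>r. \<not> r \<le> K) R)) \<le> r * (\<Prod>r\<in>#R. r)"
        using False add.prems[of r] b nn by (intro mult_mono add.IH add.prems) auto
      then show ?thesis using False by (simp add: mult_ac)
    qed
  qed simp
  ultimately have "b ^ g * K ^ s \<le> 1" unfolding g_def s_def by linarith
  then have "b ^ g \<le> (b\<^sup>2) ^ s" using b by (simp add: field_simps power_divide)
  then have "b ^ g \<le> b ^ (2 * s)" by (simp only: power_mult)
  then have "(1 / b) ^ (2 * s) \<le> (1 / b) ^ g" using b by (simp add: power_one_over field_simps)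
  then have s2: "2 * s \<le> g" by (rule power_le_imp_le_exp[rotated]) (use b in simp)
  have "card E \<le> 2 * \<Delta> * mstar" by (rule card_E_le_mstar[OF deg(1)])
  also have "\<dots> \<le> 2 * \<Delta> * (2 * g)" using gs s2 by (intro mult_le_mono2) linarith
  finally have cE: "card E \<le> 4 * \<Delta> * g" by simp
  have l0: "l > 0" using l(1) b by (auto simp: b_def[symmetric])
  define q where "q = 1 - 2 * b\<^sup>2 / (\<Lambda> + K)\<^sup>2"
  have \<rho>q: "\<rho> = sqrt q" by (simp add: \<rho> q_def b_def K_def)
  have LK: "\<Lambda> + K > 0" using l l0 by (simp add: K_def add_pos_nonneg)
  have fac: "cmod (z + of_real r) \<le> \<rho> * (l + r)" if r: "b \<le> r" "r \<le> K" for r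
  proof -
    have r0: "r > 0" using r b by simp
    have "(cmod (z + of_real r))\<^sup>2 = l\<^sup>2 + 2 * (r * Re z) + r\<^sup>2"
      unfolding z(1)[symmetric] cmod_power2 by (simp add: power2_eq_square algebra_simps)
    also have "\<dots> \<le> l\<^sup>2 + r\<^sup>2" using z(2) r0 by (simp add: mult_nonneg_nonpos)
    also have "\<dots> = (l + r)\<^sup>2 - 2 * (l * r)" by (simp add: power2_eq_square algebra_simps)
    \<comment> \<open>Both \<open>l\<close> and \<open>r\<close> are at least \<open>b\<close>. The
      additive gain obtained here becomes the factor \<open>q\<close> because
      \<open>l + r \<le> \<Lambda> + K\<close>.\<close>
    also have "\<dots> \<le> (l + r)\<^sup>2 - 2 * b\<^sup>2 * 1"
    proof -
      have "b * b \<le> l * r" by (rule mult_mono) (use l(1) r b l0 in \<open>simp_all add: b_def\<close>)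
      then show ?thesis by (simp add: power2_eq_square)
    qed
    also have "\<dots> \<le> (l + r)\<^sup>2 - 2 * b\<^sup>2 * ((l + r)\<^sup>2 / (\<Lambda> + K)\<^sup>2)"
    proof -
      have "(l + r)\<^sup>2 \<le> (\<Lambda> + K)\<^sup>2" using l r l0 r0 by (intro power_mono) auto
      then have "(l + r)\<^sup>2 / (\<Lambda> + K)\<^sup>2 \<le> 1" using LK by simp
      then show ?thesis by (intro diff_left_mono mult_left_mono) auto
    qed
    also have "\<dots> = q * (l + r)\<^sup>2" by (simp add: q_def algebra_simps)
    finally have "(cmod (z + of_real r))\<^sup>2 \<le> q * (l + r)\<^sup>2" .
    then have "cmod (z + of_real r) \<le> sqrt (q * (l + r)\<^sup>2)" by (rule real_le_rsqrt)
    then show ?thesis using l0 r0 by (simp add: \<rho>q real_sqrt_mult)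
  qed
  have "1 \<le> K" using b by (simp add: power_le_one)
  then have "b \<le> K" using b by linarith
  then have "0 \<le> \<rho> * (l + b)" using fac[of b] norm_ge_zero order_trans by blast
  then have \<rho>0: "\<rho> \<ge> 0" using l0 b by (simp add: zero_le_mult_iff)
  have "cmod (\<Prod>r\<in>#R. z + of_real r) \<le> \<rho> ^ size (filter_mset (\<lambda>r. r \<le> K) R) * (\<Prod>r\<in>#R. l + r)"
    using Rb
  proof (induction R)
    case (add r R)
    have r: "r \<ge> b" using add.prems by simp
    have nn: "0 \<le> \<rho> ^ size (filter_mset (\<lambda>r. r \<le> K) R) * (\<Prod>r\<in>#R. l + r)"

    proof (intro mult_nonneg_nonneg prod_mset_nonneg)
      show "l + r' \<ge> 0" if "r' \<in># R" for r' using that add.prems[of r'] b l0 by simp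
    qed (use \<rho>0 in auto)
    have IH: "cmod (\<Prod>r\<in>#R. z + of_real r) \<le> \<rho> ^ size (filter_mset (\<lambda>r. r \<le> K) R) * (\<Prod>r\<in>#R. l + r)"
      using add by auto
    show ?case
    proof (cases "r \<le> K")
      case True
      have "cmod (z + of_real r) * cmod (\<Prod>r\<in>#R. z + of_real r)
        \<le> (\<rho> * (l + r)) * (\<rho> ^ size (filter_mset (\<lambda>r. r \<le> K) R) * (\<Prod>r\<in>#R. l + r))"
        using fac[OF r True] \<rho>0 l0 r b by (intro mult_mono IH) auto
      then show ?thesis using True by (simp add: norm_mult mult_ac)
    next
      case False
      have "cmod (z + of_real r) \<le> l + r" using norm_triangle_ineq[of z "of_real r"] z r b by simp
      then have "cmod (z + of_real r) * cmod (\<Prod>r\<in>#R. z + of_real r)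
        \<le> (l + r) * (\<rho> ^ size (filter_mset (\<lambda>r. r \<le> K) R) * (\<Prod>r\<in>#R. l + r))"
        using l0 r b by (intro mult_mono IH) auto
      then show ?thesis using False by (simp add: norm_mult mult_ac)
    qed
  qed simp
  then have "mnum mstar * cmod (\<Prod>r\<in>#R. z + of_real r) \<le> mnum mstar * (\<rho> ^ g * (\<Prod>r\<in>#R. l + r))"
    unfolding g_def by (intro mult_left_mono) auto
  moreover have "Z {} l = mnum mstar * (\<Prod>r\<in>#R. l + r)"
  proof -
    have "of_real (\<Prod>r\<in>#R. l + r) = (\<Prod>r\<in>#R. complex_of_real l + of_real r)"
      by (induction R) auto
    then have "complex_of_real (Z {} l) = of_real (mnum mstar * (\<Prod>r\<in>#R. l + r))"
      unfolding Z_of_real[symmetric] R(4) by simp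
    then show ?thesis by (simp only: of_real_eq_iff)
  qed
  ultimately have "cmod (Z {} z) \<le> \<rho> ^ g * Z {} l" unfolding R(4) by (simp add: norm_mult mult_ac)
  with cE show ?thesis by (rule that)
qed

end

section \<open>Extraction of a coefficient\<close>

definition zeta :: "nat \<Rightarrow> complex" where
  "zeta N = (of_nat N + \<i>)\<^sup>2 / of_nat (N\<^sup>2 + 1)"

text \<open>\<open>zeta N\<close> is \<open>(N + \<i>) / (N - \<i>)\<close> with the denominator
  made real, hence twice the argument of \<open>N + \<i>\<close>. Its angle is about
  \<open>2 / N\<close>, small enough to separate all exponents up to \<open>N\<close>.\<close>

lemma zeta_eq_cis:
  assumes "N \<ge> 1"
  shows "zeta N = cis (2 * arctan (1 / N))"
proof -
  define y where "y = 1 / real N"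
  have y: "sqrt (1 + y\<^sup>2) * sqrt (1 + y\<^sup>2) = 1 + y\<^sup>2" by (simp add: abs_of_nonneg)
  have "cis (2 * arctan y) = cis (arctan y) ^ 2" by (simp add: cis_mult power2_eq_square)
  also have "cis (arctan y) = (1 + \<i> * of_real y) / of_real (sqrt (1 + y\<^sup>2))"
    by (simp add: complex_eq_iff cos_arctan sin_arctan)
  also have "\<dots> ^ 2 = (1 + \<i> * of_real y) ^ 2 / of_real (1 + y\<^sup>2)"
    by (simp add: power_divide power2_eq_square[of "of_real (sqrt (1 + y\<^sup>2))"] y flip: of_real_mult)
  also have "\<dots> = zeta N"
  proof -
    have N: "(of_nat N :: complex) \<noteq> 0" using assms by simp
    have "1 + \<i> * of_real y = (of_nat N + \<i>) / of_nat N" using N by (simp add: y_def field_simps)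
    moreover have "complex_of_real (1 + y\<^sup>2) = of_nat (N\<^sup>2 + 1) / (of_nat N)\<^sup>2"
      using N by (simp add: y_def field_simps)
    ultimately show ?thesis using N by (simp add: zeta_def power_divide)
  qed
  finally show ?thesis by (simp add: y_def)
qed

lemma cos_ge_half: "\<bar>x::real\<bar> \<le> 1 \<Longrightarrow> cos x \<ge> 1 / 2"
  using cos_monotone_0_pi_le[of "\<bar>x\<bar>" "pi / 3"] pi_gt3 by (simp add: cos_60)

lemma sin_ge_half:
  fixes x :: real
  assumes "0 \<le> x" "x \<le> 1"
  shows "sin x \<ge> x / 2"
proof (cases "x = 0")
  case False
  then obtain t where t: "0 < t" "t < x" "sin x - sin 0 = (x - 0) * cos t"
    using MVT2[of 0 x sin cos] assms by (auto intro: DERIV_sin)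
  have "x * (1 / 2) \<le> x * cos t" using assms t by (intro mult_left_mono cos_ge_half) auto
  then show ?thesis using t by simp
qed simp

lemma arctan_ge_half:
  fixes y :: real
  assumes "0 \<le> y" "y \<le> 1"
  shows "arctan y \<ge> y / 2"
proof -
  define x where "x = arctan y"
  have x: "0 \<le> x" "x \<le> 1" using assms arctan_le_self[of y] by (auto simp: x_def)
  have "y = sin x / cos x" using tan_arctan[of y] by (simp add: tan_def x_def)
  also have "\<dots> \<le> x / (1 / 2)" using x cos_ge_half[of x] by (intro frac_le sin_x_le_x) auto
  finally show ?thesis by (simp add: x_def)
qed

lemma norm_zeta: "N \<ge> 1 \<Longrightarrow> cmod (zeta N) = 1"
  by (simp add: zeta_eq_cis)

text \<open>The half-angle \<open>m * arctan (1/N)\<close> is at most 1 for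
  \<open>m \<le> N\<close>, so the rotation does not come round to 1 again, and the chord
  \<open>2 * sin\<close> of the half-angle is at least the half-angle, which exceeds
  \<open>1 / (2 * N)\<close>.\<close>

lemma zeta_power_diff:
  assumes "1 \<le> m" "m \<le> N"
  shows "cmod (zeta N ^ m - 1) \<ge> 1 / (2 * N)"
proof -
  define x where "x = m * arctan (1 / N)"
  have N: "N \<ge> 1" using assms by simp
  have a: "arctan (1 / N) \<ge> 1 / (2 * N)" using arctan_ge_half[of "1 / N"] N by simp
  have "x \<le> N * arctan (1 / N)" using assms by (auto simp: x_def intro!: mult_right_mono)
  also have "\<dots> \<le> N * (1 / N)" by (intro mult_left_mono arctan_le_self) auto
  finally have x1: "x \<le> 1" using N by simp
  have "1 * arctan (1 / N) \<le> x" unfolding x_def using assms by (intro mult_right_mono) auto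
  then have x0: "1 / (2 * N) \<le> x" using a by simp
  have x2: "0 \<le> x" by (rule order_trans[OF _ x0]) simp
  have eq: "zeta N ^ m = cis (2 * x)" using N by (simp add: zeta_eq_cis Complex.DeMoivre x_def mult_ac)
  have "cis (2 * x) - 1 = cis x * (cis x - cis (- x))" by (simp add: right_diff_distrib cis_mult)
  also have "cis x - cis (- x) = 2 * \<i> * of_real (sin x)" by (simp add: complex_eq_iff)
  finally have "cis (2 * x) - 1 = cis x * (2 * \<i> * of_real (sin x))" .
  then have "cmod (zeta N ^ m - 1) = 2 * \<bar>sin x\<bar>" unfolding eq by (simp add: norm_mult)
  moreover have "sin x \<ge> x / 2" by (rule sin_ge_half[OF x2 x1])
  ultimately show ?thesis using x0 by linarith
qed

text \<open>This replaces the orthogonality of roots of unity: the bound does not depend on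
  \<open>J\<close>, so averaging over many more than \<open>N\<close> powers suppresses all
  exponents but one.\<close>

lemma geometric_sum_bound:
  fixes w :: complex and N :: nat
  assumes "cmod w = 1" "cmod (w - 1) \<ge> 1 / (2 * N)" "N \<ge> 1"
  shows "cmod (\<Sum>j<J. w ^ j) \<le> 4 * N"
proof -
  have "w \<noteq> 1" using assms by auto
  then have "(\<Sum>j<J. w ^ j) = (w ^ J - 1) / (w - 1)" by (rule geometric_sum)
  then have "cmod (\<Sum>j<J. w ^ j) = cmod (w ^ J - 1) / cmod (w - 1)" by (simp add: norm_divide)
  also have "\<dots> \<le> 2 / (1 / (2 * N))"
    using norm_triangle_ineq4[of "w ^ J" 1] assms by (intro frac_le) (auto simp: norm_power)
  finally show ?thesis by simp
qed

text \<open>As \<open>P i = m * s i\<close>, the number \<open>m\<close> is the quotient of the sums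
  of \<open>P\<close> and \<open>s\<close>. The errors of \<open>T\<close> are additive, so an index
  with tiny \<open>P i\<close> may be estimated badly; all errors together are still at most
  \<open>\<epsilon> / 8\<close> of the single good term \<open>P i0\<close>. The errors of
  \<open>s i / r i\<close> are relative and need no good index.\<close>

lemma relative_approx_quotient:
  fixes P T s r :: "'a \<Rightarrow> real" and e p m \<epsilon> :: real
  assumes fin: "finite I" and i0: "i0 \<in> I" "p \<le> P i0" "p > 0" and m: "m > 0"
    and P: "\<And>i. i \<in> I \<Longrightarrow> P i = m * s i" "\<And>i. i \<in> I \<Longrightarrow> s i > 0"
    and T: "\<And>i. i \<in> I \<Longrightarrow> \<bar>T i - P i\<bar> \<le> e" and e: "card I * e \<le> \<epsilon> / 8 * p" "e \<le> \<epsilon> / 8"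
    and r: "\<And>i. i \<in> I \<Longrightarrow> \<bar>r i - 1\<bar> \<le> e"
    and \<epsilon>: "0 < \<epsilon>" "\<epsilon> < 1"
  shows "relative_approx \<epsilon> m (sum T I / (\<Sum>i\<in>I. s i / r i))" "sum T I > 0" "(\<Sum>i\<in>I. s i / r i) > 0"
proof -
  define S where "S = sum s I"
  have Ppos: "P i > 0" if "i \<in> I" for i using P m that by simp
  have S: "S > 0" unfolding S_def using fin i0 P(2) by (intro sum_pos) auto
  have mS: "m * S = sum P I" unfolding S_def sum_distrib_left by (rule sum.cong) (simp_all add: P)
  have "P i0 \<le> sum P I" using Ppos by (intro member_le_sum[OF i0(1)]) (auto intro: less_imp_le fin)
  then have p: "p \<le> m * S" using i0 mS by linarith
  have "\<bar>sum T I - sum P I\<bar> \<le> (\<Sum>i\<in>I. \<bar>T i - P i\<bar>)" unfolding sum_subtractf[symmetric] by (rule sum_abs)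
  also have "\<dots> \<le> card I * e" using sum_mono[OF T, of I] by simp
  also have "\<dots> \<le> \<epsilon> / 8 * p" by (rule e)
  also have "\<dots> \<le> \<epsilon> / 8 * (m * S)" using p \<epsilon> by (intro mult_left_mono) auto
  finally have T1: "(1 - \<epsilon> / 8) * (m * S) \<le> sum T I" "sum T I \<le> (1 + \<epsilon> / 8) * (m * S)"
    unfolding mS left_diff_distrib distrib_right by linarith+
  have e0: "e \<ge> 0" using T[OF i0(1)] by linarith
  have rb: "1 - e \<le> r i" "r i \<le> 1 + e" if "i \<in> I" for i using r[OF that] by (auto simp: abs_le_iff)
  have e1: "1 - e > 0" using e(2) \<epsilon> by linarith
  have rpos: "r i > 0" if "i \<in> I" for i using rb(1)[OF that] e1 by linarith
  define D where "D = (\<Sum>i\<in>I. s i / r i)"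
  have "S / (1 + e) = (\<Sum>i\<in>I. s i / (1 + e))" by (simp add: S_def sum_divide_distrib)
  also have "\<dots> \<le> D" unfolding D_def
    using rb rpos P(2) by (intro sum_mono frac_le) (auto intro: less_imp_le)
  finally have D1: "S / (1 + e) \<le> D" .
  have "D \<le> (\<Sum>i\<in>I. s i / (1 - e))" unfolding D_def
    using rb e1 P(2) by (intro sum_mono frac_le) (auto intro: less_imp_le)
  also have "\<dots> = S / (1 - e)" by (simp add: S_def sum_divide_distrib)
  finally have D2: "D \<le> S / (1 - e)" .
  have D0: "D > 0" using D1 S e0 by (smt (verit) divide_pos_pos)
  have T0: "sum T I > 0" using T1(1) m S \<epsilon> by (smt (verit) mult_pos_pos divide_less_eq_1_pos)
  \<comment> \<open>Numerator and denominator may each be off by \<open>\<epsilon> / 8\<close>. For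
    \<epsilon> below 1, \<open>exp (- \<epsilon>)\<close> is at most
    \<open>1 - \<epsilon> / 2\<close>, which leaves room for both.\<close>
  have ex: "exp (- \<epsilon>) \<le> (1 - \<epsilon> / 8) * (1 - e)"
  proof -
    have "exp (- \<epsilon>) \<le> 1 / (1 + \<epsilon>)"
      using exp_ge_add_one_self[of \<epsilon>] \<epsilon> by (simp add: exp_minus field_simps)
    also have "\<dots> \<le> 1 - \<epsilon> / 2"
    proof -
      have "\<epsilon> * \<epsilon> \<le> \<epsilon>" using \<epsilon> by simp
      then show ?thesis using \<epsilon> by (simp add: field_simps)
    qed
    also have "\<dots> \<le> (1 - \<epsilon> / 8) * (1 - \<epsilon> / 8)" using \<epsilon> by (simp add: algebra_simps)
    also have "\<dots> \<le> (1 - \<epsilon> / 8) * (1 - e)" using e \<epsilon> by (intro mult_left_mono) auto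
    finally show ?thesis .
  qed
  have ex': "(1 + \<epsilon> / 8) * (1 + e) \<le> exp \<epsilon>"
  proof -
    have "(1 + \<epsilon> / 8) * (1 + e) \<le> (1 + \<epsilon> / 8) * (1 + \<epsilon> / 8)" using e \<epsilon> by (intro mult_left_mono) auto
    also have "\<dots> \<le> exp (\<epsilon> / 8) * exp (\<epsilon> / 8)" using \<epsilon> by (intro mult_mono exp_ge_add_one_self) auto
    also have "\<dots> = exp (\<epsilon> / 4)" by (simp add: exp_add[symmetric])
    also have "\<dots> \<le> exp \<epsilon>" using \<epsilon> by simp
    finally show ?thesis .
  qed
  have "exp (- \<epsilon>) * m * D \<le> exp (- \<epsilon>) * m * (S / (1 - e))" using m D2 by (intro mult_left_mono) auto
  also have "\<dots> = exp (- \<epsilon>) * (m * S / (1 - e))" by simp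
  also have "\<dots> \<le> (1 - \<epsilon> / 8) * (1 - e) * (m * S / (1 - e))"
    using m S e1 by (intro mult_right_mono ex) auto
  also have "\<dots> = (1 - \<epsilon> / 8) * (m * S)" using e1 by simp
  finally have A1: "exp (- \<epsilon>) * m \<le> sum T I / D" using T1(1) D0 by (simp add: pos_le_divide_eq)
  have "(1 + \<epsilon> / 8) * (m * S) = (1 + \<epsilon> / 8) * (1 + e) * m * (S / (1 + e))" using e0 by simp
  also have "\<dots> \<le> (1 + \<epsilon> / 8) * (1 + e) * m * D" using D1 m \<epsilon> e0 by (intro mult_left_mono) auto
  also have "\<dots> \<le> exp \<epsilon> * m * D" using ex' m D0 by (intro mult_right_mono) auto
  finally have A2: "sum T I / D \<le> exp \<epsilon> * m" using T1(2) D0 by (simp add: pos_divide_le_eq)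
  show "relative_approx \<epsilon> m (sum T I / (\<Sum>i\<in>I. s i / r i))" "sum T I > 0" "(\<Sum>i\<in>I. s i / r i) > 0"
    using A1 A2 T0 D0 by (auto simp: relative_approx_def D_def)
qed

section \<open>Approximate Fourier inversion\<close>

context fin_graph
begin

lemma norm_Z_le: "cmod (Z {} z) \<le> Z {} (cmod z)"
  unfolding Z_eq_sum by (rule order_trans[OF norm_sum]) (simp add: norm_mult norm_power)

lemma Z_real_pos: "(l::real) > 0 \<Longrightarrow> Z {} l > 0"
proof -
  assume l: "l > 0"
  have "of_nat (mnum 0) * l ^ 0 \<le> Z {} l" unfolding Z_eq_sum
    using l by (intro member_le_sum) auto
  then show ?thesis by (simp add: mnum_0)
qed

text \<open>After the rotation by \<open>- j * k\<close> the exponent \<open>m\<close> contributes a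
  geometric sum with ratio \<open>zeta N ^ (m - k)\<close> (conjugated for \<open>m < k\<close>).
  For \<open>m = k\<close> this is \<open>J\<close>, and all others are at most
  \<open>4 * N\<close>, since \<open>mstar \<le> N\<close> bounds the distance of the
  exponents.\<close>

lemma fourier_coefficient:
  fixes l :: real
  assumes l: "l > 0" and N: "mstar \<le> N" "N \<ge> 1" and k: "k \<le> mstar"
  shows "cmod ((\<Sum>j<J. Z {} (of_real l * zeta N ^ j) * cnj (zeta N) ^ (j * k)) - of_nat J * of_real (mnum k * l ^ k))
    \<le> 4 * N * Z {} l"
proof -
  let ?w = "\<lambda>m. zeta N ^ m * cnj (zeta N) ^ k"
  have unit: "zeta N * cnj (zeta N) = 1"
    using norm_zeta[OF N(2)] by (simp add: complex_norm_square[symmetric])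
  have cz: "cmod (zeta N) = 1" by (rule norm_zeta[OF N(2)])
  have wk: "?w k = 1" by (simp add: power_mult_distrib[symmetric] unit)
  have w1: "cmod (?w m - 1) \<ge> 1 / (2 * N)" if "m \<le> mstar" "m \<noteq> k" for m
  proof (cases "m \<ge> k")
    case True
    have "?w m = zeta N ^ (m - k) * (zeta N ^ k * cnj (zeta N) ^ k)"
      using True by (simp add: power_add[symmetric] mult.assoc[symmetric])
    then have "?w m = zeta N ^ (m - k)" using wk by simp
    then show ?thesis using zeta_power_diff[of "m - k" N] True that N by simp
  next
    case False
    have "cnj (zeta N) ^ k = cnj (zeta N) ^ m * cnj (zeta N) ^ (k - m)"
      using False by (simp add: power_add[symmetric])
    then have "?w m = (zeta N * cnj (zeta N)) ^ m * cnj (zeta N) ^ (k - m)"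
      by (simp add: power_mult_distrib mult.assoc)
    then have "?w m - 1 = cnj (zeta N ^ (k - m) - 1)" by (simp add: unit)
    then have "cmod (?w m - 1) = cmod (zeta N ^ (k - m) - 1)" by (simp only: complex_mod_cnj)
    then show ?thesis using zeta_power_diff[of "k - m" N] False that N k by simp
  qed
  have "(\<Sum>j<J. Z {} (of_real l * zeta N ^ j) * cnj (zeta N) ^ (j * k))
     = (\<Sum>j<J. \<Sum>m\<le>mstar. of_real (mnum m * l ^ m) * ?w m ^ j)"
    unfolding Z_eq_sum sum_distrib_right
    by (intro sum.cong refl) (simp add: power_mult_distrib power_mult[symmetric] mult_ac)
  also have "\<dots> = (\<Sum>m\<le>mstar. of_real (mnum m * l ^ m) * (\<Sum>j<J. ?w m ^ j))"
    by (subst sum.swap) (simp add: sum_distrib_left)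
  also have "\<dots> = of_real (mnum k * l ^ k) * (\<Sum>j<J. ?w k ^ j)
      + (\<Sum>m\<in>{..mstar} - {k}. of_real (mnum m * l ^ m) * (\<Sum>j<J. ?w m ^ j))"
    using k by (intro sum.remove) auto
  finally have "cmod ((\<Sum>j<J. Z {} (of_real l * zeta N ^ j) * cnj (zeta N) ^ (j * k)) - of_nat J * of_real (mnum k * l ^ k))
    = cmod (\<Sum>m\<in>{..mstar} - {k}. of_real (mnum m * l ^ m) * (\<Sum>j<J. ?w m ^ j))"
    unfolding wk by simp
  also have "\<dots> \<le> (\<Sum>m\<in>{..mstar} - {k}. (mnum m * l ^ m) * (4 * N))"
  proof (rule order_trans[OF norm_sum sum_mono])
    fix m assume m: "m \<in> {..mstar} - {k}"
    have "cmod (\<Sum>j<J. ?w m ^ j) \<le> 4 * N"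
      by (rule geometric_sum_bound) (use m w1 N cz in \<open>auto simp: norm_mult norm_power\<close>)
    then show "cmod (of_real (mnum m * l ^ m) * (\<Sum>j<J. ?w m ^ j)) \<le> (mnum m * l ^ m) * (4 * N)"
      unfolding norm_mult norm_of_real using l by (intro mult_mono) auto
  qed
  also have "\<dots> \<le> (\<Sum>m\<le>mstar. (mnum m * l ^ m) * (4 * N))"
    using l by (intro sum_mono2) auto
  also have "\<dots> = 4 * N * Z {} l" by (simp add: Z_eq_sum sum_distrib_left mult_ac)
  finally show ?thesis by simp
qed

text \<open>There are three errors: \<open>4 * \<xi>\<close> for replacing \<open>Z\<close> by
  \<open>Zt\<close> both on the circle and in the normalising value at \<open>l\<close> (their
  quotient is at most 2), \<tau> for the angles left out, and \<open>4 * N / J\<close> for the lack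
  of exact orthogonality.\<close>

lemma coefficient_error:
  fixes l :: real
  assumes l: "l > 0" and N: "mstar \<le> N" "N \<ge> 1" and k: "k \<le> mstar" and J: "J \<ge> 1" and \<xi>: "\<xi> \<le> 1 / 2"
    and approx: "\<And>j. j \<in> G \<Longrightarrow> Z {} (of_real l * zeta N ^ j) \<noteq> 0 \<and> cmod (Zt d (of_real l * zeta N ^ j) / Z {} (of_real l * zeta N ^ j) - 1) \<le> \<xi>"
    and approx0: "cmod (Zt d (of_real l) / Z {} (of_real l) - 1) \<le> \<xi>"
    and tail: "\<And>j. j \<notin> G \<Longrightarrow> cmod (Z {} (of_real l * zeta N ^ j)) \<le> \<tau> * Z {} l" and \<tau>: "\<tau> \<ge> 0"
  shows "\<bar>Re (\<Sum>j\<in>{..<J} \<inter> G. Zt d (of_real l * zeta N ^ j) * cnj (zeta N) ^ (j * k)) / (J * Re (Zt d (of_real l)))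
     - mnum k * l ^ k / Z {} l\<bar> \<le> 4 * \<xi> + \<tau> + 4 * real N / real J"
    and "Re (Zt d (of_real l)) > 0" "\<bar>Re (Zt d (of_real l)) / Z {} l - 1\<bar> \<le> \<xi>"
proof -
  define zl where "zl = Z {} l"
  define zr where "zr = Re (Zt d (of_real l))"
  define z where "z = (\<lambda>j. of_real l * zeta N ^ j)"
  define c where "c = (\<lambda>j. cnj (zeta N) ^ (j * k))"
  have zl: "zl > 0" unfolding zl_def by (rule Z_real_pos[OF l])
  have nz: "cmod (z j) = l" for j using l norm_zeta[OF N(2)] by (simp add: z_def norm_mult norm_power)
  have nc: "cmod (c j) = 1" for j using norm_zeta[OF N(2)] by (simp add: c_def norm_power)
  have "\<bar>zr / zl - 1\<bar> = \<bar>Re (Zt d (of_real l) / Z {} (of_real l) - 1)\<bar>"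
    by (simp add: zr_def zl_def Z_of_real Re_divide_of_real)
  also have "\<dots> \<le> \<xi>" using approx0 abs_Re_le_cmod order_trans by blast
  finally have zr: "\<bar>zr / zl - 1\<bar> \<le> \<xi>" .
  then have "zr / zl \<ge> 1 / 2" using \<xi> by linarith
  then have zr2: "zl \<le> 2 * zr" using zl by (simp add: field_simps)
  then have zr0: "zr > 0" using zl by linarith
  have \<xi>0: "\<xi> \<ge> 0" using zr by linarith
  show "Re (Zt d (of_real l)) > 0" "\<bar>Re (Zt d (of_real l)) / Z {} l - 1\<bar> \<le> \<xi>"
    using zr zr0 by (simp_all add: zr_def zl_def)
  have 1: "cmod (Zt d (z j) / of_real zr - Z {} (z j) / of_real zl) \<le> 4 * \<xi>" if j: "j \<in> G" for j
  proof -
    define e where "e = Zt d (z j) / Z {} (z j) - 1"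
    have Znz: "Z {} (z j) \<noteq> 0" and e: "cmod e \<le> \<xi>" using approx[OF j] by (auto simp: z_def e_def)
    have Zte: "Zt d (z j) = Z {} (z j) * (1 + e)" using Znz by (simp add: e_def field_simps)
    have "Zt d (z j) / of_real zr - Z {} (z j) / of_real zl
        = (Z {} (z j) / of_real zr) * (e - of_real (zr / zl - 1))"
      unfolding Zte using zl zr0 by (simp add: field_simps)
    then have "cmod (Zt d (z j) / of_real zr - Z {} (z j) / of_real zl)
       = (cmod (Z {} (z j)) / zr) * cmod (e - of_real (zr / zl - 1))"
      using zr0 by (simp add: norm_mult norm_divide del: of_real_diff of_real_divide)
    also have "\<dots> \<le> 2 * (2 * \<xi>)"
    proof (rule mult_mono)
      have "cmod (Z {} (z j)) \<le> zl" using norm_Z_le[of "z j"] by (simp add: nz zl_def)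
      then show "cmod (Z {} (z j)) / zr \<le> 2" using zr2 zr0 by (simp add: field_simps)
      have "cmod (e - of_real (zr / zl - 1)) \<le> cmod e + \<bar>zr / zl - 1\<bar>"
        using norm_triangle_ineq4[of e "of_real (zr / zl - 1)"] by (simp only: norm_of_real)
      then show "cmod (e - of_real (zr / zl - 1)) \<le> 2 * \<xi>" using e zr by linarith
    qed auto
    finally show ?thesis by simp
  qed
  let ?S = "\<Sum>j\<in>{..<J} \<inter> G. Zt d (z j) * c j"
  let ?F = "\<Sum>j<J. Z {} (z j) * c j"
  have "cmod (?S / of_real zr - ?F / of_real zl) \<le> J * (4 * \<xi> + \<tau>)"
  proof -
    let ?t = "\<lambda>j. (if j \<in> G then Zt d (z j) * c j / of_real zr else 0) - Z {} (z j) * c j / of_real zl"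
    have "?S / of_real zr - ?F / of_real zl = (\<Sum>j<J. ?t j)"
      by (simp add: sum_subtractf sum_divide_distrib sum.inter_restrict if_distrib[of "\<lambda>x. x / of_real zr"] cong: if_cong)
    also have "cmod \<dots> \<le> (\<Sum>j<J. 4 * \<xi> + \<tau>)"
    proof (rule order_trans[OF norm_sum sum_mono])
      fix j
      show "cmod (?t j) \<le> 4 * \<xi> + \<tau>"
      proof (cases "j \<in> G")
        case True
        have "?t j = (Zt d (z j) / of_real zr - Z {} (z j) / of_real zl) * c j"
          using True by (simp add: algebra_simps)
        then show ?thesis using 1[OF True] \<tau> by (simp add: norm_mult nc)
      next
        case False
        have "cmod (?t j) = cmod (Z {} (z j)) / zl" using False zl by (simp add: norm_divide norm_mult nc)
        also have "\<dots> \<le> \<tau>" using tail[OF False] zl by (simp add: z_def zl_def field_simps)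
        finally show ?thesis using \<xi>0 by simp
      qed
    qed
    finally show ?thesis by simp
  qed
  moreover have "cmod (?F / of_real zl - of_nat J * of_real (mnum k * l ^ k / zl)) \<le> 4 * N"
  proof -
    have "?F / of_real zl - of_nat J * of_real (mnum k * l ^ k / zl) = (?F - of_nat J * of_real (mnum k * l ^ k)) / of_real zl"
      by (simp add: diff_divide_distrib)
    then have "cmod (?F / of_real zl - of_nat J * of_real (mnum k * l ^ k / zl))
       = cmod (?F - of_nat J * of_real (mnum k * l ^ k)) / zl"
      using zl by (simp only: norm_divide norm_of_real abs_of_pos)
    also have "\<dots> \<le> (4 * N * zl) / zl"
      using fourier_coefficient[OF l N k, of J] zl unfolding z_def c_def zl_def
      by (intro divide_right_mono) auto
    finally show ?thesis using zl by simp
  qed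
  ultimately have "cmod (?S / of_real zr - of_nat J * of_real (mnum k * l ^ k / zl)) \<le> J * (4 * \<xi> + \<tau>) + 4 * N"
    using norm_triangle_ineq[of "?S / of_real zr - ?F / of_real zl" "?F / of_real zl - of_nat J * of_real (mnum k * l ^ k / zl)"]
    by simp
  then have "\<bar>Re (?S / of_real zr - of_nat J * of_real (mnum k * l ^ k / zl))\<bar> \<le> J * (4 * \<xi> + \<tau>) + 4 * N"
    using abs_Re_le_cmod order_trans by blast
  moreover have "Re (?S / of_real zr - of_nat J * of_real (mnum k * l ^ k / zl))
      = J * (Re ?S / (J * zr) - mnum k * l ^ k / zl)"
  proof -
    have "Re (X / of_real zr - of_nat J * of_real y) = J * (Re X / (J * zr) - y)" for X y
      using J zr0 by (simp add: right_diff_distrib)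
    then show ?thesis .
  qed
  ultimately have "J * \<bar>Re ?S / (J * zr) - mnum k * l ^ k / zl\<bar> \<le> J * (4 * \<xi> + \<tau>) + 4 * N"
    using J by (simp add: abs_mult)
  then show "\<bar>Re (\<Sum>j\<in>{..<J} \<inter> G. Zt d (of_real l * zeta N ^ j) * cnj (zeta N) ^ (j * k)) / (J * Re (Zt d (of_real l)))
     - mnum k * l ^ k / Z {} l\<bar> \<le> 4 * \<xi> + \<tau> + 4 * real N / real J"
    unfolding z_def c_def zr_def zl_def using J by (simp add: field_simps)
qed

end

section \<open>The estimate\<close>

text \<open>Index \<open>q ^ 5\<close> is the activity \<open>1 / (8 * \<Delta>)\<close>, the radius
  of the disc in \<open>Rt_error_disc\<close>. Up to this index \<open>arc\<close> keeps all angles,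
  beyond it only those in the right half-plane.\<close>

definition activity :: "nat \<Rightarrow> nat \<Rightarrow> nat \<Rightarrow> real" where
  "activity \<Delta> q i = real i / real (8 * \<Delta> * q ^ 5)"

definition arc :: "nat \<Rightarrow> nat \<Rightarrow> nat set" where
  "arc q i = {j. i \<le> q ^ 5 \<or> Re (zeta (q\<^sup>2) ^ j) \<ge> 0}"

context fin_graph
begin

text \<open>\<open>est_num\<close> estimates the weight of coefficient \<open>k\<close>, namely
  \<open>m_k * \<lambda>^k / Z(\<lambda>)\<close>, and \<open>est_den\<close> the same without the
  factor \<open>m_k\<close>.\<close>

definition est_num :: "nat \<Rightarrow> nat \<Rightarrow> nat \<Rightarrow> nat \<Rightarrow> nat \<Rightarrow> nat \<Rightarrow> real" where
  "est_num \<Delta> q d J k i = Re (\<Sum>j\<in>{..<J} \<inter> arc q i. Zt d (of_real (activity \<Delta> q i) * zeta (q\<^sup>2) ^ j)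
      * cnj (zeta (q\<^sup>2)) ^ (j * k)) / (J * Re (Zt d (of_real (activity \<Delta> q i))))"

definition est_den :: "nat \<Rightarrow> nat \<Rightarrow> nat \<Rightarrow> nat \<Rightarrow> nat \<Rightarrow> real" where
  "est_den \<Delta> q d k i = activity \<Delta> q i ^ k / Re (Zt d (of_real (activity \<Delta> q i)))"

lemma mstar_le: "mstar \<le> n * n"
proof -
  have "mstar \<le> card E" using mstar_attained card_mono[OF finite_E] by (metis is_matching_def)
  then show ?thesis using card_E_le by linarith
qed

text \<open>The common part of both regimes. Some activity has weight at least
  \<open>1 / q ^ cp\<close>, and the error per activity is \<open>1 / q ^ ce\<close>. The gap
  \<open>ce - cp\<close> has to cover the number of activities: \<open>a\<close> pays for the
  constant \<open>64 * \<Delta> * \<Lambda>\<close>, 5 for the factor \<open>q ^ 5\<close> in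
  \<open>g\<close>, and 1 for \<open>\<epsilon> \<ge> 1 / q\<close>.\<close>

lemma estimate_aux:
  fixes \<Lambda> L :: nat and X \<epsilon> :: real
  assumes deg: "\<And>v. v < n \<Longrightarrow> degree E v \<le> \<Delta>" "\<Delta> \<ge> 1" and \<Lambda>: "\<Lambda> \<ge> 1"
    and n: "1 \<le> n" "n \<le> q" and q: "q \<ge> 2" and k: "k \<le> mstar"
    and X: "X = 2 * \<Delta> * \<Lambda>" and d: "n * ((2 * X + 4) * (X / (X + 1)) ^ d) * 2 \<le> 1 / q ^ (ce + 3)"
    and J: "J \<ge> q ^ (ce + 6)" and \<epsilon>: "0 < \<epsilon>" "\<epsilon> < 1" "1 \<le> \<epsilon> * q"
    and g: "g \<le> \<Lambda> * 8 * \<Delta> * q ^ 5" and a: "64 * \<Delta> * \<Lambda> \<le> 2 ^ a" and ce: "ce \<ge> cp + 6 + a"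
    and tail: "\<And>i z. i \<in> {1..g} \<Longrightarrow> i > q ^ 5 \<Longrightarrow> cmod z = activity \<Delta> q i \<Longrightarrow> Re z \<le> 0 \<Longrightarrow>
       cmod (Z {} z) \<le> 1 / q ^ (ce + 2) * Z {} (activity \<Delta> q i)"
    and i0: "i0 \<in> {1..g}" "1 / q ^ cp \<le> mnum k * (activity \<Delta> q i0 ^ k / Z {} (activity \<Delta> q i0))"
  shows "relative_approx \<epsilon> (mnum k) ((\<Sum>i\<in>{1..g}. est_num \<Delta> q d J k i) / (\<Sum>i\<in>{1..g}. est_den \<Delta> q d k i))"
    "(\<Sum>i\<in>{1..g}. est_num \<Delta> q d J k i) > 0" "(\<Sum>i\<in>{1..g}. est_den \<Delta> q d k i) > 0"
    "\<And>i j d S v. i \<in> {1..g} \<Longrightarrow> j \<in> arc q i \<Longrightarrow> Rt (of_real (activity \<Delta> q i) * zeta (q\<^sup>2) ^ j) d S v \<noteq> 0"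
proof -
  define N where "N = q\<^sup>2"
  have N: "mstar \<le> N" "N \<ge> 1" using mstar_le mult_le_mono[OF n(2) n(2)] q
    by (auto simp: N_def power2_eq_square)
  have act: "activity \<Delta> q i > 0" "activity \<Delta> q i \<le> \<Lambda>" if "i \<in> {1..g}" for i
  proof -
    have "real i \<le> real (\<Lambda> * (8 * \<Delta> * q ^ 5))" using that g by (intro of_nat_mono) (simp add: mult.assoc)
    then show "activity \<Delta> q i > 0" "activity \<Delta> q i \<le> \<Lambda>"
      using that deg(2) q by (auto simp: activity_def pos_divide_le_eq)
  qed
  let ?z = "\<lambda>i j. of_real (activity \<Delta> q i) * zeta N ^ j"
  define \<xi> where "\<xi> = 2 * (n * ((2 * X + 4) * (X / (X + 1)) ^ d))"
  have q1: "real q \<ge> 2" using q by simp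
  have \<xi>: "\<xi> \<le> 1 / q ^ (ce + 3)" using d by (simp add: \<xi>_def mult_ac)
  have q8: "real q ^ 3 \<ge> 8" using power_mono[OF q1, of 3] by simp
  have q4: "real q ^ 2 \<ge> 4" using power_mono[OF q1, of 2] by simp
  have pq: "real q ^ m \<ge> 1" for m using q1 by simp
  have "1 / real q ^ (ce + 3) \<le> 1 / (1 * 8)" unfolding power_add
    using q q8 pq by (intro divide_left_mono mult_mono) auto
  with \<xi> have \<xi>8: "\<xi> \<le> 1 / 8" by simp
  have zn: "cmod (?z i j) = activity \<Delta> q i" if "i \<in> {1..g}" for i j
    using act(1)[OF that] norm_zeta[OF N(2)] by (simp add: norm_mult norm_power)
  have dom: "Re (?z i j) \<ge> 0 \<or> cmod (?z i j) * \<Delta> \<le> 1 / 8" if "i \<in> {1..g}" "j \<in> arc q i" for i j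
  proof (cases "i \<le> q ^ 5")
    case True
    then have "real i \<le> real (q ^ 5)" by (intro of_nat_mono)
    then have "activity \<Delta> q i * \<Delta> \<le> 1 / 8" using deg(2) q by (simp add: activity_def field_simps)
    then show ?thesis using zn[OF that(1)] by simp
  next
    case False
    then show ?thesis using that(2) act(1)[OF that(1)] by (auto simp: arc_def N_def)
  qed
  have err: "Rt (?z i j) d' S v \<noteq> 0 \<and> Z {} (?z i j) \<noteq> 0 \<and> cmod (Zt d (?z i j) / Z {} (?z i j) - 1) \<le> \<xi>"
    if i: "i \<in> {1..g}" and j: "j \<in> arc q i" for i j d' S v
  proof -
    have z0: "?z i j \<noteq> 0" using zn[OF i, of j] act(1)[OF i] by (metis norm_zero less_irrefl)
    have cz: "cmod (?z i j) \<le> \<Lambda>" using zn[OF i] act(2)[OF i] by simp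
    have \<Lambda>': "1 \<le> real \<Lambda>" using \<Lambda> by simp
    have X': "X = real (2 * \<Delta>) * real \<Lambda>" using X by simp
    have n\<eta>: "real n * ((2 * X + 4) * (X / (X + 1)) ^ m) \<le> 1" if "m = d" for m
      using \<xi>8 that by (simp add: \<xi>_def)
    note Zt_error[OF z0 cz dom[OF i j] \<Lambda>' deg X' n\<eta>[OF refl] n(1)]
    moreover have "Rt (?z i j) d' S v \<noteq> 0"
    proof (cases "Re (?z i j) \<ge> 0")
      case True
      then have "Re (csqrt (?z i j)) > 0" using z0
        by (intro Re_csqrt_pos) (auto simp: complex_nonpos_Reals_iff complex_eq_iff)
      then show ?thesis by (rule Rt_nonzero) simp
    next
      case False
      then have "cmod (?z i j) * \<Delta> \<le> 1 / 8" using dom[OF i j] by blast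
      moreover have "card (nbrs S v) \<le> \<Delta>" for S v
      proof (cases "v < n")
        case False
        then have "nbrs S v = {}" using edge_lt by (auto simp: nbrs_def)
        then show ?thesis by simp
      qed (meson card_nbrs deg order_trans)
      ultimately show ?thesis by (rule Rt_error_disc(1))
    qed
    ultimately show ?thesis by (auto simp: \<xi>_def)
  qed
  show "Rt (of_real (activity \<Delta> q i) * zeta (q\<^sup>2) ^ j) d S v \<noteq> 0" if "i \<in> {1..g}" "j \<in> arc q i" for i j d S v
    using err[OF that] by (simp add: N_def)
  have arc0: "0 \<in> arc q i" for i by (simp add: arc_def)
  define \<tau> where "\<tau> = 1 / real q ^ (ce + 2)"
  have tail': "cmod (Z {} (?z i j)) \<le> \<tau> * Z {} (activity \<Delta> q i)" if "i \<in> {1..g}" "j \<notin> arc q i" for i j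
    unfolding \<tau>_def
  proof (rule order_trans[OF tail[OF that(1)]])
    show "Re (?z i j) \<le> 0" using that act(1)[OF that(1)]
      by (auto simp: arc_def N_def mult_nonneg_nonpos intro: less_imp_le)
  qed (use that zn in \<open>auto simp: arc_def\<close>)
  have J1: "J \<ge> 1" using q J one_le_power[of q "ce + 6"] by linarith
  define e where "e = 1 / real q ^ ce"
  \<comment> \<open>The surplus exponents 3, 2 and 6 in the bounds on \<xi>, \<tau> and
    \<open>J\<close>, the last reduced by 2 because \<open>N = q^2\<close>, give shares
    \<open>e / 2\<close>, \<open>e / 4\<close> and \<open>e / 4\<close>, using only
    \<open>q \<ge> 2\<close>.\<close>
  have esum: "4 * \<xi> + \<tau> + 4 * real N / real J \<le> e"
  proof -
    have "4 * \<xi> \<le> 4 * (1 / (q ^ ce * q ^ 3))" using \<xi> by (simp add: power_add)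
    also have "\<dots> \<le> 4 * (1 / (q ^ ce * 8))" using q q8 pq[of ce] by (intro mult_left_mono divide_left_mono) auto
    finally have 1: "4 * \<xi> \<le> e / 2" by (simp add: e_def)
    have "\<tau> = 1 / (q ^ ce * q ^ 2)" unfolding \<tau>_def power_add by simp
    also have "\<dots> \<le> 1 / (q ^ ce * 4)" using q q4 pq[of ce] by (intro divide_left_mono mult_left_mono) auto
    finally have 2: "\<tau> \<le> e / 4" by (simp add: e_def)
    have "4 * real N / real J \<le> 4 * real N / real (q ^ (ce + 6))"
      using J J1 q by (intro divide_left_mono of_nat_mono) auto
    also have "real (q ^ (ce + 6)) = real q ^ ce * (real q ^ 2 * real q ^ 2) * real q ^ 2"
      by (simp add: ac_simps flip: power_add)
    also have "4 * real N / (real q ^ ce * (real q ^ 2 * real q ^ 2) * real q ^ 2) = 4 / (real q ^ ce * (real q ^ 2 * real q ^ 2))"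
      using q1 by (simp add: N_def field_simps)
    also have "\<dots> \<le> 4 / (real q ^ ce * (4 * 4))" using q q4 pq[of ce]
      by (intro divide_left_mono mult_left_mono mult_mono) auto
    finally have 3: "4 * real N / real J \<le> e / 4" by (simp add: e_def)
    show ?thesis using 1 2 3 by linarith
  qed
  let ?P = "\<lambda>i. mnum k * (activity \<Delta> q i ^ k / Z {} (activity \<Delta> q i))"
  have est: "\<bar>est_num \<Delta> q d J k i - ?P i\<bar> \<le> e" "Re (Zt d (of_real (activity \<Delta> q i))) > 0"
    "\<bar>Re (Zt d (of_real (activity \<Delta> q i))) / Z {} (activity \<Delta> q i) - 1\<bar> \<le> e" if i: "i \<in> {1..g}" for i
  proof -
    have h1: "\<xi> \<le> 1 / 2" using \<xi>8 by simp
    have h2: "Z {} (?z i j) \<noteq> 0 \<and> cmod (Zt d (?z i j) / Z {} (?z i j) - 1) \<le> \<xi>" if "j \<in> arc q i" for j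
      using err[OF i that] by blast
    have h3: "cmod (Zt d (of_real (activity \<Delta> q i)) / Z {} (of_real (activity \<Delta> q i)) - 1) \<le> \<xi>"
      using err[OF i arc0] by simp
    have h4: "0 \<le> \<tau>" by (simp add: \<tau>_def)
    note * = coefficient_error[where G = "arc q i", OF act(1)[OF i] N k J1 h1 h2 h3 tail'[OF i] h4]
    show "\<bar>est_num \<Delta> q d J k i - ?P i\<bar> \<le> e"
      unfolding est_num_def N_def[symmetric] times_divide_eq_right using *(1) esum by linarith
    show "Re (Zt d (of_real (activity \<Delta> q i))) > 0" by (rule *(2))
    have "0 \<le> \<xi>" using *(3) by linarith
    then have "\<xi> \<le> e" using esum h4 by (smt (verit) divide_nonneg_nonneg of_nat_0_le_iff)
    then show "\<bar>Re (Zt d (of_real (activity \<Delta> q i))) / Z {} (activity \<Delta> q i) - 1\<bar> \<le> e" using *(3) by linarith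
  qed
  have p0: "1 / real q ^ cp > 0" using q1 by simp
  have mk: "real (mnum k) > 0" using mnum_pos[OF k] by simp
  have s0: "activity \<Delta> q i ^ k / Z {} (activity \<Delta> q i) > 0" if "i \<in> {1..g}" for i
    using act[OF that] Z_real_pos[OF act(1)[OF that]] by simp
  have q6: "real q ^ ce = real q ^ cp * real q ^ a * real q ^ 5 * real q * real q ^ (ce - (cp + 6 + a))"
  proof -
    have "ce = cp + a + 5 + 1 + (ce - (cp + 6 + a))" using ce by simp
    then have "real q ^ ce = real q ^ (cp + a + 5 + 1 + (ce - (cp + 6 + a)))" by (rule arg_cong)
    then show ?thesis by (simp only: power_add power_one_right)
  qed
  have \<epsilon>q: "1 \<le> \<epsilon> * q" by (rule \<epsilon>(3))
  have card_e: "card {1..g} * e \<le> \<epsilon> / 8 * (1 / real q ^ cp)"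
  proof -
    have "8 * g \<le> (64 * \<Delta> * \<Lambda>) * q ^ 5" using g by (simp add: ac_simps)
    also have "\<dots> \<le> 2 ^ a * q ^ 5" using a by (rule mult_right_mono) simp
    also have "\<dots> \<le> q ^ a * q ^ 5" using q by (intro mult_right_mono power_mono) auto
    finally have "real (8 * g) \<le> real (q ^ a * q ^ 5)" by (rule of_nat_mono)
    then have "8 * real g * 1 \<le> (real q ^ a * real q ^ 5) * (\<epsilon> * q)" using \<epsilon>q by (intro mult_mono[of "8 * real g"]) auto
    also have "\<dots> \<le> (real q ^ a * real q ^ 5) * (\<epsilon> * q) * real q ^ (ce - (cp + 6 + a))"
      using mult_left_mono[OF pq[of "ce - (cp + 6 + a)"], of "(real q ^ a * real q ^ 5) * (\<epsilon> * q)"] \<epsilon> by simp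
    finally have "8 * real g * real q ^ cp \<le> ((real q ^ a * real q ^ 5) * (\<epsilon> * q) * real q ^ (ce - (cp + 6 + a))) * real q ^ cp"
      using pq[of cp] by (intro mult_right_mono) auto
    also have "\<dots> = \<epsilon> * real q ^ ce" unfolding q6 by (simp only: mult_ac)
    finally have *: "8 * real g * real q ^ cp \<le> \<epsilon> * real q ^ ce" .
    have "real g * (8 * real q ^ cp) \<le> \<epsilon> * real q ^ ce" using * by (simp only: mult_ac)
    then have "real g / real q ^ ce \<le> \<epsilon> / (8 * real q ^ cp)"
      using q1 by (subst frac_le_eq) (auto simp: divide_le_0_iff zero_le_mult_iff)
    then show ?thesis by (simp add: e_def)
  qed
  have e8: "e \<le> \<epsilon> / 8"
  proof -
    have "1 * e \<le> card {1..g} * e" using i0 by (intro mult_right_mono) (auto simp: e_def)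
    also have "\<dots> \<le> \<epsilon> / 8 * (1 / real q ^ cp)" by (rule card_e)
    also have "\<dots> \<le> \<epsilon> / 8 * 1" using q pq[of cp] \<epsilon> by (intro mult_left_mono) (auto simp: divide_le_eq_1)
    finally show ?thesis by simp
  qed
  have den: "est_den \<Delta> q d k i = (activity \<Delta> q i ^ k / Z {} (activity \<Delta> q i)) / (Re (Zt d (of_real (activity \<Delta> q i))) / Z {} (activity \<Delta> q i))"
    if "i \<in> {1..g}" for i
    using Z_real_pos[OF act(1)[OF that]] by (simp add: est_den_def)
  have den_sum: "(\<Sum>i\<in>{1..g}. est_den \<Delta> q d k i) = (\<Sum>i\<in>{1..g}. (activity \<Delta> q i ^ k / Z {} (activity \<Delta> q i)) / (Re (Zt d (of_real (activity \<Delta> q i))) / Z {} (activity \<Delta> q i)))"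
    by (rule sum.cong[OF refl den])
  note concl = relative_approx_quotient[where I = "{1..g}" and P = ?P
      and s = "\<lambda>i. activity \<Delta> q i ^ k / Z {} (activity \<Delta> q i)"
      and T = "est_num \<Delta> q d J k"
      and r = "\<lambda>i. Re (Zt d (of_real (activity \<Delta> q i))) / Z {} (activity \<Delta> q i)", OF _ i0 p0 mk refl s0 est(1) card_e e8 est(3) \<epsilon>(1,2)]
  show "relative_approx \<epsilon> (mnum k) ((\<Sum>i\<in>{1..g}. est_num \<Delta> q d J k i) / (\<Sum>i\<in>{1..g}. est_den \<Delta> q d k i))"
    "(\<Sum>i\<in>{1..g}. est_num \<Delta> q d J k i) > 0" "(\<Sum>i\<in>{1..g}. est_den \<Delta> q d k i) > 0"
    unfolding den_sum by (rule concl; simp)+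
qed

text \<open>The activity of the mode is rounded up to the grid. Since \<open>l \<ge> 1 / q^2\<close>
  and the spacing is at most \<open>1 / q^4\<close>, the relative change is at most
  \<open>1 / q^2\<close>; no exponent exceeds \<open>q^2\<close>, so \<open>Z\<close> grows at most
  by the factor 3, whereas the numerator \<open>l^k\<close> does not decrease.\<close>

lemma mode_on_grid:
  fixes \<Lambda> :: nat
  assumes deg: "\<And>v. v < n \<Longrightarrow> degree E v \<le> \<Delta>" "\<Delta> \<ge> 1"
    and n: "1 \<le> n" "n \<le> q" and q: "q \<ge> 2"
    and k: "1 \<le> k" "k < mstar" and D: "mstar \<le> D * (mstar - k)" and \<Lambda>: "\<Lambda> = 2 ^ (2 * \<Delta> * D)"
  obtains i where "i \<in> {1..\<Lambda> * 8 * \<Delta> * q ^ 5}"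
    "1 / q ^ 5 \<le> mnum k * (activity \<Delta> q i ^ k / Z {} (activity \<Delta> q i))"
proof -
  obtain l :: real where l: "l > 0" "l \<le> 2 ^ (2 * \<Delta> * D)" "1 \<le> l * (n * n)"
    "Z {} l \<le> (n * n + 1) * (mnum k * l ^ k)"
    by (rule mode_activity[OF deg k D])
  define w where "w = real (8 * \<Delta> * q ^ 5)"
  have w: "w > 0" using deg(2) q by (simp add: w_def)
  define i where "i = nat \<lceil>l * w\<rceil>"
  have i: "real i \<ge> l * w" "real i \<le> l * w + 1" "i \<ge> 1" using l(1) w
    unfolding i_def using ceiling_correct[of "l * w"] by (auto simp: Suc_le_eq)
  define x where "x = activity \<Delta> q i"
  have xw: "x = i / w" by (simp add: x_def activity_def w_def)
  have lx: "l \<le> x" using i(1) w by (simp add: xw field_simps)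
  have x0: "x > 0" using lx l by simp
  have q1: "real q \<ge> 2" using q by simp
  have "1 \<le> l * real (q * q)"
    using l(3) mult_le_mono[OF n(2) n(2)] l(1)
    by (smt (verit) mult_left_mono of_nat_mono)
  then have lq: "1 \<le> l * (real q)\<^sup>2" by (simp add: power2_eq_square)
  have "x \<le> l + 1 / w" using i(2) w by (simp add: xw field_simps)
  also have "1 / w \<le> l / (real q)\<^sup>2"
  proof -
    have "(real q)\<^sup>2 * 1 \<le> (real q)\<^sup>2 * (l * (real q)\<^sup>2)" using lq by (intro mult_left_mono) auto
    also have "\<dots> = l * real q ^ 4" by (simp add: power2_eq_square eval_nat_numeral)
    also have "\<dots> \<le> l * w"
    proof (intro mult_left_mono)
      have "q ^ 4 * 1 \<le> q ^ 4 * (8 * \<Delta> * q)" using deg(2) q by (intro mult_left_mono) auto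
      also have "\<dots> = 8 * \<Delta> * q ^ 5" by (simp add: eval_nat_numeral)
      finally have "real (q ^ 4) \<le> w" unfolding w_def by (intro of_nat_mono) simp
      then show "real q ^ 4 \<le> w" by simp
    qed (use l in auto)
    finally show ?thesis using w q1 by (simp add: field_simps)
  qed
  finally have xl: "x \<le> l * (1 + 1 / real (q\<^sup>2))" by (simp add: algebra_simps)
  define c where "c = (1 + 1 / real (q\<^sup>2)) ^ q\<^sup>2"
  have "c \<le> exp (1 / real (q\<^sup>2)) ^ q\<^sup>2" unfolding c_def by (intro power_mono exp_ge_add_one_self) auto
  also have "\<dots> = exp 1" using q by (simp flip: exp_of_nat_mult)
  also have "\<dots> \<le> 3" by (rule exp_le)
  finally have c3: "c \<le> 3" .
  have "Z {} x \<le> (\<Sum>m\<le>mstar. real (mnum m) * (l ^ m * c))" unfolding Z_eq_sum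
  proof (intro sum_mono mult_left_mono)
    fix m assume m: "m \<in> {..mstar}"
    have "m \<le> q\<^sup>2" using m mstar_le mult_le_mono[OF n(2) n(2)] by (simp add: power2_eq_square)
    then have "(1 + 1 / real (q\<^sup>2)) ^ m \<le> c" unfolding c_def by (intro power_increasing) auto
    then have "l ^ m * (1 + 1 / real (q\<^sup>2)) ^ m \<le> l ^ m * c" using l(1) by (intro mult_left_mono) auto
    moreover have "x ^ m \<le> (l * (1 + 1 / real (q\<^sup>2))) ^ m" using xl x0 by (intro power_mono) auto
    ultimately show "x ^ m \<le> l ^ m * c" by (simp add: power_mult_distrib)
  qed auto
  also have "\<dots> = c * Z {} l" by (simp add: Z_eq_sum sum_distrib_left mult_ac)
  also have "\<dots> \<le> 3 * Z {} l" using c3 Z_real_pos[OF l(1)] by (intro mult_right_mono) auto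
  also have "\<dots> \<le> 3 * ((n * n + 1) * (mnum k * l ^ k))" using l(4) by simp
  also have "\<dots> \<le> real q ^ 5 * (mnum k * l ^ k)"
  proof -
    have "n * n \<le> q * q" by (rule mult_le_mono[OF n(2) n(2)])
    then have "3 * (n * n + 1) \<le> 3 * (q * q) + 3" by simp
    also have "\<dots> \<le> 4 * (q * q)" using mult_le_mono[OF q q] by simp
    also have "\<dots> \<le> (q * q * q) * (q * q)" using mult_le_mono[OF mult_le_mono[OF q q] q] by (intro mult_le_mono1) simp
    also have "\<dots> = q ^ 5" by (simp add: eval_nat_numeral)
    finally have "real (3 * (n * n + 1)) \<le> real (q ^ 5)" by (rule of_nat_mono)
    then have "real (3 * (n * n + 1)) * (mnum k * l ^ k) \<le> real (q ^ 5) * (mnum k * l ^ k)"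
      using l(1) by (intro mult_right_mono) auto
    then show ?thesis by (simp add: algebra_simps)
  qed
  also have "\<dots> \<le> real q ^ 5 * (mnum k * x ^ k)" using l(1) lx by (intro mult_left_mono power_mono) auto
  finally have "Z {} x \<le> real q ^ 5 * (mnum k * x ^ k)" .
  then have "1 / real q ^ 5 \<le> mnum k * (x ^ k / Z {} x)"
    using Z_real_pos[OF x0] q1 by (simp add: field_simps)
  moreover have "i \<in> {1..\<Lambda> * 8 * \<Delta> * q ^ 5}"
  proof -
    have "l * w \<le> \<Lambda> * w" using l(2) w by (intro mult_right_mono) (auto simp: \<Lambda>)
    also have "\<dots> = of_int (int (\<Lambda> * 8 * \<Delta> * q ^ 5))" by (simp add: w_def)
    finally have "\<lceil>l * w\<rceil> \<le> int (\<Lambda> * 8 * \<Delta> * q ^ 5)" by (rule ceiling_le)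
    then have "i \<le> \<Lambda> * 8 * \<Delta> * q ^ 5" unfolding i_def by (rule nat_le_iff[THEN iffD2])
    then show ?thesis using i(3) by simp
  qed
  ultimately show ?thesis using that by (simp add: x_def)
qed

text \<open>At activity \<open>x = 1 / (8 * \<Delta>)\<close> one has
  \<open>Z {} x \<le> 2^(card E)\<close> and \<open>x^k \<ge> x^(card E)\<close>, so the weight is
  at least \<open>(16 * \<Delta>)^(- card E)\<close>. This is an inverse power of \<open>q\<close>
  when \<open>card E\<close> is \<open>O(log q)\<close>, and the whole circle lies in the
  disc.\<close>

lemma small_graph_weight:
  assumes deg: "\<Delta> \<ge> 1" and q: "q = 2 ^ L" and E: "2 * card E \<le> cE * L" and k: "k \<le> mstar"
  shows "1 / real q ^ ((\<Delta> + 4) * cE) \<le> mnum k * (activity \<Delta> q (q ^ 5) ^ k / Z {} (activity \<Delta> q (q ^ 5)))"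
proof -
  define x where "x = activity \<Delta> q (q ^ 5)"
  have x: "x = 1 / (8 * \<Delta>)" using q by (simp add: x_def activity_def)
  have x0: "0 < x" "x \<le> 1" using deg by (auto simp: x)
  have kE: "k \<le> card E" using k mstar_attained card_mono[OF finite_E]
    by (metis is_matching_def order_trans)
  have "Z {} x \<le> Z {} (1::real)" unfolding Z_eq_sum using x0 by (intro sum_mono mult_left_mono power_mono) auto
  also have "\<dots> = real (Z {} (1::nat))" by (simp add: Z_def)
  also have "\<dots> \<le> real (2 ^ card E)" by (rule of_nat_mono[OF Z_one_le])
  finally have Z2: "Z {} x \<le> 2 ^ card E" by simp
  have "\<Delta> \<le> 2 ^ \<Delta>" using less_exp[of \<Delta>] by simp
  then have "16 * \<Delta> \<le> 2 ^ (\<Delta> + 4)" by (simp add: power_add)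
  then have d16: "real (16 * \<Delta>) \<le> 2 ^ (\<Delta> + 4)" by (metis of_nat_mono of_nat_numeral of_nat_power)
  have "real (16 * \<Delta>) ^ card E \<le> (2 ^ (\<Delta> + 4)) ^ card E" using d16 by (intro power_mono) auto
  also have "\<dots> = 2 ^ ((\<Delta> + 4) * card E)" by (simp add: power_mult)
  also have "\<dots> \<le> 2 ^ ((\<Delta> + 4) * (cE * L))" using E by (intro power_increasing mult_left_mono) auto
  also have "\<dots> = real q ^ ((\<Delta> + 4) * cE)" by (simp add: q power_mult[symmetric] mult_ac)
  finally have "1 / real q ^ ((\<Delta> + 4) * cE) \<le> 1 / real (16 * \<Delta>) ^ card E"
    using deg by (intro divide_left_mono) (auto simp: q)
  also have "\<dots> = (x / 2) ^ card E" by (simp add: x power_one_over)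
  also have "\<dots> = x ^ card E / 2 ^ card E" by (rule power_divide)
  also have "\<dots> \<le> x ^ k / Z {} x"
    using x0 kE Z2 Z_real_pos[OF x0(1)] by (intro frac_le power_decreasing) auto
  also have "\<dots> \<le> mnum k * (x ^ k / Z {} x)"
  proof -
    have "1 \<le> real (mnum k)" using mnum_pos[OF k] by simp
    then show ?thesis using x0 Z_real_pos[OF x0(1)] by (simp add: mult_le_cancel_right1 divide_le_cancel)
  qed
  finally show ?thesis by (simp add: x_def)
qed

end

text \<open>The two regimes of the number \<open>g\<close> of activities: if \<open>card E\<close> is at most a constant times
  \<open>log q\<close>, the activities in the disc of absolute convergence already give coefficient \<open>k\<close> a weight
  that is polynomial in \<open>1 / q\<close>; otherwise the part of the circle that is left out is negligible.\<close>

theorem estimate: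
  assumes \<Delta>: "\<Delta> \<ge> 1" and \<delta>: "0 < \<delta>" "\<delta> < (1 :: real)"
  obtains \<Lambda> cE cd cJ :: nat where "\<Lambda> \<ge> 1"
    "\<And>L n E k \<epsilon> q d J g. fin_graph n E \<Longrightarrow> (\<And>v. v < n \<Longrightarrow> degree E v \<le> \<Delta>) \<Longrightarrow> 1 \<le> L \<Longrightarrow> 1 \<le> n \<Longrightarrow> n \<le> q \<Longrightarrow>
      1 \<le> \<epsilon> * real q \<Longrightarrow> 0 < \<epsilon> \<Longrightarrow> \<epsilon> < 1 \<Longrightarrow> 1 \<le> k \<Longrightarrow> real k \<le> (1 - \<delta>) * real (matching_number E) \<Longrightarrow>
      q = 2 ^ L \<Longrightarrow> d = cd * L \<Longrightarrow> J = q ^ cJ \<Longrightarrow> g = (if 2 * card E \<le> cE * L then q ^ 5 else \<Lambda> * 8 * \<Delta> * q ^ 5) \<Longrightarrow>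
      relative_approx \<epsilon> (num_matchings E k) ((\<Sum>i\<in>{1..g}. fin_graph.est_num n E \<Delta> q d J k i) / (\<Sum>i\<in>{1..g}. fin_graph.est_den n E \<Delta> q d k i))
      \<and> (\<Sum>i\<in>{1..g}. fin_graph.est_num n E \<Delta> q d J k i) > 0 \<and> (\<Sum>i\<in>{1..g}. fin_graph.est_den n E \<Delta> q d k i) > 0
      \<and> (\<forall>i\<in>{1..g}. \<forall>j\<in>arc q i. \<forall>d S v. fin_graph.Rt E (of_real (activity \<Delta> q i) * zeta (q\<^sup>2) ^ j) d S v \<noteq> 0)"
proof -
  \<comment> \<open>With \<open>D \<ge> 1 / \<delta>\<close> the hypothesis on \<open>k\<close>
    becomes \<open>mstar \<le> D * (mstar - k)\<close>.\<close>
  define D where "D = nat \<lceil>1 / \<delta>\<rceil>"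
  have D: "1 \<le> D * \<delta>"
  proof -
    have "1 / \<delta> \<le> D" unfolding D_def using \<delta> by (simp add: of_nat_nat real_nat_ceiling_ge)
    then show ?thesis using \<delta> by (simp add: field_simps)
  qed
  define \<Lambda> :: nat where "\<Lambda> = 2 ^ (2 * \<Delta> * D)"
  have \<Lambda>: "\<Lambda> \<ge> 1" by (simp add: \<Lambda>_def)
  obtain a where a: "64 * \<Delta> * \<Lambda> \<le> 2 ^ a" using less_exp less_imp_le by blast
  \<comment> \<open>The error exponent for many edges, where \<open>mode_on_grid\<close> gives
    \<open>cp = 5\<close>. It must not depend on \<open>cE\<close>: the threshold \<open>cE\<close>
    is chosen from it, and the larger exponent \<open>ce\<close> for few edges depends on
    \<open>cE\<close>. There is no circle, because with few edges no angle is left out.\<close>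
  define ce1 where "ce1 = 5 + 6 + a"
  define \<rho> where "\<rho> = sqrt (1 - 2 * (1 / (8 * real \<Delta>))\<^sup>2 / (real \<Lambda> + (8 * real \<Delta>)\<^sup>2)\<^sup>2)"
  have \<rho>: "0 \<le> \<rho>" "\<rho> < 1"
  proof -
    define K where "K = real \<Lambda> + (8 * real \<Delta>)\<^sup>2"
    have "1 + 1 \<le> K" unfolding K_def using \<Lambda> \<Delta> by (intro add_mono one_le_power) auto
    then have K: "2 * 2 \<le> K\<^sup>2" using mult_mono[of 2 K 2 K] by (simp add: power2_eq_square)
    define y where "y = (1 / (8 * real \<Delta>))\<^sup>2"
    have y: "0 < y" "y \<le> 1" using \<Delta> by (auto simp: y_def intro!: power_le_one)
    have K0: "K\<^sup>2 > 0" and yK: "2 * y \<le> K\<^sup>2" using K y by linarith+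
    have "0 < 2 * y / K\<^sup>2" using K0 y by (intro divide_pos_pos) auto
    moreover have "2 * y / K\<^sup>2 \<le> 1" using K0 yK by (subst pos_divide_le_eq) auto
    ultimately show "0 \<le> \<rho>" "\<rho> < 1" unfolding \<rho>_def K_def[symmetric] y_def[symmetric] by auto
  qed
  \<comment> \<open>If \<open>2 * card E > cE * L\<close>, then \<open>tail_bound\<close> with
    \<open>card E \<le> 4 * \<Delta> * h\<close> gives at least \<open>t * (ce1 + 2) * L\<close>
    factors \<rho>, so the tail is below
    \<open>2^(-(ce1 + 2) * L) = 1 / q^(ce1 + 2)\<close>.\<close>
  obtain t where t: "\<rho> ^ t < 1 / 2" using real_arch_pow_inv[of "1/2" \<rho>] \<rho> by auto
  define cE where "cE = 8 * \<Delta> * (t * (ce1 + 2))"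
  define cp where "cp = 5 + (\<Delta> + 4) * cE"
  define ce where "ce = cp + 6 + a"
  define X where "X = 2 * real \<Delta> * real \<Lambda>"
  have X: "X > 0" using \<Delta> \<Lambda> by (simp add: X_def)
  \<comment> \<open>\<open>2 ^ b\<close> absorbs the constant of the truncation error. Then depth
    \<open>cd * L\<close> makes the contraction at most \<open>1 / q^(ce + 4 + b)\<close>; one of
    these powers pays for the factor \<open>n\<close>.\<close>
  obtain b :: nat where b: "2 * (2 * X + 4) \<le> 2 ^ b"
    using real_arch_pow[of 2 "2 * (2 * X + 4)"] less_imp_le by auto
  obtain cd where cd: "(X / (X + 1)) ^ cd < (1 / 2) ^ (ce + 4 + b)"
    using real_arch_pow_inv[of "(1 / 2) ^ (ce + 4 + b)" "X / (X + 1)"] X by auto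
  show ?thesis
  proof (rule that[OF \<Lambda>, where cE = cE and cd = cd and cJ = "ce + 6"])
    fix L n E k q d J g and \<epsilon> :: real
    assume "fin_graph n E" and deg: "\<And>v. v < n \<Longrightarrow> degree E v \<le> \<Delta>" and L: "1 \<le> L" and n: "1 \<le> n" "n \<le> q"
      and \<epsilon>: "1 \<le> \<epsilon> * real q" "0 < \<epsilon>" "\<epsilon> < 1" and k1: "1 \<le> k" and k: "real k \<le> (1 - \<delta>) * real (matching_number E)"
      and q: "q = 2 ^ L" and d: "d = cd * L" and J: "J = q ^ (ce + 6)"
      and g: "g = (if 2 * card E \<le> cE * L then q ^ 5 else \<Lambda> * 8 * \<Delta> * q ^ 5)"
    interpret fin_graph n E by fact
    have q2: "2 \<le> q" using L self_le_power[of 2 L] by (simp add: q)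
    have m0: "real mstar > 0" using k k1 \<delta> by (smt (verit) mult_nonneg_nonpos of_nat_0_le_iff of_nat_1 of_nat_le_iff)
    have km: "real mstar * \<delta> \<le> real mstar - real k" using k by (simp add: algebra_simps)
    then have "real k < real mstar" using m0 \<delta> by (smt (verit) mult_pos_pos)
    then have kl: "k < mstar" by simp
    have Dm: "mstar \<le> D * (mstar - k)"
    proof -
      have "real mstar * 1 \<le> real mstar * (D * \<delta>)" using D by (intro mult_left_mono) auto
      also have "\<dots> = D * (real mstar * \<delta>)" by simp
      also have "\<dots> \<le> D * (real mstar - real k)" using km by (intro mult_left_mono) auto
      also have "\<dots> = real (D * (mstar - k))" using kl by simp
      finally show ?thesis by (simp only: mult_1_right of_nat_le_iff)
    qed
    have dd: "real n * ((2 * X + 4) * (X / (X + 1)) ^ d) * 2 \<le> 1 / real q ^ (ce + 3)"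
    proof -
      have "(X / (X + 1)) ^ d = ((X / (X + 1)) ^ cd) ^ L" by (simp add: d power_mult)
      also have "\<dots> \<le> ((1 / 2) ^ (ce + 4 + b)) ^ L" using cd X by (intro power_mono) auto
      also have "\<dots> = 1 / real q ^ (ce + 4 + b)" by (simp add: q power_mult[symmetric] mult.commute power_one_over)
      finally have 1: "(X / (X + 1)) ^ d \<le> 1 / real q ^ (ce + 4 + b)" .
      have "2 ^ b \<le> real q ^ b" using q2 by (intro power_mono) auto
      with b have 2: "2 * (2 * X + 4) \<le> real q ^ b" by linarith
      have "real n * ((2 * X + 4) * (X / (X + 1)) ^ d) * 2 = real n * (2 * (2 * X + 4)) * (X / (X + 1)) ^ d" by simp
      also have "\<dots> \<le> real q * real q ^ b * (1 / real q ^ (ce + 4 + b))"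
        using 1 2 n X by (intro mult_mono) auto
      also have "\<dots> = 1 / real q ^ (ce + 3)"
      proof -
        have "real q ^ (ce + 4 + b) = real q * real q ^ b * real q ^ (ce + 3)"
          by (simp add: ac_simps flip: power_add power_Suc)
        then show ?thesis using q2 by simp
      qed
      finally show ?thesis .
    qed
    have gle: "g \<le> \<Lambda> * 8 * \<Delta> * q ^ 5" using g \<Lambda> \<Delta> by auto
    have X': "X = 2 * \<Delta> * \<Lambda>" by (simp add: X_def)
    show "relative_approx \<epsilon> (num_matchings E k) ((\<Sum>i\<in>{1..g}. est_num \<Delta> q d J k i) / (\<Sum>i\<in>{1..g}. est_den \<Delta> q d k i))
      \<and> (\<Sum>i\<in>{1..g}. est_num \<Delta> q d J k i) > 0 \<and> (\<Sum>i\<in>{1..g}. est_den \<Delta> q d k i) > 0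
      \<and> (\<forall>i\<in>{1..g}. \<forall>j\<in>arc q i. \<forall>d S v. Rt (of_real (activity \<Delta> q i) * zeta (q\<^sup>2) ^ j) d S v \<noteq> 0)"
    proof (cases "2 * card E \<le> cE * L")
      case True
      then have g': "g = q ^ 5" using g by simp
      have i0: "q ^ 5 \<in> {1..g}" using q2 g' by simp
      have ce': "ce \<ge> (\<Delta> + 4) * cE + 6 + a" by (simp add: ce_def cp_def)
      have tail: "cmod (Z {} z) \<le> 1 / real q ^ (ce + 2) * Z {} (activity \<Delta> q i)" if "i \<in> {1..g}" "i > q ^ 5" for i and z :: complex
        using that g' by simp
      from estimate_aux[OF deg \<Delta> \<Lambda> n q2 less_imp_le[OF kl] X' dd eq_refl[OF J[symmetric]] \<epsilon>(2,3,1) gle a ce' tail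
        i0 small_graph_weight[OF \<Delta> q True less_imp_le[OF kl]]]
      show ?thesis by blast
    next
      case False
      then have g': "g = \<Lambda> * 8 * \<Delta> * q ^ 5" using g by simp
      obtain i0 where i0: "i0 \<in> {1..g}" "1 / real q ^ 5 \<le> mnum k * (activity \<Delta> q i0 ^ k / Z {} (activity \<Delta> q i0))"
        unfolding g' by (rule mode_on_grid[OF deg \<Delta> n q2 k1 kl Dm \<Lambda>_def])
      have ce1: "ce1 \<ge> 5 + 6 + a" and le: "ce1 \<le> ce" by (auto simp: ce1_def ce_def cp_def)
      have J': "q ^ (ce1 + 6) \<le> J" unfolding J using le q2 by (intro power_increasing) auto
      have "1 / real q ^ (ce + 3) \<le> 1 / real q ^ (ce1 + 3)"
        using le q2 by (intro divide_left_mono power_increasing) auto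
      with dd have dd1: "real n * ((2 * X + 4) * (X / (X + 1)) ^ d) * 2 \<le> 1 / real q ^ (ce1 + 3)" by linarith
      have tail: "cmod (Z {} z) \<le> 1 / real q ^ (ce1 + 2) * Z {} (activity \<Delta> q i)"
        if i: "i \<in> {1..g}" "i > q ^ 5" and z: "cmod z = activity \<Delta> q i" "Re z \<le> 0" for i z
      proof -
        have "real i \<ge> real (q ^ 5)" using i(2) by (intro of_nat_mono) simp
        then have l1: "1 / (8 * real \<Delta>) \<le> activity \<Delta> q i" using \<Delta> q2 by (simp add: activity_def field_simps)
        have "real i \<le> real (\<Lambda> * (8 * \<Delta> * q ^ 5))" using i(1) g' by (intro of_nat_mono) (simp add: mult.assoc)
        then have l2: "activity \<Delta> q i \<le> real \<Lambda>"
          using \<Delta> q2 by (simp add: activity_def pos_divide_le_eq)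
        obtain h where h: "card E \<le> 4 * \<Delta> * h" "cmod (Z {} z) \<le> \<rho> ^ h * Z {} (activity \<Delta> q i)"
          by (rule tail_bound[OF deg \<Delta> z l1 l2 \<rho>_def])
        have "8 * \<Delta> * (t * (ce1 + 2) * L) < 8 * \<Delta> * h" using False h(1) by (simp add: cE_def algebra_simps)
        then have "t * (ce1 + 2) * L \<le> h" by simp
        then have "\<rho> ^ h \<le> \<rho> ^ (t * (ce1 + 2) * L)" using \<rho> by (intro power_decreasing) auto
        also have "\<dots> = (\<rho> ^ t) ^ ((ce1 + 2) * L)" by (simp only: power_mult[symmetric] mult.assoc)
        also have "\<dots> \<le> (1 / 2) ^ ((ce1 + 2) * L)" using t \<rho> by (intro power_mono) auto
        also have "\<dots> = 1 / real q ^ (ce1 + 2)"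
          by (simp only: q power_one_over of_nat_power of_nat_numeral power_mult[symmetric] mult.commute[of L])
        finally have "\<rho> ^ h * Z {} (activity \<Delta> q i) \<le> 1 / real q ^ (ce1 + 2) * Z {} (activity \<Delta> q i)"
          using l1 \<Delta> by (intro mult_right_mono less_imp_le[OF Z_real_pos]) (auto intro: less_le_trans[rotated])
        with h(2) show ?thesis by linarith
      qed
      from estimate_aux[OF deg \<Delta> \<Lambda> n q2 less_imp_le[OF kl] X' dd1 J' \<epsilon>(2,3,1) gle a ce1 tail i0]
      show ?thesis by blast
    qed
  qed
qed

section \<open>Bounded loop programs\<close>

datatype fexp =
    Cst nat
  | Par nat
  | Arr nat fexp
  | Input fexp
  | Plus fexp fexp
  | Minus fexp fexp
  | Times fexp fexp
  | Quot fexp fexp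

datatype fp =
    Nop
  | Assign nat fexp fexp
  | Then fp fp
  | Cond fexp fp fp
  | Repeat fexp fp

text \<open>A layer of bounded loop programs over an unbounded supply of arrays. The parameters are
  \<open>\<pi> 0\<close>, a cap on the number of iterations of every loop, \<open>\<pi> 1\<close>, the modulus by which every stored
  value is reduced, and four further constants. The cap and the modulus make the running time bound
  purely syntactic.\<close>

primrec ev :: "(nat \<Rightarrow> nat) \<Rightarrow> (nat \<Rightarrow> nat) \<Rightarrow> (nat \<Rightarrow> nat \<Rightarrow> nat) \<Rightarrow> fexp \<Rightarrow> nat" where
  "ev inp \<pi> \<sigma> (Cst c) = c"
| "ev inp \<pi> \<sigma> (Par i) = \<pi> i"
| "ev inp \<pi> \<sigma> (Arr a e) = \<sigma> a (ev inp \<pi> \<sigma> e)"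
| "ev inp \<pi> \<sigma> (Input e) = inp (ev inp \<pi> \<sigma> e)"
| "ev inp \<pi> \<sigma> (Plus a b) = ev inp \<pi> \<sigma> a + ev inp \<pi> \<sigma> b"
| "ev inp \<pi> \<sigma> (Minus a b) = ev inp \<pi> \<sigma> a - ev inp \<pi> \<sigma> b"
| "ev inp \<pi> \<sigma> (Times a b) = ev inp \<pi> \<sigma> a * ev inp \<pi> \<sigma> b"
| "ev inp \<pi> \<sigma> (Quot a b) = ev inp \<pi> \<sigma> a div ev inp \<pi> \<sigma> b"

primrec den :: "(nat \<Rightarrow> nat) \<Rightarrow> (nat \<Rightarrow> nat) \<Rightarrow> fp \<Rightarrow> (nat \<Rightarrow> nat \<Rightarrow> nat) \<Rightarrow> nat \<Rightarrow> nat \<Rightarrow> nat" where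
  "den inp \<pi> Nop = (\<lambda>\<sigma>. \<sigma>)"
| "den inp \<pi> (Assign a i e) = (\<lambda>\<sigma>. \<sigma>(a := (\<sigma> a)(ev inp \<pi> \<sigma> i := ev inp \<pi> \<sigma> e mod \<pi> 1)))"
| "den inp \<pi> (Then p r) = (\<lambda>\<sigma>. den inp \<pi> r (den inp \<pi> p \<sigma>))"
| "den inp \<pi> (Cond e p r) = (\<lambda>\<sigma>. if ev inp \<pi> \<sigma> e \<noteq> 0 then den inp \<pi> p \<sigma> else den inp \<pi> r \<sigma>)"
| "den inp \<pi> (Repeat e p) = (\<lambda>\<sigma>. (den inp \<pi> p ^^ min (ev inp \<pi> \<sigma> e) (\<pi> 0)) \<sigma>)"

text \<open>Cells 2 to 7 hold the parameters, cells 8 to 31 the loop counters, and the 64 arrays are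
  interleaved from cell 32 on.\<close>

primrec cexp :: "fexp \<Rightarrow> expr" where
  "cexp (Cst c) = Const c"
| "cexp (Par i) = Mem (Const (2 + i))"
| "cexp (Arr a e) = Mem (Add (Const (32 + a)) (Mul (Const 64) (cexp e)))"
| "cexp (Input e) = Inp (cexp e)"
| "cexp (Plus a b) = Add (cexp a) (cexp b)"
| "cexp (Minus a b) = Sub (cexp a) (cexp b)"
| "cexp (Times a b) = Mul (cexp a) (cexp b)"
| "cexp (Quot a b) = Div (cexp a) (cexp b)"

text \<open>The machine has no remainder and no minimum: the remainder is
  \<open>e - (e div m) * m\<close>, and \<open>e - (e - c)\<close> with truncated subtraction is
  \<open>min e c\<close>. A loop at nesting depth \<open>h\<close> counts down in cell
  \<open>8 + h\<close>.\<close>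

primrec compile :: "nat \<Rightarrow> fp \<Rightarrow> prog" where
  "compile h Nop = Skip"
| "compile h (Assign a i e) = Store (Add (Const (32 + a)) (Mul (Const 64) (cexp i)))
     (Sub (cexp e) (Mul (Div (cexp e) (Mem (Const 3))) (Mem (Const 3))))"
| "compile h (Then p r) = Seq (compile h p) (compile h r)"
| "compile h (Cond e p r) = If (cexp e) (compile h p) (compile h r)"
| "compile h (Repeat e p) = Seq (Store (Const (8 + h)) (Sub (cexp e) (Sub (cexp e) (Mem (Const 2)))))
     (While (Mem (Const (8 + h)))
       (Seq (compile (Suc h) p) (Store (Const (8 + h)) (Sub (Mem (Const (8 + h))) (Const 1)))))"

primrec wf_fexp :: "fexp \<Rightarrow> bool" where
  "wf_fexp (Cst c) \<longleftrightarrow> True"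
| "wf_fexp (Par i) \<longleftrightarrow> i < 6"
| "wf_fexp (Arr a e) \<longleftrightarrow> a < 64 \<and> wf_fexp e"
| "wf_fexp (Input e) \<longleftrightarrow> wf_fexp e"
| "wf_fexp (Plus a b) \<longleftrightarrow> wf_fexp a \<and> wf_fexp b"
| "wf_fexp (Minus a b) \<longleftrightarrow> wf_fexp a \<and> wf_fexp b"
| "wf_fexp (Times a b) \<longleftrightarrow> wf_fexp a \<and> wf_fexp b"
| "wf_fexp (Quot a b) \<longleftrightarrow> wf_fexp a \<and> wf_fexp b"

primrec wf_fp :: "nat \<Rightarrow> fp \<Rightarrow> bool" where
  "wf_fp h Nop \<longleftrightarrow> True"
| "wf_fp h (Assign a i e) \<longleftrightarrow> h \<le> 24 \<and> a < 64 \<and> wf_fexp i \<and> wf_fexp e"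
| "wf_fp h (Then p r) \<longleftrightarrow> wf_fp h p \<and> wf_fp h r"
| "wf_fp h (Cond e p r) \<longleftrightarrow> wf_fexp e \<and> wf_fp h p \<and> wf_fp h r"
| "wf_fp h (Repeat e p) \<longleftrightarrow> h < 24 \<and> wf_fexp e \<and> wf_fp (Suc h) p"

definition represents :: "(nat \<Rightarrow> nat) \<Rightarrow> (nat \<Rightarrow> nat) \<Rightarrow> (nat \<Rightarrow> nat \<Rightarrow> nat) \<Rightarrow> bool" where
  "represents \<pi> s \<sigma> \<longleftrightarrow> (\<forall>i<6. s (2 + i) = \<pi> i) \<and> (\<forall>a<64. \<forall>i. s (32 + a + 64 * i) = \<sigma> a i)"

text \<open>The invariant behind all cost bounds: every cell and every input item fits into
  \<open>W\<close> bits. It is preserved because stored values are reduced modulo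
  \<open>\<pi> 1\<close>, and loop counters are at most \<open>\<pi> 0\<close>.\<close>

definition bounded_state :: "(nat \<Rightarrow> nat) \<Rightarrow> (nat \<Rightarrow> nat) \<Rightarrow> nat \<Rightarrow> (nat \<Rightarrow> nat) \<Rightarrow> bool" where
  "bounded_state inp \<pi> W s \<longleftrightarrow> (\<forall>x. s x \<le> \<pi> 1) \<and> (\<forall>x. inp x \<le> \<pi> 1) \<and> 1 \<le> \<pi> 1 \<and> \<pi> 1 < 2 ^ W \<and> \<pi> 0 \<le> \<pi> 1"

lemma val_cexp:
  "represents \<pi> s \<sigma> \<Longrightarrow> wf_fexp e \<Longrightarrow> val inp s (cexp e) = ev inp \<pi> \<sigma> e"
  by (induction e) (auto simp: represents_def)

text \<open>A constant \<open>c\<close> has size \<open>Suc c\<close>, so that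
  \<open>c < 2 ^ c\<close> lets constants obey the same bound \<open>2 ^ (W * size)\<close> as all
  other expressions.\<close>

primrec expr_size :: "expr \<Rightarrow> nat" where
  "expr_size (Const c) = Suc c"
| "expr_size (Mem a) = Suc (expr_size a)"
| "expr_size (Inp a) = Suc (expr_size a)"
| "expr_size (Add a b) = Suc (expr_size a + expr_size b)"
| "expr_size (Sub a b) = Suc (expr_size a + expr_size b)"
| "expr_size (Mul a b) = Suc (expr_size a + expr_size b)"
| "expr_size (Div a b) = Suc (expr_size a + expr_size b)"

lemma val_le:
  assumes s: "\<And>x. s x \<le> m" and inp: "\<And>x. inp x \<le> m" and m: "m < 2 ^ W" "1 \<le> m"
  shows "val inp s e \<le> 2 ^ (W * expr_size e)"
proof -
  have W: "W \<ge> 1" using m by (cases W) auto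
  have m': "m \<le> 2 ^ (W * Suc k)" for k
  proof -
    have "(2::nat) ^ W \<le> 2 ^ (W * Suc k)" by (intro power_increasing) auto
    then show ?thesis using m by linarith
  qed
  have *: "x + y \<le> 2 ^ (W * Suc (i + j)) \<and> x * y \<le> 2 ^ (W * Suc (i + j)) \<and> x \<le> 2 ^ (W * Suc (i + j))"
    if xy: "x \<le> 2 ^ (W * i)" "y \<le> 2 ^ (W * j)" for x y i j :: nat
  proof -
    have "2 ^ (W * i) \<le> (2::nat) ^ (W * (i + j))" "2 ^ (W * j) \<le> (2::nat) ^ (W * (i + j))"
      by (intro power_increasing; simp)+
    then have xy': "x \<le> 2 ^ (W * (i + j))" "y \<le> 2 ^ (W * (i + j))" using xy by linarith+
    have "2 * 2 ^ (W * (i + j)) \<le> (2::nat) ^ W * 2 ^ (W * (i + j))"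
      using W self_le_power[of "2::nat" W] by (intro mult_right_mono) auto
    then have "2 * 2 ^ (W * (i + j)) \<le> (2::nat) ^ (W * Suc (i + j))" by (simp add: power_add)
    moreover have "x * y \<le> 2 ^ (W * i) * 2 ^ (W * j)" by (rule mult_le_mono[OF xy])
    then have "x * y \<le> 2 ^ (W * (i + j))" by (simp add: power_add algebra_simps)
    ultimately show ?thesis using xy' by linarith
  qed
  show ?thesis
  proof (induction e)
    case (Const c)
    have "c < 2 ^ c" by (rule less_exp)
    also have "\<dots> \<le> (2::nat) ^ (W * Suc c)"
      by (intro power_increasing) (use W mult_le_mono[of 1 W c "Suc c"] in auto)
    finally show ?case by simp
  next
    case (Mem a)
    then show ?case using m' s le_trans by (simp only: val.simps expr_size.simps) blast
  next
    case (Inp a)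
    then show ?case using m' inp le_trans by (simp only: val.simps expr_size.simps) blast
  next
    case (Add a b)
    then show ?case using * by simp
  next
    case (Sub a b)
    then show ?case using *[of "val inp s a" _ "val inp s b"] diff_le_self le_trans by (simp only: val.simps expr_size.simps) blast
  next
    case (Mul a b)
    then show ?case using * by simp
  next
    case (Div a b)
    then show ?case using *[of "val inp s a" _ "val inp s b"] div_le_dividend le_trans by (simp only: val.simps expr_size.simps) blast
  qed
qed

lemma num_bits_le: "x \<le> 2 ^ k \<Longrightarrow> num_bits x \<le> Suc k"
  using floor_log_mono[THEN monoD, of x "2 ^ k"] by (simp add: num_bits_def)

lemma cost_le:
  assumes "\<And>x. s x \<le> m" "\<And>x. inp x \<le> m" "m < 2 ^ W" "1 \<le> m"
  shows "cost inp s e \<le> expr_size e * Suc (W * expr_size e)"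
proof -
  have nb: "num_bits (val inp s e) \<le> Suc (W * expr_size e)" for e
    by (rule num_bits_le[OF val_le[OF assms]])
  have W: "W \<ge> 1" using assms(3,4) by (cases W) auto
  have *: "x + y + z \<le> Suc (i + j) * Suc (W * Suc (i + j))"
    if "x \<le> i * Suc (W * i)" "y \<le> j * Suc (W * j)" "z \<le> Suc (W * Suc (i + j))" for x y z i j
  proof -
    have "i * Suc (W * i) \<le> i * Suc (W * Suc (i + j))" "j * Suc (W * j) \<le> j * Suc (W * Suc (i + j))"
      by (rule mult_le_mono2, subst Suc_le_mono, rule mult_le_mono2, simp)+
    then show ?thesis using that by (simp add: algebra_simps)
  qed
  show ?thesis
  proof (induction e)
    case (Const c)
    then show ?case using nb[of "Const c"] by (simp add: le_trans[of _ "Suc (W + W * c)"])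
  next
    case (Mem a)
    then show ?case using *[of "cost inp s a" "expr_size a" 0 0] nb[of "Mem a"] by simp
  next
    case (Inp a)
    then show ?case using *[of "cost inp s a" "expr_size a" 0 0] nb[of "Inp a"] by simp
  next
    case (Add a b)
    then show ?case using *[of "cost inp s a" "expr_size a" "cost inp s b" "expr_size b"] nb[of "Add a b"] by simp
  next
    case (Sub a b)
    then show ?case using *[of "cost inp s a" "expr_size a" "cost inp s b" "expr_size b"] nb[of "Sub a b"] by simp
  next
    case (Mul a b)
    then show ?case using *[of "cost inp s a" "expr_size a" "cost inp s b" "expr_size b"] nb[of "Mul a b"] by simp
  next
    case (Div a b)
    then show ?case using *[of "cost inp s a" "expr_size a" "cost inp s b" "expr_size b"] nb[of "Div a b"] by simp
  qed
qed

definition expr_cost :: "expr \<Rightarrow> nat" where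
  "expr_cost e = expr_size e * Suc (expr_size e)"

lemma cost_le':
  assumes "bounded_state inp \<pi> W s"
  shows "cost inp s e \<le> expr_cost e * W"
proof -
  have W: "W \<ge> 1" using assms by (cases W) (auto simp: bounded_state_def)
  have "cost inp s e \<le> expr_size e * Suc (W * expr_size e)"
    by (rule cost_le[where m = "\<pi> 1"]) (use assms in \<open>auto simp: bounded_state_def\<close>)
  also have "\<dots> \<le> expr_size e * (W * Suc (expr_size e))" using W by (intro mult_le_mono2) simp
  also have "\<dots> = expr_cost e * W" by (simp only: expr_cost_def ac_simps)
  finally show ?thesis .
qed

lemma bounded_state_W: "bounded_state inp \<pi> W s \<Longrightarrow> W \<ge> 1"
  by (cases W) (auto simp: bounded_state_def)

lemma bounded_state_upd: "bounded_state inp \<pi> W s \<Longrightarrow> y \<le> \<pi> 1 \<Longrightarrow> bounded_state inp \<pi> W (s(x := y))"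
  by (auto simp: bounded_state_def)

lemma represents_upd_reserved: "represents \<pi> s \<sigma> \<Longrightarrow> 8 \<le> x \<Longrightarrow> x < 32 \<Longrightarrow> represents \<pi> (s(x := y)) \<sigma>"
  by (auto simp: represents_def)

lemma represents_upd_array:
  assumes "represents \<pi> s \<sigma>" "a < 64"
  shows "represents \<pi> (s(32 + a + 64 * i := y)) (\<sigma>(a := (\<sigma> a)(i := y)))"
proof -
  have inj: "b = a \<and> j = i" if "32 + b + 64 * j = 32 + a + 64 * i" "b < 64" for b j
  proof -
    have eq: "b + 64 * j = a + 64 * i" using that by simp
    then have "(b + 64 * j) mod 64 = (a + 64 * i) mod 64" by (rule arg_cong)
    then have "b = a" using that assms(2) by simp
    then show ?thesis using eq by simp
  qed
  show ?thesis unfolding represents_def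
  proof (intro conjI allI impI)
    fix j :: nat assume "j < 6"
    then show "(s(32 + a + 64 * i := y)) (2 + j) = \<pi> j" using assms(1) by (simp add: represents_def)
  next
    fix b j :: nat assume b: "b < 64"
    show "(s(32 + a + 64 * i := y)) (32 + b + 64 * j) = (\<sigma>(a := (\<sigma> a)(i := y))) b j"
    proof (cases "b = a \<and> j = i")
      case False
      then have "32 + b + 64 * j \<noteq> 32 + a + 64 * i" using inj[OF _ b] by blast
      then have "(s(32 + a + 64 * i := y)) (32 + b + 64 * j) = s (32 + b + 64 * j)" by (rule fun_upd_other)
      also have "\<dots> = \<sigma> b j" using assms(1) b by (simp add: represents_def)
      finally show ?thesis using False by auto
    qed simp
  qed
qed

text \<open>\<open>C\<close> and \<open>c\<close> depend only on the program text: each loop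
  multiplies the time by at most \<open>\<pi> 0 + 1\<close>, whatever its count evaluates to. That
  the cells below \<open>8 + h\<close> are unchanged protects the counters of the enclosing
  loops.\<close>

theorem compile_correct:
  "wf_fp h p \<Longrightarrow> \<exists>C c. \<forall>inp \<pi> W s \<sigma>. bounded_state inp \<pi> W s \<longrightarrow> represents \<pi> s \<sigma> \<longrightarrow>
     (\<exists>t s'. runs inp (compile h p) s t s' \<and> bounded_state inp \<pi> W s' \<and> represents \<pi> s' (den inp \<pi> p \<sigma>)
       \<and> (\<forall>x<8 + h. s' x = s x) \<and> t \<le> C * W * (\<pi> 0 + 1) ^ c)"
proof (induction p arbitrary: h)
  case Nop
  show ?case
  proof (rule exI[of _ 1], rule exI[of _ 1], intro allI impI)
    fix inp \<pi> W s \<sigma>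
    assume 1: "bounded_state inp \<pi> W s" "represents \<pi> s \<sigma>"
    have "1 \<le> 1 * W * (\<pi> 0 + 1) ^ 1" using bounded_state_W[OF 1(1)] by simp
    then show "\<exists>t s'. runs inp (compile h Nop) s t s' \<and> bounded_state inp \<pi> W s' \<and> represents \<pi> s' (den inp \<pi> Nop \<sigma>)
       \<and> (\<forall>x<8 + h. s' x = s x) \<and> t \<le> 1 * W * (\<pi> 0 + 1) ^ 1"
      using 1 runs.Skip by (intro exI[of _ 1] exI[of _ s]) auto
  qed
next
  case (Assign a i e)
  let ?a = "Add (Const (32 + a)) (Mul (Const 64) (cexp i))"
  let ?e = "Sub (cexp e) (Mul (Div (cexp e) (Mem (Const 3))) (Mem (Const 3)))"
  show ?case
  proof (rule exI[of _ "expr_cost ?a + expr_cost ?e + 1"], rule exI[of _ 0], intro allI impI)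
    fix inp \<pi> W s \<sigma>
    assume 1: "bounded_state inp \<pi> W s" "represents \<pi> s \<sigma>"
    have s3: "s 3 = \<pi> 1" using 1(2) unfolding represents_def by (auto dest: spec[of _ 1] simp: numeral_3_eq_3)
    have va: "val inp s ?a = 32 + a + 64 * ev inp \<pi> \<sigma> i"
      using val_cexp[OF 1(2)] Assign by simp
    have ve: "val inp s ?e = ev inp \<pi> \<sigma> e mod \<pi> 1"
      using val_cexp[OF 1(2)] Assign s3 by (simp add: minus_div_mult_eq_mod)
    have "ev inp \<pi> \<sigma> e mod \<pi> 1 \<le> \<pi> 1"
      using 1(1) by (intro less_imp_le mod_less_divisor) (auto simp: bounded_state_def)
    then have b: "bounded_state inp \<pi> W (s(val inp s ?a := val inp s ?e))"
      unfolding ve by (rule bounded_state_upd[OF 1(1)])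
    have r: "represents \<pi> (s(val inp s ?a := val inp s ?e)) (den inp \<pi> (Assign a i e) \<sigma>)"
      unfolding va ve using represents_upd_array[OF 1(2)] Assign by simp
    have "cost inp s ?a + cost inp s ?e + 1 \<le> expr_cost ?a * W + expr_cost ?e * W + 1 * W"
      by (intro add_mono cost_le'[OF 1(1)]) (use bounded_state_W[OF 1(1)] in simp)
    also have "\<dots> = (expr_cost ?a + expr_cost ?e + 1) * W * (\<pi> 0 + 1) ^ 0" by (simp only: add_mult_distrib power_0 mult_1_right)
    finally have t: "cost inp s ?a + cost inp s ?e + 1 \<le> (expr_cost ?a + expr_cost ?e + 1) * W * (\<pi> 0 + 1) ^ 0" .
    show "\<exists>t s'. runs inp (compile h (Assign a i e)) s t s' \<and> bounded_state inp \<pi> W s' \<and> represents \<pi> s' (den inp \<pi> (Assign a i e) \<sigma>)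
       \<and> (\<forall>x<8 + h. s' x = s x) \<and> t \<le> (expr_cost ?a + expr_cost ?e + 1) * W * (\<pi> 0 + 1) ^ 0"
    proof (intro exI[of _ "cost inp s ?a + cost inp s ?e + 1"] exI[of _ "s(val inp s ?a := val inp s ?e)"] conjI b r t)
      show "runs inp (compile h (Assign a i e)) s (cost inp s ?a + cost inp s ?e + 1) (s(val inp s ?a := val inp s ?e))"
        unfolding compile.simps by (rule runs.Store)
      show "\<forall>x<8 + h. (s(val inp s ?a := val inp s ?e)) x = s x" unfolding va using Assign by auto
    qed
  qed
next
  case (Then p r)
  obtain C1 c1 where 1: "\<And>inp \<pi> W s \<sigma>. bounded_state inp \<pi> W s \<Longrightarrow> represents \<pi> s \<sigma> \<Longrightarrow>
     (\<exists>t s'. runs inp (compile h p) s t s' \<and> bounded_state inp \<pi> W s' \<and> represents \<pi> s' (den inp \<pi> p \<sigma>)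
       \<and> (\<forall>x<8 + h. s' x = s x) \<and> t \<le> C1 * W * (\<pi> 0 + 1) ^ c1)"
    using Then.IH(1)[of h] Then.prems by fastforce
  obtain C2 c2 where 2: "\<And>inp \<pi> W s \<sigma>. bounded_state inp \<pi> W s \<Longrightarrow> represents \<pi> s \<sigma> \<Longrightarrow>
     (\<exists>t s'. runs inp (compile h r) s t s' \<and> bounded_state inp \<pi> W s' \<and> represents \<pi> s' (den inp \<pi> r \<sigma>)
       \<and> (\<forall>x<8 + h. s' x = s x) \<and> t \<le> C2 * W * (\<pi> 0 + 1) ^ c2)"
    using Then.IH(2)[of h] Then.prems by fastforce
  show ?case
  proof (rule exI[of _ "C1 + C2"], rule exI[of _ "c1 + c2"], intro allI impI)
    fix inp \<pi> W s \<sigma>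
    assume s: "bounded_state inp \<pi> W s" "represents \<pi> s \<sigma>"
    obtain t s' where t: "runs inp (compile h p) s t s'" "bounded_state inp \<pi> W s'" "represents \<pi> s' (den inp \<pi> p \<sigma>)"
       "\<forall>x<8 + h. s' x = s x" "t \<le> C1 * W * (\<pi> 0 + 1) ^ c1" using 1[OF s] by auto
    obtain u s'' where u: "runs inp (compile h r) s' u s''" "bounded_state inp \<pi> W s''" "represents \<pi> s'' (den inp \<pi> r (den inp \<pi> p \<sigma>))"
       "\<forall>x<8 + h. s'' x = s' x" "u \<le> C2 * W * (\<pi> 0 + 1) ^ c2" using 2[OF t(2,3)] by auto
    have "t + u \<le> C1 * W * (\<pi> 0 + 1) ^ (c1 + c2) + C2 * W * (\<pi> 0 + 1) ^ (c1 + c2)"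
      by (intro add_mono le_trans[OF t(5)] le_trans[OF u(5)] mult_le_mono2 power_increasing) auto
    also have "\<dots> = (C1 + C2) * W * (\<pi> 0 + 1) ^ (c1 + c2)" by (simp only: add_mult_distrib)
    finally show "\<exists>t s'. runs inp (compile h (Then p r)) s t s' \<and> bounded_state inp \<pi> W s' \<and> represents \<pi> s' (den inp \<pi> (Then p r) \<sigma>)
       \<and> (\<forall>x<8 + h. s' x = s x) \<and> t \<le> (C1 + C2) * W * (\<pi> 0 + 1) ^ (c1 + c2)"
      using t u runs.Seq[OF t(1) u(1)] by (intro exI[of _ "t + u"] exI[of _ s'']) auto
  qed
next
  case (Cond e p r)
  obtain C1 c1 where 1: "\<And>inp \<pi> W s \<sigma>. bounded_state inp \<pi> W s \<Longrightarrow> represents \<pi> s \<sigma> \<Longrightarrow>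
     (\<exists>t s'. runs inp (compile h p) s t s' \<and> bounded_state inp \<pi> W s' \<and> represents \<pi> s' (den inp \<pi> p \<sigma>)
       \<and> (\<forall>x<8 + h. s' x = s x) \<and> t \<le> C1 * W * (\<pi> 0 + 1) ^ c1)"
    using Cond.IH(1)[of h] Cond.prems by fastforce
  obtain C2 c2 where 2: "\<And>inp \<pi> W s \<sigma>. bounded_state inp \<pi> W s \<Longrightarrow> represents \<pi> s \<sigma> \<Longrightarrow>
     (\<exists>t s'. runs inp (compile h r) s t s' \<and> bounded_state inp \<pi> W s' \<and> represents \<pi> s' (den inp \<pi> r \<sigma>)
       \<and> (\<forall>x<8 + h. s' x = s x) \<and> t \<le> C2 * W * (\<pi> 0 + 1) ^ c2)"
    using Cond.IH(2)[of h] Cond.prems by fastforce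
  let ?C = "expr_cost (cexp e) + C1 + C2 + 1"
  show ?case
  proof (rule exI[of _ ?C], rule exI[of _ "c1 + c2"], intro allI impI)
    fix inp \<pi> W s \<sigma>
    assume s: "bounded_state inp \<pi> W s" "represents \<pi> s \<sigma>"
    have W: "W \<ge> 1" by (rule bounded_state_W[OF s(1)])
    have ve: "val inp s (cexp e) = ev inp \<pi> \<sigma> e" using val_cexp[OF s(2)] Cond.prems by simp
    have pw: "1 \<le> (\<pi> 0 + 1) ^ (c1 + c2)" by simp
    have tt: "cost inp s (cexp e) + t + 1 \<le> ?C * W * (\<pi> 0 + 1) ^ (c1 + c2)"
      if "t \<le> C1 * W * (\<pi> 0 + 1) ^ c1 \<or> t \<le> C2 * W * (\<pi> 0 + 1) ^ c2" for t
    proof -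
      have "C1 * W * (\<pi> 0 + 1) ^ c1 \<le> C1 * W * (\<pi> 0 + 1) ^ (c1 + c2)" "C2 * W * (\<pi> 0 + 1) ^ c2 \<le> C2 * W * (\<pi> 0 + 1) ^ (c1 + c2)"
        by (intro mult_le_mono2 power_increasing; simp)+
      then have "t \<le> C1 * W * (\<pi> 0 + 1) ^ (c1 + c2) + C2 * W * (\<pi> 0 + 1) ^ (c1 + c2)" using that by linarith
      moreover have "cost inp s (cexp e) \<le> expr_cost (cexp e) * W * (\<pi> 0 + 1) ^ (c1 + c2)"
        using mult_le_mono[OF cost_le'[OF s(1)] pw] by simp
      moreover have "1 \<le> 1 * W * (\<pi> 0 + 1) ^ (c1 + c2)" using mult_le_mono[OF W pw] by simp
      ultimately have "cost inp s (cexp e) + t + 1 \<le> expr_cost (cexp e) * W * (\<pi> 0 + 1) ^ (c1 + c2) + C1 * W * (\<pi> 0 + 1) ^ (c1 + c2)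
        + C2 * W * (\<pi> 0 + 1) ^ (c1 + c2) + 1 * W * (\<pi> 0 + 1) ^ (c1 + c2)" by linarith
      then show ?thesis by (simp only: add_mult_distrib)
    qed
    show "\<exists>t s'. runs inp (compile h (Cond e p r)) s t s' \<and> bounded_state inp \<pi> W s' \<and> represents \<pi> s' (den inp \<pi> (Cond e p r) \<sigma>)
       \<and> (\<forall>x<8 + h. s' x = s x) \<and> t \<le> ?C * W * (\<pi> 0 + 1) ^ (c1 + c2)"
    proof (cases "ev inp \<pi> \<sigma> e = 0")
      case True
      obtain t s' where t: "runs inp (compile h r) s t s'" "bounded_state inp \<pi> W s'" "represents \<pi> s' (den inp \<pi> r \<sigma>)"
       "\<forall>x<8 + h. s' x = s x" "t \<le> C2 * W * (\<pi> 0 + 1) ^ c2" using 2[OF s] by auto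
      show ?thesis using t tt[of t] True runs.IfFalse[of inp s "cexp e" "compile h r" t s' "compile h p"] ve
        by (intro exI[of _ "cost inp s (cexp e) + t + 1"] exI[of _ s']) auto
    next
      case False
      obtain t s' where t: "runs inp (compile h p) s t s'" "bounded_state inp \<pi> W s'" "represents \<pi> s' (den inp \<pi> p \<sigma>)"
       "\<forall>x<8 + h. s' x = s x" "t \<le> C1 * W * (\<pi> 0 + 1) ^ c1" using 1[OF s] by auto
      show ?thesis using t tt[of t] False runs.IfTrue[of inp s "cexp e" "compile h p" t s' "compile h r"] ve
        by (intro exI[of _ "cost inp s (cexp e) + t + 1"] exI[of _ s']) auto
    qed
  qed
next
  case (Repeat e p)
  then have h: "h < 24" "wf_fexp e" "wf_fp (Suc h) p" by auto
  obtain C c where 1: "\<And>inp \<pi> W s \<sigma>. bounded_state inp \<pi> W s \<Longrightarrow> represents \<pi> s \<sigma> \<Longrightarrow>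
     (\<exists>t s'. runs inp (compile (Suc h) p) s t s' \<and> bounded_state inp \<pi> W s' \<and> represents \<pi> s' (den inp \<pi> p \<sigma>)
       \<and> (\<forall>x<8 + Suc h. s' x = s x) \<and> t \<le> C * W * (\<pi> 0 + 1) ^ c)"
    using Repeat.IH[OF h(3)] by fastforce
  let ?ctr = "Mem (Const (8 + h))"
  let ?dec = "Store (Const (8 + h)) (Sub ?ctr (Const 1))"
  let ?w = "While ?ctr (Seq (compile (Suc h) p) ?dec)"
  let ?b = "Sub (cexp e) (Sub (cexp e) (Mem (Const 2)))"
  define B where "B = C + (expr_cost ?ctr + expr_cost (Const (8 + h)) + expr_cost (Sub ?ctr (Const 1)) + 2)"
  let ?C = "expr_cost (Const (8 + h)) + expr_cost ?b + 1 + B"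
  have loop: "\<exists>t s'. runs inp ?w s t s' \<and> bounded_state inp \<pi> W s' \<and> represents \<pi> s' ((den inp \<pi> p ^^ m) \<sigma>)
       \<and> (\<forall>x<8 + h. s' x = s x) \<and> t \<le> Suc m * (B * W * (\<pi> 0 + 1) ^ c)"
    if "bounded_state inp \<pi> W s" "represents \<pi> s \<sigma>" "s (8 + h) = m" for inp \<pi> W s \<sigma> m
    using that
  proof (induction m arbitrary: s \<sigma>)
    case 0
    have W: "W \<ge> 1" by (rule bounded_state_W[OF 0(1)])
    have "cost inp s ?ctr + 1 \<le> expr_cost ?ctr * W + 1 * W" using cost_le'[OF 0(1), of ?ctr] W by linarith
    also have "\<dots> \<le> B * W" unfolding B_def add_mult_distrib by simp
    also have "\<dots> \<le> B * W * (\<pi> 0 + 1) ^ c" using mult_le_mono2[of 1 "(\<pi> 0 + 1) ^ c" "B * W"] by simp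
    finally have "cost inp s ?ctr + 1 \<le> Suc 0 * (B * W * (\<pi> 0 + 1) ^ c)" by simp
    then show ?case using runs.WhileFalse[of inp s ?ctr "Seq (compile (Suc h) p) ?dec"] 0
      by (intro exI[of _ "cost inp s ?ctr + 1"] exI[of _ s]) auto
  next
    case (Suc m)
    have W: "W \<ge> 1" by (rule bounded_state_W[OF Suc(2)])
    obtain t s1 where t: "runs inp (compile (Suc h) p) s t s1" "bounded_state inp \<pi> W s1" "represents \<pi> s1 (den inp \<pi> p \<sigma>)"
       "\<forall>x<8 + Suc h. s1 x = s x" "t \<le> C * W * (\<pi> 0 + 1) ^ c" using 1[OF Suc(2,3)] by auto
    have c1: "s1 (8 + h) = Suc m" using t(4) Suc(4) by auto
    define s2 where "s2 = s1(val inp s1 (Const (8 + h)) := val inp s1 (Sub ?ctr (Const 1)))"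
    have s2: "s2 = s1(8 + h := m)" by (simp add: s2_def c1)
    have "m \<le> \<pi> 1" using t(2) c1 unfolding bounded_state_def by (metis Suc_leD)
    then have b2: "bounded_state inp \<pi> W s2" unfolding s2 by (rule bounded_state_upd[OF t(2)])
    have r2: "represents \<pi> s2 (den inp \<pi> p \<sigma>)" unfolding s2 by (rule represents_upd_reserved[OF t(3)]) (use h in auto)
    have "s2 (8 + h) = m" by (simp add: s2)
    from Suc.IH[OF b2 r2 this] obtain u s3 where u: "runs inp ?w s2 u s3" "bounded_state inp \<pi> W s3"
       "represents \<pi> s3 ((den inp \<pi> p ^^ m) (den inp \<pi> p \<sigma>))" "\<forall>x<8 + h. s3 x = s2 x" "u \<le> Suc m * (B * W * (\<pi> 0 + 1) ^ c)"
      by auto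
    let ?d = "cost inp s1 (Const (8 + h)) + cost inp s1 (Sub ?ctr (Const 1)) + 1"
    have dec: "runs inp ?dec s1 ?d s2" unfolding s2_def by (rule runs.Store)
    have r: "runs inp ?w s (cost inp s ?ctr + (t + ?d) + u + 1) s3"
      by (rule runs.WhileTrue[OF _ runs.Seq[OF t(1) dec] u(1)]) (use Suc(4) in simp)
    have pw: "1 \<le> (\<pi> 0 + 1) ^ c" by simp
    have "cost inp s ?ctr + ?d + 1 \<le> (expr_cost ?ctr + expr_cost (Const (8 + h)) + expr_cost (Sub ?ctr (Const 1)) + 2) * W"
      using cost_le'[OF Suc(2), of ?ctr] cost_le'[OF t(2), of "Const (8 + h)"] cost_le'[OF t(2), of "Sub ?ctr (Const 1)"] W
      unfolding add_mult_distrib by linarith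
    also have "\<dots> \<le> (expr_cost ?ctr + expr_cost (Const (8 + h)) + expr_cost (Sub ?ctr (Const 1)) + 2) * W * (\<pi> 0 + 1) ^ c"
      using mult_le_mono2[OF pw, of "(expr_cost ?ctr + expr_cost (Const (8 + h)) + expr_cost (Sub ?ctr (Const 1)) + 2) * W"] by simp
    finally have "cost inp s ?ctr + (t + ?d) + 1 \<le> B * W * (\<pi> 0 + 1) ^ c"
      using t(5) unfolding B_def add_mult_distrib by linarith
    then have "cost inp s ?ctr + (t + ?d) + u + 1 \<le> Suc (Suc m) * (B * W * (\<pi> 0 + 1) ^ c)"
      using u(5) unfolding mult_Suc by linarith
    moreover have "(den inp \<pi> p ^^ m) (den inp \<pi> p \<sigma>) = (den inp \<pi> p ^^ Suc m) \<sigma>" by (simp only: funpow_Suc_right o_apply)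
    moreover have "\<forall>x<8 + h. s3 x = s x" using u(4) t(4) by (auto simp: s2)
    ultimately show ?case using r u(2,3) by (intro exI[of _ "cost inp s ?ctr + (t + ?d) + u + 1"] exI[of _ s3]) auto
  qed
  show ?case
  proof (rule exI[of _ ?C], rule exI[of _ "Suc c"], intro allI impI)
    fix inp \<pi> W s \<sigma>
    assume s: "bounded_state inp \<pi> W s" "represents \<pi> s \<sigma>"
    have W: "W \<ge> 1" by (rule bounded_state_W[OF s(1)])
    have ve: "val inp s (cexp e) = ev inp \<pi> \<sigma> e" using val_cexp[OF s(2) h(2)] .
    define m where "m = min (ev inp \<pi> \<sigma> e) (\<pi> 0)"
    have "s 2 = \<pi> 0" using s(2) unfolding represents_def by (auto dest: spec[of _ 0] simp: numeral_2_eq_2)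
    then have vb: "val inp s ?b = m" by (simp add: ve m_def min_def)
    define s1 where "s1 = s(val inp s (Const (8 + h)) := val inp s ?b)"
    have s1: "s1 = s(8 + h := m)" unfolding s1_def vb by simp
    have m: "m \<le> \<pi> 0" by (simp add: m_def)
    have b1: "bounded_state inp \<pi> W s1" unfolding s1 using s(1) m
      by (intro bounded_state_upd) (auto simp: bounded_state_def)
    have r1: "represents \<pi> s1 \<sigma>" unfolding s1 by (rule represents_upd_reserved[OF s(2)]) (use h in auto)
    have "s1 (8 + h) = m" by (simp add: s1)
    from loop[OF b1 r1 this] obtain u s2 where u: "runs inp ?w s1 u s2" "bounded_state inp \<pi> W s2"
       "represents \<pi> s2 ((den inp \<pi> p ^^ m) \<sigma>)" "\<forall>x<8 + h. s2 x = s1 x" "u \<le> Suc m * (B * W * (\<pi> 0 + 1) ^ c)"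
      by auto
    let ?d = "cost inp s (Const (8 + h)) + cost inp s ?b + 1"
    have r: "runs inp (compile h (Repeat e p)) s (?d + u) s2"
      unfolding compile.simps by (rule runs.Seq[OF _ u(1)]) (unfold s1_def, rule runs.Store)
    have pw: "1 \<le> (\<pi> 0 + 1) ^ Suc c" by (rule one_le_power) simp
    have "?d \<le> (expr_cost (Const (8 + h)) + expr_cost ?b + 1) * W"
      using cost_le'[OF s(1), of "Const (8 + h)"] cost_le'[OF s(1), of ?b] W unfolding add_mult_distrib by linarith
    also have "\<dots> \<le> (expr_cost (Const (8 + h)) + expr_cost ?b + 1) * W * (\<pi> 0 + 1) ^ Suc c"
      using mult_le_mono2[OF pw, of "(expr_cost (Const (8 + h)) + expr_cost ?b + 1) * W"] by simp
    finally have d: "?d \<le> (expr_cost (Const (8 + h)) + expr_cost ?b + 1) * W * (\<pi> 0 + 1) ^ Suc c" .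
    have "u \<le> (\<pi> 0 + 1) * (B * W * (\<pi> 0 + 1) ^ c)" by (rule le_trans[OF u(5) mult_le_mono1]) (use m in simp)
    also have "\<dots> = B * W * (\<pi> 0 + 1) ^ Suc c" by (simp only: power_Suc ac_simps)
    finally have "?d + u \<le> ?C * W * (\<pi> 0 + 1) ^ Suc c" using d unfolding add_mult_distrib by linarith
    moreover have "\<forall>x<8 + h. s2 x = s x" using u(4) by (auto simp: s1)
    moreover have "den inp \<pi> (Repeat e p) \<sigma> = (den inp \<pi> p ^^ m) \<sigma>" by (simp add: m_def)
    ultimately show "\<exists>t s'. runs inp (compile h (Repeat e p)) s t s' \<and> bounded_state inp \<pi> W s' \<and> represents \<pi> s' (den inp \<pi> (Repeat e p) \<sigma>)
       \<and> (\<forall>x<8 + h. s' x = s x) \<and> t \<le> ?C * W * (\<pi> 0 + 1) ^ Suc c"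
      using r u(2,3) by (intro exI[of _ "?d + u"] exI[of _ s2]) auto
  qed
qed

section \<open>Computation of the parameters\<close>

primrec epow :: "expr \<Rightarrow> nat \<Rightarrow> expr" where
  "epow e 0 = Const 1"
| "epow e (Suc c) = Mul e (epow e c)"

lemma val_epow: "val inp s (epow e c) = val inp s e ^ c"
  by (induction c) auto

text \<open>Cell 5 starts at 1, so index \<open>1 + n * n + cell 5\<close> is first the leading
  digit of \<epsilon>; the guard is nonzero while the digit is 0. Cell 4 is kept equal to 2 to the
  power of cell 5, so \<open>q\<close> ends as the first power of two with
  \<open>\<epsilon> * q \<ge> 1\<close>, from which \<open>doubling_loop\<close> continues until
  \<open>q \<ge> n\<close>.\<close>

definition first_digit_loop :: prog where
  "first_digit_loop = While (Sub (Const 1) (Inp (Add (Add (Const 1) (Mul (Inp (Const 0)) (Inp (Const 0)))) (Mem (Const 5)))))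
     (Seq (Store (Const 4) (Add (Mem (Const 4)) (Mem (Const 4)))) (Store (Const 5) (Add (Mem (Const 5)) (Const 1))))"

definition doubling_loop :: prog where
  "doubling_loop = While (Sub (Inp (Const 0)) (Mem (Const 4)))
     (Seq (Store (Const 4) (Add (Mem (Const 4)) (Mem (Const 4)))) (Store (Const 5) (Add (Mem (Const 5)) (Const 1))))"

definition power_loop :: prog where
  "power_loop = While (Mem (Const 7))
     (Seq (Store (Const 6) (Add (Mem (Const 6)) (Mem (Const 6)))) (Store (Const 7) (Sub (Mem (Const 7)) (Const 1))))"

text \<open>Cells 2 to 6 end as \<open>K = q^c\<close>, \<open>M = B^2 + 1\<close>,
  \<open>q\<close>, \<open>L\<close> and \<open>B = 2^K\<close>, the parameters 0 to 4 of the loop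
  language; the scratch cell 7 has returned to 0.\<close>

definition prelude :: "nat \<Rightarrow> prog" where
  "prelude c = Seq (Store (Const 4) (Const 2)) (Seq (Store (Const 5) (Const 1))
     (Seq first_digit_loop (Seq doubling_loop (Seq (Store (Const 2) (epow (Mem (Const 4)) c))
     (Seq (Store (Const 7) (Mem (Const 2))) (Seq (Store (Const 6) (Const 1))
     (Seq power_loop (Store (Const 3) (Add (Mul (Mem (Const 6)) (Mem (Const 6))) (Const 1))))))))))"

definition runs_le :: "(nat \<Rightarrow> nat) \<Rightarrow> prog \<Rightarrow> (nat \<Rightarrow> nat) \<Rightarrow> nat \<Rightarrow> (nat \<Rightarrow> nat) \<Rightarrow> bool" where
  "runs_le inp p s T s' \<longleftrightarrow> (\<exists>t\<le>T. runs inp p s t s')"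

lemma runs_le_Seq: "runs_le inp p s T s' \<Longrightarrow> runs_le inp r s' U s'' \<Longrightarrow> runs_le inp (Seq p r) s (T + U) s''"
  unfolding runs_le_def by (meson add_mono runs.Seq)

lemma runs_le_mono: "runs_le inp p s T s' \<Longrightarrow> T \<le> U \<Longrightarrow> runs_le inp p s U s'"
  unfolding runs_le_def by (meson le_trans)

lemma runs_le_While:
  assumes "\<And>j. j < m \<Longrightarrow> val inp (f j) b \<noteq> 0" "\<And>j. j < m \<Longrightarrow> runs_le inp p (f j) T (f (Suc j))"
    and "val inp (f m) b = 0" and "\<And>j. j \<le> m \<Longrightarrow> cost inp (f j) b \<le> c"
  shows "runs_le inp (While b p) (f 0) (Suc m * (T + c + 1)) (f m)"
  using assms
proof (induction m arbitrary: f)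
  case 0
  then show ?case using runs.WhileFalse[of inp "f 0" b p] unfolding runs_le_def
    by (intro exI[of _ "cost inp (f 0) b + 1"]) (auto simp: trans_le_add2)
next
  case (Suc m)
  from Suc.IH[of "\<lambda>j. f (Suc j)"] Suc.prems
  obtain u where u: "u \<le> Suc m * (T + c + 1)" "runs inp (While b p) (f (Suc 0)) u (f (Suc m))"
    unfolding runs_le_def by fastforce
  obtain t where t: "t \<le> T" "runs inp p (f 0) t (f (Suc 0))" using Suc.prems(2)[of 0] by (auto simp: runs_le_def)
  have "runs inp (While b p) (f 0) (cost inp (f 0) b + t + u + 1) (f (Suc m))"
    by (rule runs.WhileTrue[OF _ t(2) u(2)]) (use Suc.prems(1)[of 0] in simp)
  moreover have "cost inp (f 0) b + t + u + 1 \<le> Suc (Suc m) * (T + c + 1)"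
    using Suc.prems(4)[of 0] t(1) u(1) unfolding mult_Suc by linarith
  ultimately show ?case unfolding runs_le_def by blast
qed

lemma leading_digit:
  assumes "0 < \<epsilon>" "\<epsilon> < 1"
  obtains h where "\<And>j. j < h \<Longrightarrow> binary_digit \<epsilon> j = 0" "binary_digit \<epsilon> h = 1" "1 \<le> \<epsilon> * 2 ^ Suc h" "\<epsilon> * 2 ^ h < 1"
proof -
  have "\<exists>h. 1 \<le> \<epsilon> * 2 ^ Suc h"
  proof -
    obtain m where "(1 / 2) ^ m < \<epsilon>" using real_arch_pow_inv[of \<epsilon> "1 / 2"] assms by auto
    then have "1 < \<epsilon> * 2 ^ m" by (simp add: power_one_over field_simps)
    also have "\<dots> \<le> \<epsilon> * 2 ^ Suc m" using assms by simp
    finally show ?thesis by (intro exI[of _ m]) simp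
  qed
  then obtain h where h: "1 \<le> \<epsilon> * 2 ^ Suc h" "\<And>j. j < h \<Longrightarrow> \<not> 1 \<le> \<epsilon> * 2 ^ Suc j"
    using exists_least_iff[of "\<lambda>h. 1 \<le> \<epsilon> * 2 ^ Suc h"] by blast
  have lt: "\<epsilon> * 2 ^ h < 1"
    using h(2)[of "h - 1"] assms by (cases h) auto
  show ?thesis
  proof (rule that[of h])
    show "binary_digit \<epsilon> j = 0" if "j < h" for j
    proof -
      have "\<lfloor>\<epsilon> * 2 ^ Suc j\<rfloor> = 0" using h(2)[OF that] assms by (intro floor_unique) auto
      then show ?thesis by (simp add: binary_digit_def)
    qed
    have "\<lfloor>\<epsilon> * 2 ^ Suc h\<rfloor> = 1" using h(1) lt by (intro floor_unique) auto
    then show "binary_digit \<epsilon> h = 1" by (simp add: binary_digit_def)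
  qed (use h lt in auto)
qed

definition params :: "nat \<Rightarrow> nat \<Rightarrow> nat \<Rightarrow> nat \<Rightarrow> nat \<Rightarrow> nat" where
  "params K q L B i = (if i = 0 then K else if i = 1 then B\<^sup>2 + 1 else if i = 2 then q else if i = 3 then L
     else if i = 4 then B else 0)"

definition regs :: "nat \<Rightarrow> nat \<Rightarrow> nat \<Rightarrow> nat \<Rightarrow> nat \<Rightarrow> nat \<Rightarrow> nat \<Rightarrow> nat" where
  "regs K M q L B j = (\<lambda>_. 0)(2 := K, 3 := M, 4 := q, 5 := L, 6 := B, 7 := j)"

lemma regs_simps [simp]:
  "regs K M q L B j 2 = K" "regs K M q L B j 3 = M" "regs K M q L B j 4 = q" "regs K M q L B j 5 = L"
  "regs K M q L B j 6 = B" "regs K M q L B j 7 = j"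
  "(regs K M q L B j)(2 := x) = regs x M q L B j" "(regs K M q L B j)(3 := x) = regs K x q L B j"
  "(regs K M q L B j)(4 := x) = regs K M x L B j" "(regs K M q L B j)(5 := x) = regs K M q x B j"
  "(regs K M q L B j)(6 := x) = regs K M q L x j" "(regs K M q L B j)(7 := x) = regs K M q L B x"
  by (auto simp: regs_def fun_eq_iff)

lemma regs_le: "K \<le> m \<Longrightarrow> M \<le> m \<Longrightarrow> q \<le> m \<Longrightarrow> L \<le> m \<Longrightarrow> B \<le> m \<Longrightarrow> j \<le> m \<Longrightarrow> regs K M q L B j x \<le> m"
  by (auto simp: regs_def)

text \<open>The bound \<open>\<epsilon> * q \<le> 2 * n\<close> makes polynomial in \<open>q\<close>
  mean polynomial in \<open>n / \<epsilon>\<close>: either the digit loop determines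
  \<open>q\<close> and \<open>\<epsilon> * q < 2\<close>, or the last doubling started below
  \<open>n\<close>. The condition \<open>c \<ge> 2\<close> lets the input item \<open>k\<close>, up
  to \<open>n * n\<close>, fit below the modulus.\<close>

lemma prelude_correct:
  assumes c: "c \<ge> 2"
  shows "\<exists>C. \<forall>n E k (\<epsilon> :: real). 1 \<le> n \<longrightarrow> k \<le> n * n \<longrightarrow> 0 < \<epsilon> \<longrightarrow> \<epsilon> < 1 \<longrightarrow>
    (\<exists>L q t s. q = 2 ^ L \<and> 1 \<le> L \<and> n \<le> q \<and> 1 \<le> \<epsilon> * real q \<and> \<epsilon> * real q \<le> 2 * real n
      \<and> runs (encode_input n E k \<epsilon>) (prelude c) (\<lambda>_. 0) t s \<and> t \<le> C * (2 * q ^ c + 2) * (q ^ c + 1)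
      \<and> represents (params (q ^ c) q L (2 ^ q ^ c)) s (\<lambda>_ _. 0)
      \<and> bounded_state (encode_input n E k \<epsilon>) (params (q ^ c) q L (2 ^ q ^ c)) (2 * q ^ c + 2) s)"
proof -
  let ?g1 = "Sub (Const 1) (Inp (Add (Add (Const 1) (Mul (Inp (Const 0)) (Inp (Const 0)))) (Mem (Const 5))))"
  let ?g2 = "Sub (Inp (Const 0)) (Mem (Const 4))"
  let ?g3 = "Mem (Const 7)"
  let ?s = "\<lambda>i e. expr_cost (Const i) + expr_cost e + 1"
  define b1 where "b1 = ?s 4 (Add (Mem (Const 4)) (Mem (Const 4))) + ?s 5 (Add (Mem (Const 5)) (Const 1))"
  define b3 where "b3 = ?s 6 (Add (Mem (Const 6)) (Mem (Const 6))) + ?s 7 (Sub (Mem (Const 7)) (Const 1))"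
  define D where "D = ?s 4 (Const 2) + ?s 5 (Const 1) + (b1 + expr_cost ?g1 + 1) + (b1 + expr_cost ?g2 + 1)
     + ?s 2 (epow (Mem (Const 4)) c) + ?s 7 (Mem (Const 2)) + ?s 6 (Const 1) + (b3 + expr_cost ?g3 + 1)
     + ?s 3 (Add (Mul (Mem (Const 6)) (Mem (Const 6))) (Const 1))"
  show ?thesis
  proof (rule exI[of _ D], intro allI impI)
    fix n k :: nat and E :: "nat set set" and \<epsilon> :: real
    assume n: "1 \<le> n" and k: "k \<le> n * n" and \<epsilon>: "0 < \<epsilon>" "\<epsilon> < 1"
    define inp where "inp = encode_input n E k \<epsilon>"
    have inp0: "inp 0 = n" by (simp add: inp_def encode_input_def)
    have digit: "inp (2 + n * n + j) = binary_digit \<epsilon> j" for j by (simp add: inp_def encode_input_def)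
    obtain h where h: "\<And>j. j < h \<Longrightarrow> binary_digit \<epsilon> j = 0" "binary_digit \<epsilon> h = 1" "1 \<le> \<epsilon> * 2 ^ Suc h" "\<epsilon> * 2 ^ h < 1"
      using leading_digit[OF \<epsilon>] by metis
    have "1 * 2 ^ n \<le> 2 ^ Suc h * (2::nat) ^ n" by (rule mult_le_mono1) simp
    then have "n \<le> 2 ^ Suc h * 2 ^ n" using less_exp[of n] by linarith
    then have "\<exists>m. n \<le> 2 ^ Suc h * 2 ^ m" ..
    then obtain m where m: "n \<le> 2 ^ Suc h * 2 ^ m" "\<And>j. j < m \<Longrightarrow> \<not> n \<le> 2 ^ Suc h * 2 ^ j"
      using exists_least_iff[of "\<lambda>m. n \<le> 2 ^ Suc h * 2 ^ m"] by blast
    define L where "L = Suc h + m"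
    define q :: nat where "q = 2 ^ L"
    have q: "q = 2 ^ Suc h * 2 ^ m" by (simp add: q_def L_def power_add)
    have nq: "n \<le> q" using m(1) q by simp
    have q2: "q \<ge> 2" using self_le_power[of "2::nat" L] by (simp add: q_def L_def)
    have \<epsilon>q: "1 \<le> \<epsilon> * q"
    proof -
      have "\<epsilon> * 2 ^ Suc h * 1 \<le> \<epsilon> * 2 ^ Suc h * 2 ^ m" using \<epsilon> by (intro mult_left_mono) auto
      then show ?thesis using h(3) by (simp add: q mult.assoc)
    qed
    have q\<epsilon>: "\<epsilon> * q \<le> 2 * n"
    proof (cases m)
      case 0
      then have "\<epsilon> * q = 2 * (\<epsilon> * 2 ^ h)" by (simp add: q)
      also have "\<dots> \<le> 2 * 1" using h(4) by simp
      finally show ?thesis using n by simp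
    next
      case (Suc m')
      then have "2 ^ Suc h * 2 ^ m' < n" using m(2)[of m'] by simp
      then have "q \<le> 2 * n" by (simp add: q Suc)
      then have "real q \<le> 2 * real n" by simp
      moreover have "\<epsilon> * real q \<le> 1 * real q" using \<epsilon> by (intro mult_right_mono) auto
      ultimately show ?thesis by simp
    qed
    define K where "K = q ^ c"
    define B :: nat where "B = 2 ^ K"
    define M where "M = B\<^sup>2 + 1"
    \<comment> \<open>The word length: \<open>M = 2^(2 * K) + 1\<close> is less than
      \<open>2^(2 * K + 2)\<close>.\<close>
    define W where "W = 2 * K + 2"
    have qK: "q * q \<le> K" using power_increasing[OF c, of q] q2 by (simp add: K_def power2_eq_square)
    have KB: "K < B" by (simp add: B_def)
    have B1: "B \<ge> 1" by (simp add: B_def)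
    have BM: "B < M" using self_le_power[of B 2] B1 by (simp add: M_def)
    have Lq: "L < q" by (simp add: q_def)
    have qq: "q \<le> q * q" by simp
    have MW: "M < 2 ^ W"
    proof -
      have "B\<^sup>2 = 2 ^ (2 * K)" by (simp add: B_def power_mult[symmetric] mult.commute)
      then have "2 ^ W = 4 * B\<^sup>2" by (simp add: W_def power_add)
      moreover have "B\<^sup>2 \<ge> 1" using B1 by simp
      ultimately show ?thesis unfolding M_def by linarith
    qed
    have inpM: "inp x \<le> M" for x
    proof -
      have "n * n \<le> q * q" by (rule mult_le_mono[OF nq nq])
      then have "n \<le> M" "k \<le> M" "1 \<le> M" using nq k qK KB BM qq by linarith+
      moreover have "binary_digit \<epsilon> j \<le> 1" for j
      proof -
        have "\<lfloor>\<epsilon> * 2 ^ Suc j\<rfloor> mod 2 = 0 \<or> \<lfloor>\<epsilon> * 2 ^ Suc j\<rfloor> mod 2 = 1" by presburger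
        then show ?thesis by (auto simp: binary_digit_def)
      qed
      ultimately show ?thesis by (auto simp: inp_def encode_input_def intro: le_trans)
    qed
    have pM: "params K q L B 0 = K" "params K q L B 1 = M" by (simp_all add: params_def M_def)
    have cost: "cost inp s e \<le> expr_cost e * W" if "\<forall>x. s x \<le> M" for s e
      by (rule cost_le'[where \<pi> = "params K q L B" and s = s])
        (unfold bounded_state_def pM, use that inpM MW KB BM in auto)
    have W1: "W \<ge> 1" by (simp add: W_def)
    have st: "runs_le inp (Store (Const i) e) s (?s i e * W) (s(i := val inp s e))" if "\<forall>x. s x \<le> M" for s i e
    proof -
      have "runs inp (Store (Const i) e) s (cost inp s (Const i) + cost inp s e + 1) (s(val inp s (Const i) := val inp s e))"
        by (rule runs.Store)
      moreover have "cost inp s (Const i) + cost inp s e + 1 \<le> ?s i e * W"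
        using cost[OF that, of "Const i"] cost[OF that, of e] W1 unfolding add_mult_distrib by linarith
      ultimately show ?thesis unfolding runs_le_def by auto
    qed
    have qM: "q \<le> M" "L \<le> M" "K \<le> M" "B \<le> M" using qq qK KB BM Lq by linarith+
    have pq: "2 ^ j \<le> M" if "j \<le> L" for j
    proof -
      have "(2::nat) ^ j \<le> 2 ^ L" using that by (intro power_increasing) auto
      then show ?thesis using qM(1) unfolding q_def by linarith
    qed
    have pB: "2 ^ j \<le> M" if "j \<le> K" for j
    proof -
      have "(2::nat) ^ j \<le> 2 ^ K" using that by (intro power_increasing) auto
      then show ?thesis using qM(4) unfolding B_def by linarith
    qed
    have dbl: "runs_le inp (Seq (Store (Const 4) (Add (Mem (Const 4)) (Mem (Const 4)))) (Store (Const 5) (Add (Mem (Const 5)) (Const 1))))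
        (regs 0 0 (2 ^ j) j 0 0) (b1 * W) (regs 0 0 (2 ^ Suc j) (Suc j) 0 0)" if "Suc j \<le> L" for j
    proof -
      have l: "\<forall>x. regs 0 0 (2 ^ j) j 0 0 x \<le> M" "\<forall>x. regs 0 0 (2 ^ Suc j) j 0 0 x \<le> M"
        by (intro allI regs_le pq; use that qM in simp)+
      have "runs_le inp (Store (Const 4) (Add (Mem (Const 4)) (Mem (Const 4)))) (regs 0 0 (2 ^ j) j 0 0)
          (?s 4 (Add (Mem (Const 4)) (Mem (Const 4))) * W) (regs 0 0 (2 ^ Suc j) j 0 0)"
        using st[OF l(1), of 4 "Add (Mem (Const 4)) (Mem (Const 4))"] by (simp add: mult_2)
      from runs_le_Seq[OF this st[OF l(2), of 5 "Add (Mem (Const 5)) (Const 1)"]]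
      show ?thesis unfolding b1_def add_mult_distrib by simp
    qed
    have lp1: "runs_le inp first_digit_loop (regs 0 0 2 1 0 0) (Suc h * (b1 * W + expr_cost ?g1 * W + 1)) (regs 0 0 (2 ^ Suc h) (Suc h) 0 0)"
    proof -
      have v: "val inp (regs 0 0 (2 ^ Suc j) (Suc j) 0 0) ?g1 = 1 - binary_digit \<epsilon> j" for j
        using digit[of j] by (simp add: inp0)
      have "\<forall>x. regs 0 0 (2 ^ Suc j) (Suc j) 0 0 x \<le> M" if "j \<le> h" for j
        by (intro allI regs_le pq) (use that qM in \<open>simp_all add: L_def\<close>)
      then have "runs_le inp first_digit_loop (regs 0 0 (2 ^ Suc 0) (Suc 0) 0 0) (Suc h * (b1 * W + expr_cost ?g1 * W + 1)) (regs 0 0 (2 ^ Suc h) (Suc h) 0 0)"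
        unfolding first_digit_loop_def
        by (intro runs_le_While[where f = "\<lambda>j. regs 0 0 (2 ^ Suc j) (Suc j) 0 0"] dbl cost) (use v h in \<open>auto simp: L_def\<close>)
      then show ?thesis by simp
    qed
    have lp2: "runs_le inp doubling_loop (regs 0 0 (2 ^ Suc h) (Suc h) 0 0) (Suc m * (b1 * W + expr_cost ?g2 * W + 1)) (regs 0 0 q L 0 0)"
    proof -
      have "\<forall>x. regs 0 0 (2 ^ (Suc h + j)) (Suc h + j) 0 0 x \<le> M" if "j \<le> m" for j
        by (intro allI regs_le pq) (use that qM in \<open>simp_all add: L_def\<close>)
      moreover have "val inp (regs 0 0 (2 ^ (Suc h + j)) (Suc h + j) 0 0) ?g2 = n - 2 ^ (Suc h + j)" for j
        by (simp add: inp0)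
      moreover have "2 ^ (Suc h + j) < n" if "j < m" for j using m(2)[OF that] unfolding power_add by linarith
      moreover have "n \<le> 2 ^ (Suc h + m)" using m(1) unfolding power_add .
      moreover have "runs_le inp (Seq (Store (Const 4) (Add (Mem (Const 4)) (Mem (Const 4)))) (Store (Const 5) (Add (Mem (Const 5)) (Const 1))))
        (regs 0 0 (2 ^ (Suc h + j)) (Suc h + j) 0 0) (b1 * W) (regs 0 0 (2 ^ (Suc h + Suc j)) (Suc h + Suc j) 0 0)" if "j < m" for j
        using dbl[of "Suc h + j"] that unfolding L_def add_Suc_right by simp
      ultimately have "runs_le inp doubling_loop (regs 0 0 (2 ^ (Suc h + 0)) (Suc h + 0) 0 0) (Suc m * (b1 * W + expr_cost ?g2 * W + 1)) (regs 0 0 (2 ^ (Suc h + m)) (Suc h + m) 0 0)"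
        unfolding doubling_loop_def
        by (intro runs_le_While[where f = "\<lambda>j. regs 0 0 (2 ^ (Suc h + j)) (Suc h + j) 0 0"] cost) (simp_all add: not_le)
      then show ?thesis by (simp only: add_0_right L_def[symmetric] q_def[symmetric])
    qed
    have lp3: "runs_le inp power_loop (regs K 0 q L 1 K) (Suc K * (b3 * W + expr_cost ?g3 * W + 1)) (regs K 0 q L B 0)"
    proof -
      have l: "\<forall>x. regs K 0 q L (2 ^ j) i x \<le> M" if "j \<le> K" "i \<le> K" for j i
        by (intro allI regs_le pB) (use that qM in simp_all)
      have body: "runs_le inp (Seq (Store (Const 6) (Add (Mem (Const 6)) (Mem (Const 6)))) (Store (Const 7) (Sub (Mem (Const 7)) (Const 1))))
        (regs K 0 q L (2 ^ j) (K - j)) (b3 * W) (regs K 0 q L (2 ^ Suc j) (K - Suc j))" if "j < K" for j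
      proof -
        have l1: "\<forall>x. regs K 0 q L (2 ^ j) (K - j) x \<le> M" "\<forall>x. regs K 0 q L (2 ^ Suc j) (K - j) x \<le> M"
          using l[of j "K - j"] l[of "Suc j" "K - j"] that by simp_all
        have "runs_le inp (Store (Const 6) (Add (Mem (Const 6)) (Mem (Const 6)))) (regs K 0 q L (2 ^ j) (K - j))
          (?s 6 (Add (Mem (Const 6)) (Mem (Const 6))) * W) (regs K 0 q L (2 ^ Suc j) (K - j))"
          using st[OF l1(1), of 6 "Add (Mem (Const 6)) (Mem (Const 6))"] by (simp add: mult_2)
        from runs_le_Seq[OF this st[OF l1(2), of 7 "Sub (Mem (Const 7)) (Const 1)"]]
        show ?thesis unfolding b3_def add_mult_distrib by simp
      qed
      have "runs_le inp power_loop (regs K 0 q L (2 ^ 0) (K - 0)) (Suc K * (b3 * W + expr_cost ?g3 * W + 1)) (regs K 0 q L (2 ^ K) (K - K))"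
        unfolding power_loop_def
        by (intro runs_le_While[where f = "\<lambda>j. regs K 0 q L (2 ^ j) (K - j)"] body cost l) auto
      then show ?thesis by (simp add: B_def)
    qed
    have z: "(\<lambda>_. 0) = regs 0 0 0 0 0 0" by (auto simp: regs_def fun_eq_iff)
    have rl: "\<forall>x. regs 0 0 0 0 0 0 x \<le> M" "\<forall>x. regs 0 0 2 0 0 0 x \<le> M" "\<forall>x. regs 0 0 q L 0 0 x \<le> M" "\<forall>x. regs K 0 q L 0 0 x \<le> M"
      "\<forall>x. regs K 0 q L 0 K x \<le> M" "\<forall>x. regs K 0 q L B 0 x \<le> M"
      by (intro allI regs_le; use qM q2 in simp)+
    have s1: "runs_le inp (Store (Const 4) (Const 2)) (\<lambda>_. 0) (?s 4 (Const 2) * W) (regs 0 0 2 0 0 0)"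
      unfolding z using st[OF rl(1), of 4 "Const 2"] by simp
    have s2: "runs_le inp (Store (Const 5) (Const 1)) (regs 0 0 2 0 0 0) (?s 5 (Const 1) * W) (regs 0 0 2 1 0 0)"
      using st[OF rl(2), of 5 "Const 1"] by simp
    have s3: "runs_le inp (Store (Const 2) (epow (Mem (Const 4)) c)) (regs 0 0 q L 0 0) (?s 2 (epow (Mem (Const 4)) c) * W) (regs K 0 q L 0 0)"
      using st[OF rl(3), of 2 "epow (Mem (Const 4)) c"] by (simp add: val_epow K_def)
    have s4: "runs_le inp (Store (Const 7) (Mem (Const 2))) (regs K 0 q L 0 0) (?s 7 (Mem (Const 2)) * W) (regs K 0 q L 0 K)"
      using st[OF rl(4), of 7 "Mem (Const 2)"] by simp
    have s5: "runs_le inp (Store (Const 6) (Const 1)) (regs K 0 q L 0 K) (?s 6 (Const 1) * W) (regs K 0 q L 1 K)"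
      using st[OF rl(5), of 6 "Const 1"] by simp
    have s6: "runs_le inp (Store (Const 3) (Add (Mul (Mem (Const 6)) (Mem (Const 6))) (Const 1))) (regs K 0 q L B 0)
        (?s 3 (Add (Mul (Mem (Const 6)) (Mem (Const 6))) (Const 1)) * W) (regs K M q L B 0)"
      using st[OF rl(6), of 3 "Add (Mul (Mem (Const 6)) (Mem (Const 6))) (Const 1)"] by (simp add: M_def power2_eq_square)
    have lp: "runs_le inp p s (C * W * (K + 1)) s'" if "runs_le inp p s (Suc i * (a * W + b * W + 1)) s'" "i \<le> K" "C = a + b + 1" for p s s' i a b C
    proof (rule runs_le_mono[OF that(1)])
      have "a * W + b * W + 1 \<le> C * W" using W1 unfolding that(3) add_mult_distrib by linarith
      then have "Suc i * (a * W + b * W + 1) \<le> (K + 1) * (C * W)" using that(2) by (intro mult_le_mono) auto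
      then show "Suc i * (a * W + b * W + 1) \<le> C * W * (K + 1)" by (simp only: ac_simps)
    qed
    have up: "runs_le inp p s (C * W * (K + 1)) s'" if "runs_le inp p s (C * W) s'" for p s s' C
      by (rule runs_le_mono[OF that]) simp
    have hK: "h \<le> K" "m \<le> K" using Lq qq qK unfolding L_def by linarith+
    have "runs_le inp (prelude c) (\<lambda>_. 0) (D * W * (K + 1)) (regs K M q L B 0)"
      using runs_le_Seq[OF up[OF s1] runs_le_Seq[OF up[OF s2] runs_le_Seq[OF lp[OF lp1 hK(1) refl] runs_le_Seq[OF lp[OF lp2 hK(2) refl]
        runs_le_Seq[OF up[OF s3] runs_le_Seq[OF up[OF s4] runs_le_Seq[OF up[OF s5] runs_le_Seq[OF lp[OF lp3 order_refl refl] up[OF s6]]]]]]]]]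
      unfolding prelude_def D_def by (rule runs_le_mono) (simp only: add_mult_distrib add.assoc order_refl)
    then obtain t where t: "t \<le> D * W * (K + 1)" "runs inp (prelude c) (\<lambda>_. 0) t (regs K M q L B 0)"
      unfolding runs_le_def by blast
    have rep: "represents (params K q L B) (regs K M q L B 0) (\<lambda>_ _. 0)"
      unfolding represents_def
    proof (intro conjI allI impI)
      fix i :: nat assume "i < 6"
      then have "i \<in> {0, 1, 2, 3, 4, 5}" by auto
      then show "regs K M q L B 0 (2 + i) = params K q L B i" by (auto simp: params_def regs_def M_def)
    qed (simp add: regs_def)
    have bs: "bounded_state inp (params K q L B) W (regs K M q L B 0)"
      unfolding bounded_state_def pM using regs_le[of K M M q L B 0] qM inpM MW KB BM by auto
    show "\<exists>L q t s. q = 2 ^ L \<and> 1 \<le> L \<and> n \<le> q \<and> 1 \<le> \<epsilon> * real q \<and> \<epsilon> * real q \<le> 2 * real n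
      \<and> runs (encode_input n E k \<epsilon>) (prelude c) (\<lambda>_. 0) t s \<and> t \<le> D * (2 * q ^ c + 2) * (q ^ c + 1)
      \<and> represents (params (q ^ c) q L (2 ^ q ^ c)) s (\<lambda>_ _. 0)
      \<and> bounded_state (encode_input n E k \<epsilon>) (params (q ^ c) q L (2 ^ q ^ c)) (2 * q ^ c + 2) s"
      using t rep bs nq \<epsilon>q q\<epsilon> unfolding K_def[symmetric] B_def inp_def W_def
      by (intro exI[of _ L] exI[of _ q] exI[of _ t] exI[of _ "regs K M q L B 0"])
        (auto simp: q_def L_def K_def B_def)
  qed
qed

section \<open>Exact evaluation of the path tree\<close>

text \<open>\<open>accum\<close> adds the fractions \<open>fst (f j) / snd (f j)\<close> to the fraction \<open>snd a / fst a\<close> without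
  division; note that the components are swapped.\<close>

primrec accum :: "complex \<times> complex \<Rightarrow> (nat \<Rightarrow> bool) \<Rightarrow> (nat \<Rightarrow> complex \<times> complex) \<Rightarrow> nat \<Rightarrow> complex \<times> complex" where
  "accum a g f 0 = a"
| "accum a g f (Suc u) = (let b = accum a g f u in
     if g u then (fst b * snd (f u), snd b * snd (f u) + fst (f u) * fst b) else b)"

lemma fst_accum: "fst (accum a g f m) = fst a * (\<Prod>u\<in>{u. u < m \<and> g u}. snd (f u))"
proof (induction m)
  case (Suc m)
  have "{u. u < Suc m \<and> g u} = (if g m then insert m {u. u < m \<and> g u} else {u. u < m \<and> g u})"
    by (auto simp: less_Suc_eq)
  then show ?case using Suc by (simp add: Let_def ac_simps)
qed simp

lemma snd_accum:
  assumes "fst a \<noteq> 0" "\<And>u. u < m \<Longrightarrow> g u \<Longrightarrow> snd (f u) \<noteq> 0"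
  shows "snd (accum a g f m) = fst (accum a g f m) * (snd a / fst a + (\<Sum>u\<in>{u. u < m \<and> g u}. fst (f u) / snd (f u)))"
  using assms(2)
proof (induction m)
  case (Suc m)
  have "{u. u < Suc m \<and> g u} = (if g m then insert m {u. u < m \<and> g u} else {u. u < m \<and> g u})"
    by (auto simp: less_Suc_eq)
  then show ?case using Suc by (auto simp: Let_def field_simps)
qed (use assms(1) in simp)

lemma accum_cong:
  "(\<And>u. u < m \<Longrightarrow> g u \<Longrightarrow> f u = f' u) \<Longrightarrow> accum a g f m = accum a g f' m"
  by (induction m) (auto simp: Let_def)

definition cnj2 :: "complex \<times> complex \<Rightarrow> complex \<times> complex" where
  "cnj2 a = (cnj (fst a), cnj (snd a))"

lemma accum_cnj2: "accum (cnj2 a) g (\<lambda>u. cnj2 (f u)) m = cnj2 (accum a g f m)"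
  by (induction m) (auto simp: Let_def cnj2_def)

lemma accum_bound:
  assumes "cmod (fst a) \<le> b" "cmod (snd a) \<le> b" "h \<ge> 1"
    and "\<And>u. u < m \<Longrightarrow> g u \<Longrightarrow> cmod (fst (f u)) \<le> h" "\<And>u. u < m \<Longrightarrow> g u \<Longrightarrow> cmod (snd (f u)) \<le> h"
  shows "cmod (fst (accum a g f m)) \<le> b * (2 * h) ^ m \<and> cmod (snd (accum a g f m)) \<le> b * (2 * h) ^ m"
  using assms(4,5)
proof (induction m)
  case 0
  then show ?case using assms by simp
next
  case (Suc m)
  let ?c = "b * (2 * h) ^ m"
  have IH: "cmod (fst (accum a g f m)) \<le> ?c" "cmod (snd (accum a g f m)) \<le> ?c" using Suc by auto
  have c0: "?c \<ge> 0" using IH(1) norm_ge_zero order_trans by blast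
  have c1: "?c * (2 * h) = b * (2 * h) ^ Suc m" by simp
  have c2: "?c \<le> ?c * (2 * h)" using mult_left_mono[of 1 "2 * h" ?c] c0 assms(3) by simp
  show ?case
  proof (cases "g m")
    case True
    have f: "cmod (fst (f m)) \<le> h" "cmod (snd (f m)) \<le> h" using Suc.prems True by auto
    have "cmod (fst (accum a g f m) * snd (f m)) \<le> ?c * h"
      unfolding norm_mult using IH f c0 by (intro mult_mono) auto
    moreover have "cmod (snd (accum a g f m) * snd (f m)) \<le> ?c * h"
      unfolding norm_mult using IH f c0 by (intro mult_mono) auto
    moreover have "cmod (fst (f m) * fst (accum a g f m)) \<le> h * ?c"
      unfolding norm_mult using IH f c0 assms(3) by (intro mult_mono) auto
    moreover have "?c * h \<ge> 0" using c0 assms(3) by simp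
    moreover have "?c * (2 * h) = ?c * h + ?c * h" "h * ?c = ?c * h" by simp_all
    ultimately have "cmod (fst (accum a g f m) * snd (f m)) \<le> ?c * (2 * h)"
      "cmod (snd (accum a g f m) * snd (f m) + fst (f m) * fst (accum a g f m)) \<le> ?c * (2 * h)"
      using norm_triangle_ineq[of "snd (accum a g f m) * snd (f m)" "fst (f m) * fst (accum a g f m)"]
      by linarith+
    then show ?thesis using True unfolding c1 by (simp add: Let_def)
  next
    case False
    then show ?thesis using IH c2 unfolding c1 by (simp add: Let_def)
  qed
qed

text \<open>The exponent counts only the active indices. In the tree these are at most \<Delta>
  children; with the exponent \<open>m\<close> of \<open>accum_bound\<close>, that is
  \<open>n\<close>, the bit length would grow by a factor \<open>n\<close> per level, which is
  superpolynomial at logarithmic depth.\<close>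

lemma accum_bound_card:
  fixes b :: real
  assumes "b \<ge> 1" and "\<And>u. u < m \<Longrightarrow> g u \<Longrightarrow> cmod (fst (f u)) \<le> b" "\<And>u. u < m \<Longrightarrow> g u \<Longrightarrow> cmod (snd (f u)) \<le> b"
  shows "cmod (fst (accum (1, 0) g f m)) \<le> b ^ card {u. u < m \<and> g u}
    \<and> cmod (snd (accum (1, 0) g f m)) \<le> card {u. u < m \<and> g u} * b ^ card {u. u < m \<and> g u}"
  using assms(2,3)
proof (induction m)
  case 0
  then show ?case by simp
next
  case (Suc m)
  let ?c = "card {u. u < m \<and> g u}"
  have IH: "cmod (fst (accum (1, 0) g f m)) \<le> b ^ ?c" "cmod (snd (accum (1, 0) g f m)) \<le> ?c * b ^ ?c" using Suc by auto
  have eq: "{u. u < Suc m \<and> g u} = (if g m then insert m {u. u < m \<and> g u} else {u. u < m \<and> g u})"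
    by (auto simp: less_Suc_eq)
  show ?case
  proof (cases "g m")
    case True
    have c: "card {u. u < Suc m \<and> g u} = Suc ?c" using eq True by simp
    have f: "cmod (fst (f m)) \<le> b" "cmod (snd (f m)) \<le> b" using Suc.prems True by auto
    have 1: "cmod (fst (accum (1, 0) g f m) * snd (f m)) \<le> b ^ ?c * b"
      unfolding norm_mult using IH f assms(1) by (intro mult_mono) auto
    have "cmod (snd (accum (1, 0) g f m) * snd (f m)) \<le> (?c * b ^ ?c) * b"
      unfolding norm_mult using IH f assms(1) by (intro mult_mono) auto
    moreover have "cmod (fst (f m) * fst (accum (1, 0) g f m)) \<le> b * b ^ ?c"
      unfolding norm_mult using IH f assms(1) by (intro mult_mono) auto
    ultimately have "cmod (snd (accum (1, 0) g f m) * snd (f m) + fst (f m) * fst (accum (1, 0) g f m)) \<le> (?c * b ^ ?c) * b + b * b ^ ?c"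
      using norm_triangle_ineq order_trans add_mono by meson
    also have "\<dots> = Suc ?c * b ^ Suc ?c" by (simp add: algebra_simps)
    finally show ?thesis using True 1 unfolding c by (simp add: Let_def mult.commute)
  next
    case False
    then show ?thesis using IH eq by (simp add: Let_def)
  qed
qed

text \<open>If \<open>snd a / fst a\<close> is the sum of the children's ratios and
  \<open>x / y\<close> the point, this is the fraction \<open>1 / (1 + (x / y) * sum)\<close> as
  numerator and denominator, cleared of divisions.\<close>

definition node :: "complex \<Rightarrow> complex \<Rightarrow> complex \<times> complex \<Rightarrow> complex \<times> complex" where
  "node x y a = (y * fst a, y * fst a + x * snd a)"

section \<open>Division-free evaluation of the path tree\<close>

context fin_graph
begin

primrec tree :: "complex \<Rightarrow> complex \<Rightarrow> nat \<Rightarrow> nat set \<Rightarrow> nat \<Rightarrow> complex \<times> complex" where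
  "tree x y 0 S v = node x y (1, 0)"
| "tree x y (Suc d) S v = node x y (accum (1, 0) (\<lambda>u. {v, u} \<in> E \<and> u \<notin> insert v S) (tree x y d (insert v S)) n)"

lemma nbrs_eq: "{u. u < n \<and> {v, u} \<in> E \<and> u \<notin> insert v S} = nbrs S v"
  using edge_lt by (auto simp: nbrs_def)

lemma tree_ratio:
  assumes nz: "\<And>d S v. Rt (x / y) d S v \<noteq> 0" and y: "y \<noteq> 0"
  shows "fst (tree x y d S v) \<noteq> 0 \<and> snd (tree x y d S v) \<noteq> 0
    \<and> fst (tree x y d S v) / snd (tree x y d S v) = Rt (x / y) d S v"
proof (induction d arbitrary: S v)
  case 0
  then show ?case using y by (simp add: node_def)
next
  case (Suc d)
  let ?g = "\<lambda>u. {v, u} \<in> E \<and> u \<notin> insert v S"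
  define a where "a = accum (1, 0) ?g (tree x y d (insert v S)) n"
  have a1: "fst a = (\<Prod>u\<in>nbrs S v. snd (tree x y d (insert v S) u))"
    unfolding a_def fst_accum nbrs_eq by simp
  then have a0: "fst a \<noteq> 0" using Suc by simp
  have a2: "snd a = fst a * (\<Sum>u\<in>nbrs S v. Rt (x / y) d (insert v S) u)"
    unfolding a_def by (subst snd_accum) (use Suc in \<open>auto simp: nbrs_eq[unfolded insert_iff de_Morgan_disj]\<close>)
  define s where "s = 1 + x / y * (\<Sum>u\<in>nbrs S v. Rt (x / y) d (insert v S) u)"
  have s0: "s \<noteq> 0" using nz[of "Suc d" S v] by (simp add: s_def)
  have f: "fst (tree x y (Suc d) S v) = y * fst a" by (simp add: node_def a_def)
  have "snd (tree x y (Suc d) S v) = y * fst a + x * snd a" by (simp add: node_def a_def)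
  also have "\<dots> = y * fst a * s" using y by (simp add: a2 s_def algebra_simps)
  finally have g: "snd (tree x y (Suc d) S v) = y * fst a * s" .
  show ?case unfolding f g using a0 y s0 by (simp add: s_def inverse_eq_divide)
qed

lemma tree_cnj2: "tree (cnj x) (cnj y) d S v = cnj2 (tree x y d S v)"
proof (induction d arbitrary: S v)
  case 0
  show ?case by (simp add: node_def cnj2_def)
next
  case (Suc d)
  have "tree (cnj x) (cnj y) d (insert v S) = (\<lambda>u. cnj2 (tree x y d (insert v S) u))"
    by (rule ext) (rule Suc)
  moreover have "(1, 0) = cnj2 (1, 0)" by (simp add: cnj2_def)
  ultimately have "accum (1, 0) g (tree (cnj x) (cnj y) d (insert v S)) n = cnj2 (accum (1, 0) g (tree x y d (insert v S)) n)" for g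
    using accum_cnj2[of "(1, 0)" g "tree x y d (insert v S)" n] by (simp only:)
  then show ?case by (simp add: node_def cnj2_def)
qed

text \<open>On the positive axis all operations are additions and products of positive reals. This
  is why the fractions for \<open>Zt\<close> at a real activity have positive parts, so that the
  final fractions have positive denominators.\<close>

lemma tree_pos:
  assumes "a \<ge> 0" "b > 0"
  shows "\<exists>p>0. \<exists>r>0. tree (of_real a) (of_real b) d S v = (of_real p, of_real r)"
proof (induction d arbitrary: S v)
  case 0
  show ?case using assms by (intro exI[of _ b]) (simp add: node_def)
next
  case (Suc d)
  have "\<exists>p>0. \<exists>r\<ge>0. accum (1, 0) g (tree (of_real a) (of_real b) d T) m = (of_real p, of_real r)" for g T m
  proof (induction m)
    case 0
    show ?case by (intro exI[of _ 1] exI[of _ 0] conjI) auto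
  next
    case (Suc m)
    then obtain p r where pr: "p > 0" "r \<ge> 0" "accum (1, 0) g (tree (of_real a) (of_real b) d T) m = (of_real p, of_real r)" by blast
    obtain p' r' where pr': "p' > 0" "r' > 0" "tree (of_real a) (of_real b) d T m = (of_real p', of_real r')"
      using \<open>\<And>v S. \<exists>p>0. \<exists>r>0. tree (of_real a) (of_real b) d S v = (of_real p, of_real r)\<close> by blast
    show ?case
    proof (cases "g m")
      case True
      then show ?thesis using pr pr' by (intro exI[of _ "p * r'"] exI[of _ "r * r' + p' * p"] conjI) auto
    next
      case False
      then show ?thesis using pr by auto
    qed
  qed
  then obtain p r where pr: "p > 0" "r \<ge> 0"
    "accum (1, 0) (\<lambda>u. {v, u} \<in> E \<and> u \<notin> insert v S) (tree (of_real a) (of_real b) d (insert v S)) n = (of_real p, of_real r)" by blast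
  show ?case unfolding tree.simps pr using pr(1,2) assms
    by (intro exI[of _ "b * p"] exI[of _ "b * p + a * r"] conjI) (auto simp: node_def intro!: add_pos_nonneg)
qed

text \<open>One level multiplies at most \<Delta> children and one further factor \<open>Y\<close>,
  and \<open>1 + \<Delta> * (\<Delta> + 1)^d \<le> (\<Delta> + 1)^(d + 1)\<close>. For depth
  \<open>O(log q)\<close> the exponent is polynomial in \<open>q\<close>.\<close>

lemma tree_bound:
  assumes deg: "\<And>v. v < n \<Longrightarrow> degree E v \<le> \<Delta>" and Y: "cmod y + cmod x * \<Delta> \<le> Y" "Y \<ge> 1"
  shows "cmod (fst (tree x y d S v)) \<le> Y ^ ((\<Delta> + 1) ^ d) \<and> cmod (snd (tree x y d S v)) \<le> Y ^ ((\<Delta> + 1) ^ d)"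
proof (induction d arbitrary: S v)
  case 0
  have "cmod y \<le> Y" using Y by (smt (verit) mult_nonneg_nonneg norm_ge_zero of_nat_0_le_iff)
  then show ?case by (simp add: node_def)
next
  case (Suc d)
  let ?g = "\<lambda>u. {v, u} \<in> E \<and> u \<notin> insert v S"
  define b where "b = Y ^ ((\<Delta> + 1) ^ d)"
  define a where "a = accum (1, 0) ?g (tree x y d (insert v S)) n"
  have b1: "b \<ge> 1" using Y by (simp add: b_def)
  have c: "card (nbrs S v) \<le> \<Delta>"
  proof (cases "v < n")
    case False
    then have "nbrs S v = {}" using edge_lt by (auto simp: nbrs_def)
    then show ?thesis by simp
  qed (meson card_nbrs deg order_trans)
  have "cmod (fst a) \<le> b ^ card (nbrs S v) \<and> cmod (snd a) \<le> card (nbrs S v) * b ^ card (nbrs S v)"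
    unfolding a_def nbrs_eq[symmetric]
    by (rule accum_bound_card[OF b1]) (use Suc in \<open>auto simp: b_def\<close>)
  moreover have "b ^ card (nbrs S v) \<le> b ^ \<Delta>" using b1 c by (intro power_increasing) auto
  moreover have "card (nbrs S v) * b ^ card (nbrs S v) \<le> \<Delta> * b ^ \<Delta>"
    using b1 c calculation(2) by (intro mult_mono) auto
  ultimately have a: "cmod (fst a) \<le> b ^ \<Delta>" "cmod (snd a) \<le> \<Delta> * b ^ \<Delta>" by linarith+
  have bp: "b ^ \<Delta> \<ge> 0" using b1 by simp
  have 1: "cmod (y * fst a) \<le> cmod y * b ^ \<Delta>" unfolding norm_mult using a by (intro mult_left_mono) auto
  have 2: "cmod (x * snd a) \<le> cmod x * (\<Delta> * b ^ \<Delta>)" unfolding norm_mult using a by (intro mult_left_mono) auto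
  have "cmod (y * fst a) + cmod (x * snd a) \<le> (cmod y + cmod x * \<Delta>) * b ^ \<Delta>" using 1 2 by (simp add: algebra_simps)
  also have "\<dots> \<le> Y * b ^ \<Delta>" using Y bp by (intro mult_right_mono) auto
  also have "\<dots> = Y ^ (1 + (\<Delta> + 1) ^ d * \<Delta>)" by (simp add: b_def power_add power_mult)
  also have "\<dots> \<le> Y ^ ((\<Delta> + 1) ^ Suc d)" using Y by (intro power_increasing) (auto simp: algebra_simps)
  finally have *: "cmod (y * fst a) + cmod (x * snd a) \<le> Y ^ ((\<Delta> + 1) ^ Suc d)" .
  have "tree x y (Suc d) S v = (y * fst a, y * fst a + x * snd a)" by (simp add: node_def a_def)
  then show ?case using * norm_triangle_ineq[of "y * fst a" "x * snd a"] norm_ge_zero[of "x * snd a"]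
    unfolding fst_conv snd_conv by (metis (no_types, lifting) fst_conv snd_conv le_add_same_cancel1 order_trans)
qed

definition forest :: "complex \<Rightarrow> complex \<Rightarrow> nat \<Rightarrow> complex \<times> complex" where
  "forest x y d = (\<Prod>r<n. fst (tree x y d {..<r} r), \<Prod>r<n. snd (tree x y d {..<r} r))"

lemma forest_ratio:
  assumes nz: "\<And>d S v. Rt (x / y) d S v \<noteq> 0" and y: "y \<noteq> 0"
  shows "fst (forest x y d) \<noteq> 0" "snd (forest x y d) \<noteq> 0" "snd (forest x y d) / fst (forest x y d) = Zt d (x / y)"
proof -
  note * = tree_ratio[OF nz y]
  show "fst (forest x y d) \<noteq> 0" "snd (forest x y d) \<noteq> 0" using * by (auto simp: forest_def)
  show "snd (forest x y d) / fst (forest x y d) = Zt d (x / y)"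
    unfolding Zt_def forest_def fst_conv snd_conv prod_dividef[symmetric]
    by (rule prod.cong[OF refl]) (metis * inverse_divide)
qed

lemma forest_cnj2: "forest (cnj x) (cnj y) d = cnj2 (forest x y d)"
  by (simp add: forest_def tree_cnj2) (simp add: cnj2_def)

lemma forest_pos:
  assumes "a \<ge> 0" "b > 0"
  shows "\<exists>p>0. \<exists>r>0. forest (of_real a) (of_real b) d = (of_real p, of_real r)"
proof -
  have "\<exists>p>0. \<exists>r>0. (\<Prod>r<m. fst (tree (of_real a) (of_real b) d {..<r} r)) = complex_of_real p
     \<and> (\<Prod>r<m. snd (tree (of_real a) (of_real b) d {..<r} r)) = of_real r" for m
  proof (induction m)
    case 0
    show ?case by (intro exI[of _ 1] conjI) auto
  next
    case (Suc m)
    then obtain p r where 1: "p > 0" "r > 0" "(\<Prod>r<m. fst (tree (of_real a) (of_real b) d {..<r} r)) = complex_of_real p"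
     "(\<Prod>r<m. snd (tree (of_real a) (of_real b) d {..<r} r)) = complex_of_real r" by blast
    obtain p' r' where 2: "p' > 0" "r' > 0" "tree (of_real a) (of_real b) d {..<m} m = (of_real p', of_real r')"
      using tree_pos[OF assms] by blast
    show ?case using 1 2 by (intro exI[of _ "p * p'"] conjI exI[of _ "r * r'"]) auto
  qed
  then show ?thesis unfolding forest_def by blast
qed

lemma forest_bound:
  assumes deg: "\<And>v. v < n \<Longrightarrow> degree E v \<le> \<Delta>" and Y: "cmod y + cmod x * \<Delta> \<le> Y" "Y \<ge> 1"
  shows "cmod (fst (forest x y d)) \<le> Y ^ ((\<Delta> + 1) ^ d * n) \<and> cmod (snd (forest x y d)) \<le> Y ^ ((\<Delta> + 1) ^ d * n)"
proof -
  have "(\<Prod>r<n. cmod (fst (tree x y d {..<r} r))) \<le> (\<Prod>r<n. Y ^ ((\<Delta> + 1) ^ d))"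
    "(\<Prod>r<n. cmod (snd (tree x y d {..<r} r))) \<le> (\<Prod>r<n. Y ^ ((\<Delta> + 1) ^ d))"
    by (intro prod_mono conjI norm_ge_zero; use tree_bound[OF deg Y] in blast)+
  then show ?thesis by (simp add: forest_def prod_norm[symmetric] power_mult)
qed

text \<open>The point with activity index \<open>i\<close> and angle \<open>j\<close> is written as
  \<open>x / y\<close> with Gaussian integers; \<open>I\<close> is \<open>\<i>\<close> or its
  negative. As \<open>Z\<close> is the product of inverse ratios, the numerator of the term comes
  from \<open>snd\<close> of the forest. The remaining factors are
  \<open>cnj (zeta (q\<^sup>2)) ^ (j * k)\<close> when \<open>I = \<i>\<close>, and its conjugate
  otherwise.\<close>

definition arc_term :: "nat \<Rightarrow> nat \<Rightarrow> nat \<Rightarrow> nat \<Rightarrow> nat \<Rightarrow> complex \<Rightarrow> nat \<Rightarrow> complex \<times> complex" where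
  "arc_term \<Delta> q d k i I j = (let f = forest (of_nat i * ((of_nat (q\<^sup>2) + I)\<^sup>2) ^ j) (of_nat (8 * \<Delta> * q ^ 5) * of_nat ((q\<^sup>2)\<^sup>2 + 1) ^ j) d
     in (snd f * ((of_nat (q\<^sup>2) - I)\<^sup>2 ^ k) ^ j, fst f * (of_nat ((q\<^sup>2)\<^sup>2 + 1) ^ k) ^ j))"

text \<open>The second pass continues from the first and adds the conjugates of its terms. So the
  fraction is twice the real part of the sum and its denominator is the squared modulus of the first
  denominator: a real part is taken with ring operations only.\<close>

definition arc_sum :: "nat \<Rightarrow> nat \<Rightarrow> nat \<Rightarrow> nat \<Rightarrow> nat \<Rightarrow> nat \<Rightarrow> complex \<times> complex" where
  "arc_sum \<Delta> q d J k i = accum (accum (1, 0) (\<lambda>j. j \<in> arc q i) (arc_term \<Delta> q d k i \<i>) J) (\<lambda>j. j \<in> arc q i) (arc_term \<Delta> q d k i (-\<i>)) J"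

definition real_forest :: "nat \<Rightarrow> nat \<Rightarrow> nat \<Rightarrow> nat \<Rightarrow> complex \<times> complex" where
  "real_forest \<Delta> q d i = forest (of_nat i) (of_nat (8 * \<Delta> * q ^ 5)) d"

definition num_sum :: "nat \<Rightarrow> nat \<Rightarrow> nat \<Rightarrow> nat \<Rightarrow> nat \<Rightarrow> nat \<Rightarrow> complex \<times> complex" where
  "num_sum \<Delta> q d J k = accum (1, 0) (\<lambda>_. True) (\<lambda>i.
     (fst (real_forest \<Delta> q d (Suc i)) * snd (arc_sum \<Delta> q d J k (Suc i)), snd (real_forest \<Delta> q d (Suc i)) * fst (arc_sum \<Delta> q d J k (Suc i))))"

definition den_sum :: "nat \<Rightarrow> nat \<Rightarrow> nat \<Rightarrow> nat \<Rightarrow> nat \<Rightarrow> complex \<times> complex" where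
  "den_sum \<Delta> q d k = accum (1, 0) (\<lambda>_. True) (\<lambda>i.
     (of_nat (Suc i) ^ k * fst (real_forest \<Delta> q d (Suc i)), of_nat (8 * \<Delta> * q ^ 5) ^ k * snd (real_forest \<Delta> q d (Suc i))))"

text \<open>In \<open>num_sum\<close> and \<open>den_sum\<close> the numerator is the second
  component. \<open>num_sum\<close> omits the division by \<open>J\<close> and carries the factor 2
  of \<open>arc_sum\<close>, which is repaired by \<open>2 * J\<close> in the denominator of the
  output. That \<open>a\<close> and \<open>b\<close> are positive reals is what permits decoding
  them from residues.\<close>

lemma output_ratio:
  assumes \<Delta>: "\<Delta> \<ge> 1" and q: "q \<ge> 1" and J: "J \<ge> 1"
    and nz: "\<And>i j d S v. i \<in> {1..g} \<Longrightarrow> j \<in> arc q i \<Longrightarrow> Rt (of_real (activity \<Delta> q i) * zeta (q\<^sup>2) ^ j) d S v \<noteq> 0"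
    and pos: "(\<Sum>i\<in>{1..g}. est_num \<Delta> q d J k i) > 0" "(\<Sum>i\<in>{1..g}. est_den \<Delta> q d k i) > 0"
  obtains a b :: real where "snd (num_sum \<Delta> q d J k g) * fst (den_sum \<Delta> q d k g) = of_real a" "a > 0"
    "of_nat (2 * J) * snd (den_sum \<Delta> q d k g) * fst (num_sum \<Delta> q d J k g) = of_real b" "b > 0"
    "a / b = (\<Sum>i\<in>{1..g}. est_num \<Delta> q d J k i) / (\<Sum>i\<in>{1..g}. est_den \<Delta> q d k i)"
proof -
  let ?c = "\<lambda>I. (of_nat (q\<^sup>2) + I)\<^sup>2 :: complex" and ?y = "of_nat (8 * \<Delta> * q ^ 5) :: complex" and ?w = "of_nat ((q\<^sup>2)\<^sup>2 + 1) :: complex"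
  have w0: "?w \<noteq> 0" by (metis Suc_eq_plus1 nat.simps(3) of_nat_eq_0_iff)
  have y0: "?y \<noteq> 0" using \<Delta> q by simp
  have z1: "of_nat i * ?c \<i> ^ j / (?y * ?w ^ j) = of_real (activity \<Delta> q i) * zeta (q\<^sup>2) ^ j" for i j
    by (simp add: activity_def zeta_def power_divide)
  have z0: "of_nat i / ?y = of_real (activity \<Delta> q i) * zeta (q\<^sup>2) ^ 0" for i
    by (simp add: activity_def)
  have arc0: "0 \<in> arc q i" for i by (simp add: arc_def)
  have cz: "(of_nat (q\<^sup>2) - \<i>)\<^sup>2 / ?w = cnj (zeta (q\<^sup>2))" by (simp add: zeta_def)
  have cnj_term: "arc_term \<Delta> q d k i (-\<i>) j = cnj2 (arc_term \<Delta> q d k i \<i> j)" for i j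
  proof -
    have "forest (of_nat i * ?c (-\<i>) ^ j) (?y * ?w ^ j) d = forest (cnj (of_nat i * ?c \<i> ^ j)) (cnj (?y * ?w ^ j)) d"
      by simp
    also have "\<dots> = cnj2 (forest (of_nat i * ?c \<i> ^ j) (?y * ?w ^ j) d)" by (rule forest_cnj2)
    finally show ?thesis by (simp add: arc_term_def Let_def cnj2_def)
  qed
  define S where "S i = (\<Sum>j\<in>{..<J} \<inter> arc q i. Zt d (of_real (activity \<Delta> q i) * zeta (q\<^sup>2) ^ j) * cnj (zeta (q\<^sup>2)) ^ (j * k))" for i
  have set_eq: "{j. j < J \<and> j \<in> A} = {..<J} \<inter> A" for A by auto
  have tnz: "snd (arc_term \<Delta> q d k i \<i> j) \<noteq> 0"
    and tr: "fst (arc_term \<Delta> q d k i \<i> j) / snd (arc_term \<Delta> q d k i \<i> j) = Zt d (of_real (activity \<Delta> q i) * zeta (q\<^sup>2) ^ j) * cnj (zeta (q\<^sup>2)) ^ (j * k)"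
    if i: "i \<in> {1..g}" and j: "j \<in> arc q i" for i j
  proof -
    define f where "f = forest (of_nat i * ?c \<i> ^ j) (?y * ?w ^ j) d"
    have yw: "?y * ?w ^ j \<noteq> 0" using y0 w0 by simp
    have nz': "Rt (of_nat i * ?c \<i> ^ j / (?y * ?w ^ j)) d S v \<noteq> 0" for d S v
      unfolding z1 by (rule nz[OF i j])
    note fr = forest_ratio[OF nz' yw, where d = d, folded f_def, unfolded z1]
    have t: "arc_term \<Delta> q d k i \<i> j = (snd f * ((of_nat (q\<^sup>2) - \<i>)\<^sup>2 ^ k) ^ j, fst f * (?w ^ k) ^ j)"
      by (simp add: arc_term_def f_def Let_def)
    show "snd (arc_term \<Delta> q d k i \<i> j) \<noteq> 0" using fr w0 unfolding t by simp
    have pw: "snd f * (u ^ k) ^ j / (fst f * (W ^ k) ^ j) = snd f / fst f * (u / W) ^ (j * k)" for u W :: complex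
      by (simp add: power_divide power_mult[symmetric] mult.commute)
    show "fst (arc_term \<Delta> q d k i \<i> j) / snd (arc_term \<Delta> q d k i \<i> j) = Zt d (of_real (activity \<Delta> q i) * zeta (q\<^sup>2) ^ j) * cnj (zeta (q\<^sup>2)) ^ (j * k)"
      unfolding t fst_conv snd_conv pw fr(3) cz ..
  qed
  have arcs: "\<exists>D>0. fst (arc_sum \<Delta> q d J k i) = of_real D \<and> snd (arc_sum \<Delta> q d J k i) = of_real D * of_real (2 * Re (S i))"
    if i: "i \<in> {1..g}" for i
  proof -
    let ?t = "arc_term \<Delta> q d k i \<i>"
    define A where "A = accum (1, 0) (\<lambda>j. j \<in> arc q i) ?t J"
    define D where "D = (\<Prod>j\<in>{..<J} \<inter> arc q i. snd (?t j))"
    have A1: "fst A = D" unfolding A_def fst_accum set_eq D_def by simp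
    have D0: "D \<noteq> 0" using tnz[OF i] by (simp add: D_def)
    have A2: "snd A = D * S i" unfolding A_def
      by (subst snd_accum) (use tnz[OF i] tr[OF i] A1 in \<open>auto simp: A_def set_eq S_def\<close>)
    have as: "arc_sum \<Delta> q d J k i = accum A (\<lambda>j. j \<in> arc q i) (\<lambda>j. cnj2 (?t j)) J"
      unfolding arc_sum_def A_def by (rule accum_cong) (rule cnj_term)
    have "fst (arc_sum \<Delta> q d J k i) = D * cnj D" unfolding as fst_accum set_eq A1 by (simp add: D_def cnj2_def)
    then have F: "fst (arc_sum \<Delta> q d J k i) = of_real ((cmod D)\<^sup>2)" by (simp only: complex_norm_square)
    have "snd (arc_sum \<Delta> q d J k i) = fst (arc_sum \<Delta> q d J k i) * (S i + cnj (S i))"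
      unfolding as by (subst snd_accum) (use tnz[OF i] tr[OF i, symmetric] A1 A2 D0 in \<open>auto simp: cnj2_def set_eq S_def\<close>)
    then have "snd (arc_sum \<Delta> q d J k i) = of_real ((cmod D)\<^sup>2) * of_real (2 * Re (S i))"
      unfolding F complex_add_cnj .
    then show ?thesis using F D0 by (intro exI[of _ "(cmod D)\<^sup>2"]) auto
  qed
  have rf: "\<exists>p>0. \<exists>r>0. real_forest \<Delta> q d i = (of_real p, of_real r) \<and> Re (Zt d (of_real (activity \<Delta> q i))) = r / p"
    if i: "i \<in> {1..g}" for i
  proof -
    have "real (8 * \<Delta> * q ^ 5) > 0" using \<Delta> q by simp
    then obtain p r where pr: "p > 0" "r > 0" "real_forest \<Delta> q d i = (of_real p, of_real r)"
      using forest_pos[of "real i" "real (8 * \<Delta> * q ^ 5)" d] unfolding real_forest_def of_real_of_nat_eq by auto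
    have nz': "Rt (of_nat i / ?y) d S v \<noteq> 0" for d S v
      unfolding z0 by (rule nz[OF i arc0])
    have "Zt d (of_real (activity \<Delta> q i)) = of_real r / of_real p"
      using forest_ratio(3)[OF nz' y0, of d] pr(3) unfolding z0 real_forest_def by simp
    then show ?thesis using pr by (intro exI[of _ p] conjI exI[of _ r]) (auto simp: Re_divide_of_real)
  qed
  let ?nt = "\<lambda>i. (fst (real_forest \<Delta> q d i) * snd (arc_sum \<Delta> q d J k i), snd (real_forest \<Delta> q d i) * fst (arc_sum \<Delta> q d J k i))"
  let ?dt = "\<lambda>i. (of_nat i ^ k * fst (real_forest \<Delta> q d i), ?y ^ k * snd (real_forest \<Delta> q d i))"
  have nt: "snd (?nt i) = of_real (Re (snd (?nt i))) \<and> Re (snd (?nt i)) > 0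
      \<and> fst (?nt i) / snd (?nt i) = of_real (2 * J * est_num \<Delta> q d J k i)" if i: "i \<in> {1..g}" for i
  proof -
    obtain D where D: "D > 0" "fst (arc_sum \<Delta> q d J k i) = of_real D" "snd (arc_sum \<Delta> q d J k i) = of_real D * of_real (2 * Re (S i))"
      using arcs[OF i] by blast
    obtain p r where pr: "p > 0" "r > 0" "real_forest \<Delta> q d i = (of_real p, of_real r)" "Re (Zt d (of_real (activity \<Delta> q i))) = r / p"
      using rf[OF i] by blast
    have e: "est_num \<Delta> q d J k i = Re (S i) / (J * (r / p))" unfolding est_num_def S_def pr(4) ..
    have "fst (?nt i) / snd (?nt i) = of_real (p * (D * (2 * Re (S i))) / (r * D))" using D pr by simp
    also have "p * (D * (2 * Re (S i))) / (r * D) = 2 * J * est_num \<Delta> q d J k i"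
      unfolding e using D(1) pr(1,2) J by (simp add: field_simps)
    finally show ?thesis using D pr by simp
  qed
  have dt: "snd (?dt i) = of_real (Re (snd (?dt i))) \<and> Re (snd (?dt i)) > 0
      \<and> fst (?dt i) / snd (?dt i) = of_real (est_den \<Delta> q d k i)" if i: "i \<in> {1..g}" for i
  proof -
    obtain p r where pr: "p > 0" "r > 0" "real_forest \<Delta> q d i = (of_real p, of_real r)" "Re (Zt d (of_real (activity \<Delta> q i))) = r / p"
      using rf[OF i] by blast
    define Y where "Y = real (8 * \<Delta> * q ^ 5)"
    have Y: "Y > 0" "?y = of_real Y" using \<Delta> q by (simp_all add: Y_def)
    have e: "est_den \<Delta> q d k i = (real i / Y) ^ k / (r / p)" unfolding est_den_def pr(4) by (simp only: activity_def Y_def)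
    have d1: "?dt i = (of_real (real i ^ k * p), of_real (Y ^ k * r))" using pr Y by simp
    have d2: "real i ^ k * p / (Y ^ k * r) = est_den \<Delta> q d k i" unfolding e by (simp add: power_divide)
    have "Y ^ k * r > 0" using Y pr by simp
    then show ?thesis unfolding d1 fst_conv snd_conv Re_complex_of_real of_real_divide[symmetric] d2 by blast
  qed
  have Suc_in: "Suc i \<in> {1..g}" if "i < g" for i using that by simp
  have accum_real: "\<exists>N0>0. fst (accum (1, 0) (\<lambda>_. True) (\<lambda>i. F (Suc i)) g) = of_real N0
      \<and> snd (accum (1, 0) (\<lambda>_. True) (\<lambda>i. F (Suc i)) g) = of_real N0 * of_real (\<Sum>i\<in>{1..g}. e i)"
    if F: "\<And>i. i \<in> {1..g} \<Longrightarrow> snd (F i) = of_real (Re (snd (F i))) \<and> Re (snd (F i)) > 0 \<and> fst (F i) / snd (F i) = of_real (e i)"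
    for F :: "nat \<Rightarrow> complex \<times> complex" and e :: "nat \<Rightarrow> real"
  proof -
    define N0 where "N0 = (\<Prod>i<g. Re (snd (F (Suc i))))"
    have N0: "N0 > 0" unfolding N0_def using F[OF Suc_in] by (intro prod_pos) auto
    have s: "{u. u < g \<and> True} = {..<g}" by auto
    have "(\<Prod>i<g. snd (F (Suc i))) = (\<Prod>i<g. of_real (Re (snd (F (Suc i)))))"
      by (rule prod.cong[OF refl]) (use F[OF Suc_in] in auto)
    then have 1: "fst (accum (1, 0) (\<lambda>_. True) (\<lambda>i. F (Suc i)) g) = of_real N0" unfolding fst_accum s by (simp add: N0_def)
    have "(\<Sum>i<g. fst (F (Suc i)) / snd (F (Suc i))) = (\<Sum>i<g. of_real (e (Suc i)))"
      by (rule sum.cong[OF refl]) (use F[OF Suc_in] in auto)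
    also have "\<dots> = of_real (\<Sum>i\<in>{1..g}. e i)" by (simp add: sum.atLeast1_atMost_eq)
    finally have 2: "(\<Sum>i<g. fst (F (Suc i)) / snd (F (Suc i))) = of_real (\<Sum>i\<in>{1..g}. e i)" .
    have nz: "snd (F (Suc u)) \<noteq> 0" if "u < g" for u using F[OF Suc_in[OF that]] by (metis less_irrefl of_real_0 zero_complex.sel(1))
    have "snd (accum (1, 0) (\<lambda>_. True) (\<lambda>i. F (Suc i)) g) = of_real N0 * of_real (\<Sum>i\<in>{1..g}. e i)"
      by (subst snd_accum) (use nz 1 2 s in \<open>simp_all only: fst_conv snd_conv, simp_all\<close>)
    then show ?thesis using N0 1 by blast
  qed
  obtain N0 where N0: "N0 > 0" "fst (num_sum \<Delta> q d J k g) = of_real N0"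
      "snd (num_sum \<Delta> q d J k g) = of_real N0 * of_real (\<Sum>i\<in>{1..g}. 2 * J * est_num \<Delta> q d J k i)"
    using accum_real[of ?nt, OF nt] unfolding num_sum_def by blast
  obtain D0 where D0: "D0 > 0" "fst (den_sum \<Delta> q d k g) = of_real D0"
      "snd (den_sum \<Delta> q d k g) = of_real D0 * of_real (\<Sum>i\<in>{1..g}. est_den \<Delta> q d k i)"
    using accum_real[of ?dt, OF dt] unfolding den_sum_def by blast
  let ?N = "\<Sum>i\<in>{1..g}. est_num \<Delta> q d J k i" and ?D = "\<Sum>i\<in>{1..g}. est_den \<Delta> q d k i"
  have N: "(\<Sum>i\<in>{1..g}. 2 * J * est_num \<Delta> q d J k i) = 2 * J * ?N" by (simp add: sum_distrib_left)
  show ?thesis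
  proof (rule that[of "N0 * (2 * J * ?N) * D0" "2 * J * (D0 * ?D) * N0"])
    show "snd (num_sum \<Delta> q d J k g) * fst (den_sum \<Delta> q d k g) = of_real (N0 * (2 * J * ?N) * D0)"
      unfolding N0 D0 N by simp
    show "of_nat (2 * J) * snd (den_sum \<Delta> q d k g) * fst (num_sum \<Delta> q d J k g) = of_real (2 * J * (D0 * ?D) * N0)"
      unfolding N0 D0 by simp
    show "N0 * (2 * J * ?N) * D0 > 0" "2 * J * (D0 * ?D) * N0 > 0" using N0(1) D0(1) J pos by simp_all
    show "N0 * (2 * J * ?N) * D0 / (2 * J * (D0 * ?D) * N0) = ?N / ?D" using N0(1) D0(1) J pos(2) by simp
  qed
qed

end

section \<open>Gaussian integers in the machine and depth-first search\<close>

text \<open>Gaussian integers modulo \<open>B\<^sup>2 + 1\<close>, where \<open>B\<close> plays the role of \<open>\<i>\<close>.\<close>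

definition rep :: "nat \<Rightarrow> complex \<Rightarrow> nat \<Rightarrow> bool" where
  "rep B c m \<longleftrightarrow> (\<exists>a b. c = of_int a + \<i> * of_int b \<and> (int B ^ 2 + 1) dvd int m - (a + b * int B))"

lemma rep_add:
  assumes "rep B c m" "rep B c' m'"
  shows "rep B (c + c') (m + m')"
proof -
  obtain a b a' b' where *: "c = of_int a + \<i> * of_int b" "(int B ^ 2 + 1) dvd int m - (a + b * int B)"
    "c' = of_int a' + \<i> * of_int b'" "(int B ^ 2 + 1) dvd int m' - (a' + b' * int B)"
    using assms by (auto simp: rep_def)
  have "(int B ^ 2 + 1) dvd (int m - (a + b * int B)) + (int m' - (a' + b' * int B))" by (rule dvd_add[OF *(2,4)])
  then show ?thesis unfolding rep_def
    by (intro exI[of _ "a + a'"] exI[of _ "b + b'"]) (auto simp: *(1,3) algebra_simps)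
qed

lemma rep_mult:
  assumes "rep B c m" "rep B c' m'"
  shows "rep B (c * c') (m * m')"
proof -
  obtain a b a' b' where *: "c = of_int a + \<i> * of_int b" "(int B ^ 2 + 1) dvd int m - (a + b * int B)"
    "c' = of_int a' + \<i> * of_int b'" "(int B ^ 2 + 1) dvd int m' - (a' + b' * int B)"
    using assms by (auto simp: rep_def)
  \<comment> \<open>The last summand replaces \<open>B^2\<close> by \<open>-1\<close>, as
    multiplication of Gaussian integers requires.\<close>
  have "int (m * m') - ((a * a' - b * b') + (a * b' + b * a') * int B)
    = (int m - (a + b * int B)) * int m' + (a + b * int B) * (int m' - (a' + b' * int B)) + (int B ^ 2 + 1) * (b * b')"
    by (simp add: algebra_simps power2_eq_square)
  moreover have "(int B ^ 2 + 1) dvd \<dots>" by (intro dvd_add dvd_mult2[OF *(2)] dvd_mult[OF *(4)] dvd_triv_left)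
  moreover have "c * c' = of_int (a * a' - b * b') + \<i> * of_int (a * b' + b * a')"
    unfolding * by (simp add: complex_eq_iff algebra_simps)
  ultimately show ?thesis unfolding rep_def by metis
qed

lemma rep_of_nat: "rep B (of_nat a) a"
  unfolding rep_def by (intro exI[of _ "int a"] exI[of _ 0]) auto

lemma rep_0: "rep B 0 0" and rep_1: "rep B 1 1"
  using rep_of_nat[of B 0] rep_of_nat[of B 1] by auto

lemma rep_i: "rep B \<i> B"
  unfolding rep_def by (intro exI[of _ 0] exI[of _ 1]) auto

lemma rep_mod [simp]: "rep B c (m mod (B\<^sup>2 + 1)) \<longleftrightarrow> rep B c m"
proof -
  have "int (m mod (B\<^sup>2 + 1)) = int m mod (int B ^ 2 + 1)" by (simp add: zmod_int add.commute)
  then show ?thesis by (simp add: rep_def mod_eq_dvd_iff[symmetric])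
qed

lemma rep_minus:
  assumes "rep B c m" "m \<le> B\<^sup>2 + 1"
  shows "rep B (- c) (B\<^sup>2 + 1 - m)"
proof -
  obtain a b where *: "c = of_int a + \<i> * of_int b" "(int B ^ 2 + 1) dvd int m - (a + b * int B)"
    using assms by (auto simp: rep_def)
  have eq: "int (B\<^sup>2 + 1 - m) - (- a + - b * int B) = (int B ^ 2 + 1) - (int m - (a + b * int B))"
    using assms(2) by (simp add: of_nat_diff)
  have d: "(int B ^ 2 + 1) dvd int (B\<^sup>2 + 1 - m) - (- a + - b * int B)"
    unfolding eq by (rule dvd_diff[OF dvd_refl *(2)])
  have "- c = of_int (- a) + \<i> * of_int (- b)" using *(1) by simp
  with d show ?thesis unfolding rep_def by blast
qed

lemma rep_power: "rep B c m \<Longrightarrow> rep B (c ^ i) (m ^ i)"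
  by (induction i) (auto intro: rep_1[simplified] rep_mult)

text \<open>Decoding works because a real Gaussian integer has no multiple of \<open>B\<close>,
  hence is congruent to the residue, and both lie in the same interval of length
  \<open>B^2 + 1\<close>.\<close>

lemma rep_real:
  assumes "rep B (of_real r) m" "m < B\<^sup>2 + 1" "0 \<le> r" "r < real (B\<^sup>2 + 1)"
  shows "real m = r"
proof -
  obtain a b where *: "of_real r = of_int a + \<i> * of_int b" "(int B ^ 2 + 1) dvd int m - (a + b * int B)"
    using assms by (auto simp: rep_def)
  have ab: "r = of_int a" "b = 0" using *(1) by (auto simp: complex_eq_iff)
  have "(int B ^ 2 + 1) dvd int m - a" using * ab by simp
  moreover have "0 \<le> a" using ab(1) assms(3) by simp
  moreover have "a < int B ^ 2 + 1"
  proof -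
    have "real_of_int a < real_of_int (int (B\<^sup>2 + 1))" using ab(1) assms(4) by simp
    then have "a < int (B\<^sup>2 + 1)" by (simp only: of_int_less_iff)
    then show ?thesis by simp
  qed
  moreover have "int m < int B ^ 2 + 1" using assms(2) by (simp flip: of_nat_power)
  ultimately have "int m = a" using zdvd_imp_le[of "int B ^ 2 + 1" "int m - a"] zdvd_imp_le[of "int B ^ 2 + 1" "a - int m"]
    by (smt (verit) dvd_diff_commute of_nat_0_le_iff)
  then show ?thesis using ab by simp
qed

text \<open>Small real numbers are read as signed residues: nonnegative ones occupy the lower half
  of the range, and adding the modulus moves negative ones to the upper half.\<close>

lemma rep_sign:
  assumes "rep B (of_real r) m" "m < B\<^sup>2 + 1" "2 * \<bar>r\<bar> < real (B\<^sup>2 + 1)"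
  shows "2 * m < B\<^sup>2 + 1 \<longleftrightarrow> 0 \<le> r"
proof (cases "0 \<le> r")
  case True
  then have "real m = r" using assms by (intro rep_real[of B]) auto
  then have "real (2 * m) < real (B\<^sup>2 + 1)" using assms(3) True by simp
  then show ?thesis using True by (simp only: of_nat_less_iff)
next
  case False
  have "m \<noteq> 0"
  proof
    assume "m = 0"
    then have "rep B (of_real (- r)) (B\<^sup>2 + 1)" using rep_minus[OF assms(1)] by simp
    then have "rep B (of_real (- r)) ((B\<^sup>2 + 1) mod (B\<^sup>2 + 1))" by (simp only: rep_mod)
    then have "real ((B\<^sup>2 + 1) mod (B\<^sup>2 + 1)) = - r" using False assms(3) by (intro rep_real[of B]) auto
    then show False using False by simp
  qed
  have "rep B (of_real (- r)) (B\<^sup>2 + 1 - m)" using rep_minus[OF assms(1)] assms(2) by simp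
  then have "real (B\<^sup>2 + 1 - m) = - r" using False assms \<open>m \<noteq> 0\<close> by (intro rep_real[of B]) auto
  then have "real (2 * (B\<^sup>2 + 1 - m)) < real (B\<^sup>2 + 1)" using assms(3) False by simp
  then have "2 * (B\<^sup>2 + 1 - m) < B\<^sup>2 + 1" by (simp only: of_nat_less_iff)
  then show ?thesis using False by linarith
qed

section \<open>Depth-first search as a bounded loop\<close>

abbreviation var :: "nat \<Rightarrow> fexp" where "var a \<equiv> Arr a (Cst 0)"
abbreviation set_var :: "nat \<Rightarrow> fexp \<Rightarrow> fp" where "set_var a \<equiv> Assign a (Cst 0)"

text \<open>Array 8 is the level, and 9 to 12 are the stack of vertices, next candidates, denominators and
  numerators; array 7 marks the removed vertices.\<close>

definition push_node :: fp where
  "push_node = Then (set_var 8 (Plus (var 8) (Cst 1))) (Then (Assign 9 (var 8) (var 38)) (Then (Assign 10 (var 8) (Cst 0))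
     (Then (Assign 11 (var 8) (Cst 1)) (Then (Assign 12 (var 8) (Cst 0)) (Assign 7 (var 38) (Cst 1))))))"

definition try_child :: fp where
  "try_child = Then (set_var 38 (Arr 10 (var 8))) (Then (Assign 10 (var 8) (Plus (var 38) (Cst 1)))
     (Cond (Times (Input (Plus (Cst 2) (Plus (Times (Arr 9 (var 8)) (Input (Cst 0))) (var 38)))) (Minus (Cst 1) (Arr 7 (var 38))))
       push_node Nop))"

text \<open>Variables 13 and 14 receive the finished fraction of the node, which is then added to
  the parent as in \<open>accum\<close>. The parent's numerator is updated before its denominator,
  because it needs the old one.\<close>

definition pop_node :: fp where
  "pop_node = Then (set_var 13 (Times (var 3) (Arr 11 (var 8))))
     (Then (set_var 14 (Plus (Times (var 3) (Arr 11 (var 8))) (Times (var 2) (Arr 12 (var 8)))))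
     (Then (Assign 7 (Arr 9 (var 8)) (Cst 0)) (Then (set_var 8 (Minus (var 8) (Cst 1)))
     (Then (Assign 12 (var 8) (Plus (Times (Arr 12 (var 8)) (var 14)) (Times (var 13) (Arr 11 (var 8)))))
       (Assign 11 (var 8) (Times (Arr 11 (var 8)) (var 14)))))))"

text \<open>A node at level \<open>l + 1\<close> has \<open>cd * L - l\<close> levels of the tree
  below it, so the second factor of the guard is positive exactly when children are allowed. At
  level 0 the step is idle, so running more iterations than necessary is harmless.\<close>

definition dfs_step :: "nat \<Rightarrow> fp" where
  "dfs_step cd = Cond (var 8)
     (Cond (Times (Minus (Input (Cst 0)) (Arr 10 (var 8))) (Minus (Plus (Times (Cst cd) (Par 3)) (Cst 1)) (var 8)))
       try_child pop_node) Nop"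

text \<open>Level 0 is a sentinel with fraction 0/1. Adding the tree of the root to it leaves the
  tree's denominator in array 11 and its numerator in array 12. The pop unmarks the root, so it is
  marked again afterwards: later roots must avoid all earlier ones.\<close>

definition root_prog :: "nat \<Rightarrow> fp" where
  "root_prog cd = Then (set_var 8 (Cst 1)) (Then (Assign 9 (Cst 1) (var 6)) (Then (Assign 10 (Cst 1) (Cst 0))
     (Then (Assign 11 (Cst 1) (Cst 1)) (Then (Assign 12 (Cst 1) (Cst 0)) (Then (set_var 11 (Cst 1)) (Then (set_var 12 (Cst 0))
     (Then (Assign 7 (var 6) (Cst 1)) (Then (Repeat (Par 0) (dfs_step cd))
     (Then (set_var 5 (Times (var 5) (var 11))) (Then (set_var 4 (Times (var 4) (var 12)))
     (Then (Assign 7 (var 6) (Cst 1)) (set_var 6 (Plus (var 6) (Cst 1))))))))))))))"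

definition clear_marks :: fp where
  "clear_marks = Then (set_var 37 (Cst 0))
     (Repeat (Input (Cst 0)) (Then (Assign 7 (var 37) (Cst 0)) (set_var 37 (Plus (var 37) (Cst 1)))))"

definition forest_prog :: "nat \<Rightarrow> fp" where
  "forest_prog cd = Then clear_marks (Then (set_var 4 (Cst 1)) (Then (set_var 5 (Cst 1)) (Then (set_var 6 (Cst 0))
     (Repeat (Input (Cst 0)) (root_prog cd)))))"

lemma funpow_invariant:
  assumes "\<And>j \<sigma>. j < m \<Longrightarrow> I j \<sigma> \<Longrightarrow> I (Suc j) (f \<sigma>)" "I 0 \<sigma>"
  shows "I m ((f ^^ m) \<sigma>)"
  using assms(1)
proof (induction m)
  case (Suc m)
  then show ?case by simp
qed (use assms(2) in simp)

lemma funpow_fixpoint: "f x = x \<Longrightarrow> (f ^^ m) x = x"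
  by (induction m) auto

locale machine = fin_graph n E for n :: nat and E :: "nat set set" +
  fixes inp :: "nat \<Rightarrow> nat" and \<pi> :: "nat \<Rightarrow> nat" and k K q L B M cd :: nat
  assumes inp_0: "inp 0 = n" and inp_1: "inp (Suc 0) = k"
    and adj: "\<And>v u. v < n \<Longrightarrow> u < n \<Longrightarrow> inp (Suc (Suc (v * n + u))) = of_bool ({v, u} \<in> E)"
    and \<pi>: "\<pi> 0 = K" "\<pi> (Suc 0) = M" "\<pi> 2 = q" "\<pi> 3 = L" "\<pi> 4 = B"
    and M: "M = B\<^sup>2 + 1" and KM: "K < M" and nK: "n \<le> K" and dK: "cd * L + 2 \<le> K"
begin

abbreviation "run \<equiv> den inp \<pi>"
abbreviation "R \<equiv> rep B"
abbreviation "dfs \<equiv> run (dfs_step cd)"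

lemma R_mod [simp]: "R c (m mod M) \<longleftrightarrow> R c m"
  unfolding M by (rule rep_mod)

lemma nM: "n < M" and dM: "Suc (cd * L) < M" and M2: "Suc 0 < M" and one_mod [simp]: "Suc 0 mod M = Suc 0"
  using nK dK KM by auto

text \<open>What a search above level \<open>l\<close> leaves alone: the stack entries below
  \<open>l\<close>, and all arrays except its own working storage.\<close>

definition frame :: "nat \<Rightarrow> (nat \<Rightarrow> nat \<Rightarrow> nat) \<Rightarrow> (nat \<Rightarrow> nat \<Rightarrow> nat) \<Rightarrow> bool" where
  "frame l \<sigma> \<sigma>' \<longleftrightarrow> (\<forall>i<l. \<sigma>' 9 i = \<sigma> 9 i \<and> \<sigma>' 10 i = \<sigma> 10 i \<and> \<sigma>' 11 i = \<sigma> 11 i \<and> \<sigma>' 12 i = \<sigma> 12 i)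
     \<and> (\<forall>a. a \<notin> {7, 8, 9, 10, 11, 12, 13, 14, 38} \<longrightarrow> \<sigma>' a = \<sigma> a)"

lemma frame_refl: "frame l \<sigma> \<sigma>"
  by (simp add: frame_def)

lemma frame_trans: "frame l \<sigma> \<sigma>' \<Longrightarrow> frame l \<sigma>' \<sigma>'' \<Longrightarrow> frame l \<sigma> \<sigma>''"
  by (auto simp: frame_def)

lemma frame_mono: "frame l \<sigma> \<sigma>' \<Longrightarrow> l' \<le> l \<Longrightarrow> frame l' \<sigma> \<sigma>'"
  by (auto simp: frame_def)

lemma frame_other: "frame l \<sigma> \<sigma>' \<Longrightarrow> a \<notin> {7, 8, 9, 10, 11, 12, 13, 14, 38} \<Longrightarrow> \<sigma>' a = \<sigma> a"
  by (auto simp: frame_def)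

definition marks :: "(nat \<Rightarrow> nat \<Rightarrow> nat) \<Rightarrow> nat set \<Rightarrow> bool" where
  "marks \<sigma> S \<longleftrightarrow> (\<forall>u<n. \<sigma> 7 u = of_bool (u \<in> S))"

definition visiting :: "(nat \<Rightarrow> nat \<Rightarrow> nat) \<Rightarrow> nat \<Rightarrow> nat \<Rightarrow> nat set \<Rightarrow> nat \<Rightarrow> complex \<times> complex \<Rightarrow> bool" where
  "visiting \<sigma> l v S m a \<longleftrightarrow> \<sigma> 8 0 = l \<and> \<sigma> 9 l = v \<and> \<sigma> 10 l = m \<and> R (fst a) (\<sigma> 11 l) \<and> R (snd a) (\<sigma> 12 l)
     \<and> marks \<sigma> (insert v S)"

lemma try_child_skip:
  assumes "visiting \<sigma> l v S m a" "1 \<le> l" "l \<le> cd * L" "m < n" "v < n" "\<not> ({v, m} \<in> E \<and> m \<notin> insert v S)"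
  shows "visiting (dfs \<sigma>) l v S (Suc m) a \<and> frame l \<sigma> (dfs \<sigma>)"
  using assms nM dM adj[of v m]
  by (auto simp: visiting_def dfs_step_def try_child_def frame_def marks_def inp_0 \<pi>)

lemma try_child_push:
  assumes "visiting \<sigma> l v S m a" "1 \<le> l" "l \<le> cd * L" "m < n" "v < n" "{v, m} \<in> E" "m \<notin> insert v S"
  shows "visiting (dfs \<sigma>) (Suc l) m (insert v S) 0 (1, 0) \<and> frame l \<sigma> (dfs \<sigma>) \<and> dfs \<sigma> 9 l = v \<and> dfs \<sigma> 10 l = Suc m
    \<and> R (fst a) (dfs \<sigma> 11 l) \<and> R (snd a) (dfs \<sigma> 12 l)"
proof -
  have "m < M" "Suc m < M" "l < M" "Suc l < M" using assms nM dM by auto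
  then show ?thesis using assms nM dM adj[of v m] rep_0[of B] rep_1[of B]
    by (auto simp: visiting_def dfs_step_def try_child_def push_node_def frame_def marks_def inp_0 \<pi>)
qed

lemma pop_node_correct:
  assumes "visiting \<sigma> (Suc l) v S m a" "n \<le> m \<or> cd * L \<le> l" "l \<le> cd * L" "v < n" "v \<notin> S"
    and "R (fst b) (\<sigma> 11 l)" "R (snd b) (\<sigma> 12 l)" "R x (\<sigma> 2 0)" "R y (\<sigma> 3 0)"
  shows "dfs \<sigma> 8 0 = l \<and> marks (dfs \<sigma>) S \<and> frame l \<sigma> (dfs \<sigma>) \<and> dfs \<sigma> 9 l = \<sigma> 9 l \<and> dfs \<sigma> 10 l = \<sigma> 10 l
    \<and> R (fst b * snd (node x y a)) (dfs \<sigma> 11 l) \<and> R (snd b * snd (node x y a) + fst (node x y a) * fst b) (dfs \<sigma> 12 l)"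
proof -
  have lM: "l < M" "l mod M = l" using assms dM by auto
  have c: "(n - m) * (Suc (cd * L) - Suc l) = 0" using assms(2) by auto
  have 1: "R (fst b * snd (node x y a)) (\<sigma> 11 l * ((\<sigma> 3 0 * \<sigma> 11 (Suc l) + \<sigma> 2 0 * \<sigma> 12 (Suc l)) mod M) mod M)"
    using assms by (auto simp: node_def visiting_def intro!: rep_mult rep_add)
  have 2: "R (snd b * snd (node x y a) + fst (node x y a) * fst b)
     ((\<sigma> 12 l * ((\<sigma> 3 0 * \<sigma> 11 (Suc l) + \<sigma> 2 0 * \<sigma> 12 (Suc l)) mod M) + (\<sigma> 3 0 * \<sigma> 11 (Suc l)) mod M * \<sigma> 11 l) mod M)"
    using assms by (auto simp: node_def visiting_def intro!: rep_mult rep_add)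
  show ?thesis using assms lM c 1 2
    by (auto simp: visiting_def dfs_step_def pop_node_def frame_def marks_def inp_0 \<pi>)
qed

text \<open>An inner node costs one step per candidate, pushes included, one pop, and the time of at
  most \<Delta> subtrees.\<close>

primrec dfs_time :: "nat \<Rightarrow> nat \<Rightarrow> nat" where
  "dfs_time \<Delta> 0 = 1"
| "dfs_time \<Delta> (Suc r) = n + 1 + \<Delta> * dfs_time \<Delta> r"

lemma dfs_time_le: "dfs_time \<Delta> r \<le> (n + 1) * (\<Delta> + 1) ^ r"
proof (induction r)
  case (Suc r)
  have "dfs_time \<Delta> (Suc r) \<le> (n + 1) * 1 + \<Delta> * ((n + 1) * (\<Delta> + 1) ^ r)"
    using Suc by simp
  also have "\<dots> \<le> (n + 1) * (\<Delta> + 1) ^ r + \<Delta> * ((n + 1) * (\<Delta> + 1) ^ r)"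
    by (intro add_right_mono mult_le_mono2) simp
  also have "\<dots> = (n + 1) * (\<Delta> + 1) ^ Suc r" by (simp add: algebra_simps)
  finally show ?case .
qed simp

text \<open>The outer induction is on the remaining depth, the inner one on the next candidate, with
  the partial \<open>accum\<close> as invariant. The step count is only bounded because it depends
  on the graph; later steps do no harm, by \<open>dfs_idle\<close>.\<close>

lemma dfs_correct:
  assumes deg: "\<And>v. v < n \<Longrightarrow> degree E v \<le> \<Delta>"
  shows "visiting \<sigma> (Suc l) v S 0 (1, 0) \<Longrightarrow> r + l = cd * L \<Longrightarrow> v < n \<Longrightarrow> v \<notin> S \<Longrightarrow>
    R (fst b) (\<sigma> 11 l) \<Longrightarrow> R (snd b) (\<sigma> 12 l) \<Longrightarrow> R x (\<sigma> 2 0) \<Longrightarrow> R y (\<sigma> 3 0) \<Longrightarrow>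
    \<exists>t\<le>dfs_time \<Delta> r. let \<sigma>' = (dfs ^^ t) \<sigma>; f = tree x y r S v in
      \<sigma>' 8 0 = l \<and> marks \<sigma>' S \<and> frame l \<sigma> \<sigma>' \<and> \<sigma>' 9 l = \<sigma> 9 l \<and> \<sigma>' 10 l = \<sigma> 10 l
      \<and> R (fst b * snd f) (\<sigma>' 11 l) \<and> R (snd b * snd f + fst f * fst b) (\<sigma>' 12 l)"
proof (induction r arbitrary: \<sigma> l v S b)
  case 0
  have "n \<le> 0 \<or> cd * L \<le> l" "l \<le> cd * L" using 0 by auto
  from pop_node_correct[OF 0(1) this 0(3-)] show ?case
    by (intro exI[of _ 1]) (simp add: Let_def)
next
  case (Suc r)
  note IH = Suc.IH and prems = Suc.prems
  let ?g = "\<lambda>u. {v, u} \<in> E \<and> u \<notin> insert v S"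
  let ?a = "accum (1, 0) ?g (tree x y r (insert v S))"
  have "\<exists>t\<le>m + card {u. u < m \<and> ?g u} * dfs_time \<Delta> r.
      visiting ((dfs ^^ t) \<sigma>) (Suc l) v S m (?a m) \<and> frame (Suc l) \<sigma> ((dfs ^^ t) \<sigma>)" if "m \<le> n" for m
    using that
  proof (induction m)
    case 0
    show ?case using prems(1) by (intro exI[of _ 0]) (simp add: frame_refl)
  next
    case (Suc m)
    then obtain t where t: "t \<le> m + card {u. u < m \<and> ?g u} * dfs_time \<Delta> r"
      "visiting ((dfs ^^ t) \<sigma>) (Suc l) v S m (?a m)" "frame (Suc l) \<sigma> ((dfs ^^ t) \<sigma>)" by auto
    define \<sigma>1 where "\<sigma>1 = (dfs ^^ t) \<sigma>"
    have at1: "visiting \<sigma>1 (Suc l) v S m (?a m)" and fr1: "frame (Suc l) \<sigma> \<sigma>1" using t by (simp_all add: \<sigma>1_def)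
    have ld: "1 \<le> Suc l" "Suc l \<le> cd * L" "m < n" using Suc.prems prems(2) by auto
    have eq: "{u. u < Suc m \<and> ?g u} = (if ?g m then insert m {u. u < m \<and> ?g u} else {u. u < m \<and> ?g u})"
      by (auto simp: less_Suc_eq)
    show ?case
    proof (cases "?g m")
      case False
      from try_child_skip[OF at1 ld prems(3) False]
      have "visiting (dfs \<sigma>1) (Suc l) v S (Suc m) (?a m)" "frame (Suc l) \<sigma> (dfs \<sigma>1)" using frame_trans[OF fr1] by auto
      moreover have "?a (Suc m) = ?a m" by (simp only: accum.simps Let_def if_not_P[OF False])
      ultimately show ?thesis using t(1) False unfolding eq
        by (intro exI[of _ "Suc t"]) (simp add: \<sigma>1_def)
    next
      case True
      define \<sigma>2 where "\<sigma>2 = dfs \<sigma>1"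
      from try_child_push[OF at1 ld prems(3)] True
      have 2: "visiting \<sigma>2 (Suc (Suc l)) m (insert v S) 0 (1, 0)" "frame (Suc l) \<sigma>1 \<sigma>2" "\<sigma>2 9 (Suc l) = v" "\<sigma>2 10 (Suc l) = Suc m"
        "R (fst (?a m)) (\<sigma>2 11 (Suc l))" "R (snd (?a m)) (\<sigma>2 12 (Suc l))" by (auto simp: \<sigma>2_def)
      have fr2: "frame (Suc l) \<sigma> \<sigma>2" by (rule frame_trans[OF fr1 2(2)])
      have xy: "R x (\<sigma>2 2 0)" "R y (\<sigma>2 3 0)" using frame_other[OF fr2] prems(7,8) by auto
      have "r + Suc l = cd * L" "m \<notin> insert v S" using prems(2) True by auto
      from IH[OF 2(1) this(1) ld(3) this(2) 2(5,6) xy]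
      obtain t2 where t2: "t2 \<le> dfs_time \<Delta> r" "(dfs ^^ t2) \<sigma>2 8 0 = Suc l" "marks ((dfs ^^ t2) \<sigma>2) (insert v S)"
        "frame (Suc l) \<sigma>2 ((dfs ^^ t2) \<sigma>2)" "(dfs ^^ t2) \<sigma>2 9 (Suc l) = \<sigma>2 9 (Suc l)" "(dfs ^^ t2) \<sigma>2 10 (Suc l) = \<sigma>2 10 (Suc l)"
        "R (fst (?a m) * snd (tree x y r (insert v S) m)) ((dfs ^^ t2) \<sigma>2 11 (Suc l))"
        "R (snd (?a m) * snd (tree x y r (insert v S) m) + fst (tree x y r (insert v S) m) * fst (?a m)) ((dfs ^^ t2) \<sigma>2 12 (Suc l))"
        unfolding Let_def by blast
      have aS: "?a (Suc m) = (fst (?a m) * snd (tree x y r (insert v S) m), snd (?a m) * snd (tree x y r (insert v S) m) + fst (tree x y r (insert v S) m) * fst (?a m))"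
        by (simp only: accum.simps Let_def if_P[OF True])
      have at3: "visiting ((dfs ^^ t2) \<sigma>2) (Suc l) v S (Suc m) (?a (Suc m))"
        unfolding aS visiting_def fst_conv snd_conv using t2(2,3,5-8) 2(3,4) by simp
      have fr3: "frame (Suc l) \<sigma> ((dfs ^^ t2) \<sigma>2)" by (rule frame_trans[OF fr2 t2(4)])
      have run: "(dfs ^^ t2) \<sigma>2 = (dfs ^^ (t2 + Suc t)) \<sigma>" by (simp only: funpow_add \<sigma>2_def \<sigma>1_def funpow.simps o_apply)
      have cardS: "card {u. u < Suc m \<and> ?g u} = Suc (card {u. u < m \<and> ?g u})" unfolding eq using True by simp
      have "t2 + Suc t \<le> Suc m + card {u. u < Suc m \<and> ?g u} * dfs_time \<Delta> r"
        using t(1) t2(1) unfolding cardS by simp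
      then show ?thesis using at3 fr3 unfolding run by blast
    qed
  qed
  from this[OF order_refl] obtain t where t: "t \<le> n + card {u. u < n \<and> ?g u} * dfs_time \<Delta> r"
      "visiting ((dfs ^^ t) \<sigma>) (Suc l) v S n (?a n)" "frame (Suc l) \<sigma> ((dfs ^^ t) \<sigma>)" by auto
  define \<sigma>1 where "\<sigma>1 = (dfs ^^ t) \<sigma>"
  have fr1: "frame (Suc l) \<sigma> \<sigma>1" using t by (simp add: \<sigma>1_def)
  have eqs: "\<sigma>1 9 l = \<sigma> 9 l" "\<sigma>1 10 l = \<sigma> 10 l" "\<sigma>1 11 l = \<sigma> 11 l" "\<sigma>1 12 l = \<sigma> 12 l" "\<sigma>1 2 = \<sigma> 2" "\<sigma>1 3 = \<sigma> 3"
    using fr1 by (auto simp: frame_def)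
  have l: "n \<le> n \<or> cd * L \<le> l" "l \<le> cd * L" using Suc.prems by auto
  have reps: "R (fst b) (\<sigma>1 11 l)" "R (snd b) (\<sigma>1 12 l)" "R x (\<sigma>1 2 0)" "R y (\<sigma>1 3 0)"
    using Suc.prems unfolding eqs by auto
  note pop = pop_node_correct[OF t(2)[folded \<sigma>1_def] l Suc.prems(3,4) reps]
  have "card {u. u < n \<and> ?g u} \<le> \<Delta>" unfolding nbrs_eq using card_nbrs deg[OF Suc.prems(3)] le_trans by blast
  then have "card {u. u < n \<and> ?g u} * dfs_time \<Delta> r \<le> \<Delta> * dfs_time \<Delta> r" by (rule mult_le_mono1)
  then have time: "Suc t \<le> dfs_time \<Delta> (Suc r)" using t(1) unfolding dfs_time.simps by linarith
  have run: "(dfs ^^ Suc t) \<sigma> = dfs \<sigma>1" by (simp add: \<sigma>1_def)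
  have fr2: "frame l \<sigma> (dfs \<sigma>1)" using frame_trans[OF frame_mono[OF fr1]] pop by auto
  show ?case
    using time pop fr2 unfolding run[symmetric] Let_def tree.simps eqs by blast
qed


lemma dfs_idle: "\<sigma> 8 0 = 0 \<Longrightarrow> dfs \<sigma> = \<sigma>"
  by (simp add: dfs_step_def)

lemma root_prog_correct:
  assumes deg: "\<And>v. v < n \<Longrightarrow> degree E v \<le> \<Delta>" and fuel: "dfs_time \<Delta> (cd * L) \<le> K"
    and \<sigma>: "marks \<sigma> {..<r}" "\<sigma> 6 0 = r" "r < n" "R p (\<sigma> 4 0)" "R s (\<sigma> 5 0)" "R x (\<sigma> 2 0)" "R y (\<sigma> 3 0)"
  shows "marks (run (root_prog cd) \<sigma>) {..<Suc r} \<and> run (root_prog cd) \<sigma> 6 0 = Suc r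
    \<and> R (p * fst (tree x y (cd * L) {..<r} r)) (run (root_prog cd) \<sigma> 4 0)
    \<and> R (s * snd (tree x y (cd * L) {..<r} r)) (run (root_prog cd) \<sigma> 5 0)
    \<and> (\<forall>a. a \<notin> {4, 5, 6, 7, 8, 9, 10, 11, 12, 13, 14, 38} \<longrightarrow> run (root_prog cd) \<sigma> a = \<sigma> a)"
proof -
  let ?f = "tree x y (cd * L) {..<r} r"
  define \<sigma>1 where "\<sigma>1 = \<sigma>(8 := (\<sigma> 8)(0 := 1), 9 := (\<sigma> 9)(1 := r), 10 := (\<sigma> 10)(1 := 0), 11 := (\<sigma> 11)(1 := 1, 0 := 1),
     12 := (\<sigma> 12)(1 := 0, 0 := 0), 7 := (\<sigma> 7)(r := 1))"
  have rM: "r < M" "Suc r < M" using \<sigma>(3) nM by auto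
  have v: "visiting \<sigma>1 (Suc 0) r {..<r} 0 (1, 0)"
    using \<sigma> rep_0[of B] rep_1[of B] by (auto simp: visiting_def \<sigma>1_def marks_def)
  have reps: "R (fst (1 :: complex, 0 :: complex)) (\<sigma>1 11 0)" "R (snd (1 :: complex, 0 :: complex)) (\<sigma>1 12 0)"
      "R x (\<sigma>1 2 0)" "R y (\<sigma>1 3 0)"
    using \<sigma> rep_0[of B] rep_1[of B] by (auto simp: \<sigma>1_def)
  obtain t where t: "t \<le> dfs_time \<Delta> (cd * L)" "(dfs ^^ t) \<sigma>1 8 0 = 0" "marks ((dfs ^^ t) \<sigma>1) {..<r}"
    "frame 0 \<sigma>1 ((dfs ^^ t) \<sigma>1)" "R (snd ?f) ((dfs ^^ t) \<sigma>1 11 0)" "R (fst ?f) ((dfs ^^ t) \<sigma>1 12 0)"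
    using dfs_correct[OF deg v, of "cd * L" "(1, 0)" x y] \<sigma>(3) reps by (auto simp: Let_def)
  define \<sigma>2 where "\<sigma>2 = (dfs ^^ t) \<sigma>1"
  \<comment> \<open>The loop always makes \<open>K\<close> iterations; those after the search has
    finished are idle.\<close>
  have "K = (K - t) + t" using t(1) fuel by simp
  then have "(dfs ^^ K) \<sigma>1 = (dfs ^^ (K - t)) \<sigma>2" unfolding \<sigma>2_def by (metis comp_apply funpow_add)
  also have "dfs \<sigma>2 = \<sigma>2" by (rule dfs_idle) (use t(2) \<sigma>2_def in simp)
  then have "(dfs ^^ (K - t)) \<sigma>2 = \<sigma>2" by (rule funpow_fixpoint)
  finally have K: "(dfs ^^ K) \<sigma>1 = \<sigma>2" .
  have s2: "\<sigma>2 4 = \<sigma> 4" "\<sigma>2 5 = \<sigma> 5" "\<sigma>2 6 = \<sigma> 6" using frame_other[OF t(4)[folded \<sigma>2_def]] by (auto simp: \<sigma>1_def)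
  have eq: "run (root_prog cd) \<sigma> = \<sigma>2(5 := (\<sigma> 5)(0 := \<sigma> 5 0 * \<sigma>2 11 0 mod M), 4 := (\<sigma> 4)(0 := \<sigma> 4 0 * \<sigma>2 12 0 mod M),
      7 := (\<sigma>2 7)(r := 1), 6 := (\<sigma> 6)(0 := Suc r))"
  proof -
    have "run (Then (set_var 8 (Cst 1)) (Then (Assign 9 (Cst 1) (var 6)) (Then (Assign 10 (Cst 1) (Cst 0))
     (Then (Assign 11 (Cst 1) (Cst 1)) (Then (Assign 12 (Cst 1) (Cst 0)) (Then (set_var 11 (Cst 1)) (Then (set_var 12 (Cst 0))
     (Assign 7 (var 6) (Cst 1))))))))) \<sigma> = \<sigma>1"
      using \<sigma>(2) rM by (auto simp: \<sigma>1_def \<pi> fun_eq_iff)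
    then have "run (root_prog cd) \<sigma> = run (Then (Repeat (Par 0) (dfs_step cd))
     (Then (set_var 5 (Times (var 5) (var 11))) (Then (set_var 4 (Times (var 4) (var 12)))
     (Then (Assign 7 (var 6) (Cst 1)) (set_var 6 (Plus (var 6) (Cst 1))))))) \<sigma>1"
      by (simp add: root_prog_def)
    also have "\<dots> = run (Then (set_var 5 (Times (var 5) (var 11))) (Then (set_var 4 (Times (var 4) (var 12)))
     (Then (Assign 7 (var 6) (Cst 1)) (set_var 6 (Plus (var 6) (Cst 1)))))) \<sigma>2"
      by (simp add: \<pi> K)
    finally show ?thesis using \<sigma>(2) rM s2 by (simp add: \<pi>)
  qed
  have m2: "marks \<sigma>2 {..<r}" using t(3) by (simp add: \<sigma>2_def)
  have m3: "marks (run (root_prog cd) \<sigma>) {..<Suc r}" unfolding marks_def eq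
    using m2 by (auto simp: marks_def less_Suc_eq)
  have "\<forall>a. a \<notin> {4, 5, 6, 7, 8, 9, 10, 11, 12, 13, 14, 38} \<longrightarrow> run (root_prog cd) \<sigma> a = \<sigma> a"
    unfolding eq using frame_other[OF t(4)[folded \<sigma>2_def]] by (auto simp: \<sigma>1_def)
  moreover have "R (p * fst ?f) (run (root_prog cd) \<sigma> 4 0)" "R (s * snd ?f) (run (root_prog cd) \<sigma> 5 0)"
    unfolding eq using rep_mult[OF \<sigma>(4) t(6)] rep_mult[OF \<sigma>(5) t(5)] by (simp_all add: \<sigma>2_def)
  ultimately show ?thesis using m3 eq by simp
qed

lemma clear_marks_correct:
  "marks (run clear_marks \<sigma>) {} \<and> (\<forall>a. a \<notin> {7, 37} \<longrightarrow> run clear_marks \<sigma> a = \<sigma> a)"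
proof -
  let ?f = "run (Then (Assign 7 (var 37) (Cst 0)) (set_var 37 (Plus (var 37) (Cst 1))))"
  let ?I = "\<lambda>j \<sigma>'. \<sigma>' 37 0 = j \<and> (\<forall>u<j. \<sigma>' 7 u = 0) \<and> (\<forall>a. a \<notin> {7, 37} \<longrightarrow> \<sigma>' a = \<sigma> a)"
  have "?I n ((?f ^^ n) (\<sigma>(37 := (\<sigma> 37)(0 := 0))))"
  proof (rule funpow_invariant[where I = ?I and f = ?f and m = n])
    fix j \<sigma>'
    assume j: "j < n" and I: "?I j \<sigma>'"
    have jM: "Suc j < M" using j nM by simp
    have f: "?f \<sigma>' = \<sigma>'(7 := (\<sigma>' 7)(j := 0), 37 := (\<sigma>' 37)(0 := Suc j))"
      using I jM by (simp add: \<pi>)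
    show "?I (Suc j) (?f \<sigma>')" unfolding f using I by (simp add: less_Suc_eq)
  qed simp
  moreover have "run clear_marks \<sigma> = (?f ^^ n) (\<sigma>(37 := (\<sigma> 37)(0 := 0)))"
    unfolding clear_marks_def using nK by (simp add: inp_0 \<pi> min_absorb1)
  ultimately show ?thesis by (auto simp: marks_def)
qed

lemma forest_prog_correct:
  assumes deg: "\<And>v. v < n \<Longrightarrow> degree E v \<le> \<Delta>" and fuel: "dfs_time \<Delta> (cd * L) \<le> K"
    and xy: "R x (\<sigma> 2 0)" "R y (\<sigma> 3 0)"
  shows "R (fst (forest x y (cd * L))) (run (forest_prog cd) \<sigma> 4 0)
    \<and> R (snd (forest x y (cd * L))) (run (forest_prog cd) \<sigma> 5 0)
    \<and> (\<forall>a. a \<notin> {4, 5, 6, 7, 8, 9, 10, 11, 12, 13, 14, 37, 38} \<longrightarrow> run (forest_prog cd) \<sigma> a = \<sigma> a)"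
proof -
  define \<sigma>0 where "\<sigma>0 = run clear_marks \<sigma>"
  define \<sigma>1 where "\<sigma>1 = \<sigma>0(4 := (\<sigma>0 4)(0 := 1), 5 := (\<sigma>0 5)(0 := 1), 6 := (\<sigma>0 6)(0 := 0))"
  have cl: "marks \<sigma>0 {}" "\<And>a. a \<notin> {7, 37} \<Longrightarrow> \<sigma>0 a = \<sigma> a" using clear_marks_correct[of \<sigma>] by (auto simp: \<sigma>0_def)
  have eq: "run (forest_prog cd) \<sigma> = (run (root_prog cd) ^^ n) \<sigma>1"
    unfolding forest_prog_def using nK M2 by (simp add: inp_0 \<pi> min_absorb1 \<sigma>1_def \<sigma>0_def)
  let ?d = "cd * L"
  let ?I = "\<lambda>j \<sigma>'. marks \<sigma>' {..<j} \<and> \<sigma>' 6 0 = j \<and> R (\<Prod>r<j. fst (tree x y ?d {..<r} r)) (\<sigma>' 4 0)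
     \<and> R (\<Prod>r<j. snd (tree x y ?d {..<r} r)) (\<sigma>' 5 0) \<and> (\<forall>a. a \<notin> {4, 5, 6, 7, 8, 9, 10, 11, 12, 13, 14, 37, 38} \<longrightarrow> \<sigma>' a = \<sigma> a)"
  have "?I n ((run (root_prog cd) ^^ n) \<sigma>1)"
  proof (rule funpow_invariant[where I = ?I and f = "run (root_prog cd)" and m = n])
    fix j \<sigma>'
    assume j: "j < n" and I: "?I j \<sigma>'"
    then have xy': "R x (\<sigma>' 2 0)" "R y (\<sigma>' 3 0)" using xy by simp_all
    have I': "marks \<sigma>' {..<j}" "\<sigma>' 6 0 = j" "R (\<Prod>r<j. fst (tree x y ?d {..<r} r)) (\<sigma>' 4 0)"
      "R (\<Prod>r<j. snd (tree x y ?d {..<r} r)) (\<sigma>' 5 0)"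
      "\<And>a. a \<notin> {4, 5, 6, 7, 8, 9, 10, 11, 12, 13, 14, 37, 38} \<Longrightarrow> \<sigma>' a = \<sigma> a" using I by simp_all
    note c = root_prog_correct[OF deg fuel I'(1,2) j I'(3,4) xy']
    have "run (root_prog cd) \<sigma>' a = \<sigma> a" if "a \<notin> {4, 5, 6, 7, 8, 9, 10, 11, 12, 13, 14, 37, 38}" for a
      using c I'(5)[OF that] that by simp
    then show "?I (Suc j) (run (root_prog cd) \<sigma>')" using c by (simp only: prod.lessThan_Suc) blast
  next
    show "?I 0 \<sigma>1" using cl rep_1[of B] by (simp add: \<sigma>1_def marks_def)
  qed
  then show ?thesis unfolding eq forest_def by simp
qed

end

section \<open>The main program\<close>

primrec fpow :: "fexp \<Rightarrow> nat \<Rightarrow> fexp" where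
  "fpow e 0 = Cst 1"
| "fpow e (Suc c) = Times e (fpow e c)"

lemma ev_fpow [simp]: "ev inp \<pi> \<sigma> (fpow e c) = ev inp \<pi> \<sigma> e ^ c"
  by (induction c) auto

definition eN :: fexp where "eN = Times (Par 2) (Par 2)"
definition eW :: fexp where "eW = Plus (Times eN eN) (Cst 1)"
definition eQ5 :: fexp where "eQ5 = fpow (Par 2) 5"
definition eY :: "nat \<Rightarrow> fexp" where "eY \<Delta> = Times (Cst (8 * \<Delta>)) eQ5"
definition ePlus :: fexp where "ePlus = fpow (Plus eN (var 17)) 2"
definition eMinus :: fexp where "eMinus = fpow (Plus eN (Minus (Par 1) (var 17))) 2"

text \<open>Registers from here on: 0 is the activity index; 2, 3 are the arguments and 4, 5 the
  result of \<open>forest_prog\<close>; 17 represents \<open>I\<close>; 18, 19, 20 are the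
  \<open>j\<close>-th powers of \<open>(q^2 + I)^2\<close>, \<open>(q^2 - I)^2\<close> and
  \<open>q^4 + 1\<close>; 21, 22 are the \<open>k\<close>-th powers of the last two, and 23, 24 the
  \<open>j\<close>-th powers of those; 15, 16 hold the real forest. The pairs 25/26, 27/28, 29/30
  are numerator and denominator of \<open>arc_sum\<close>, \<open>num_sum\<close> and
  \<open>den_sum\<close>.\<close>

definition powers_prog :: "nat \<Rightarrow> nat \<Rightarrow> fexp \<Rightarrow> fexp \<Rightarrow> fp" where
  "powers_prog a b e f = Then (set_var a (Cst 1)) (Then (set_var b (Cst 1))
     (Repeat (Input (Cst 1)) (Then (set_var a (Times (var a) e)) (set_var b (Times (var b) f)))))"

definition term_prog :: "nat \<Rightarrow> nat \<Rightarrow> fp" where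
  "term_prog cd \<Delta> = Then (set_var 2 (Times (var 0) (var 18))) (Then (set_var 3 (Times (eY \<Delta>) (var 20)))
     (Then (forest_prog cd)
     (Then (set_var 25 (Plus (Times (var 25) (Times (var 4) (var 24))) (Times (Times (var 5) (var 23)) (var 26))))
       (set_var 26 (Times (var 26) (Times (var 4) (var 24)))))))"

definition advance_prog :: fp where
  "advance_prog = Then (set_var 18 (Times (var 18) ePlus)) (Then (set_var 19 (Times (var 19) eMinus))
     (Then (set_var 20 (Times (var 20) eW)) (Then (set_var 23 (Times (var 23) (var 21))) (set_var 24 (Times (var 24) (var 22))))))"

text \<open>The condition is a disjunction by addition: the first summand is positive iff the index
  is at most \<open>q ^ 5\<close>, the second iff twice the residue in 38 is below the modulus,
  which is the test of \<open>rep_sign\<close>.\<close>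

definition arc_body :: "nat \<Rightarrow> nat \<Rightarrow> fp" where
  "arc_body cd \<Delta> = Then (set_var 38 (Plus (var 18) (var 19)))
     (Then (Cond (Plus (Minus (Plus eQ5 (Cst 1)) (var 0)) (Minus (Par 1) (Times (Cst 2) (var 38)))) (term_prog cd \<Delta>) Nop)
       advance_prog)"

definition arc_prog :: "nat \<Rightarrow> nat \<Rightarrow> nat \<Rightarrow> fp" where
  "arc_prog cd \<Delta> cJ = Then (powers_prog 21 22 eMinus eW) (Then (set_var 18 (Cst 1)) (Then (set_var 19 (Cst 1))
     (Then (set_var 20 (Cst 1)) (Then (set_var 23 (Cst 1)) (Then (set_var 24 (Cst 1))
     (Repeat (fpow (Par 2) cJ) (arc_body cd \<Delta>)))))))"

definition count_prog :: fp where
  "count_prog = Then (set_var 32 (Cst 0)) (Then (set_var 35 (Cst 0)) (Repeat (Input (Cst 0))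
     (Then (set_var 36 (Cst 0)) (Then (Repeat (var 35)
        (Then (set_var 32 (Plus (var 32) (Input (Plus (Cst 2) (Plus (Times (var 35) (Input (Cst 0))) (var 36))))))
          (set_var 36 (Plus (var 36) (Cst 1)))))
       (set_var 35 (Plus (var 35) (Cst 1)))))))"

definition real_prog :: "nat \<Rightarrow> nat \<Rightarrow> fp" where
  "real_prog cd \<Delta> = Then (set_var 0 (Plus (var 0) (Cst 1))) (Then (powers_prog 33 34 (var 0) (eY \<Delta>))
     (Then (set_var 2 (var 0)) (Then (set_var 3 (eY \<Delta>)) (Then (forest_prog cd)
     (Then (set_var 15 (var 4)) (Then (set_var 16 (var 5))
     (Then (set_var 29 (Plus (Times (var 29) (Times (var 34) (var 16))) (Times (Times (var 33) (var 15)) (var 30))))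
       (set_var 30 (Times (var 30) (Times (var 34) (var 16)))))))))))"

definition grid_body :: "nat \<Rightarrow> nat \<Rightarrow> nat \<Rightarrow> fp" where
  "grid_body cd \<Delta> cJ = Then (real_prog cd \<Delta>) (Then (set_var 25 (Cst 0)) (Then (set_var 26 (Cst 1))
     (Then (set_var 17 (Par 4)) (Then (arc_prog cd \<Delta> cJ) (Then (set_var 17 (Minus (Par 1) (Par 4))) (Then (arc_prog cd \<Delta> cJ)
     (Then (set_var 27 (Plus (Times (var 27) (Times (var 16) (var 26))) (Times (Times (var 15) (var 25)) (var 28))))
       (set_var 28 (Times (var 28) (Times (var 16) (var 26)))))))))))"

definition main_prog :: "nat \<Rightarrow> nat \<Rightarrow> nat \<Rightarrow> nat \<Rightarrow> nat \<Rightarrow> fp" where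
  "main_prog cd \<Delta> cJ cE \<Lambda> = Then count_prog
     (Then (Cond (Minus (Times (Cst 2) (var 32)) (Times (Cst cE) (Par 3)))
        (set_var 31 (Times (Cst (\<Lambda> * 8 * \<Delta>)) eQ5)) (set_var 31 eQ5))
     (Then (set_var 27 (Cst 0)) (Then (set_var 28 (Cst 1)) (Then (set_var 29 (Cst 0)) (Then (set_var 30 (Cst 1))
     (Then (set_var 0 (Cst 0)) (Then (Repeat (var 31) (grid_body cd \<Delta> cJ))
     (Then (set_var 39 (Times (var 27) (var 30)))
       (set_var 40 (Times (Times (Times (Cst 2) (fpow (Par 2) cJ)) (var 29)) (var 28)))))))))))"

locale algorithm = machine +
  fixes \<Delta> \<Lambda> cE cJ :: nat
  assumes deg: "\<And>v. v < n \<Longrightarrow> degree E v \<le> \<Delta>" and fuel: "dfs_time \<Delta> (cd * L) \<le> K"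
    and kK: "k \<le> K" and JK: "q ^ cJ \<le> K" and gK: "\<Lambda> * 8 * \<Delta> * q ^ 5 \<le> K" "q ^ 5 \<le> K" and nnK: "n * n \<le> K"
    and signM: "4 * ((q\<^sup>2)\<^sup>2 + 1) ^ (q ^ cJ) < M" and q1: "1 \<le> q"
begin

abbreviation "W \<equiv> (q\<^sup>2)\<^sup>2 + 1"
abbreviation "Y \<equiv> 8 * \<Delta> * q ^ 5"

lemma ev_eN: "ev inp \<pi> \<sigma> eN = q\<^sup>2" and ev_eW: "ev inp \<pi> \<sigma> eW = W" and ev_eQ5: "ev inp \<pi> \<sigma> eQ5 = q ^ 5"
  and ev_eY: "ev inp \<pi> \<sigma> (eY \<Delta>) = Y"
  by (simp_all add: eN_def eW_def eQ5_def eY_def \<pi> power2_eq_square)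

lemma R_ePlus: "R I (\<sigma> 17 0) \<Longrightarrow> R ((of_nat (q\<^sup>2) + I)\<^sup>2) (ev inp \<pi> \<sigma> ePlus)"
  unfolding ePlus_def ev_fpow ev.simps ev_eN by (intro rep_power rep_add rep_of_nat) simp

lemma R_eMinus: "R I (\<sigma> 17 0) \<Longrightarrow> \<sigma> 17 0 \<le> M \<Longrightarrow> R ((of_nat (q\<^sup>2) - I)\<^sup>2) (ev inp \<pi> \<sigma> eMinus)"
proof -
  assume "R I (\<sigma> 17 0)" "\<sigma> 17 0 \<le> M"
  then have "R (- I) (M - \<sigma> 17 0)" unfolding M by (rule rep_minus)
  then have "R ((of_nat (q\<^sup>2) + - I)\<^sup>2) (ev inp \<pi> \<sigma> eMinus)"
    unfolding eMinus_def ev_fpow ev.simps ev_eN by (intro rep_power rep_add rep_of_nat) (simp add: \<pi>)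
  then show ?thesis by simp
qed

lemma powers_prog_correct:
  assumes ab: "a \<noteq> b"
    and e: "\<And>\<sigma>'. (\<And>x. x \<noteq> a \<Longrightarrow> x \<noteq> b \<Longrightarrow> \<sigma>' x = \<sigma> x) \<Longrightarrow> R c (ev inp \<pi> \<sigma>' e)"
    and f: "\<And>\<sigma>'. (\<And>x. x \<noteq> a \<Longrightarrow> x \<noteq> b \<Longrightarrow> \<sigma>' x = \<sigma> x) \<Longrightarrow> R c' (ev inp \<pi> \<sigma>' f)"
  shows "R (c ^ k) (run (powers_prog a b e f) \<sigma> a 0) \<and> R (c' ^ k) (run (powers_prog a b e f) \<sigma> b 0)
    \<and> (\<forall>x. x \<noteq> a \<longrightarrow> x \<noteq> b \<longrightarrow> run (powers_prog a b e f) \<sigma> x = \<sigma> x)"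
proof -
  let ?f = "run (Then (set_var a (Times (var a) e)) (set_var b (Times (var b) f)))"
  let ?\<sigma> = "\<sigma>(a := (\<sigma> a)(0 := 1), b := (\<sigma> b)(0 := 1))"
  let ?I = "\<lambda>j \<sigma>'. R (c ^ j) (\<sigma>' a 0) \<and> R (c' ^ j) (\<sigma>' b 0) \<and> (\<forall>x. x \<noteq> a \<longrightarrow> x \<noteq> b \<longrightarrow> \<sigma>' x = \<sigma> x)"
  have "?I k ((?f ^^ k) ?\<sigma>)"
  proof (rule funpow_invariant[where I = ?I and f = ?f and m = k])
    fix j \<sigma>'
    assume I: "?I j \<sigma>'"
    define \<sigma>1 where "\<sigma>1 = run (set_var a (Times (var a) e)) \<sigma>'"
    have s1: "\<sigma>1 = \<sigma>'(a := (\<sigma>' a)(0 := \<sigma>' a 0 * ev inp \<pi> \<sigma>' e mod M))" by (simp add: \<sigma>1_def \<pi>)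
    have R1: "R (c ^ Suc j) (\<sigma>1 a 0)" unfolding s1 using rep_mult[of B c _ "c ^ j", OF e[of \<sigma>']] I by (simp add: mult.commute)
    have f1: "R c' (ev inp \<pi> \<sigma>1 f)" by (rule f) (use I s1 in auto)
    have R2: "R (c' ^ Suc j) (\<sigma>1 b 0 * ev inp \<pi> \<sigma>1 f mod M)" using rep_mult[OF f1, of "c' ^ j" "\<sigma>1 b 0"] I ab s1 by (simp add: mult.commute)
    have "?f \<sigma>' = \<sigma>1(b := (\<sigma>1 b)(0 := \<sigma>1 b 0 * ev inp \<pi> \<sigma>1 f mod M))" by (simp add: \<sigma>1_def \<pi>)
    then show "?I (Suc j) (?f \<sigma>')" using R1 R2 I ab s1 by simp
  qed (use ab rep_1[of B] in simp)
  moreover have "run (powers_prog a b e f) \<sigma> = (?f ^^ k) ?\<sigma>"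
    unfolding powers_prog_def using kK M2 ab by (simp add: inp_1 \<pi> min_absorb1)
  ultimately show ?thesis by simp
qed

lemma term_prog_correct:
  assumes "\<sigma> 0 0 = i" "R c (\<sigma> 18 0)" "R w (\<sigma> 20 0)" "R c' (\<sigma> 23 0)" "R w' (\<sigma> 24 0)" "R (snd a) (\<sigma> 25 0)" "R (fst a) (\<sigma> 26 0)"
    and t: "t = (let f = forest (of_nat i * c) (of_nat Y * w) (cd * L) in (snd f * c', fst f * w'))"
  shows "R (snd a * snd t + fst t * fst a) (run (term_prog cd \<Delta>) \<sigma> 25 0)" "R (fst a * snd t) (run (term_prog cd \<Delta>) \<sigma> 26 0)"
    "x \<notin> {2, 3, 4, 5, 6, 7, 8, 9, 10, 11, 12, 13, 14, 25, 26, 37, 38} \<Longrightarrow> run (term_prog cd \<Delta>) \<sigma> x = \<sigma> x"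
proof -
  define \<sigma>1 where "\<sigma>1 = \<sigma>(2 := (\<sigma> 2)(0 := i * \<sigma> 18 0 mod M), 3 := (\<sigma> 3)(0 := Y * \<sigma> 20 0 mod M))"
  define \<sigma>2 where "\<sigma>2 = run (forest_prog cd) \<sigma>1"
  have "R (of_nat i * c) (\<sigma>1 2 0)" "R (of_nat Y * w) (\<sigma>1 3 0)"
    unfolding \<sigma>1_def using rep_mult[OF rep_of_nat assms(2)] rep_mult[OF rep_of_nat assms(3)] by (simp_all del: of_nat_mult)
  note fp = forest_prog_correct[where \<sigma> = \<sigma>1 and x = "of_nat i * c" and y = "of_nat Y * w", OF deg fuel this, folded \<sigma>2_def]
  define f where "f = forest (of_nat i * c) (of_nat Y * w) (cd * L)"
  have t': "t = (snd f * c', fst f * w')" by (simp add: t f_def Let_def)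
  have same: "\<sigma>2 x = \<sigma> x" if "x \<notin> {2, 3, 4, 5, 6, 7, 8, 9, 10, 11, 12, 13, 14, 37, 38}" for x
    using fp that by (simp add: \<sigma>1_def)
  have s: "\<sigma>2 23 = \<sigma> 23" "\<sigma>2 24 = \<sigma> 24" "\<sigma>2 25 = \<sigma> 25" "\<sigma>2 26 = \<sigma> 26" by (simp_all add: same)
  have eq: "run (term_prog cd \<Delta>) \<sigma> = \<sigma>2(25 := (\<sigma> 25)(0 := (\<sigma> 25 0 * (\<sigma>2 4 0 * \<sigma> 24 0) + \<sigma>2 5 0 * \<sigma> 23 0 * \<sigma> 26 0) mod M),
      26 := (\<sigma> 26)(0 := \<sigma> 26 0 * (\<sigma>2 4 0 * \<sigma> 24 0) mod M))"
    unfolding term_prog_def using assms(1) by (simp add: ev_eY \<pi> \<sigma>1_def[symmetric] \<sigma>2_def[symmetric] s)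
  have f1: "R (fst f) (\<sigma>2 4 0)" "R (snd f) (\<sigma>2 5 0)" using fp by (simp_all add: f_def)
  show "R (snd a * snd t + fst t * fst a) (run (term_prog cd \<Delta>) \<sigma> 25 0)"
    unfolding eq t' using rep_add[OF rep_mult[OF assms(6) rep_mult[OF f1(1) assms(5)]] rep_mult[OF rep_mult[OF f1(2) assms(4)] assms(7)]] by simp
  show "R (fst a * snd t) (run (term_prog cd \<Delta>) \<sigma> 26 0)"
    unfolding eq t' using rep_mult[OF assms(7) rep_mult[OF f1(1) assms(5)]] by simp
  show "run (term_prog cd \<Delta>) \<sigma> x = \<sigma> x" if "x \<notin> {2, 3, 4, 5, 6, 7, 8, 9, 10, 11, 12, 13, 14, 25, 26, 37, 38}"
    unfolding eq using that same[of x] by simp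
qed

lemma advance_prog_correct:
  assumes "R I (\<sigma> 17 0)" "\<sigma> 17 0 \<le> M"
    and "R c (\<sigma> 18 0)" "R c1 (\<sigma> 19 0)" "R w (\<sigma> 20 0)" "R c2 (\<sigma> 23 0)" "R w2 (\<sigma> 24 0)" "R c3 (\<sigma> 21 0)" "R w3 (\<sigma> 22 0)"
  shows "R (c * (of_nat (q\<^sup>2) + I)\<^sup>2) (run advance_prog \<sigma> 18 0)" "R (c1 * (of_nat (q\<^sup>2) - I)\<^sup>2) (run advance_prog \<sigma> 19 0)"
    "R (w * of_nat W) (run advance_prog \<sigma> 20 0)" "R (c2 * c3) (run advance_prog \<sigma> 23 0)" "R (w2 * w3) (run advance_prog \<sigma> 24 0)"
    "x \<notin> {18, 19, 20, 23, 24} \<Longrightarrow> run advance_prog \<sigma> x = \<sigma> x"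
proof -
  have eq: "run advance_prog \<sigma> = \<sigma>(18 := (\<sigma> 18)(0 := \<sigma> 18 0 * ev inp \<pi> \<sigma> ePlus mod M), 19 := (\<sigma> 19)(0 := \<sigma> 19 0 * ev inp \<pi> \<sigma> eMinus mod M),
     20 := (\<sigma> 20)(0 := \<sigma> 20 0 * W mod M), 23 := (\<sigma> 23)(0 := \<sigma> 23 0 * \<sigma> 21 0 mod M), 24 := (\<sigma> 24)(0 := \<sigma> 24 0 * \<sigma> 22 0 mod M))"
    by (simp add: advance_prog_def ePlus_def eMinus_def ev_eN ev_eW \<pi>)
  note m = rep_mult[OF assms(3) R_ePlus[where \<sigma> = \<sigma>, OF assms(1)]] rep_mult[OF assms(4) R_eMinus[where \<sigma> = \<sigma>, OF assms(1,2)]] rep_mult[OF assms(5) rep_of_nat[of B W]]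
    rep_mult[OF assms(6,8)] rep_mult[OF assms(7,9)]
  show "R (c * (of_nat (q\<^sup>2) + I)\<^sup>2) (run advance_prog \<sigma> 18 0)" "R (c1 * (of_nat (q\<^sup>2) - I)\<^sup>2) (run advance_prog \<sigma> 19 0)"
    "R (w * of_nat W) (run advance_prog \<sigma> 20 0)" "R (c2 * c3) (run advance_prog \<sigma> 23 0)" "R (w2 * w3) (run advance_prog \<sigma> 24 0)"
    unfolding eq using m by (simp_all del: of_nat_add of_nat_power of_nat_mult)
  show "run advance_prog \<sigma> x = \<sigma> x" if "x \<notin> {18, 19, 20, 23, 24}" unfolding eq using that by simp
qed

text \<open>The two conjugate powers add up to twice the real part of
  \<open>zeta (q\<^sup>2) ^ j\<close> times the positive number \<open>W ^ j\<close>, whichever sign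
  \<open>I\<close> has. \<open>signM\<close> keeps this sum in the range where the residue reveals
  its sign, so membership in \<open>arc\<close> is decided exactly.\<close>

lemma arc_test:
  assumes I: "I = \<i> \<or> I = - \<i>" and j: "j < q ^ cJ"
    and c: "R (((of_nat (q\<^sup>2) + I)\<^sup>2) ^ j) m" "R (((of_nat (q\<^sup>2) - I)\<^sup>2) ^ j) m'"
  shows "(Suc (q ^ 5) - i + (M - 2 * ((m + m') mod M)) \<noteq> 0) \<longleftrightarrow> j \<in> arc q i"
proof -
  define u where "u = (of_nat (q\<^sup>2) + \<i>)\<^sup>2"
  define r where "r = 2 * Re (u ^ j)"
  have W0: "real W > 0" by (simp only: of_nat_0_less_iff)
  have cu: "(of_nat (q\<^sup>2) - \<i>)\<^sup>2 = cnj u" by (simp add: u_def)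
  have "((of_nat (q\<^sup>2) + I)\<^sup>2) ^ j + ((of_nat (q\<^sup>2) - I)\<^sup>2) ^ j = u ^ j + cnj (u ^ j)"
    using I cu by (auto simp: u_def simp del: of_nat_power)
  also have "\<dots> = of_real r" by (simp only: complex_add_cnj r_def)
  finally have rr: "R (of_real r) ((m + m') mod M)" using rep_add[OF c] by simp
  have z: "u = of_real (real W) * zeta (q\<^sup>2)"
  proof -
    have "(of_nat W :: complex) \<noteq> 0" by (metis Suc_eq_plus1 nat.simps(3) of_nat_eq_0_iff)
    then show ?thesis by (simp add: u_def zeta_def del: of_nat_add of_nat_power)
  qed
  have re: "Re (u ^ j) = real W ^ j * Re (zeta (q\<^sup>2) ^ j)"
    unfolding z power_mult_distrib by (simp del: of_nat_add of_nat_power add: Re_complex_of_real flip: of_real_power)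
  have "\<bar>Re (u ^ j)\<bar> \<le> cmod (u ^ j)" by (rule abs_Re_le_cmod)
  also have "\<dots> = real W ^ j"
    unfolding z power_mult_distrib norm_mult norm_power norm_of_real abs_of_pos[OF W0]
    using norm_zeta[of "q\<^sup>2"] q1 by simp
  also have "\<dots> \<le> real W ^ (q ^ cJ)" using j by (intro power_increasing) auto
  finally have "2 * \<bar>r\<bar> \<le> 4 * real W ^ (q ^ cJ)" by (simp add: r_def)
  also have "\<dots> < real M" using signM by (metis of_nat_less_iff of_nat_mult of_nat_numeral of_nat_power)
  finally have small: "2 * \<bar>r\<bar> < real (B\<^sup>2 + 1)" by (simp add: M)
  have "(m + m') mod M < B\<^sup>2 + 1" using M by simp
  from rep_sign[OF rr this small] have "2 * ((m + m') mod M) < M \<longleftrightarrow> 0 \<le> r" by (simp only: M)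
  also have "0 \<le> r \<longleftrightarrow> 0 \<le> Re (zeta (q\<^sup>2) ^ j)"
  proof -
    have "0 \<le> 2 * (p * x) \<longleftrightarrow> 0 \<le> x" if "p > 0" for p x :: real using that by (simp add: zero_le_mult_iff)
    from this[OF zero_less_power[OF W0]] show ?thesis unfolding r_def re .
  qed
  finally have "2 * ((m + m') mod M) < M \<longleftrightarrow> 0 \<le> Re (zeta (q\<^sup>2) ^ j)" .
  then show ?thesis unfolding arc_def mem_Collect_eq by auto
qed


lemma arc_prog_correct:
  assumes \<sigma>: "\<sigma> 0 0 = i" "R I (\<sigma> 17 0)" "\<sigma> 17 0 \<le> M" "R (snd a) (\<sigma> 25 0)" "R (fst a) (\<sigma> 26 0)" and I: "I = \<i> \<or> I = - \<i>"
    and b: "b = accum a (\<lambda>j. j \<in> arc q i) (arc_term \<Delta> q (cd * L) k i I) (q ^ cJ)"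
  shows "R (snd b) (run (arc_prog cd \<Delta> cJ) \<sigma> 25 0)" "R (fst b) (run (arc_prog cd \<Delta> cJ) \<sigma> 26 0)"
    "x \<notin> {2, 3, 4, 5, 6, 7, 8, 9, 10, 11, 12, 13, 14, 18, 19, 20, 21, 22, 23, 24, 25, 26, 37, 38} \<Longrightarrow> run (arc_prog cd \<Delta> cJ) \<sigma> x = \<sigma> x"
proof -
  let ?c = "(of_nat (q\<^sup>2) + I)\<^sup>2" and ?c' = "(of_nat (q\<^sup>2) - I)\<^sup>2"
  let ?T = "{2, 3, 4, 5, 6, 7, 8, 9, 10, 11, 12, 13, 14, 18, 19, 20, 21, 22, 23, 24, 25, 26, 37, 38} :: nat set"
  let ?t = "arc_term \<Delta> q (cd * L) k i I"
  let ?a = "accum a (\<lambda>j. j \<in> arc q i) ?t"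
  define \<sigma>1 where "\<sigma>1 = run (powers_prog 21 22 eMinus eW) \<sigma>"
  have e: "R ?c' (ev inp \<pi> \<sigma>' eMinus)" if "\<And>x. x \<noteq> 21 \<Longrightarrow> x \<noteq> 22 \<Longrightarrow> \<sigma>' x = \<sigma> x" for \<sigma>'
    by (rule R_eMinus) (use that[of 17] \<sigma> in simp_all)
  have f: "R (of_nat W) (ev inp \<pi> \<sigma>' eW)" for \<sigma>' unfolding ev_eW by (rule rep_of_nat)
  have "R (?c' ^ k) (\<sigma>1 21 0) \<and> R (of_nat W ^ k) (\<sigma>1 22 0) \<and> (\<forall>x. x \<noteq> 21 \<longrightarrow> x \<noteq> 22 \<longrightarrow> \<sigma>1 x = \<sigma> x)"
    unfolding \<sigma>1_def by (rule powers_prog_correct[OF _ e f]) simp_all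
  then have p: "R (?c' ^ k) (\<sigma>1 21 0)" "R (of_nat W ^ k) (\<sigma>1 22 0)" "\<And>x. x \<noteq> 21 \<Longrightarrow> x \<noteq> 22 \<Longrightarrow> \<sigma>1 x = \<sigma> x" by blast+
  define \<sigma>2 where "\<sigma>2 = \<sigma>1(18 := (\<sigma>1 18)(0 := 1), 19 := (\<sigma>1 19)(0 := 1), 20 := (\<sigma>1 20)(0 := 1), 23 := (\<sigma>1 23)(0 := 1), 24 := (\<sigma>1 24)(0 := 1))"
  let ?f = "run (arc_body cd \<Delta>)"
  have eq: "run (arc_prog cd \<Delta> cJ) \<sigma> = (?f ^^ (q ^ cJ)) \<sigma>2"
    unfolding arc_prog_def using JK M2 by (simp add: \<sigma>1_def \<sigma>2_def \<pi> min_absorb1)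
  let ?I = "\<lambda>j \<sigma>'. R (?c ^ j) (\<sigma>' 18 0) \<and> R (?c' ^ j) (\<sigma>' 19 0) \<and> R (of_nat W ^ j) (\<sigma>' 20 0)
    \<and> R ((?c' ^ k) ^ j) (\<sigma>' 23 0) \<and> R ((of_nat W ^ k) ^ j) (\<sigma>' 24 0) \<and> R (snd (?a j)) (\<sigma>' 25 0) \<and> R (fst (?a j)) (\<sigma>' 26 0)
    \<and> \<sigma>' 21 = \<sigma>1 21 \<and> \<sigma>' 22 = \<sigma>1 22 \<and> (\<forall>x. x \<notin> ?T \<longrightarrow> \<sigma>' x = \<sigma> x)"
  have "?I (q ^ cJ) ((?f ^^ (q ^ cJ)) \<sigma>2)"
  proof (rule funpow_invariant[where I = ?I and f = ?f and m = "q ^ cJ"])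
    show "?I 0 \<sigma>2" using \<sigma> p rep_1[of B] by (simp add: \<sigma>2_def)
  next
    fix j \<sigma>'
    assume j: "j < q ^ cJ" and "?I j \<sigma>'"
    then have i: "R (?c ^ j) (\<sigma>' 18 0)" "R (?c' ^ j) (\<sigma>' 19 0)" "R (of_nat W ^ j) (\<sigma>' 20 0)"
      "R ((?c' ^ k) ^ j) (\<sigma>' 23 0)" "R ((of_nat W ^ k) ^ j) (\<sigma>' 24 0)" "R (snd (?a j)) (\<sigma>' 25 0)" "R (fst (?a j)) (\<sigma>' 26 0)"
      "\<sigma>' 21 = \<sigma>1 21" "\<sigma>' 22 = \<sigma>1 22" "\<And>x. x \<notin> ?T \<Longrightarrow> \<sigma>' x = \<sigma> x" by blast+
    define \<sigma>3 where "\<sigma>3 = \<sigma>'(38 := (\<sigma>' 38)(0 := (\<sigma>' 18 0 + \<sigma>' 19 0) mod M))"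
    have s3: "\<sigma>3 x = \<sigma>' x" if "x \<noteq> 38" for x using that by (simp add: \<sigma>3_def)
    define \<sigma>4 where "\<sigma>4 = (if j \<in> arc q i then run (term_prog cd \<Delta>) \<sigma>3 else \<sigma>3)"
    have i0: "\<sigma>3 0 0 = i" using s3[of 0] i(10)[of 0] \<sigma>(1) by simp
    have test: "ev inp \<pi> \<sigma>3 (Plus (Minus (Plus eQ5 (Cst 1)) (var 0)) (Minus (Par 1) (Times (Cst 2) (var 38)))) \<noteq> 0 \<longleftrightarrow> j \<in> arc q i"
      using arc_test[OF I j i(1,2), of i] i0 by (simp add: ev_eQ5 \<pi> \<sigma>3_def del: add_is_0 diff_is_0_eq)
    have body: "?f \<sigma>' = run advance_prog \<sigma>4"
    proof -
      have "run (set_var 38 (Plus (var 18) (var 19))) \<sigma>' = \<sigma>3" by (simp add: \<sigma>3_def \<pi>)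
      moreover have "run (Cond (Plus (Minus (Plus eQ5 (Cst 1)) (var 0)) (Minus (Par 1) (Times (Cst 2) (var 38)))) (term_prog cd \<Delta>) Nop) \<sigma>3 = \<sigma>4"
        unfolding \<sigma>4_def den.simps test ..
      ultimately show ?thesis unfolding arc_body_def by (simp only: den.simps)
    qed
    have i3: "R (?c ^ j) (\<sigma>3 18 0)" "R (of_nat W ^ j) (\<sigma>3 20 0)" "R ((?c' ^ k) ^ j) (\<sigma>3 23 0)" "R ((of_nat W ^ k) ^ j) (\<sigma>3 24 0)"
      "R (snd (?a j)) (\<sigma>3 25 0)" "R (fst (?a j)) (\<sigma>3 26 0)" using i by (simp_all add: s3)
    have t: "?t j = (let f = forest (of_nat i * ?c ^ j) (of_nat Y * of_nat W ^ j) (cd * L) in (snd f * (?c' ^ k) ^ j, fst f * (of_nat W ^ k) ^ j))"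
      by (simp only: arc_term_def)
    note tp = term_prog_correct[where \<sigma> = \<sigma>3 and i = i and a = "?a j", OF i0 i3 t]
    have acc4: "R (snd (?a (Suc j))) (\<sigma>4 25 0) \<and> R (fst (?a (Suc j))) (\<sigma>4 26 0)"
      using tp(1,2) i3(5,6) by (cases "j \<in> arc q i") (simp_all add: \<sigma>4_def Let_def del: of_nat_add of_nat_power of_nat_mult)
    have s4: "\<sigma>4 x = \<sigma>' x" if "x \<notin> {2, 3, 4, 5, 6, 7, 8, 9, 10, 11, 12, 13, 14, 25, 26, 37, 38}" for x
      using tp(3)[OF that] s3[of x] that by (simp add: \<sigma>4_def)
    have r17: "R I (\<sigma>4 17 0)" "\<sigma>4 17 0 \<le> M" using s4[of 17] i(10)[of 17] \<sigma>(2,3) by simp_all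
    have i4: "R (?c ^ j) (\<sigma>4 18 0)" "R (?c' ^ j) (\<sigma>4 19 0)" "R (of_nat W ^ j) (\<sigma>4 20 0)"
      "R ((?c' ^ k) ^ j) (\<sigma>4 23 0)" "R ((of_nat W ^ k) ^ j) (\<sigma>4 24 0)" "R (?c' ^ k) (\<sigma>4 21 0)" "R (of_nat W ^ k) (\<sigma>4 22 0)"
      using i p(1,2) by (simp_all add: s4 del: of_nat_add of_nat_power)
    note ad = advance_prog_correct[where \<sigma> = \<sigma>4, OF r17 i4]
    have "run advance_prog \<sigma>4 x = \<sigma> x" if "x \<notin> ?T" for x
      using ad(6)[of x] s4[of x] i(10)[of x] that by simp
    moreover have "run advance_prog \<sigma>4 21 = \<sigma>1 21" "run advance_prog \<sigma>4 22 = \<sigma>1 22" "run advance_prog \<sigma>4 25 = \<sigma>4 25" "run advance_prog \<sigma>4 26 = \<sigma>4 26"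
      using i(8,9) by (simp_all add: ad(6) s4)
    ultimately show "?I (Suc j) (?f \<sigma>')" unfolding body power_Suc2 using ad(1-5) acc4 by (simp only:) blast
  qed
  then show "R (snd b) (run (arc_prog cd \<Delta> cJ) \<sigma> 25 0)" "R (fst b) (run (arc_prog cd \<Delta> cJ) \<sigma> 26 0)"
    "x \<notin> ?T \<Longrightarrow> run (arc_prog cd \<Delta> cJ) \<sigma> x = \<sigma> x"
    unfolding eq b by blast+
qed

lemma card_E_eq: "card E = (\<Sum>v<n. card {u. u < v \<and> {v, u} \<in> E})"
proof -
  have "E = (\<Union>v<n. (\<lambda>u. {v, u}) ` {u. u < v \<and> {v, u} \<in> E})"
  proof (intro equalityI subsetI)
    fix e assume e: "e \<in> E"
    then obtain a b where ab: "e = {a, b}" "a \<noteq> b" using edge_card by (meson card_2_iff)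
    define u v where "u = min a b" and "v = max a b"
    have uv: "e = {v, u}" "u < v" using ab by (auto simp: u_def v_def min_def max_def)
    then have "v < n" using edge_lt[of v u] e by simp
    then show "e \<in> (\<Union>v<n. (\<lambda>u. {v, u}) ` {u. u < v \<and> {v, u} \<in> E})" using uv e by auto
  qed auto
  then have "card E = card (\<Union>v<n. (\<lambda>u. {v, u}) ` {u. u < v \<and> {v, u} \<in> E})" by simp
  also have "\<dots> = (\<Sum>v<n. card ((\<lambda>u. {v, u}) ` {u. u < v \<and> {v, u} \<in> E}))"
    by (rule card_UN_disjoint) (auto simp: doubleton_eq_iff)
  also have "\<dots> = (\<Sum>v<n. card {u. u < v \<and> {v, u} \<in> E})"
    by (intro sum.cong refl card_image inj_on_doubleton)
  finally show ?thesis .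
qed

lemma count_prog_correct:
  "run count_prog \<sigma> 32 0 = card E \<and> (\<forall>x. x \<notin> {32, 35, 36} \<longrightarrow> run count_prog \<sigma> x = \<sigma> x)"
proof -
  define N where "N v u = card {w. w < u \<and> {v, w} \<in> E}" for v u
  have N_le: "N v u \<le> u" for v u unfolding N_def using card_mono[of "{..<u}" "{w. w < u \<and> {v, w} \<in> E}"] by auto
  have N_Suc: "N v (Suc u) = N v u + of_bool ({v, u} \<in> E)" for v u
  proof -
    have "{w. w < Suc u \<and> {v, w} \<in> E} = (if {v, u} \<in> E then insert u {w. w < u \<and> {v, w} \<in> E} else {w. w < u \<and> {v, w} \<in> E})"
      by (auto simp: less_Suc_eq)
    then show ?thesis by (simp add: N_def)
  qed
  let ?g = "run (Then (set_var 32 (Plus (var 32) (Input (Plus (Cst 2) (Plus (Times (var 35) (Input (Cst 0))) (var 36))))))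
          (set_var 36 (Plus (var 36) (Cst 1))))"
  let ?f = "run (Then (set_var 36 (Cst 0)) (Then (Repeat (var 35)
        (Then (set_var 32 (Plus (var 32) (Input (Plus (Cst 2) (Plus (Times (var 35) (Input (Cst 0))) (var 36))))))
          (set_var 36 (Plus (var 36) (Cst 1)))))
       (set_var 35 (Plus (var 35) (Cst 1)))))"
  let ?I = "\<lambda>v \<sigma>'. \<sigma>' 35 0 = v \<and> \<sigma>' 32 0 = (\<Sum>w<v. N w w) \<and> (\<forall>x. x \<notin> {32, 35, 36} \<longrightarrow> \<sigma>' x = \<sigma> x)"
  let ?\<sigma> = "\<sigma>(32 := (\<sigma> 32)(0 := 0), 35 := (\<sigma> 35)(0 := 0))"
  have "?I n ((?f ^^ n) ?\<sigma>)"
  proof (rule funpow_invariant[where I = ?I and f = ?f and m = n])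
    fix v \<sigma>'
    assume v: "v < n" and I: "?I v \<sigma>'"
    let ?J = "\<lambda>u \<sigma>''. \<sigma>'' 36 0 = u \<and> \<sigma>'' 35 0 = v \<and> \<sigma>'' 32 0 = (\<Sum>w<v. N w w) + N v u \<and> (\<forall>x. x \<notin> {32, 35, 36} \<longrightarrow> \<sigma>'' x = \<sigma> x)"
    have vM: "Suc v < M" using v nM by simp
    have J: "?J v ((?g ^^ v) (\<sigma>'(36 := (\<sigma>' 36)(0 := 0))))"
    proof (rule funpow_invariant[where I = ?J and f = ?g and m = v])
      fix u \<sigma>''
      assume u: "u < v" and J: "?J u \<sigma>''"
      have "(\<Sum>w<v. N w w) \<le> (\<Sum>w<v. n)" using N_le v by (intro sum_mono) (meson le_trans less_imp_le lessThan_iff order_less_trans)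
      also have "\<dots> = v * n" by simp
      finally have "(\<Sum>w<v. N w w) + N v (Suc u) \<le> v * n + n" using N_le[of v "Suc u"] u v by linarith
      also have "\<dots> \<le> n * n" using v mult_le_mono1[of "Suc v" n n] by simp
      finally have lt: "(\<Sum>w<v. N w w) + N v (Suc u) < M" using nnK KM by linarith
      have a: "inp (Suc (Suc (v * n + u))) = of_bool ({v, u} \<in> E)" using adj[of v u] u v by simp
      have lt': "((\<Sum>w<v. N w w) + N v u + of_bool ({v, u} \<in> E)) mod M = (\<Sum>w<v. N w w) + N v (Suc u)"
        using lt by (simp add: N_Suc add.assoc del: sum.lessThan_Suc)
      have uM: "Suc u mod M = Suc u" using u vM by simp
      have "?g \<sigma>'' = \<sigma>''(32 := (\<sigma>'' 32)(0 := (\<Sum>w<v. N w w) + N v (Suc u)), 36 := (\<sigma>'' 36)(0 := Suc u))"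
        using J a lt' uM by (simp add: inp_0 \<pi>)
      then show "?J (Suc u) (?g \<sigma>'')" using J by simp
    next
      show "?J 0 (\<sigma>'(36 := (\<sigma>' 36)(0 := 0)))" using I by (simp add: N_def)
    qed
    have "min v K = v" using v nK by simp
    then have "?f \<sigma>' = (let \<sigma>'' = (?g ^^ v) (\<sigma>'(36 := (\<sigma>' 36)(0 := 0))) in \<sigma>''(35 := (\<sigma>'' 35)(0 := (\<sigma>'' 35 0 + 1) mod M)))"
      using I by (simp add: Let_def \<pi>)
    then show "?I (Suc v) (?f \<sigma>')" using J vM by (simp add: Let_def del: funpow.simps)
  next
    show "?I 0 ?\<sigma>" by simp
  qed
  moreover have "run count_prog \<sigma> = (?f ^^ n) ?\<sigma>"
    unfolding count_prog_def using nK by (simp add: inp_0 \<pi> min_absorb1)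
  ultimately show ?thesis unfolding card_E_eq N_def by simp
qed

end

context algorithm
begin

lemma real_prog_correct:
  assumes \<sigma>: "\<sigma> 0 0 = j" "Suc j \<le> K" "R (snd a) (\<sigma> 29 0)" "R (fst a) (\<sigma> 30 0)"
    and f: "f = real_forest \<Delta> q (cd * L) (Suc j)"
  shows "run (real_prog cd \<Delta>) \<sigma> 0 0 = Suc j" "R (fst f) (run (real_prog cd \<Delta>) \<sigma> 15 0)" "R (snd f) (run (real_prog cd \<Delta>) \<sigma> 16 0)"
    "R (snd a * (of_nat Y ^ k * snd f) + (of_nat (Suc j) ^ k * fst f) * fst a) (run (real_prog cd \<Delta>) \<sigma> 29 0)"
    "R (fst a * (of_nat Y ^ k * snd f)) (run (real_prog cd \<Delta>) \<sigma> 30 0)"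
    "x \<notin> {0, 2, 3, 4, 5, 6, 7, 8, 9, 10, 11, 12, 13, 14, 15, 16, 29, 30, 33, 34, 37, 38} \<Longrightarrow> run (real_prog cd \<Delta>) \<sigma> x = \<sigma> x"
proof -
  let ?pp = "powers_prog 33 34 (var 0) (eY \<Delta>)"
  define \<sigma>1 where "\<sigma>1 = \<sigma>(0 := (\<sigma> 0)(0 := Suc j))"
  define \<sigma>2 where "\<sigma>2 = run ?pp \<sigma>1"
  define \<sigma>3 where "\<sigma>3 = \<sigma>2(2 := (\<sigma>2 2)(0 := Suc j mod M), 3 := (\<sigma>2 3)(0 := Y mod M))"
  define \<sigma>4 where "\<sigma>4 = run (forest_prog cd) \<sigma>3"
  have jM: "Suc j < M" using \<sigma>(2) KM by simp
  have e: "R (of_nat (Suc j)) (ev inp \<pi> \<sigma>' (var 0))" if "\<And>x. x \<noteq> 33 \<Longrightarrow> x \<noteq> 34 \<Longrightarrow> \<sigma>' x = \<sigma>1 x" for \<sigma>'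
    using that[of 0] rep_of_nat[of B "Suc j"] by (simp add: \<sigma>1_def del: of_nat_Suc)
  have e': "R (of_nat Y) (ev inp \<pi> \<sigma>' (eY \<Delta>))" for \<sigma>' unfolding ev_eY by (rule rep_of_nat)
  have "R (of_nat (Suc j) ^ k) (\<sigma>2 33 0) \<and> R (of_nat Y ^ k) (\<sigma>2 34 0) \<and> (\<forall>x. x \<noteq> 33 \<longrightarrow> x \<noteq> 34 \<longrightarrow> \<sigma>2 x = \<sigma>1 x)"
    unfolding \<sigma>2_def by (rule powers_prog_correct[OF _ e e']) simp_all
  then have p: "R (of_nat (Suc j) ^ k) (\<sigma>2 33 0)" "R (of_nat Y ^ k) (\<sigma>2 34 0)" "\<And>x. x \<noteq> 33 \<Longrightarrow> x \<noteq> 34 \<Longrightarrow> \<sigma>2 x = \<sigma>1 x" by blast+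
  have "R (of_nat (Suc j)) (\<sigma>3 2 0)" "R (of_nat Y) (\<sigma>3 3 0)"
    unfolding \<sigma>3_def using rep_of_nat[of B "Suc j"] rep_of_nat[of B Y] by (simp_all del: of_nat_Suc of_nat_mult of_nat_power)
  note fp = forest_prog_correct[where \<sigma> = \<sigma>3 and x = "of_nat (Suc j)" and y = "of_nat Y", OF deg fuel this, folded \<sigma>4_def real_forest_def, folded f]
  have s4: "\<sigma>4 x = \<sigma>2 x" if "x \<notin> {2, 3, 4, 5, 6, 7, 8, 9, 10, 11, 12, 13, 14, 37, 38}" for x
    using fp that by (simp add: \<sigma>3_def)
  have s: "\<sigma>4 x = \<sigma> x" if "x \<notin> {0, 2, 3, 4, 5, 6, 7, 8, 9, 10, 11, 12, 13, 14, 33, 34, 37, 38}" for x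
    using s4[of x] p(3)[of x] that by (simp add: \<sigma>1_def)
  have s34: "\<sigma>4 33 = \<sigma>2 33" "\<sigma>4 34 = \<sigma>2 34" "\<sigma>4 29 = \<sigma> 29" "\<sigma>4 30 = \<sigma> 30"
    using s4[of 33] s4[of 34] s[of 29] s[of 30] by simp_all
  have s0: "\<sigma>4 0 = \<sigma>1 0" using s4[of 0] p(3)[of 0] by simp
  have r15: "R (fst f) (\<sigma>4 4 0)" "R (snd f) (\<sigma>4 5 0)" using fp by blast+
  have s2: "\<sigma>2 0 0 = Suc j" using p(3)[of 0] by (simp add: \<sigma>1_def)
  have eq: "run (real_prog cd \<Delta>) \<sigma> = \<sigma>4(15 := (\<sigma>4 15)(0 := \<sigma>4 4 0 mod M), 16 := (\<sigma>4 16)(0 := \<sigma>4 5 0 mod M),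
      29 := (\<sigma> 29)(0 := (\<sigma> 29 0 * (\<sigma>2 34 0 * (\<sigma>4 5 0 mod M)) + \<sigma>2 33 0 * (\<sigma>4 4 0 mod M) * \<sigma> 30 0) mod M),
      30 := (\<sigma> 30)(0 := \<sigma> 30 0 * (\<sigma>2 34 0 * (\<sigma>4 5 0 mod M)) mod M))"
  proof -
    have 1: "run (set_var 0 (Plus (var 0) (Cst 1))) \<sigma> = \<sigma>1" using \<sigma>(1) jM by (simp add: \<sigma>1_def \<pi>)
    have 2: "run (Then (set_var 2 (var 0)) (set_var 3 (eY \<Delta>))) \<sigma>2 = \<sigma>3" using s2 by (simp add: \<sigma>3_def ev_eY \<pi>)
    have "run (real_prog cd \<Delta>) \<sigma> = run (Then (set_var 15 (var 4)) (Then (set_var 16 (var 5))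
     (Then (set_var 29 (Plus (Times (var 29) (Times (var 34) (var 16))) (Times (Times (var 33) (var 15)) (var 30))))
       (set_var 30 (Times (var 30) (Times (var 34) (var 16))))))) \<sigma>4"
      unfolding real_prog_def using 1 2 unfolding den.simps(3) \<sigma>4_def \<sigma>2_def by (simp only:)
    then show ?thesis using s34 by (simp add: \<pi>)
  qed
  have m: "R (fst f) (\<sigma>4 4 0 mod M)" "R (snd f) (\<sigma>4 5 0 mod M)" using r15 by simp_all
  show "run (real_prog cd \<Delta>) \<sigma> 0 0 = Suc j" unfolding eq using s0 by (simp add: \<sigma>1_def)
  show "R (fst f) (run (real_prog cd \<Delta>) \<sigma> 15 0)" "R (snd f) (run (real_prog cd \<Delta>) \<sigma> 16 0)"
    unfolding eq using m by simp_all
  have "R (snd a * (of_nat Y ^ k * snd f) + (of_nat (Suc j) ^ k * fst f) * fst a)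
      (\<sigma> 29 0 * (\<sigma>2 34 0 * (\<sigma>4 5 0 mod M)) + \<sigma>2 33 0 * (\<sigma>4 4 0 mod M) * \<sigma> 30 0)"
    by (intro rep_add rep_mult \<sigma> p m)
  then show "R (snd a * (of_nat Y ^ k * snd f) + (of_nat (Suc j) ^ k * fst f) * fst a) (run (real_prog cd \<Delta>) \<sigma> 29 0)"
    unfolding eq by simp
  have "R (fst a * (of_nat Y ^ k * snd f)) (\<sigma> 30 0 * (\<sigma>2 34 0 * (\<sigma>4 5 0 mod M)))"
    by (intro rep_mult \<sigma> p m)
  then show "R (fst a * (of_nat Y ^ k * snd f)) (run (real_prog cd \<Delta>) \<sigma> 30 0)" unfolding eq by simp
  show "run (real_prog cd \<Delta>) \<sigma> x = \<sigma> x" if "x \<notin> {0, 2, 3, 4, 5, 6, 7, 8, 9, 10, 11, 12, 13, 14, 15, 16, 29, 30, 33, 34, 37, 38}"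
    unfolding eq using that s[of x] by simp
qed

lemma grid_body_correct:
  assumes \<sigma>: "\<sigma> 0 0 = j" "Suc j \<le> K" "R (snd a) (\<sigma> 27 0)" "R (fst a) (\<sigma> 28 0)" "R (snd b) (\<sigma> 29 0)" "R (fst b) (\<sigma> 30 0)"
    and f: "f = real_forest \<Delta> q (cd * L) (Suc j)" and s: "s = arc_sum \<Delta> q (cd * L) (q ^ cJ) k (Suc j)"
  shows "run (grid_body cd \<Delta> cJ) \<sigma> 0 0 = Suc j"
    "R (snd a * (snd f * fst s) + (fst f * snd s) * fst a) (run (grid_body cd \<Delta> cJ) \<sigma> 27 0)"
    "R (fst a * (snd f * fst s)) (run (grid_body cd \<Delta> cJ) \<sigma> 28 0)"
    "R (snd b * (of_nat Y ^ k * snd f) + (of_nat (Suc j) ^ k * fst f) * fst b) (run (grid_body cd \<Delta> cJ) \<sigma> 29 0)"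
    "R (fst b * (of_nat Y ^ k * snd f)) (run (grid_body cd \<Delta> cJ) \<sigma> 30 0)"
proof -
  define \<sigma>1 where "\<sigma>1 = run (real_prog cd \<Delta>) \<sigma>"
  note rp = real_prog_correct[where \<sigma> = \<sigma> and a = b, OF \<sigma>(1,2,5,6) f, folded \<sigma>1_def]
  have "B \<le> B * B" by simp
  then have BM: "B < M" unfolding M power2_eq_square by linarith
  have Bm: "B mod M = B" "(M - B) mod M = M - B \<or> B = 0" using BM by auto
  define \<sigma>2 where "\<sigma>2 = \<sigma>1(25 := (\<sigma>1 25)(0 := 0), 26 := (\<sigma>1 26)(0 := 1), 17 := (\<sigma>1 17)(0 := B))"
  define \<sigma>3 where "\<sigma>3 = run (arc_prog cd \<Delta> cJ) \<sigma>2"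
  define \<sigma>4 where "\<sigma>4 = \<sigma>3(17 := (\<sigma>3 17)(0 := (M - B) mod M))"
  define \<sigma>5 where "\<sigma>5 = run (arc_prog cd \<Delta> cJ) \<sigma>4"
  let ?T = "{2, 3, 4, 5, 6, 7, 8, 9, 10, 11, 12, 13, 14, 18, 19, 20, 21, 22, 23, 24, 25, 26, 37, 38} :: nat set"
  have h2: "\<sigma>2 0 0 = Suc j" "R \<i> (\<sigma>2 17 0)" "\<sigma>2 17 0 \<le> M" "R (snd (1 :: complex, 0 :: complex)) (\<sigma>2 25 0)" "R (fst (1 :: complex, 0 :: complex)) (\<sigma>2 26 0)"
    using rp(1) rep_i[of B] BM rep_0[of B] rep_1[of B] by (simp_all add: \<sigma>2_def)
  let ?s1 = "accum (1, 0) (\<lambda>j'. j' \<in> arc q (Suc j)) (arc_term \<Delta> q (cd * L) k (Suc j) \<i>) (q ^ cJ)"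
  note a1 = arc_prog_correct[where \<sigma> = \<sigma>2 and a = "(1, 0)", OF h2 _ refl, folded \<sigma>3_def, simplified]
  have s3: "\<sigma>3 x = \<sigma>2 x" if "x \<notin> ?T" for x using a1(3) that by simp
  \<comment> \<open>The second run on the same circle uses \<open>M - B\<close> in the role of
    \<open>- \<i>\<close> and continues registers 25 and 26, as in \<open>arc_sum\<close>.\<close>
  have "R (- \<i>) (M - B)" unfolding M by (rule rep_minus[OF rep_i]) (use BM M in simp)
  then have h4: "\<sigma>4 0 0 = Suc j" "R (- \<i>) (\<sigma>4 17 0)" "\<sigma>4 17 0 \<le> M" "R (snd ?s1) (\<sigma>4 25 0)" "R (fst ?s1) (\<sigma>4 26 0)"
    using a1(1,2) s3[of 0] h2(1) BM less_imp_le[OF mod_less_divisor[of M "M - B"]] by (simp_all add: \<sigma>4_def)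
  have I: "- \<i> = \<i> \<or> - \<i> = - \<i>" by simp
  have s': "s = accum ?s1 (\<lambda>j'. j' \<in> arc q (Suc j)) (arc_term \<Delta> q (cd * L) k (Suc j) (- \<i>)) (q ^ cJ)"
    unfolding s arc_sum_def ..
  note a2 = arc_prog_correct[where \<sigma> = \<sigma>4 and a = ?s1, OF h4 I s', folded \<sigma>5_def]
  have s5: "\<sigma>5 x = \<sigma>1 x" if "x \<notin> ?T" "x \<noteq> 17" for x
    using a2(3)[of x] s3[of x] that by (simp add: \<sigma>4_def \<sigma>2_def)
  have s5': "\<sigma>5 0 = \<sigma>1 0" "\<sigma>5 15 = \<sigma>1 15" "\<sigma>5 16 = \<sigma>1 16" "\<sigma>5 27 = \<sigma> 27" "\<sigma>5 28 = \<sigma> 28" "\<sigma>5 29 = \<sigma>1 29" "\<sigma>5 30 = \<sigma>1 30"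
    using rp(6) by (simp_all add: s5)
  have eq: "run (grid_body cd \<Delta> cJ) \<sigma> = \<sigma>5(27 := (\<sigma> 27)(0 := (\<sigma> 27 0 * (\<sigma>1 16 0 * \<sigma>5 26 0) + \<sigma>1 15 0 * \<sigma>5 25 0 * \<sigma> 28 0) mod M),
      28 := (\<sigma> 28)(0 := \<sigma> 28 0 * (\<sigma>1 16 0 * \<sigma>5 26 0) mod M))"
  proof -
    have 1: "run (Then (set_var 25 (Cst 0)) (Then (set_var 26 (Cst 1)) (set_var 17 (Par 4)))) \<sigma>1 = \<sigma>2"
      using Bm M2 by (simp add: \<sigma>2_def \<pi>)
    have 2: "run (set_var 17 (Minus (Par 1) (Par 4))) \<sigma>3 = \<sigma>4" by (simp add: \<sigma>4_def \<pi>)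
    have "run (grid_body cd \<Delta> cJ) \<sigma> = run (Then (set_var 27 (Plus (Times (var 27) (Times (var 16) (var 26))) (Times (Times (var 15) (var 25)) (var 28))))
       (set_var 28 (Times (var 28) (Times (var 16) (var 26))))) \<sigma>5"
      unfolding grid_body_def using 1 2 unfolding den.simps(3) \<sigma>5_def \<sigma>3_def \<sigma>1_def by (simp only:)
    then show ?thesis using s5' by (simp add: \<pi>)
  qed
  show "run (grid_body cd \<Delta> cJ) \<sigma> 0 0 = Suc j" unfolding eq using s5' rp(1) by simp
  have "R (snd a * (snd f * fst s) + (fst f * snd s) * fst a) (\<sigma> 27 0 * (\<sigma>1 16 0 * \<sigma>5 26 0) + \<sigma>1 15 0 * \<sigma>5 25 0 * \<sigma> 28 0)"
    by (intro rep_add rep_mult \<sigma> rp a2)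
  then show "R (snd a * (snd f * fst s) + (fst f * snd s) * fst a) (run (grid_body cd \<Delta> cJ) \<sigma> 27 0)" unfolding eq by simp
  have "R (fst a * (snd f * fst s)) (\<sigma> 28 0 * (\<sigma>1 16 0 * \<sigma>5 26 0))" by (intro rep_mult \<sigma> rp a2)
  then show "R (fst a * (snd f * fst s)) (run (grid_body cd \<Delta> cJ) \<sigma> 28 0)" unfolding eq by simp
  show "R (snd b * (of_nat Y ^ k * snd f) + (of_nat (Suc j) ^ k * fst f) * fst b) (run (grid_body cd \<Delta> cJ) \<sigma> 29 0)"
    "R (fst b * (of_nat Y ^ k * snd f)) (run (grid_body cd \<Delta> cJ) \<sigma> 30 0)"
    unfolding eq using rp(4,5) s5' by simp_all
qed

lemma main_prog_correct:
  assumes g: "g = (if 2 * card E \<le> cE * L then q ^ 5 else \<Lambda> * 8 * \<Delta> * q ^ 5)"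
  shows "R (snd (num_sum \<Delta> q (cd * L) (q ^ cJ) k g) * fst (den_sum \<Delta> q (cd * L) k g)) (run (main_prog cd \<Delta> cJ cE \<Lambda>) \<sigma> 39 0)"
    "R (of_nat (2 * q ^ cJ) * snd (den_sum \<Delta> q (cd * L) k g) * fst (num_sum \<Delta> q (cd * L) (q ^ cJ) k g)) (run (main_prog cd \<Delta> cJ cE \<Lambda>) \<sigma> 40 0)"
    "run (main_prog cd \<Delta> cJ cE \<Lambda>) \<sigma> 39 0 < M" "run (main_prog cd \<Delta> cJ cE \<Lambda>) \<sigma> 40 0 < M"
proof -
  define \<sigma>1 where "\<sigma>1 = run count_prog \<sigma>"
  have c: "\<sigma>1 32 0 = card E" using count_prog_correct[of \<sigma>] by (simp add: \<sigma>1_def)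
  have gK': "g \<le> K" using g gK by simp
  define \<sigma>2 where "\<sigma>2 = \<sigma>1(31 := (\<sigma>1 31)(0 := g))"
  define \<sigma>3 where "\<sigma>3 = \<sigma>2(27 := (\<sigma>2 27)(0 := 0), 28 := (\<sigma>2 28)(0 := 1), 29 := (\<sigma>2 29)(0 := 0), 30 := (\<sigma>2 30)(0 := 1), 0 := (\<sigma>2 0)(0 := 0))"
  let ?f = "run (grid_body cd \<Delta> cJ)"
  define \<sigma>4 where "\<sigma>4 = (?f ^^ g) \<sigma>3"
  let ?N = "num_sum \<Delta> q (cd * L) (q ^ cJ) k" and ?D = "den_sum \<Delta> q (cd * L) k"
  let ?I = "\<lambda>j \<sigma>'. \<sigma>' 0 0 = j \<and> R (snd (?N j)) (\<sigma>' 27 0) \<and> R (fst (?N j)) (\<sigma>' 28 0) \<and> R (snd (?D j)) (\<sigma>' 29 0) \<and> R (fst (?D j)) (\<sigma>' 30 0)"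
  have I: "?I g \<sigma>4" unfolding \<sigma>4_def
  proof (rule funpow_invariant[where I = ?I and f = ?f and m = g])
    fix j and \<sigma>' :: "nat \<Rightarrow> nat \<Rightarrow> nat"
    assume j: "j < g" and I: "?I j \<sigma>'"
    have i: "\<sigma>' 0 0 = j" "Suc j \<le> K" "R (snd (?N j)) (\<sigma>' 27 0)" "R (fst (?N j)) (\<sigma>' 28 0)" "R (snd (?D j)) (\<sigma>' 29 0)" "R (fst (?D j)) (\<sigma>' 30 0)"
      using I j gK' by auto
    note gb = grid_body_correct[where \<sigma> = \<sigma>' and a = "?N j" and b = "?D j", OF i refl refl]
    show "?I (Suc j) (?f \<sigma>')"
      using gb unfolding num_sum_def den_sum_def accum.simps Let_def if_True fst_conv snd_conv by blast
  next
    show "?I 0 \<sigma>3" using rep_0[of B] rep_1[of B] by (simp add: \<sigma>3_def num_sum_def den_sum_def)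
  qed
  have eq: "run (main_prog cd \<Delta> cJ cE \<Lambda>) \<sigma> = \<sigma>4(39 := (\<sigma>4 39)(0 := \<sigma>4 27 0 * \<sigma>4 30 0 mod M),
      40 := (\<sigma>4 40)(0 := 2 * q ^ cJ * \<sigma>4 29 0 * \<sigma>4 28 0 mod M))"
  proof -
    have gM: "\<Lambda> * 8 * \<Delta> * q ^ 5 mod M = \<Lambda> * 8 * \<Delta> * q ^ 5" "q ^ 5 mod M = q ^ 5" using gK KM by simp_all
    have 1: "run (Cond (Minus (Times (Cst 2) (var 32)) (Times (Cst cE) (Par 3)))
        (set_var 31 (Times (Cst (\<Lambda> * 8 * \<Delta>)) eQ5)) (set_var 31 eQ5)) \<sigma>1 = \<sigma>2"
      using c gM by (simp add: g \<sigma>2_def ev_eQ5 \<pi>)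
    have 2: "run (Then (set_var 27 (Cst 0)) (Then (set_var 28 (Cst 1)) (Then (set_var 29 (Cst 0)) (Then (set_var 30 (Cst 1))
      (set_var 0 (Cst 0)))))) \<sigma>2 = \<sigma>3" using M2 by (simp add: \<sigma>3_def \<pi>)
    have 3: "run (Repeat (var 31) (grid_body cd \<Delta> cJ)) \<sigma>3 = \<sigma>4"
      using gK' by (simp add: \<sigma>3_def \<sigma>2_def \<sigma>4_def \<pi> min_absorb1)
    have "run (main_prog cd \<Delta> cJ cE \<Lambda>) \<sigma> = run (Then (set_var 39 (Times (var 27) (var 30)))
       (set_var 40 (Times (Times (Times (Cst 2) (fpow (Par 2) cJ)) (var 29)) (var 28)))) \<sigma>4"
      unfolding main_prog_def using 1 2 3 unfolding den.simps(3) \<sigma>1_def by (simp only:)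
    then show ?thesis by (simp add: \<pi>)
  qed
  have "R (snd (?N g) * fst (?D g)) (\<sigma>4 27 0 * \<sigma>4 30 0)" by (intro rep_mult) (use I in blast)+
  then show "R (snd (?N g) * fst (?D g)) (run (main_prog cd \<Delta> cJ cE \<Lambda>) \<sigma> 39 0)" unfolding eq by simp
  have "R (of_nat (2 * q ^ cJ) * snd (?D g) * fst (?N g)) (2 * q ^ cJ * \<sigma>4 29 0 * \<sigma>4 28 0)" by (intro rep_mult rep_of_nat) (use I in blast)+
  then show "R (of_nat (2 * q ^ cJ) * snd (?D g) * fst (?N g)) (run (main_prog cd \<Delta> cJ cE \<Lambda>) \<sigma> 40 0)" unfolding eq by simp
  show "run (main_prog cd \<Delta> cJ cE \<Lambda>) \<sigma> 39 0 < M" "run (main_prog cd \<Delta> cJ cE \<Lambda>) \<sigma> 40 0 < M"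
    unfolding eq using M2 by simp_all
qed

end

lemma wf_main_prog: "wf_fp 0 (main_prog cd \<Delta> cJ cE \<Lambda>)"
proof -
  have pw: "wf_fexp (fpow e c)" if "wf_fexp e" for e c using that by (induction c) auto
  have ex: "wf_fexp eN" "wf_fexp eW" "wf_fexp eQ5" "wf_fexp (eY \<Delta>)" "wf_fexp ePlus" "wf_fexp eMinus"
    by (auto simp: eN_def eW_def eQ5_def eY_def ePlus_def eMinus_def intro!: pw)
  have forest: "wf_fp h (forest_prog cd)" if "h \<le> 20" for h using that
    by (simp add: forest_prog_def clear_marks_def root_prog_def dfs_step_def try_child_def push_node_def pop_node_def)
  have powers: "wf_fp h (powers_prog a b e f)" if "h \<le> 20" "a < 64" "b < 64" "wf_fexp e" "wf_fexp f" for h a b e f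
    using that by (simp add: powers_prog_def)
  have arc: "wf_fp h (arc_prog cd \<Delta> cJ)" if "h \<le> 10" for h
    using that by (simp add: arc_prog_def arc_body_def term_prog_def advance_prog_def powers forest ex pw)
  have real: "wf_fp h (real_prog cd \<Delta>)" if "h \<le> 10" for h
    using that by (simp add: real_prog_def powers forest ex)
  show ?thesis by (simp add: main_prog_def count_prog_def grid_body_def arc real ex pw)
qed

section \<open>Size of the numbers\<close>

text \<open>\<open>Y\<close> is the bound for \<open>cmod y + cmod x * \<Delta>\<close> in
  \<open>tree_bound\<close>, valid for all activities and angles; \<open>H0\<close> bounds a forest,
  \<open>H1\<close> a term of \<open>arc_sum\<close>, \<open>H3\<close> and \<open>H4\<close> a term
  of \<open>num_sum\<close> and of \<open>den_sum\<close>. Each step of \<open>accum\<close> costs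
  twice the bound for its terms.\<close>

definition out_bound :: "nat \<Rightarrow> nat \<Rightarrow> nat \<Rightarrow> nat \<Rightarrow> nat \<Rightarrow> nat \<Rightarrow> nat \<Rightarrow> nat" where
  "out_bound \<Delta> N q d J k g = (let W = (q\<^sup>2)\<^sup>2 + 1; Y = (8 * \<Delta> * q ^ 5 + g * \<Delta>) * W ^ J; H0 = Y ^ ((\<Delta> + 1) ^ d * N);
     H1 = H0 * (W ^ k) ^ J; H3 = H0 * ((2 * H1) ^ J * (2 * H1) ^ J); H4 = Y ^ k * H0 in 2 * J * (2 * H3) ^ g * (2 * H4) ^ g)"

context fin_graph
begin

lemma output_bound:
  assumes deg: "\<And>v. v < n \<Longrightarrow> degree E v \<le> \<Delta>" "\<Delta> \<ge> 1" and q: "q \<ge> 1" and J: "J \<ge> 1"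
  shows "cmod (snd (num_sum \<Delta> q d J k g) * fst (den_sum \<Delta> q d k g)) \<le> out_bound \<Delta> n q d J k g"
    "cmod (of_nat (2 * J) * snd (den_sum \<Delta> q d k g) * fst (num_sum \<Delta> q d J k g)) \<le> out_bound \<Delta> n q d J k g"
proof -
  define W where "W = (q\<^sup>2)\<^sup>2 + 1"
  define Y0 where "Y0 = 8 * \<Delta> * q ^ 5"
  define Y where "Y = (Y0 + g * \<Delta>) * W ^ J"
  define H0 where "H0 = Y ^ ((\<Delta> + 1) ^ d * n)"
  define H1 where "H1 = H0 * (W ^ k) ^ J"
  define H3 where "H3 = H0 * ((2 * H1) ^ J * (2 * H1) ^ J)"
  define H4 where "H4 = Y ^ k * H0"
  have ob: "out_bound \<Delta> n q d J k g = 2 * J * (2 * H3) ^ g * (2 * H4) ^ g"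
    by (simp add: out_bound_def Let_def H4_def H3_def H1_def H0_def Y_def Y0_def W_def)
  have W1: "W \<ge> 1" by (simp add: W_def)
  have Y01: "Y0 \<ge> 1" using deg(2) q by (simp add: Y0_def)
  have Y1: "Y \<ge> 1" using W1 Y01 by (simp add: Y_def)
  have H01: "H0 \<ge> 1" using Y1 by (simp add: H0_def)
  have H11: "H1 \<ge> 1" using H01 W1 by (simp add: H1_def)
  have H31: "H3 \<ge> 1" using H01 H11 by (simp add: H3_def)
  have H41: "H4 \<ge> 1" using H01 Y1 by (simp add: H4_def)
  have cW: "cmod (of_nat (q\<^sup>2) + I) ^ 2 = W" "cmod (of_nat (q\<^sup>2) - I) ^ 2 = W" if "I = \<i> \<or> I = - \<i>" for I
    using that by (auto simp: W_def cmod_power2)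
  have fb: "cmod (fst (forest (of_nat i * c) (of_nat Y0 * w) d)) \<le> H0 \<and> cmod (snd (forest (of_nat i * c) (of_nat Y0 * w) d)) \<le> H0"
    if "i \<le> g" "cmod c \<le> real W ^ J" "cmod w \<le> real W ^ J" for i c w
  proof -
    have "cmod (of_nat Y0 * w) \<le> real Y0 * real W ^ J" using that by (simp add: norm_mult mult_left_mono)
    moreover have "cmod (of_nat i * c) * \<Delta> \<le> (real g * real W ^ J) * \<Delta>"
      using that unfolding norm_mult by (intro mult_right_mono mult_mono) auto
    ultimately have "cmod (of_nat Y0 * w) + cmod (of_nat i * c) * \<Delta> \<le> real Y" by (simp add: Y_def algebra_simps)
    from forest_bound[OF deg(1) this] Y1 show ?thesis by (simp add: H0_def)
  qed
  have WJ: "real W ^ j \<le> real W ^ J" if "j \<le> J" for j using that W1 by (intro power_increasing) auto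
  have tb: "cmod (fst (arc_term \<Delta> q d k i I j)) \<le> H1 \<and> cmod (snd (arc_term \<Delta> q d k i I j)) \<le> H1"
    if i: "i \<le> g" and I: "I = \<i> \<or> I = - \<i>" and j: "j < J" for i I j
  proof -
    define f where "f = forest (of_nat i * ((of_nat (q\<^sup>2) + I)\<^sup>2) ^ j) (of_nat Y0 * of_nat W ^ j) d"
    have 1: "cmod (((of_nat (q\<^sup>2) + I)\<^sup>2) ^ j) \<le> real W ^ J" "cmod (of_nat W ^ j :: complex) \<le> real W ^ J"
      using WJ[of j] j unfolding norm_power cW[OF I] by simp_all
    have ff: "cmod (fst f) \<le> H0" "cmod (snd f) \<le> H0" using fb[OF i 1] by (simp_all add: f_def)
    have t: "arc_term \<Delta> q d k i I j = (snd f * ((of_nat (q\<^sup>2) - I)\<^sup>2 ^ k) ^ j, fst f * (of_nat W ^ k) ^ j)"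
      unfolding arc_term_def f_def Let_def Y0_def W_def ..
    have pw: "(real W ^ k) ^ j \<le> (real W ^ k) ^ J" using j W1 by (intro power_increasing) auto
    have "cmod (((of_nat (q\<^sup>2) - I)\<^sup>2 ^ k) ^ j) = (real W ^ k) ^ j" unfolding norm_power cW[OF I] ..
    moreover have "cmod ((of_nat W ^ k) ^ j) = (real W ^ k) ^ j" by (simp add: norm_power)
    ultimately show ?thesis unfolding t fst_conv snd_conv norm_mult H1_def of_nat_mult of_nat_power
      using ff pw by (auto intro!: mult_mono)
  qed
  have ab: "cmod (fst (arc_sum \<Delta> q d J k i)) \<le> (2 * H1) ^ J * (2 * H1) ^ J \<and> cmod (snd (arc_sum \<Delta> q d J k i)) \<le> (2 * H1) ^ J * (2 * H1) ^ J"
    if i: "i \<le> g" for i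
  proof -
    have 1: "cmod (fst (accum (1, 0) (\<lambda>j. j \<in> arc q i) (arc_term \<Delta> q d k i \<i>) J)) \<le> 1 * (2 * real H1) ^ J
      \<and> cmod (snd (accum (1, 0) (\<lambda>j. j \<in> arc q i) (arc_term \<Delta> q d k i \<i>) J)) \<le> 1 * (2 * real H1) ^ J"
      by (rule accum_bound) (use tb[OF i] H11 in auto)
    have "cmod (fst (arc_sum \<Delta> q d J k i)) \<le> (2 * real H1) ^ J * (2 * real H1) ^ J \<and> cmod (snd (arc_sum \<Delta> q d J k i)) \<le> (2 * real H1) ^ J * (2 * real H1) ^ J"
      unfolding arc_sum_def by (rule accum_bound) (use tb[OF i] H11 1 in auto)
    then show ?thesis by simp
  qed
  have rb: "cmod (fst (real_forest \<Delta> q d i)) \<le> H0 \<and> cmod (snd (real_forest \<Delta> q d i)) \<le> H0" if i: "i \<le> g" for i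
    using fb[OF i, of 1 1] W1 by (simp add: real_forest_def Y0_def)
  have nb: "cmod (fst (num_sum \<Delta> q d J k g)) \<le> 1 * (2 * real H3) ^ g \<and> cmod (snd (num_sum \<Delta> q d J k g)) \<le> 1 * (2 * real H3) ^ g"
    unfolding num_sum_def
  proof (rule accum_bound)
    fix u assume u: "u < g"
    have "cmod (fst (real_forest \<Delta> q d (Suc u)) * snd (arc_sum \<Delta> q d J k (Suc u))) \<le> real H0 * real ((2 * H1) ^ J * (2 * H1) ^ J)"
      "cmod (snd (real_forest \<Delta> q d (Suc u)) * fst (arc_sum \<Delta> q d J k (Suc u))) \<le> real H0 * real ((2 * H1) ^ J * (2 * H1) ^ J)"
      unfolding norm_mult using rb[of "Suc u"] ab[of "Suc u"] u by (auto intro!: mult_mono simp del: of_nat_mult of_nat_power)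
    then show "cmod (fst (fst (real_forest \<Delta> q d (Suc u)) * snd (arc_sum \<Delta> q d J k (Suc u)), snd (real_forest \<Delta> q d (Suc u)) * fst (arc_sum \<Delta> q d J k (Suc u)))) \<le> real H3"
      "cmod (snd (fst (real_forest \<Delta> q d (Suc u)) * snd (arc_sum \<Delta> q d J k (Suc u)), snd (real_forest \<Delta> q d (Suc u)) * fst (arc_sum \<Delta> q d J k (Suc u)))) \<le> real H3"
      by (simp_all only: H3_def fst_conv snd_conv of_nat_mult)
  qed (use H31 in auto)
  have Yle: "Y0 \<le> Y" "i \<le> g \<Longrightarrow> i \<le> Y" for i
  proof -
    have "1 \<le> W ^ J" using W1 by simp
    then have *: "(Y0 + g * \<Delta>) * 1 \<le> Y" unfolding Y_def by (rule mult_le_mono2)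
    then show "Y0 \<le> Y" by simp
    have "g \<le> Y"
    proof (rule le_trans)
      show "g \<le> g * \<Delta>" using mult_le_mono2[OF deg(2), of g] by simp
      show "g * \<Delta> \<le> Y" using le_trans[OF le_add2 *[unfolded mult_1_right]] .
    qed
    then show "i \<le> g \<Longrightarrow> i \<le> Y" by (rule order_trans[rotated])
  qed
  have db: "cmod (fst (den_sum \<Delta> q d k g)) \<le> 1 * (2 * real H4) ^ g \<and> cmod (snd (den_sum \<Delta> q d k g)) \<le> 1 * (2 * real H4) ^ g"
    unfolding den_sum_def Y0_def[symmetric]
  proof (rule accum_bound)
    fix u assume u: "u < g"
    have p: "real (Suc u) ^ k \<le> real Y ^ k" "real Y0 ^ k \<le> real Y ^ k"
      using Yle(1) Yle(2)[of "Suc u"] u by (auto intro!: power_mono)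
    have "real (Suc u) ^ k * cmod (fst (real_forest \<Delta> q d (Suc u))) \<le> real Y ^ k * real H0"
      "real Y0 ^ k * cmod (snd (real_forest \<Delta> q d (Suc u))) \<le> real Y ^ k * real H0"
      using rb[of "Suc u"] u p by (auto intro!: mult_mono simp del: of_nat_Suc)
    then show "cmod (fst (of_nat (Suc u) ^ k * fst (real_forest \<Delta> q d (Suc u)), of_nat Y0 ^ k * snd (real_forest \<Delta> q d (Suc u)))) \<le> real H4"
      "cmod (snd (of_nat (Suc u) ^ k * fst (real_forest \<Delta> q d (Suc u)), of_nat Y0 ^ k * snd (real_forest \<Delta> q d (Suc u)))) \<le> real H4"
      by (simp_all add: H4_def norm_mult norm_power del: of_nat_Suc)
  qed (use H41 in auto)
  have "cmod (snd (num_sum \<Delta> q d J k g) * fst (den_sum \<Delta> q d k g)) \<le> (2 * real H3) ^ g * (2 * real H4) ^ g"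
    unfolding norm_mult using nb db by (intro mult_mono) auto
  also have "\<dots> \<le> (2 * real J) * ((2 * real H3) ^ g * (2 * real H4) ^ g)"
    using J mult_right_mono[of 1 "2 * real J" "(2 * real H3) ^ g * (2 * real H4) ^ g"] by simp
  also have "\<dots> = out_bound \<Delta> n q d J k g" by (simp add: ob)
  finally show "cmod (snd (num_sum \<Delta> q d J k g) * fst (den_sum \<Delta> q d k g)) \<le> out_bound \<Delta> n q d J k g" .
  have "cmod (of_nat (2 * J) * snd (den_sum \<Delta> q d k g) * fst (num_sum \<Delta> q d J k g))
      = 2 * real J * (cmod (snd (den_sum \<Delta> q d k g)) * cmod (fst (num_sum \<Delta> q d J k g)))"
    by (simp add: norm_mult)
  also have "\<dots> \<le> 2 * real J * ((2 * real H4) ^ g * (2 * real H3) ^ g)"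
    using nb db by (intro mult_left_mono mult_mono) auto
  also have "\<dots> = out_bound \<Delta> n q d J k g" by (simp add: ob)
  finally show "cmod (of_nat (2 * J) * snd (den_sum \<Delta> q d k g) * fst (num_sum \<Delta> q d J k g)) \<le> out_bound \<Delta> n q d J k g" .
qed

end

text \<open>An element of \<open>A\<close> is a whole instance and \<open>Q\<close> its scale. The
  exponent is quantified before the instance, so the closure rules below produce exponents that are
  uniform over all instances. \<open>expb\<close> is for numbers with polynomially many
  bits.\<close>

definition polyb :: "'p set \<Rightarrow> ('p \<Rightarrow> nat) \<Rightarrow> ('p \<Rightarrow> nat) \<Rightarrow> bool" where
  "polyb A Q f \<longleftrightarrow> (\<exists>e. \<forall>p\<in>A. f p \<le> Q p ^ e)"

definition expb :: "'p set \<Rightarrow> ('p \<Rightarrow> nat) \<Rightarrow> ('p \<Rightarrow> nat) \<Rightarrow> bool" where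
  "expb A Q f \<longleftrightarrow> (\<exists>e. \<forall>p\<in>A. f p \<le> 2 ^ (Q p ^ e))"

locale growth_scale =
  fixes A :: "'p set" and Q :: "'p \<Rightarrow> nat"
  assumes Q2: "\<And>p. p \<in> A \<Longrightarrow> 2 \<le> Q p"
begin

lemma polyb_const: "polyb A Q (\<lambda>_. c)"
proof -
  have "c \<le> Q p ^ c" if "p \<in> A" for p
  proof -
    have "c \<le> 2 ^ c" using less_exp[of c] by simp
    also have "\<dots> \<le> Q p ^ c" using Q2[OF that] by (rule power_mono) simp
    finally show ?thesis .
  qed
  then show ?thesis unfolding polyb_def by blast
qed

lemma polyb_mono: "polyb A Q f \<Longrightarrow> (\<And>p. p \<in> A \<Longrightarrow> h p \<le> f p) \<Longrightarrow> polyb A Q h"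
  unfolding polyb_def by (meson le_trans)

lemma polyb_Q: "polyb A Q Q"
  unfolding polyb_def by (rule exI[of _ 1]) simp

lemma polyb_add:
  assumes "polyb A Q f" "polyb A Q h"
  shows "polyb A Q (\<lambda>p. f p + h p)"
proof -
  obtain a b where ab: "\<And>p. p \<in> A \<Longrightarrow> f p \<le> Q p ^ a" "\<And>p. p \<in> A \<Longrightarrow> h p \<le> Q p ^ b"
    using assms unfolding polyb_def by blast
  have "f p + h p \<le> Q p ^ Suc (a + b)" if p: "p \<in> A" for p
  proof -
    have "Q p ^ a \<le> Q p ^ (a + b)" "Q p ^ b \<le> Q p ^ (a + b)" using Q2[OF p] by (intro power_increasing; simp)+
    then have "f p + h p \<le> 2 * Q p ^ (a + b)" using ab[OF p] by linarith
    also have "\<dots> \<le> Q p * Q p ^ (a + b)" using Q2[OF p] by (rule mult_le_mono1)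
    finally show ?thesis by simp
  qed
  then show ?thesis unfolding polyb_def by blast
qed

lemma polyb_mult:
  assumes "polyb A Q f" "polyb A Q h"
  shows "polyb A Q (\<lambda>p. f p * h p)"
proof -
  obtain a b where ab: "\<And>p. p \<in> A \<Longrightarrow> f p \<le> Q p ^ a" "\<And>p. p \<in> A \<Longrightarrow> h p \<le> Q p ^ b"
    using assms unfolding polyb_def by blast
  have "f p * h p \<le> Q p ^ (a + b)" if p: "p \<in> A" for p
    unfolding power_add by (rule mult_le_mono[OF ab[OF p]])
  then show ?thesis unfolding polyb_def by blast
qed

lemma polyb_power: "polyb A Q f \<Longrightarrow> polyb A Q (\<lambda>p. f p ^ c)"
  by (induction c) (auto intro: polyb_const[of "Suc 0", simplified] polyb_mult)

lemma expb_polyb: "polyb A Q f \<Longrightarrow> expb A Q f"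
  unfolding polyb_def expb_def by (meson le_trans less_exp less_imp_le)

lemma expb_mult:
  assumes "expb A Q f" "expb A Q h"
  shows "expb A Q (\<lambda>p. f p * h p)"
proof -
  obtain a b where ab: "\<And>p. p \<in> A \<Longrightarrow> f p \<le> 2 ^ (Q p ^ a)" "\<And>p. p \<in> A \<Longrightarrow> h p \<le> 2 ^ (Q p ^ b)"
    using assms unfolding expb_def by blast
  have "polyb A Q (\<lambda>p. Q p ^ a + Q p ^ b)" by (intro polyb_add polyb_power polyb_Q)
  then obtain e where e: "\<And>p. p \<in> A \<Longrightarrow> Q p ^ a + Q p ^ b \<le> Q p ^ e" unfolding polyb_def by blast
  have "f p * h p \<le> 2 ^ (Q p ^ e)" if p: "p \<in> A" for p
  proof -
    have "f p * h p \<le> 2 ^ (Q p ^ a + Q p ^ b)" unfolding power_add by (rule mult_le_mono[OF ab[OF p]])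
    also have "\<dots> \<le> 2 ^ (Q p ^ e)" by (rule power_increasing[OF e[OF p]]) simp
    finally show ?thesis .
  qed
  then show ?thesis unfolding expb_def by blast
qed

lemma expb_power:
  assumes "expb A Q f" "polyb A Q h"
  shows "expb A Q (\<lambda>p. f p ^ h p)"
proof -
  obtain a b where ab: "\<And>p. p \<in> A \<Longrightarrow> f p \<le> 2 ^ (Q p ^ a)" "\<And>p. p \<in> A \<Longrightarrow> h p \<le> Q p ^ b"
    using assms unfolding polyb_def expb_def by blast
  have "f p ^ h p \<le> 2 ^ (Q p ^ (a + b))" if p: "p \<in> A" for p
  proof -
    have "f p ^ h p \<le> (2 ^ (Q p ^ a)) ^ h p" by (rule power_mono[OF ab(1)[OF p]]) simp
    also have "\<dots> = 2 ^ (Q p ^ a * h p)" by (simp add: power_mult)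
    also have "\<dots> \<le> 2 ^ (Q p ^ (a + b))" unfolding power_add by (intro power_increasing mult_le_mono2 ab(2)[OF p]) simp
    finally show ?thesis .
  qed
  then show ?thesis unfolding expb_def by blast
qed

end

section \<open>Running time\<close>

text \<open>\<open>K = q^c\<close> is both the cap on loops and the bit length of \<open>B\<close>,
  so a single exponent has to dominate the loop counts polynomially and the output values and the
  sign test as numbers below \<open>2^(q^c)\<close>. None of these quantities involves
  \<open>c\<close>, so it can be chosen last.\<close>

lemma parameter_sizes:
  obtains c where "c \<ge> 2"
    "\<And>L n k g q. 1 \<le> L \<Longrightarrow> q = 2 ^ L \<Longrightarrow> n \<le> q \<Longrightarrow> k \<le> n * n \<Longrightarrow> g \<le> G * q ^ 5 \<Longrightarrow>
      (n + 1) * (\<Delta> + 1) ^ (cd * L) \<le> q ^ c \<and> n * n \<le> q ^ c \<and> cd * L + 2 \<le> q ^ c \<and> q ^ cJ \<le> q ^ c \<and> G * q ^ 5 \<le> q ^ c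
      \<and> out_bound \<Delta> n q (cd * L) (q ^ cJ) k g \<le> 2 ^ (q ^ c) \<and> 4 * ((q\<^sup>2)\<^sup>2 + 1) ^ (q ^ cJ) \<le> 2 ^ (q ^ c)"
proof -
  define Q :: "nat \<times> nat \<times> nat \<times> nat \<Rightarrow> nat" where "Q p = 2 ^ fst p" for p
  define N :: "nat \<times> nat \<times> nat \<times> nat \<Rightarrow> nat" where "N p = fst (snd p)" for p
  define k' :: "nat \<times> nat \<times> nat \<times> nat \<Rightarrow> nat" where "k' p = fst (snd (snd p))" for p
  define g' :: "nat \<times> nat \<times> nat \<times> nat \<Rightarrow> nat" where "g' p = snd (snd (snd p))" for p
  define A where "A = {p. 1 \<le> fst p \<and> N p \<le> Q p \<and> k' p \<le> N p * N p \<and> g' p \<le> G * Q p ^ 5}"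
  have Q2: "2 \<le> Q p" if "p \<in> A" for p
    using that self_le_power[of "2 :: nat" "fst p"] by (simp add: A_def Q_def)
  interpret growth_scale A Q by unfold_locales (rule Q2)
  note pc = polyb_const and pm = polyb_mono and pQ = polyb_Q and pa = polyb_add and pt = polyb_mult and pp = polyb_power
    and ep = expb_polyb and et = expb_mult and ew = expb_power
  have N: "polyb A Q N" by (rule pm[OF pQ]) (auto simp: A_def)
  have k: "polyb A Q k'" by (rule pm[OF pt[OF N N]]) (auto simp: A_def)
  have G: "polyb A Q (\<lambda>p. G * Q p ^ 5)" by (rule pt[OF pc pp[OF pQ]])
  have g: "polyb A Q g'" by (rule pm[OF G]) (auto simp: A_def)
  have J: "polyb A Q (\<lambda>p. Q p ^ cJ)" by (rule pp[OF pQ])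
  \<comment> \<open>The size of the tree is polynomial because \<open>L\<close> is the binary
    logarithm of \<open>q\<close>: \<Delta> + 1 to the power \<open>L\<close> is at most a fixed
    power of \<open>q\<close>.\<close>
  have depth: "polyb A Q (\<lambda>p. (\<Delta> + 1) ^ (cd * fst p))"
  proof (rule pm[OF pp[OF pQ]])
    fix p :: "nat \<times> nat \<times> nat \<times> nat"
    have "\<Delta> + 1 \<le> 2 ^ Suc \<Delta>" using less_exp[of "Suc \<Delta>"] by simp
    then have "(\<Delta> + 1) ^ (cd * fst p) \<le> (2 ^ Suc \<Delta>) ^ (cd * fst p)" by (rule power_mono) simp
    also have "\<dots> = Q p ^ (Suc \<Delta> * cd)" by (simp only: Q_def power_mult[symmetric] ac_simps)
    finally show "(\<Delta> + 1) ^ (cd * fst p) \<le> Q p ^ (Suc \<Delta> * cd)" .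
  qed
  have L: "polyb A Q (\<lambda>p. cd * fst p + 2)"
    by (intro pa pt pc pm[OF pQ, of fst]) (simp add: Q_def less_imp_le)
  have time: "polyb A Q (\<lambda>p. (N p + 1) * (\<Delta> + 1) ^ (cd * fst p))" by (rule pt[OF pa[OF N pc] depth])
  define W where "W p = ((Q p)\<^sup>2)\<^sup>2 + 1" for p
  define Y where "Y p = (8 * \<Delta> * Q p ^ 5 + g' p * \<Delta>) * W p ^ (Q p ^ cJ)" for p
  define H0 where "H0 p = Y p ^ ((\<Delta> + 1) ^ (cd * fst p) * N p)" for p
  define H1 where "H1 p = H0 p * (W p ^ k' p) ^ (Q p ^ cJ)" for p
  define H3 where "H3 p = H0 p * ((2 * H1 p) ^ (Q p ^ cJ) * (2 * H1 p) ^ (Q p ^ cJ))" for p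
  define H4 where "H4 p = Y p ^ k' p * H0 p" for p
  have W: "expb A Q W" unfolding W_def by (rule ep[OF pa[OF pp[OF pp[OF pQ]] pc]])
  have two: "expb A Q (\<lambda>_. 2)" by (rule ep[OF pc])
  have Y: "expb A Q Y" unfolding Y_def by (rule et[OF ep[OF pa[OF pt[OF pc pp[OF pQ]] pt[OF g pc]]] ew[OF W J]])
  have H0: "expb A Q H0" unfolding H0_def by (rule ew[OF Y pt[OF depth N]])
  have H1: "expb A Q H1" unfolding H1_def by (rule et[OF H0 ew[OF ew[OF W k] J]])
  have H1': "expb A Q (\<lambda>p. (2 * H1 p) ^ (Q p ^ cJ))" by (rule ew[OF et[OF two H1] J])
  have H3: "expb A Q H3" unfolding H3_def by (rule et[OF H0 et[OF H1' H1']])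
  have H4: "expb A Q H4" unfolding H4_def by (rule et[OF ew[OF Y k] H0])
  have out: "expb A Q (\<lambda>p. 2 * Q p ^ cJ * (2 * H3 p) ^ g' p * (2 * H4 p) ^ g' p)"
    by (rule et[OF et[OF et[OF two ep[OF J]] ew[OF et[OF two H3] g]] ew[OF et[OF two H4] g]])
  have sign: "expb A Q (\<lambda>p. 4 * W p ^ (Q p ^ cJ))" by (rule et[OF ep[OF pc] ew[OF W J]])
  have "polyb A Q (\<lambda>p. (N p + 1) * (\<Delta> + 1) ^ (cd * fst p) + N p * N p + (cd * fst p + 2) + Q p ^ cJ + G * Q p ^ 5)"
    by (rule pa[OF pa[OF pa[OF pa[OF time pt[OF N N]] L] J] G])
  then obtain a where a: "\<And>p. p \<in> A \<Longrightarrow>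
      (N p + 1) * (\<Delta> + 1) ^ (cd * fst p) + N p * N p + (cd * fst p + 2) + Q p ^ cJ + G * Q p ^ 5 \<le> Q p ^ a"
    unfolding polyb_def by blast
  obtain b where b: "\<And>p. p \<in> A \<Longrightarrow> 2 * Q p ^ cJ * (2 * H3 p) ^ g' p * (2 * H4 p) ^ g' p \<le> 2 ^ (Q p ^ b)"
    using out unfolding expb_def by blast
  obtain b' where b': "\<And>p. p \<in> A \<Longrightarrow> 4 * W p ^ (Q p ^ cJ) \<le> 2 ^ (Q p ^ b')"
    using sign unfolding expb_def by blast
  show ?thesis
  proof (rule that[of "2 + a + b + b'"])
    fix L n k g q :: nat
    assume 1: "1 \<le> L" "q = 2 ^ L" "n \<le> q" "k \<le> n * n" "g \<le> G * q ^ 5"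
    let ?p = "(L, n, k, g)"
    have p: "?p \<in> A" "Q ?p = q" "N ?p = n" "k' ?p = k" "g' ?p = g" using 1 by (auto simp: A_def Q_def N_def k'_def g'_def)
    have q1: "1 \<le> q" using 1 by simp
    let ?c = "2 + a + b + b'"
    have c: "q ^ a \<le> q ^ ?c" "q ^ b \<le> q ^ ?c" "q ^ b' \<le> q ^ ?c" using q1 by (intro power_increasing; simp)+
    have c2: "(2 :: nat) ^ (q ^ b) \<le> 2 ^ (q ^ ?c)" "(2 :: nat) ^ (q ^ b') \<le> 2 ^ (q ^ ?c)"
      by (rule power_increasing[OF c(2)], simp) (rule power_increasing[OF c(3)], simp)
    have s: "(n + 1) * (\<Delta> + 1) ^ (cd * L) + n * n + (cd * L + 2) + q ^ cJ + G * q ^ 5 \<le> q ^ a"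
      using a[OF p(1)] unfolding p fst_conv .
    have o: "out_bound \<Delta> n q (cd * L) (q ^ cJ) k g \<le> 2 ^ (q ^ b)"
      using b[OF p(1)] by (simp only: out_bound_def Let_def H4_def H3_def H1_def H0_def Y_def W_def p fst_conv)
    have w: "4 * ((q\<^sup>2)\<^sup>2 + 1) ^ (q ^ cJ) \<le> 2 ^ (q ^ b')" using b'[OF p(1)] by (simp only: W_def p)
    show "(n + 1) * (\<Delta> + 1) ^ (cd * L) \<le> q ^ ?c \<and> n * n \<le> q ^ ?c \<and> cd * L + 2 \<le> q ^ ?c \<and> q ^ cJ \<le> q ^ ?c \<and> G * q ^ 5 \<le> q ^ ?c
      \<and> out_bound \<Delta> n q (cd * L) (q ^ cJ) k g \<le> 2 ^ (q ^ ?c) \<and> 4 * ((q\<^sup>2)\<^sup>2 + 1) ^ (q ^ cJ) \<le> 2 ^ (q ^ ?c)"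
      using s c(1) le_trans[OF o c2(1)] le_trans[OF w c2(2)] by linarith
  qed simp
qed

text \<open>With \<open>x \<ge> 2\<close> all constants move into the exponent, and
  \<open>q \<le> 2 * x \<le> x^2\<close>.\<close>

lemma running_time:
  fixes q :: nat and x :: real
  assumes q: "q \<ge> 1" "real q \<le> 2 * x" "x \<ge> 2"
    and t: "t1 \<le> C1 * (2 * q ^ c + 2) * (q ^ c + 1)" "t2 \<le> C2 * (2 * q ^ c + 2) * (q ^ c + 1) ^ c2" "t3 \<le> C3 * (2 * q ^ c + 2)"
  shows "real (t1 + (t2 + t3)) \<le> x ^ (C1 + C2 + C3 + 1 + (2 * c + 1) * (2 + c2))"
proof -
  define P where "P = 2 * q ^ c"
  have qc: "1 \<le> q ^ c" using q(1) by simp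
  have P1: "q ^ c + 1 \<le> P" "2 * q ^ c + 2 \<le> 2 * P" "1 \<le> P" using qc by (simp_all add: P_def)
  have pw: "P ^ a \<le> P ^ (1 + c2)" if "a \<le> 1 + c2" for a using that P1(3) by (rule power_increasing)
  have "t1 \<le> C1 * (2 * P) * P" by (rule order_trans[OF t(1)]) (intro mult_le_mono P1(1,2) order_refl)
  moreover have "t2 \<le> C2 * (2 * P) * P ^ c2" by (rule order_trans[OF t(2)]) (intro mult_le_mono P1(1,2) order_refl power_mono; simp)
  moreover have "t3 \<le> C3 * (2 * P) * 1" unfolding mult_1_right by (rule order_trans[OF t(3)]) (intro mult_le_mono P1(2) order_refl)
  moreover have "P \<le> P ^ (1 + c2)" "P ^ c2 \<le> P ^ (1 + c2)" "1 \<le> P ^ (1 + c2)" using pw[of 1] pw[of c2] pw[of 0] by simp_all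
  ultimately have "t1 + (t2 + t3) \<le> C1 * (2 * P) * P ^ (1 + c2) + (C2 * (2 * P) * P ^ (1 + c2) + C3 * (2 * P) * P ^ (1 + c2))"
    by (intro add_mono) (erule order_trans, rule mult_le_mono2, assumption)+
  also have "\<dots> = (C1 + C2 + C3) * 2 * P ^ (2 + c2)" by (simp add: algebra_simps)
  also have "\<dots> \<le> 2 ^ (C1 + C2 + C3) * 2 * P ^ (2 + c2)" by (intro mult_le_mono1 less_imp_le less_exp)
  finally have "real (t1 + (t2 + t3)) \<le> real (2 ^ (C1 + C2 + C3) * 2 * P ^ (2 + c2))" by (simp only: of_nat_le_iff)
  also have "\<dots> = 2 ^ (C1 + C2 + C3 + 1) * real P ^ (2 + c2)" by simp
  also have "\<dots> \<le> x ^ (C1 + C2 + C3 + 1) * (x ^ (2 * c + 1)) ^ (2 + c2)"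
  proof (intro mult_mono power_mono)
    have "2 * x \<le> x * x" using q(3) by (intro mult_right_mono) auto
    then have "real q \<le> x ^ 2" using q(2) by (simp add: power2_eq_square)
    then have "real q ^ c \<le> (x ^ 2) ^ c" by (intro power_mono) auto
    then have "2 * real q ^ c \<le> x * (x ^ 2) ^ c" using q(3) by (intro mult_mono) auto
    then show "real P \<le> x ^ (2 * c + 1)" by (simp add: P_def power_mult)
  qed (use q in auto)
  also have "\<dots> = x ^ (C1 + C2 + C3 + 1 + (2 * c + 1) * (2 + c2))" by (simp only: power_add power_mult)
  finally show ?thesis .
qed

section \<open>Output and final assembly\<close>

definition emit_prog :: prog where
  "emit_prog = Seq (Store (Const 0) (cexp (var 39))) (Store (Const 1) (cexp (var 40)))"

lemma emit_prog_correct: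
  "\<exists>C. \<forall>inp \<pi> W s \<sigma>. bounded_state inp \<pi> W s \<longrightarrow> represents \<pi> s \<sigma> \<longrightarrow>
     (\<exists>t s'. runs inp emit_prog s t s' \<and> s' 0 = \<sigma> 39 0 \<and> s' 1 = \<sigma> 40 0 \<and> t \<le> C * W)"
proof -
  let ?e = "\<lambda>a. cexp (var a)"
  show ?thesis
  proof (rule exI[of _ "expr_cost (Const 0) + expr_cost (?e 39) + 1 + (expr_cost (Const 1) + expr_cost (?e 40) + 1)"], intro allI impI)
    fix inp \<pi> W s \<sigma>
    assume s: "bounded_state inp \<pi> W s" "represents \<pi> s \<sigma>"
    define s1 where "s1 = s(val inp s (Const 0) := val inp s (?e 39))"
    have v: "val inp s (?e 39) = \<sigma> 39 0" using val_cexp[OF s(2), of "var 39"] by simp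
    have "\<sigma> 39 0 = s (32 + 39 + 64 * 0)" "\<sigma> 40 0 = s (32 + 40 + 64 * 0)" using s(2)[unfolded represents_def, THEN conjunct2, rule_format, symmetric] by simp_all
    then have \<sigma>: "\<sigma> 39 0 = s 71" "\<sigma> 40 0 = s 72" by simp_all
    have s1: "bounded_state inp \<pi> W s1" unfolding s1_def v \<sigma> by (rule bounded_state_upd[OF s(1)]) (use s(1) in \<open>simp add: bounded_state_def\<close>)
    define s2 where "s2 = s1(val inp s1 (Const 1) := val inp s1 (?e 40))"
    let ?t = "cost inp s (Const 0) + cost inp s (?e 39) + 1 + (cost inp s1 (Const 1) + cost inp s1 (?e 40) + 1)"
    have r: "runs inp emit_prog s ?t s2"
      unfolding emit_prog_def s2_def by (rule runs.Seq[OF _ runs.Store]) (unfold s1_def, rule runs.Store)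
    have "?t \<le> expr_cost (Const 0) * W + expr_cost (?e 39) * W + 1 * W + (expr_cost (Const 1) * W + expr_cost (?e 40) * W + 1 * W)"
      by (intro add_mono cost_le'[OF s(1)] cost_le'[OF s1]) (use bounded_state_W[OF s(1)] in simp_all)
    then have t: "?t \<le> (expr_cost (Const 0) + expr_cost (?e 39) + 1 + (expr_cost (Const 1) + expr_cost (?e 40) + 1)) * W"
      by (simp only: add_mult_distrib)
    have "s2 0 = \<sigma> 39 0" "s2 1 = \<sigma> 40 0" by (simp_all add: s2_def s1_def \<sigma> v[unfolded \<sigma>])
    then show "\<exists>t s'. runs inp emit_prog s t s' \<and> s' 0 = \<sigma> 39 0 \<and> s' 1 = \<sigma> 40 0 \<and>
       t \<le> (expr_cost (Const 0) + expr_cost (?e 39) + 1 + (expr_cost (Const 1) + expr_cost (?e 40) + 1)) * W"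
      using r t by blast
  qed
qed

text \<open>Needed so that \<open>n / \<epsilon>\<close> is at least 2 and its powers can absorb
  constants.\<close>

lemma (in fin_graph) two_le_n: "mstar \<ge> 1 \<Longrightarrow> n \<ge> 2"
proof -
  assume "mstar \<ge> 1"
  obtain M where M: "is_matching E M" "card M = mstar" by (rule mstar_attained)
  then obtain e where "e \<in> E" using \<open>mstar \<ge> 1\<close> by (fastforce simp: is_matching_def)
  then have "e \<subseteq> {..<n}" "card e = 2" using simple by (auto simp: simple_graph_def)
  then show "n \<ge> 2" using card_mono[of "{..<n}" e] by simp
qed

theorem theorem1p1:
  fixes \<Delta> :: nat and \<delta> :: real
  assumes "\<Delta> \<ge> 3" and "0 < \<delta>" and "\<delta> < 1"
  shows "\<exists>(p :: prog) (C :: nat).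
    \<forall>(n :: nat) (E :: nat set set) (k :: nat) (\<epsilon> :: real).
      simple_graph {..<n} E \<longrightarrow> (\<forall>v<n. degree E v \<le> \<Delta>) \<longrightarrow>
      1 \<le> k \<longrightarrow> real k \<le> (1 - \<delta>) * real (matching_number E) \<longrightarrow>
      0 < \<epsilon> \<longrightarrow> \<epsilon> < 1 \<longrightarrow>
      (\<exists>A. computes_within p (encode_input n E k \<epsilon>) ((real n / \<epsilon>) ^ C) A \<and>
           relative_approx \<epsilon> (real (num_matchings E k)) A)"
proof -
  have \<Delta>1: "\<Delta> \<ge> 1" using assms(1) by simp
  obtain \<Lambda> cE cd cJ :: nat where "\<Lambda> \<ge> 1" and est:
    "\<And>L n E k \<epsilon> q d J g. fin_graph n E \<Longrightarrow> (\<And>v. v < n \<Longrightarrow> degree E v \<le> \<Delta>) \<Longrightarrow> 1 \<le> L \<Longrightarrow> 1 \<le> n \<Longrightarrow> n \<le> q \<Longrightarrow>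
      1 \<le> \<epsilon> * real q \<Longrightarrow> 0 < \<epsilon> \<Longrightarrow> \<epsilon> < 1 \<Longrightarrow> 1 \<le> k \<Longrightarrow> real k \<le> (1 - \<delta>) * real (matching_number E) \<Longrightarrow>
      q = 2 ^ L \<Longrightarrow> d = cd * L \<Longrightarrow> J = q ^ cJ \<Longrightarrow> g = (if 2 * card E \<le> cE * L then q ^ 5 else \<Lambda> * 8 * \<Delta> * q ^ 5) \<Longrightarrow>
      relative_approx \<epsilon> (num_matchings E k) ((\<Sum>i\<in>{1..g}. fin_graph.est_num n E \<Delta> q d J k i) / (\<Sum>i\<in>{1..g}. fin_graph.est_den n E \<Delta> q d k i))
      \<and> (\<Sum>i\<in>{1..g}. fin_graph.est_num n E \<Delta> q d J k i) > 0 \<and> (\<Sum>i\<in>{1..g}. fin_graph.est_den n E \<Delta> q d k i) > 0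
      \<and> (\<forall>i\<in>{1..g}. \<forall>j\<in>arc q i. \<forall>d S v. fin_graph.Rt E (of_real (activity \<Delta> q i) * zeta (q\<^sup>2) ^ j) d S v \<noteq> 0)"
  proof (rule estimate[OF \<Delta>1 assms(2,3)], goal_cases)
    case (1 \<Lambda> cE cd cJ)
    show ?case by (rule 1(1)[OF 1(2,3)])
  qed
  let ?G = "\<Lambda> * 8 * \<Delta>"
  obtain c where c: "c \<ge> 2" and sizes:
    "\<And>L n k g q. 1 \<le> L \<Longrightarrow> q = 2 ^ L \<Longrightarrow> n \<le> q \<Longrightarrow> k \<le> n * n \<Longrightarrow> g \<le> ?G * q ^ 5 \<Longrightarrow>
      (n + 1) * (\<Delta> + 1) ^ (cd * L) \<le> q ^ c \<and> n * n \<le> q ^ c \<and> cd * L + 2 \<le> q ^ c \<and> q ^ cJ \<le> q ^ c \<and> ?G * q ^ 5 \<le> q ^ c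
      \<and> out_bound \<Delta> n q (cd * L) (q ^ cJ) k g \<le> 2 ^ (q ^ c) \<and> 4 * ((q\<^sup>2)\<^sup>2 + 1) ^ (q ^ cJ) \<le> 2 ^ (q ^ c)"
  proof (rule parameter_sizes[where \<Delta> = \<Delta> and cd = cd and cJ = cJ and G = ?G], goal_cases)
    case (1 c)
    show ?case by (rule 1(1)[OF 1(2,3)])
  qed
  let ?main = "main_prog cd \<Delta> cJ cE \<Lambda>"
  obtain C1 where prelude: "\<And>n E k (\<epsilon> :: real). 1 \<le> n \<Longrightarrow> k \<le> n * n \<Longrightarrow> 0 < \<epsilon> \<Longrightarrow> \<epsilon> < 1 \<Longrightarrow>
    (\<exists>L q t s. q = 2 ^ L \<and> 1 \<le> L \<and> n \<le> q \<and> 1 \<le> \<epsilon> * real q \<and> \<epsilon> * real q \<le> 2 * real n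
      \<and> runs (encode_input n E k \<epsilon>) (prelude c) (\<lambda>_. 0) t s \<and> t \<le> C1 * (2 * q ^ c + 2) * (q ^ c + 1)
      \<and> represents (params (q ^ c) q L (2 ^ q ^ c)) s (\<lambda>_ _. 0)
      \<and> bounded_state (encode_input n E k \<epsilon>) (params (q ^ c) q L (2 ^ q ^ c)) (2 * q ^ c + 2) s)"
    using prelude_correct[OF c] by blast
  obtain C2 c2 where main: "\<And>inp \<pi> W s \<sigma>. bounded_state inp \<pi> W s \<Longrightarrow> represents \<pi> s \<sigma> \<Longrightarrow>
     (\<exists>t s'. runs inp (compile 0 ?main) s t s' \<and> bounded_state inp \<pi> W s' \<and> represents \<pi> s' (den inp \<pi> ?main \<sigma>)
       \<and> (\<forall>x<8 + 0. s' x = s x) \<and> t \<le> C2 * W * (\<pi> 0 + 1) ^ c2)"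
    using compile_correct[OF wf_main_prog[of cd \<Delta> cJ cE \<Lambda>]] by fast
  obtain C3 where emit: "\<And>inp \<pi> W s \<sigma>. bounded_state inp \<pi> W s \<Longrightarrow> represents \<pi> s \<sigma> \<Longrightarrow>
     (\<exists>t s'. runs inp emit_prog s t s' \<and> s' 0 = \<sigma> 39 0 \<and> s' 1 = \<sigma> 40 0 \<and> t \<le> C3 * W)"
    using emit_prog_correct by fast
  let ?C = "C1 + C2 + C3 + 1 + (2 * c + 1) * (2 + c2)"
  let ?p = "Seq (prelude c) (Seq (compile 0 ?main) emit_prog)"
  show ?thesis
  proof (rule exI[of _ ?p], rule exI[of _ ?C], intro allI impI)
    fix n k :: nat and E :: "nat set set" and \<epsilon> :: real
    assume graph: "simple_graph {..<n} E" and deg': "\<forall>v<n. degree E v \<le> \<Delta>" and k: "1 \<le> k" "real k \<le> (1 - \<delta>) * real (matching_number E)"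
      and \<epsilon>: "0 < \<epsilon>" "\<epsilon> < 1"
    interpret fin_graph n E by unfold_locales (rule graph)
    have deg: "degree E v \<le> \<Delta>" if "v < n" for v using deg' that by simp
    have "(1 - \<delta>) * real mstar \<le> 1 * real mstar" using assms by (intro mult_right_mono) auto
    then have "real k \<le> real mstar" using k(2) by linarith
    then have km: "k \<le> mstar" by simp
    then have n2: "n \<ge> 2" using k(1) by (intro two_le_n) simp
    have knn: "k \<le> n * n" using km mstar_le by simp
    let ?inp = "encode_input n E k \<epsilon>"
    obtain L q t1 s1 where q: "q = 2 ^ L" "1 \<le> L" "n \<le> q" "1 \<le> \<epsilon> * real q" "\<epsilon> * real q \<le> 2 * real n"
      and r1: "runs ?inp (prelude c) (\<lambda>_. 0) t1 s1" "t1 \<le> C1 * (2 * q ^ c + 2) * (q ^ c + 1)"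
        "represents (params (q ^ c) q L (2 ^ q ^ c)) s1 (\<lambda>_ _. 0)"
        "bounded_state ?inp (params (q ^ c) q L (2 ^ q ^ c)) (2 * q ^ c + 2) s1"
      using prelude[of n k \<epsilon> E] n2 knn \<epsilon> by (metis One_nat_def Suc_1 Suc_leD)
    define K where "K = q ^ c"
    define B :: nat where "B = 2 ^ K"
    define M where "M = B\<^sup>2 + 1"
    define \<pi> where "\<pi> = params K q L B"
    have fold: "params (q ^ c) q L (2 ^ q ^ c) = \<pi>" by (simp add: \<pi>_def B_def K_def)
    obtain t2 s2 where r2: "runs ?inp (compile 0 ?main) s1 t2 s2" "bounded_state ?inp \<pi> (2 * q ^ c + 2) s2"
      "represents \<pi> s2 (den ?inp \<pi> ?main (\<lambda>_ _. 0))" "t2 \<le> C2 * (2 * q ^ c + 2) * (\<pi> 0 + 1) ^ c2"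
      using main[OF r1(4,3)] unfolding fold by blast
    define \<sigma> where "\<sigma> = den ?inp \<pi> ?main (\<lambda>_ _. 0)"
    obtain t3 s3 where r3: "runs ?inp emit_prog s2 t3 s3" "s3 0 = \<sigma> 39 0" "s3 1 = \<sigma> 40 0" "t3 \<le> C3 * (2 * q ^ c + 2)"
      using emit[OF r2(2,3)] unfolding \<sigma>_def by blast
    have run: "runs ?inp ?p (\<lambda>_. 0) (t1 + (t2 + t3)) s3" by (rule runs.Seq[OF r1(1) runs.Seq[OF r2(1) r3(1)]])
    have q1: "q \<ge> 1" using q(1) by simp
    have x2: "real n / \<epsilon> \<ge> 2"
    proof -
      have "2 * \<epsilon> \<le> real n" using n2 \<epsilon> by linarith
      then show ?thesis using \<epsilon> by (simp add: le_divide_eq)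
    qed
    have "real q \<le> 2 * (real n / \<epsilon>)" using q(5) \<epsilon> by (simp add: le_divide_eq mult.commute)
    moreover have "\<pi> 0 = q ^ c" by (simp add: \<pi>_def params_def K_def)
    ultimately
    have time: "real (t1 + (t2 + t3)) \<le> (real n / \<epsilon>) ^ ?C"
      using running_time[OF q1 _ x2 r1(2) _ r3(4)] r2(4) by metis

    define g where "g = (if 2 * card E \<le> cE * L then q ^ 5 else ?G * q ^ 5)"
    let ?J = "q ^ cJ" and ?d = "cd * L"
    have "1 * q ^ 5 \<le> ?G * q ^ 5" by (rule mult_le_mono1) (use \<open>\<Lambda> \<ge> 1\<close> \<Delta>1 in simp)
    then have q5: "q ^ 5 \<le> ?G * q ^ 5" by simp
    have "g \<le> ?G * q ^ 5" unfolding g_def using q5 by (metis order_refl)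
    note size = sizes[OF q(2,1,3) knn this, folded K_def, folded B_def]
    have KB: "K < B" "B \<le> B * B" by (simp_all add: B_def)
    then have BM: "K < M" "B < M" unfolding M_def power2_eq_square by linarith+
    have nn: "n \<le> n * n" by simp
    interpret machine n E ?inp \<pi> k K q L B M cd
    proof unfold_locales
      show "?inp 0 = n" "?inp (Suc 0) = k" by (simp_all add: encode_input_def)
      show "?inp (Suc (Suc (v * n + u))) = of_bool ({v, u} \<in> E)" if "v < n" "u < n" for v u
      proof -
        have "v * n + u < Suc v * n" using that by simp
        also have "\<dots> \<le> n * n" using that by (intro mult_le_mono1) simp
        finally show ?thesis using that by (simp add: encode_input_def)
      qed
      show "\<pi> 0 = K" "\<pi> (Suc 0) = M" "\<pi> 2 = q" "\<pi> 3 = L" "\<pi> 4 = B" by (simp_all add: \<pi>_def params_def M_def)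
      show "n \<le> K" using nn size by linarith
      show "cd * L + 2 \<le> K" using size by blast
    qed (use BM M_def in auto)
    interpret algorithm n E ?inp \<pi> k K q L B M cd \<Delta> \<Lambda> cE cJ
    proof unfold_locales
      show "dfs_time \<Delta> (cd * L) \<le> K" using dfs_time_le[of \<Delta> "cd * L"] size by linarith
      show "k \<le> K" "q ^ cJ \<le> K" "\<Lambda> * 8 * \<Delta> * q ^ 5 \<le> K" "q ^ 5 \<le> K" "n * n \<le> K" using size knn q5 by linarith+
      show "4 * ((q\<^sup>2)\<^sup>2 + 1) ^ (q ^ cJ) < M" using size BM(2) by linarith
    qed (use deg q1 in auto)
    have n1: "1 \<le> n" using n2 by simp
    note e = est[OF fin_graph_axioms deg q(2) n1 q(3,4) \<epsilon> k q(1) refl refl g_def]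
    have J1: "?J \<ge> 1" using q1 by simp
    obtain a b :: real where ab: "snd (num_sum \<Delta> q ?d ?J k g) * fst (den_sum \<Delta> q ?d k g) = of_real a" "a > 0"
      "of_nat (2 * ?J) * snd (den_sum \<Delta> q ?d k g) * fst (num_sum \<Delta> q ?d ?J k g) = of_real b" "b > 0"
      "a / b = (\<Sum>i\<in>{1..g}. est_num \<Delta> q ?d ?J k i) / (\<Sum>i\<in>{1..g}. est_den \<Delta> q ?d k i)"
      by (rule output_ratio[OF \<Delta>1 q1 J1, of g ?d k]) (use e in blast)+
    note mp = main_prog_correct[OF g_def, of "\<lambda>_ _. 0", folded \<sigma>_def]
    note ob = output_bound[where g = g and d = ?d and k = k, OF deg \<Delta>1 q1 J1]
    \<comment> \<open>Both output numbers are below the modulus, so their residues are the numbers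
      themselves and the quotient of cells 0 and 1 is exactly the estimate.\<close>
    have "real (out_bound \<Delta> n q ?d ?J k g) < real M" using size BM(2) by (intro iffD2[OF of_nat_less_iff]) linarith
    then have lt: "a < real (B\<^sup>2 + 1)" "b < real (B\<^sup>2 + 1)"
      using ob ab(2,4) unfolding ab norm_of_real M_def by linarith+
    have "real (\<sigma> 39 0) = a" "real (\<sigma> 40 0) = b"
      using rep_real[OF mp(1)[unfolded ab] mp(3)[unfolded M_def] less_imp_le[OF ab(2)] lt(1)]
        rep_real[OF mp(2)[unfolded ab] mp(4)[unfolded M_def] less_imp_le[OF ab(4)] lt(2)] .
    then have out: "s3 1 \<noteq> 0" "output_value s3 = a / b" using ab(4) r3 by (auto simp: output_value_def)
    show "\<exists>A. computes_within ?p ?inp ((real n / \<epsilon>) ^ ?C) A \<and> relative_approx \<epsilon> (real (num_matchings E k)) A"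
      using run time out e ab(5) unfolding computes_within_def by metis
  qed
qed

end
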